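(* For each $\varrho\in\mathcal M$, $V(\varrho)=W(\varrho)$, where $V$ is the quasi-potential and $W$ is the stationary (non-equilibrium free energy) rate function.
   Context: Fix $\gamma\in(1,2)$, $\Phi_\ell,\Phi_r\in\mathbb R$, and $c_\gamma=\big(\sum_{z\in\mathbb Z\setminus\{0\}}|z|^{-1-\gamma}\big)^{-1}$. $\mathcal M$ is the set of finite signed measures on $[0,1]$; $\mathcal M_a=\{\mu:\|\mu\|_{TV}\le a\}$ with the weak topology; $\mathcal M=\bigcup_{a\in\mathbb N}\mathcal M_a$ has the direct limit topology, and $C([0,T],\mathcal M)=\bigcup_{a\in\mathbb N} C([0,T],\mathcal M_a)$. $\langle\cdot,\cdot\rangle$ denotes integration of a function against a measure, or the $L^2([0,1])$ inner product. Fractional notions: $\mathbb L^\gamma F(u)=c_\gamma\lim_{\varepsilon\to0}\int_0^1\mathbf 1_{|u-v|\ge\varepsilon}\frac{F(v)-F(u)}{|v-u|^{1+\gamma}}dv$; $\|F\|^2_{\gamma/2}=\frac{c_\gamma}2\iint_{[0,1]^2}\frac{(F(v)-F(u))^2}{|u-v|^{1+\gamma}}du\,dv$; $\mathcal H^{\gamma/2}=\{G\in L^2([0,1]):\|G\|_{\gamma/2}<\infty\}$ with norm squared $\|G\|_2^2+\|G\|_{\gamma/2}^2$, elements identified with continuous representatives. $\Phi_{ss}$ is the unique function in $\mathcal H^{\gamma/2}$ with $\Phi_{ss}(0)=\Phi_\ell$, $\Phi_{ss}(1)=\Phi_r$ and $\langle\Phi_{ss},\mathbb L^\gamma G\rangle=0$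 for all $G\in C_c^\infty((0,1))$. For $T>0$, $\Omega_T=[0,T]\times[0,1]$, and $C_c^{1,2}(\Omega_T)$ is the set of functions $H(t,u)=H_t(u)$, $C^1$ in $t$ and $C^2$ in $u$, such that all supports of $H_t$ lie in a fixed compact subset of $(0,1)$. $\mathcal C^{ac}$ (for horizon $T$) is the set of $\pi\in C([0,T],\mathcal M)$ with $\pi_t(du)=\Phi_t(u)du$ for some $\Phi\in L^2([0,T],\mathcal H^{\gamma/2})$ and $\Phi_t(0)=\Phi_\ell$, $\Phi_t(1)=\Phi_r$ for a.e. $t$. For $g\in L^2([0,1])$, $J_H(\pi|g)=\langle\pi_T,H_T\rangle-\langle g,H_0\rangle-\int_0^T\langle\pi_s,(\partial_s+\mathbb L^\gamma)H_s\rangle ds-\int_0^T\|H_s\|^2_{\gamma/2}ds$; $I_{[0,T]}(\pi|g)=\sup_{H\in C_c^{1,2}(\Omega_T)}J_H(\pi|g)$ if $\pi\in\mathcal C^{ac}$ and $+\infty$ otherwise. Quasi-potential: $V(\varrho)=\inf_{T>0}\inf_\pi I_{[0,T]}(\pi|\Phi_{ss})$, the second infimum over all $\pi\in C([0,T],\mathcal M)$ with $\pi_0(du)=\Phi_{ss}(u)du$ and $\pi_T=\varrho$. $W(\varrho)=\sup_{G\in C([0,1])}\big\{\langle\varrho,G\rangle-\int_0^1(\Phi_{ss}G+\frac12G^2)du\big\}$; equivalently $W(\varrho)=\frac12\int_0^1(\rho-\Phi_{ss})^2du$ if $\varrho(du)=\rho(u)du$ with $\rho\in L^2([0,1])$,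 and $+\infty$ otherwise. *)

theory Defs
  imports "HOL-Analysis.Analysis"
begin

section \<open>Finite signed measures on the unit interval\<close>

abbreviation unit_leb :: "real measure" where
  "unit_leb \<equiv> restrict_space lborel {0..1}"

text \<open>
  A finite signed measure is a real-valued countably additive function on the Borel subsets
  of the unit interval. It is extended by \<open>0\<close> to all other sets, so that equality of
  functions is equality of signed measures. (Taking all \<open>A i\<close> empty gives \<open>\<mu> {} = 0\<close>.)
\<close>

definition signed_measures :: "(real set \<Rightarrow> real) set" where
  "signed_measures = {\<mu>. (\<forall>A. A \<notin> sets unit_leb \<longrightarrow> \<mu> A = 0) \<and>
     (\<forall>A :: nat \<Rightarrow> real set. range A \<subseteq> sets unit_leb \<longrightarrow> disjoint_family A \<longrightarrow>
        (\<lambda>i. \<mu> (A i)) sums \<mu> (\<Union>i. A i))}"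

text \<open>
  Jordan decomposition: the upper variation \<open>\<mu>\<^sup>+(A) = sup {\<mu>(B) | B \<subseteq> A}\<close> and the lower variation
  \<open>\<mu>\<^sup>- = (-\<mu>)\<^sup>+\<close>, as measures. Since \<open>\<mu> {} = 0\<close> takes part in the supremum, the truncation of
  negative values by \<^const>\<open>ennreal\<close> is harmless.
\<close>

definition upper_variation :: "(real set \<Rightarrow> real) \<Rightarrow> real measure" where
  "upper_variation \<mu> = measure_of {0..1} (sets unit_leb)
     (\<lambda>A. SUP B\<in>{B \<in> sets unit_leb. B \<subseteq> A}. ennreal (\<mu> B))"

lemma emeasure_upper_variation:
  assumes \<mu>: "\<mu> \<in> signed_measures" and A: "A \<in> sets unit_leb"
  shows "emeasure (upper_variation \<mu>) A = (SUP B\<in>{B \<in> sets unit_leb. B \<subseteq> A}. ennreal (\<mu> B))"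
proof -
  let ?S = "sets unit_leb"
  define P where "P A = (SUP B\<in>{B \<in> sets unit_leb. B \<subseteq> A}. ennreal (\<mu> B))" for A
  have sums: "(\<lambda>i. \<mu> (A i)) sums \<mu> (\<Union>i. A i)"
    if "range A \<subseteq> ?S" "disjoint_family A" for A :: "nat \<Rightarrow> real set"
    using \<mu> that unfolding signed_measures_def by blast
  have empty: "\<mu> {} = 0"
  proof -
    have "(\<lambda>i::nat. \<mu> {}) sums \<mu> {}"
      using sums[of "\<lambda>_. {}"] by (simp add: disjoint_family_on_def)
    then show ?thesis
      using sums_summable summable_const_iff by blast
  qed
  have add: "\<mu> (B \<union> C) = \<mu> B + \<mu> C" if "B \<in> ?S" "C \<in> ?S" "B \<inter> C = {}" for B C
  proof -
    have "(\<lambda>i. \<mu> (binaryset B C i)) sums \<mu> (\<Union>i. binaryset B C i)"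
      using that by (intro sums) (auto simp: range_binaryset_eq disjoint_family_on_def binaryset_def)
    moreover have "(\<lambda>i. \<mu> (binaryset B C i)) sums (\<mu> B + \<mu> C)"
      using binaryset_sums[of \<mu> B C] empty by blast
    ultimately show ?thesis
      by (metis UN_binaryset_eq sums_unique2)
  qed
  have mono: "P A \<le> P B" if "A \<subseteq> B" for A B
    unfolding P_def using that by (intro SUP_subset_mono) auto
  have superadd: "P A + P B \<le> P (A \<union> B)" if "A \<inter> B = {}" for A B
  proof -
    have 1: "ennreal (\<mu> C) + ennreal (\<mu> D) \<le> P (A \<union> B)"
      if "C \<in> ?S" "C \<subseteq> A" "D \<in> ?S" "D \<subseteq> B" for C D
    proof -
      have up: "ennreal (\<mu> E) \<le> P (A \<union> B)" if "E \<in> ?S" "E \<subseteq> A \<union> B" for E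
        unfolding P_def using that by (intro SUP_upper) auto
      have "\<mu> (C \<union> D) = \<mu> C + \<mu> D"
        using that \<open>A \<inter> B = {}\<close> by (intro add) auto
      moreover have "C \<union> D \<in> ?S" "C \<union> D \<subseteq> A \<union> B" "C \<subseteq> A \<union> B" "D \<subseteq> A \<union> B"
        using that by auto
      ultimately show ?thesis
        using up[of C] up[of D] up[of "C \<union> D"] that
        by (cases "\<mu> C \<ge> 0"; cases "\<mu> D \<ge> 0") (auto simp: ennreal_neg ennreal_plus)
    qed
    have ne: "{C \<in> ?S. C \<subseteq> X} \<noteq> {}" for X by auto
    have "ennreal (\<mu> C) + P B \<le> P (A \<union> B)" if "C \<in> ?S" "C \<subseteq> A" for C
    proof -
      have "ennreal (\<mu> C) + P B = (SUP D\<in>{D \<in> ?S. D \<subseteq> B}. ennreal (\<mu> C) + ennreal (\<mu> D))"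
        unfolding P_def by (rule ennreal_SUP_add_right[OF ne])
      also have "\<dots> \<le> P (A \<union> B)"
        using 1 that by (intro SUP_least) auto
      finally show ?thesis .
    qed
    then have "(SUP C\<in>{C \<in> ?S. C \<subseteq> A}. ennreal (\<mu> C) + P B) \<le> P (A \<union> B)"
      by (intro SUP_least) auto
    then show ?thesis
      unfolding P_def[of A] by (simp only: ennreal_SUP_add_left[OF ne])
  qed
  have "countably_additive ?S P"
  proof (rule countably_additiveI)
    fix A :: "nat \<Rightarrow> real set"
    assume A: "range A \<subseteq> ?S" and dj: "disjoint_family A"
    have "(\<Sum>i<n. P (A i)) \<le> P (\<Union>i. A i)" for n
    proof -
      have "(\<Sum>i<n. P (A i)) \<le> P (\<Union>i<n. A i)"
      proof (induction n)
        case (Suc n)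
        have "(\<Sum>i<Suc n. P (A i)) \<le> P (\<Union>i<n. A i) + P (A n)"
          using Suc by (simp add: add_right_mono)
        also have "\<dots> \<le> P ((\<Union>i<n. A i) \<union> A n)"
        proof (rule superadd)
          have "A i \<inter> A n = {}" if "i < n" for i
            using disjoint_family_onD[OF dj, of i n] that by simp
          then show "(\<Union>i<n. A i) \<inter> A n = {}" by blast
        qed
        finally show ?case
          by (simp add: lessThan_Suc Un_commute)
      qed simp
      also have "\<dots> \<le> P (\<Union>i. A i)" by (intro mono) auto
      finally show ?thesis .
    qed
    then have "(\<Sum>i. P (A i)) \<le> P (\<Union>i. A i)"
      by (intro suminf_le_const) auto
    moreover have "P (\<Union>i. A i) \<le> (\<Sum>i. P (A i))"
      unfolding P_def[of "\<Union>i. A i"]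
    proof (rule SUP_least)
      fix B assume B: "B \<in> {B \<in> ?S. B \<subseteq> (\<Union>i. A i)}"
      have "(\<lambda>i. \<mu> (B \<inter> A i)) sums \<mu> (\<Union>i. B \<inter> A i)"
        using A B dj by (intro sums) (auto simp: disjoint_family_on_def)
      moreover have "(\<Union>i. B \<inter> A i) = B" using B by auto
      ultimately have lim: "(\<lambda>n. \<Sum>i<n. \<mu> (B \<inter> A i)) \<longlonglongrightarrow> \<mu> B"
        by (simp add: sums_def)
      have "ennreal (\<Sum>i<n. \<mu> (B \<inter> A i)) \<le> (\<Sum>i. P (A i))" for n
      proof -
        have "ennreal (\<Sum>i<n. \<mu> (B \<inter> A i)) \<le> ennreal (\<Sum>i<n. max 0 (\<mu> (B \<inter> A i)))"
          by (intro ennreal_leI sum_mono) auto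
        also have "\<dots> = (\<Sum>i<n. ennreal (\<mu> (B \<inter> A i)))"
        proof -
          have "ennreal (max 0 x) = ennreal x" for x :: real
            by (cases "0 \<le> x") (simp_all add: ennreal_neg)
          then show ?thesis
            by (simp add: sum_ennreal[symmetric] del: sum_ennreal)
        qed
        also have "\<dots> \<le> (\<Sum>i<n. P (A i))"
          unfolding P_def using A B by (intro sum_mono SUP_upper) auto
        also have "\<dots> \<le> (\<Sum>i. P (A i))"
          by (intro sum_le_suminf) auto
        finally show ?thesis .
      qed
      then show "ennreal (\<mu> B) \<le> (\<Sum>i. P (A i))"
        by (intro LIMSEQ_le_const2[OF tendsto_ennrealI[OF lim]]) auto
    qed
    ultimately show "(\<Sum>i. P (A i)) = P (\<Union>i. A i)" by (rule antisym)
  qed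
  moreover have "positive ?S P"
  proof -
    have "{B \<in> ?S. B \<subseteq> {}} = {{}}" by auto
    then show ?thesis using empty by (simp add: positive_def P_def)
  qed
  moreover have "sigma_algebra {0..1} ?S"
    using sets.sigma_algebra_axioms[of unit_leb] by (simp add: space_restrict_space)
  ultimately have "emeasure (measure_of {0..1} ?S P) A = P A"
    using A by (intro emeasure_measure_of_sigma)
  then show ?thesis
    unfolding upper_variation_def P_def .
qed

definition lower_variation :: "(real set \<Rightarrow> real) \<Rightarrow> real measure" where
  "lower_variation \<mu> = upper_variation (\<lambda>A. - \<mu> A)"

definition tv_norm :: "(real set \<Rightarrow> real) \<Rightarrow> ennreal" where
  "tv_norm \<mu> = emeasure (upper_variation \<mu>) {0..1} + emeasure (lower_variation \<mu>) {0..1}"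

definition pairing :: "(real set \<Rightarrow> real) \<Rightarrow> (real \<Rightarrow> real) \<Rightarrow> real" where
  "pairing \<mu> f = (LINT u|upper_variation \<mu>. f u) - (LINT u|lower_variation \<mu>. f u)"

definition density_measure :: "(real \<Rightarrow> real) \<Rightarrow> real set \<Rightarrow> real" where
  "density_measure f A = (if A \<in> sets unit_leb then LINT u:A|unit_leb. f u else 0)"

definition tv_ball :: "nat \<Rightarrow> (real set \<Rightarrow> real) set" where
  "tv_ball a = {\<mu> \<in> signed_measures. tv_norm \<mu> \<le> of_nat a}"

text \<open>The coarsest topology for which integration of each continuous function is continuous.\<close>

definition weak_topology :: "nat \<Rightarrow> (real set \<Rightarrow> real) topology" where
  "weak_topology a = topology_generated_by
     {{\<mu> \<in> tv_ball a. pairing \<mu> f \<in> U} | f U. continuous_on {0..1} f \<and> open U}"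

text \<open>Only the values of a path on \<open>[0,T]\<close> are relevant.\<close>

definition paths :: "real \<Rightarrow> (real \<Rightarrow> real set \<Rightarrow> real) set" where
  "paths T = (\<Union>a. {\<pi>. continuous_map (top_of_set {0..T}) (weak_topology a) \<pi>})"


section \<open>The regional fractional Laplacian and its Sobolev space\<close>

definition c_norm :: "real \<Rightarrow> real" where
  "c_norm \<gamma> = inverse (\<Sum>\<^sub>\<infinity>z\<in>UNIV - {0::int}. \<bar>real_of_int z\<bar> powr (-1 - \<gamma>))"

definition frac_lap :: "real \<Rightarrow> (real \<Rightarrow> real) \<Rightarrow> real \<Rightarrow> real" where
  "frac_lap \<gamma> F u = c_norm \<gamma> * Lim (at_right 0) (\<lambda>\<epsilon>.
     LINT v|unit_leb. indicator {v. \<epsilon> \<le> \<bar>u - v\<bar>} v * ((F v - F u) / \<bar>v - u\<bar> powr (1 + \<gamma>)))"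

definition seminorm_sq :: "real \<Rightarrow> (real \<Rightarrow> real) \<Rightarrow> ennreal" where
  "seminorm_sq \<gamma> F = ennreal (c_norm \<gamma> / 2) *
     (\<integral>\<^sup>+u. \<integral>\<^sup>+v. ennreal ((F v - F u)\<^sup>2 / \<bar>u - v\<bar> powr (1 + \<gamma>)) \<partial>unit_leb \<partial>unit_leb)"

text \<open>
  For \<open>\<gamma> > 1\<close> every element of the fractional Sobolev space has a continuous representative;
  the space consists of these representatives (continuity makes them square integrable).
\<close>

definition sobolev :: "real \<Rightarrow> (real \<Rightarrow> real) set" where
  "sobolev \<gamma> = {G. continuous_on {0..1} G \<and> seminorm_sq \<gamma> G < \<infinity>}"

definition sobolev_norm_sq :: "real \<Rightarrow> (real \<Rightarrow> real) \<Rightarrow> ennreal" where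
  "sobolev_norm_sq \<gamma> G = (\<integral>\<^sup>+u. ennreal ((G u)\<^sup>2) \<partial>unit_leb) + seminorm_sq \<gamma> G"

definition test_functions :: "(real \<Rightarrow> real) set" where
  "test_functions = {G. (\<forall>n x. ((deriv ^^ n) G) differentiable (at x)) \<and>
     (\<exists>K. compact K \<and> K \<subseteq> {0<..<1} \<and> (\<forall>x. x \<notin> K \<longrightarrow> G x = 0))}"

text \<open>The stationary profile, extended by \<open>0\<close> outside the unit interval to make it unique.\<close>

definition stationary_profile :: "real \<Rightarrow> real \<Rightarrow> real \<Rightarrow> real \<Rightarrow> real" where
  "stationary_profile \<gamma> \<Phi>\<^sub>l \<Phi>\<^sub>r = (THE \<Phi>. \<Phi> \<in> sobolev \<gamma> \<and> \<Phi> 0 = \<Phi>\<^sub>l \<and> \<Phi> 1 = \<Phi>\<^sub>r \<and>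
     (\<forall>G\<in>test_functions. (LINT u|unit_leb. \<Phi> u * frac_lap \<gamma> G u) = 0) \<and>
     (\<forall>u. u \<notin> {0..1} \<longrightarrow> \<Phi> u = 0))"


section \<open>The dynamical rate function\<close>

definition time_deriv :: "real \<Rightarrow> (real \<Rightarrow> real \<Rightarrow> real) \<Rightarrow> real \<Rightarrow> real \<Rightarrow> real" where
  "time_deriv T H s u = vector_derivative (\<lambda>t. H t u) (at s within {0..T})"

text \<open>
  \<open>Ht\<close>, \<open>Hu\<close>, \<open>Huu\<close> are the partial derivatives, one-sided at the boundary and jointly continuous.
\<close>

definition space_time_tests :: "real \<Rightarrow> (real \<Rightarrow> real \<Rightarrow> real) set" where
  "space_time_tests T = {H.
     (\<exists>Ht Hu Huu.
        (\<forall>t\<in>{0..T}. \<forall>u\<in>{0..1}.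
           ((\<lambda>s. H s u) has_real_derivative Ht t u) (at t within {0..T}) \<and>
           (H t has_real_derivative Hu t u) (at u within {0..1}) \<and>
           (Hu t has_real_derivative Huu t u) (at u within {0..1})) \<and>
        (\<forall>F\<in>{H, Ht, Hu, Huu}. continuous_on ({0..T} \<times> {0..1}) (\<lambda>(t, u). F t u))) \<and>
     (\<exists>K. compact K \<and> K \<subseteq> {0<..<1} \<and> (\<forall>t\<in>{0..T}. \<forall>u\<in>{0..1} - K. H t u = 0))}"

text \<open>
  The profile \<open>\<Phi>\<close> is a class in \<open>L\<^sup>2([0,T], H\<^sup>\<gamma>\<^sup>/\<^sup>2)\<close>, so all conditions on \<open>\<Phi> t\<close>, including
  that it is the density of \<open>\<pi> t\<close>, are for almost every \<open>t\<close>.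
  As the Sobolev space is separable and its elements are continuous, joint measurability is
  equivalent to strong measurability of \<open>t \<mapsto> \<Phi> t\<close> (up to modification on a null set).
\<close>

definition ac_paths :: "real \<Rightarrow> real \<Rightarrow> real \<Rightarrow> real \<Rightarrow> (real \<Rightarrow> real set \<Rightarrow> real) set" where
  "ac_paths \<gamma> \<Phi>\<^sub>l \<Phi>\<^sub>r T = {\<pi> \<in> paths T. \<exists>\<Phi> :: real \<Rightarrow> real \<Rightarrow> real.
     (\<lambda>(t, u). \<Phi> t u) \<in> borel_measurable (restrict_space borel ({0..T} \<times> {0..1})) \<and>
     (AE t in restrict_space lborel {0..T}.
        \<Phi> t \<in> sobolev \<gamma> \<and> \<Phi> t 0 = \<Phi>\<^sub>l \<and> \<Phi> t 1 = \<Phi>\<^sub>r \<and> \<pi> t = density_measure (\<Phi> t)) \<and>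
     (\<integral>\<^sup>+t. sobolev_norm_sq \<gamma> (\<Phi> t) \<partial>restrict_space lborel {0..T}) < \<infinity>}"

definition J_functional ::
  "real \<Rightarrow> real \<Rightarrow> (real \<Rightarrow> real \<Rightarrow> real) \<Rightarrow> (real \<Rightarrow> real set \<Rightarrow> real) \<Rightarrow> (real \<Rightarrow> real) \<Rightarrow> real" where
  "J_functional \<gamma> T H \<pi> g =
     pairing (\<pi> T) (H T) - (LINT u|unit_leb. g u * H 0 u)
     - (LINT s:{0..T}|lborel. pairing (\<pi> s) (\<lambda>u. time_deriv T H s u + frac_lap \<gamma> (H s) u))
     - (LINT s:{0..T}|lborel. enn2real (seminorm_sq \<gamma> (H s)))"

definition rate_functional ::
  "real \<Rightarrow> real \<Rightarrow> real \<Rightarrow> real \<Rightarrow> (real \<Rightarrow> real set \<Rightarrow> real) \<Rightarrow> (real \<Rightarrow> real) \<Rightarrow> ereal" where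
  "rate_functional \<gamma> \<Phi>\<^sub>l \<Phi>\<^sub>r T \<pi> g =
     (if \<pi> \<in> ac_paths \<gamma> \<Phi>\<^sub>l \<Phi>\<^sub>r T
      then SUP H\<in>space_time_tests T. ereal (J_functional \<gamma> T H \<pi> g) else \<infinity>)"


section \<open>Quasi-potential and stationary rate function\<close>

definition quasi_potential :: "real \<Rightarrow> real \<Rightarrow> real \<Rightarrow> (real set \<Rightarrow> real) \<Rightarrow> ereal" where
  "quasi_potential \<gamma> \<Phi>\<^sub>l \<Phi>\<^sub>r \<rho> =
     (INF T\<in>{0<..}.
        INF \<pi>\<in>{\<pi> \<in> paths T.
                 \<pi> 0 = density_measure (stationary_profile \<gamma> \<Phi>\<^sub>l \<Phi>\<^sub>r) \<and> \<pi> T = \<rho>}.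
          rate_functional \<gamma> \<Phi>\<^sub>l \<Phi>\<^sub>r T \<pi> (stationary_profile \<gamma> \<Phi>\<^sub>l \<Phi>\<^sub>r))"

definition stationary_rate :: "real \<Rightarrow> real \<Rightarrow> real \<Rightarrow> (real set \<Rightarrow> real) \<Rightarrow> ereal" where
  "stationary_rate \<gamma> \<Phi>\<^sub>l \<Phi>\<^sub>r \<rho> =
     (SUP G\<in>{G. continuous_on {0..1} G}.
        ereal (pairing \<rho> G
          - (LINT u|unit_leb. stationary_profile \<gamma> \<Phi>\<^sub>l \<Phi>\<^sub>r u * G u + (G u)\<^sup>2 / 2)))"

end

theory Submission
  imports Defs "HOL-Complex_Analysis.Great_Picard"
begin

text \<open>
  The energy form \<open>en\<close> of the regional fractional Laplacian embeds compactly by a fractional Morrey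
  inequality, so minimising Rayleigh quotients over the functions with zero boundary values yields
  an orthonormal eigenbasis \<open>ef k\<close> with eigenvalues \<open>lam k\<close>. For the fluctuation
  \<open>\<phi> = \<Phi> - \<Phi>\<^sub>s\<^sub>s\<close> with coordinates \<open>\<phi>\<^sub>k\<close> the dynamical rate formally decouples into
  \<open>\<Sum>k. \<integral> (\<phi>\<^sub>k' + lam k * \<phi>\<^sub>k)\<^sup>2 / (4 * lam k)\<close>.
  Testing with \<open>\<Sum>k<n. g\<^sub>k * exp (- lam k * (t - s)) * ef k\<close>, cut off just before time \<open>t\<close>, bounds the
  rate of every path ending in \<open>\<rho>\<close> below by \<open>\<langle>\<rho> - \<Phi>\<^sub>s\<^sub>s, g\<rangle> - \<parallel>g\<parallel>\<^sup>2 / 2\<close>. Conversely, a finite stationary rate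
  forces \<open>\<rho> - \<Phi>\<^sub>s\<^sub>s\<close> to have a square integrable density with coordinates \<open>a\<^sub>k\<close>, and the path
  \<open>a\<^sub>k * sinh (lam k * t) / sinh (lam k * T)\<close> has rate at most
  \<open>1/2 * \<Sum>k. a\<^sub>k\<^sup>2 / (1 - exp (- 2 * lam k * T))\<close>, which tends to the stationary rate as \<open>T \<rightarrow> \<infinity>\<close>.
\<close>

section \<open>Square integrable functions\<close>

text \<open>The functional is linear minus quadratic in the test, so in one mode with eigenvalue l
  the best test coordinate h maximises (\<phi>' + l \<phi>) h - l h^2; this gives the factor 4 l. As
  (\<phi>' + l \<phi>)^2 = (\<phi>' - l \<phi>)^2 + 2 l (\<phi>^2)', a mode starting at zero costs
  at least half its final square, with equality only for the reversed flow \<phi>' = l \<phi>. That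
  flow never leaves zero, whence the sinh profile and the limit of long horizons. Three obstacles
  shape the rest. Eigenfunctions are not known to be smooth or compactly supported, so smooth
  functions of compact support must be dense in energy; uniqueness of the stationary profile, which
  is tested only with such functions, needs the same density. The kernel on the interval is not
  translation invariant, so smoothing is done on the line. The final density is merely square
  integrable, and conditions for almost every time say nothing about T: weak continuity carries the
  lower bound to T, and a bound on l times the integral of exp(- 2 l (T - t)) that is uniform in l
  keeps the total energy of the optimal path finite.\<close>

definition sqint :: "'a measure \<Rightarrow> ('a \<Rightarrow> real) set" where
  "sqint M = {f \<in> borel_measurable M. integrable M (\<lambda>x. (f x)\<^sup>2)}"

text \<open>Functions are used instead of classes, so \<open>ip M f f\<close> may vanish for a
  nonzero \<open>f\<close>; definiteness is recovered only for continuous functions. Outside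
  \<open>sqint M\<close> the integral may take the default value 0, hence the membership conditions
  in the algebraic rules below.\<close>

definition ip :: "'a measure \<Rightarrow> ('a \<Rightarrow> real) \<Rightarrow> ('a \<Rightarrow> real) \<Rightarrow> real" where
  "ip M f g = (LINT x|M. f x * g x)"

abbreviation nsq :: "'a measure \<Rightarrow> ('a \<Rightarrow> real) \<Rightarrow> real" where
  "nsq M f \<equiv> ip M f f"

lemma sqint_measurable: "f \<in> sqint M \<Longrightarrow> f \<in> borel_measurable M"
  by (simp add: sqint_def)

lemma sqint_mult_integrable:
  assumes "f \<in> sqint M" "g \<in> sqint M"
  shows "integrable M (\<lambda>x. f x * g x)"
proof (rule Bochner_Integration.integrable_bound)
  show "integrable M (\<lambda>x. (f x)\<^sup>2 + (g x)\<^sup>2)"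
    using assms by (simp add: sqint_def)
  show "(\<lambda>x. f x * g x) \<in> borel_measurable M"
    using assms by (intro borel_measurable_times) (simp_all add: sqint_def)
  have "\<bar>a * b\<bar> \<le> a\<^sup>2 + b\<^sup>2" for a b :: real
  proof -
    have "2 * (\<bar>a\<bar> * \<bar>b\<bar>) \<le> a\<^sup>2 + b\<^sup>2"
      using sum_squares_bound[of "\<bar>a\<bar>" "\<bar>b\<bar>"] by (simp add: mult.assoc)
    moreover have "0 \<le> \<bar>a\<bar> * \<bar>b\<bar>" by simp
    ultimately show ?thesis unfolding abs_mult by linarith
  qed
  then show "AE x in M. norm (f x * g x) \<le> norm ((f x)\<^sup>2 + (g x)\<^sup>2)"
    by simp
qed

lemma sqint_add:
  assumes "f \<in> sqint M" "g \<in> sqint M"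
  shows "(\<lambda>x. f x + g x) \<in> sqint M"
proof -
  have "integrable M (\<lambda>x. (f x)\<^sup>2 + (g x)\<^sup>2 + 2 * (f x * g x))"
    using assms sqint_mult_integrable[OF assms] by (simp add: sqint_def)
  moreover have "(\<lambda>x. f x + g x) \<in> borel_measurable M"
    using assms by (intro borel_measurable_add) (simp_all add: sqint_def)
  ultimately show ?thesis
    by (simp add: sqint_def power2_sum mult.assoc)
qed

lemma sqint_cmult: "f \<in> sqint M \<Longrightarrow> (\<lambda>x. c * f x) \<in> sqint M"
  unfolding sqint_def by (simp add: power_mult_distrib borel_measurable_times)

lemma sqint_uminus: "f \<in> sqint M \<Longrightarrow> (\<lambda>x. - f x) \<in> sqint M"
  using sqint_cmult[of f M "-1"] by simp

lemma sqint_diff: "f \<in> sqint M \<Longrightarrow> g \<in> sqint M \<Longrightarrow> (\<lambda>x. f x - g x) \<in> sqint M"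
  using sqint_add[of f M "\<lambda>x. - g x"] sqint_uminus[of g M] by simp

lemma sqint_zero: "(\<lambda>x. 0) \<in> sqint M"
  by (simp add: sqint_def)

lemma sqint_bounded:
  assumes "finite_measure M" "f \<in> borel_measurable M" "\<And>x. x \<in> space M \<Longrightarrow> \<bar>f x\<bar> \<le> B"
  shows "f \<in> sqint M"
proof -
  interpret finite_measure M by fact
  have "integrable M (\<lambda>x. (f x)\<^sup>2)"
  proof (rule integrable_const_bound[where B = "B\<^sup>2"])
    show "AE x in M. norm ((f x)\<^sup>2) \<le> B\<^sup>2"
    proof (rule AE_I2)
      fix x assume "x \<in> space M"
      then have "\<bar>f x\<bar> \<le> B" by (rule assms(3))
      then have "\<bar>f x\<bar>\<^sup>2 \<le> B\<^sup>2" by (intro power_mono) auto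
      then show "norm ((f x)\<^sup>2) \<le> B\<^sup>2" by simp
    qed
  qed (use assms in simp)
  then show ?thesis using assms by (simp add: sqint_def)
qed

lemma ip_commute: "ip M f g = ip M g f"
  by (simp add: ip_def mult.commute)

lemma ip_add_left:
  "f \<in> sqint M \<Longrightarrow> g \<in> sqint M \<Longrightarrow> h \<in> sqint M \<Longrightarrow> ip M (\<lambda>x. f x + g x) h = ip M f h + ip M g h"
  by (simp add: ip_def distrib_right sqint_mult_integrable)

lemma ip_diff_left:
  "f \<in> sqint M \<Longrightarrow> g \<in> sqint M \<Longrightarrow> h \<in> sqint M \<Longrightarrow> ip M (\<lambda>x. f x - g x) h = ip M f h - ip M g h"
  by (simp add: ip_def left_diff_distrib sqint_mult_integrable)

lemma ip_cmult_left: "ip M (\<lambda>x. c * f x) h = c * ip M f h"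
  by (simp add: ip_def mult.assoc)

lemma ip_sum_left:
  "(\<And>i. i \<in> I \<Longrightarrow> f i \<in> sqint M) \<Longrightarrow> h \<in> sqint M \<Longrightarrow> ip M (\<lambda>x. \<Sum>i\<in>I. f i x) h = (\<Sum>i\<in>I. ip M (f i) h)"
  by (simp add: ip_def sum_distrib_right sqint_mult_integrable)

lemma ip_add_right:
  "f \<in> sqint M \<Longrightarrow> g \<in> sqint M \<Longrightarrow> h \<in> sqint M \<Longrightarrow> ip M h (\<lambda>x. f x + g x) = ip M h f + ip M h g"
  by (simp add: ip_def distrib_left sqint_mult_integrable)

lemma ip_diff_right:
  "f \<in> sqint M \<Longrightarrow> g \<in> sqint M \<Longrightarrow> h \<in> sqint M \<Longrightarrow> ip M h (\<lambda>x. f x - g x) = ip M h f - ip M h g"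
  by (simp add: ip_def right_diff_distrib sqint_mult_integrable)

lemma ip_cmult_right: "ip M h (\<lambda>x. c * f x) = c * ip M h f"
  by (simp add: ip_def mult.left_commute)

lemma ip_sum_right:
  "(\<And>i. i \<in> I \<Longrightarrow> f i \<in> sqint M) \<Longrightarrow> h \<in> sqint M \<Longrightarrow> ip M h (\<lambda>x. \<Sum>i\<in>I. f i x) = (\<Sum>i\<in>I. ip M h (f i))"
  by (simp add: ip_def sum_distrib_left sqint_mult_integrable)

lemma ip_nonneg: "0 \<le> ip M f f"
  by (simp add: ip_def)

lemma ip_add_self:
  assumes "f \<in> sqint M" "g \<in> sqint M"
  shows "nsq M (\<lambda>x. f x + g x) = ip M f f + 2 * ip M f g + ip M g g"
  using assms by (simp add: ip_add_left ip_add_right sqint_add ip_commute[of M g f])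

lemma ip_diff_self:
  assumes "f \<in> sqint M" "g \<in> sqint M"
  shows "nsq M (\<lambda>x. f x - g x) = ip M f f - 2 * ip M f g + ip M g g"
  using assms by (simp add: ip_diff_left ip_diff_right sqint_diff ip_commute[of M g f])

text \<open>Besides Cauchy-Schwarz this is the first variation argument of the development: with
  \<open>c = 0\<close> it says that a quadratic attaining its minimum 0 at \<open>t = 0\<close> has
  no linear term. The sign of \<open>a\<close> is derived, so that the lemma applies to differences
  of forms.\<close>

lemma quadratic_nonneg_discriminant:
  fixes a b c :: real
  assumes "\<And>t. 0 \<le> a * t\<^sup>2 + 2 * b * t + c"
  shows "b\<^sup>2 \<le> a * c"
proof (cases "a = 0")
  case True
  have "b = 0"
  proof (rule ccontr)
    assume "b \<noteq> 0"
    \<comment> \<open>At this point the affine function takes the value -1.\<close>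
    then show False
      using assms[of "(- c - 1) / (2 * b)"] True by (simp add: field_simps)
  qed
  then show ?thesis using True by simp
next
  case False
  have "0 < a"
  proof (rule ccontr)
    assume "\<not> 0 < a"
    then have a: "a < 0" using False by simp
    \<comment> \<open>Chosen so that \<open>a * t + (\<bar>c\<bar> + 2 * \<bar>b\<bar>)\<close>
      equals \<open>a\<close>. Since \<open>1 \<le> t\<close>, the lower order terms are at most
      \<open>t * (\<bar>c\<bar> + 2 * \<bar>b\<bar>)\<close>, and the whole quadratic is at most
      \<open>t * a\<close>, which is negative.\<close>
    define t where "t = 1 + (\<bar>c\<bar> + 2 * \<bar>b\<bar>) / (- a)"
    have "0 \<le> (\<bar>c\<bar> + 2 * \<bar>b\<bar>) / (- a)" using a by (intro divide_nonneg_nonneg) auto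
    then have "1 \<le> t" unfolding t_def by linarith
    have e: "- a * (t - 1) = \<bar>c\<bar> + 2 * \<bar>b\<bar>" using a by (simp add: t_def field_simps)
    have "0 \<le> a * t\<^sup>2 + 2 * b * t + c" by (rule assms)
    also have "\<dots> \<le> a * t\<^sup>2 + 2 * \<bar>b\<bar> * t + \<bar>c\<bar> * t"
    proof -
      have "b * t \<le> \<bar>b\<bar> * t" using \<open>1 \<le> t\<close> by (intro mult_right_mono) auto
      moreover have "\<bar>c\<bar> * 1 \<le> \<bar>c\<bar> * t" using \<open>1 \<le> t\<close> by (intro mult_left_mono) auto
      ultimately show ?thesis by linarith
    qed
    also have "\<dots> = t * (a * t + (\<bar>c\<bar> + 2 * \<bar>b\<bar>))" by (simp add: algebra_simps power2_eq_square)
    also have "\<dots> = t * a" using e by (simp add: algebra_simps)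
    also have "\<dots> < 0" using \<open>1 \<le> t\<close> a by (simp add: mult_pos_neg)
    finally show False by simp
  qed
  have "0 \<le> a * (- b / a)\<^sup>2 + 2 * b * (- b / a) + c" by (rule assms)
  also have "\<dots> = c - b\<^sup>2 / a" using \<open>0 < a\<close> by (simp add: power2_eq_square)
  finally show ?thesis using \<open>0 < a\<close> by (simp add: pos_divide_le_eq mult.commute)
qed

lemma ip_Cauchy_Schwarz:
  assumes "f \<in> sqint M" "g \<in> sqint M"
  shows "(ip M f g)\<^sup>2 \<le> ip M f f * ip M g g"
proof -
  have "(ip M f g)\<^sup>2 \<le> ip M g g * ip M f f"
  proof (rule quadratic_nonneg_discriminant)
    fix t
    have "0 \<le> nsq M (\<lambda>x. f x + t * g x)" by (rule ip_nonneg)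
    also have "\<dots> = ip M g g * t\<^sup>2 + 2 * ip M f g * t + ip M f f"
      using assms by (simp add: ip_add_self sqint_cmult ip_cmult_left ip_cmult_right power2_eq_square)
    finally show "0 \<le> ip M g g * t\<^sup>2 + 2 * ip M f g * t + ip M f f" .
  qed
  then show ?thesis by (simp add: mult.commute)
qed

lemma ip_Cauchy_Schwarz_sqrt:
  assumes "f \<in> sqint M" "g \<in> sqint M"
  shows "\<bar>ip M f g\<bar> \<le> sqrt (ip M f f) * sqrt (ip M g g)"
  using real_sqrt_le_mono[OF ip_Cauchy_Schwarz[OF assms]] by (simp add: real_sqrt_mult)

text \<open>The parallelogram identity with the norm of the difference dropped. Working with squares
  avoids roots in the error budgets, at the price of a factor 2 for each splitting.\<close>

lemma ip_add_self_le:
  assumes "f \<in> sqint M" "g \<in> sqint M"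
  shows "nsq M (\<lambda>x. f x + g x) \<le> 2 * ip M f f + 2 * ip M g g"
  using ip_add_self[OF assms] ip_diff_self[OF assms] ip_nonneg[of M "\<lambda>x. f x - g x"] by linarith

lemma ip_sqrt_triangle:
  assumes "f \<in> sqint M" "g \<in> sqint M"
  shows "sqrt (nsq M (\<lambda>x. f x + g x)) \<le> sqrt (ip M f f) + sqrt (ip M g g)"
proof (rule real_le_lsqrt)
  show "0 \<le> sqrt (ip M f f) + sqrt (ip M g g)" by (simp add: ip_nonneg)
  show "nsq M (\<lambda>x. f x + g x) \<le> (sqrt (ip M f f) + sqrt (ip M g g))\<^sup>2"
    using ip_Cauchy_Schwarz_sqrt[OF assms] ip_nonneg[of M f] ip_nonneg[of M g]
    by (simp add: ip_add_self[OF assms] power2_sum)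
qed

lemma nn_integral_sq_eq_ip:
  assumes "f \<in> sqint M"
  shows "(\<integral>\<^sup>+x. ennreal ((f x)\<^sup>2) \<partial>M) = ennreal (ip M f f)"
  using assms unfolding ip_def sqint_def
  by (subst nn_integral_eq_integral) (auto simp: power2_eq_square)

lemma sqint_iff_nn_integral:
  assumes "f \<in> borel_measurable M"
  shows "f \<in> sqint M \<longleftrightarrow> (\<integral>\<^sup>+x. ennreal ((f x)\<^sup>2) \<partial>M) < \<infinity>"
  using assms unfolding sqint_def by (subst mem_Collect_eq) (auto simp: integrable_iff_bounded)

section \<open>The unit interval\<close>

lemma space_unit_leb [simp]: "space unit_leb = {0..1}"
  by (simp add: space_restrict_space)

lemma sets_unit_leb: "sets unit_leb = sets (restrict_space borel {0..1})"
  by (intro sets_restrict_space_cong) simp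

lemma finite_measure_unit_leb: "finite_measure unit_leb"
  by (intro finite_measureI) (simp add: emeasure_restrict_space)

interpretation ul: finite_measure unit_leb
  by (rule finite_measure_unit_leb)

interpretation ulp: pair_sigma_finite unit_leb unit_leb ..

lemma measure_unit_leb [simp]: "measure unit_leb {0..1} = 1"
  by (simp add: measure_restrict_space)

lemma emeasure_unit_leb_space [simp]: "emeasure unit_leb {0..1} = 1"
  by (simp add: emeasure_restrict_space)

lemma borel_unit_leb: "f \<in> borel_measurable borel \<Longrightarrow> f \<in> borel_measurable unit_leb"
  by (simp add: measurable_restrict_space1)

lemma measurable_unit_leb_id [measurable]: "(\<lambda>x. x) \<in> borel_measurable unit_leb"
  by (intro borel_unit_leb) simp

lemma continuous_measurable_unit_leb:
  assumes "continuous_on {0..1} (f :: real \<Rightarrow> real)"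
  shows "f \<in> borel_measurable unit_leb"
  using borel_measurable_continuous_on_restrict[OF assms]
  by (simp add: measurable_cong_sets[OF sets_unit_leb refl])

lemma continuous_bounded_unit:
  assumes "continuous_on {0..1} (f :: real \<Rightarrow> real)"
  obtains B where "0 < B" "\<And>x. x \<in> {0..1} \<Longrightarrow> \<bar>f x\<bar> \<le> B"
proof -
  have "bounded (f ` {0..1})"
    by (intro compact_imp_bounded compact_continuous_image assms) simp
  then show ?thesis using that by (auto simp: bounded_pos)
qed

lemma continuous_sqint:
  assumes "continuous_on {0..1} f"
  shows "f \<in> sqint unit_leb"
proof -
  obtain B where "0 < B" "\<And>x. x \<in> {0..1} \<Longrightarrow> \<bar>f x\<bar> \<le> B"
    using continuous_bounded_unit[OF assms] by blast
  then show ?thesis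
    by (intro sqint_bounded[where B=B] continuous_measurable_unit_leb assms finite_measure_unit_leb) auto
qed

abbreviation ip2 :: "(real \<Rightarrow> real) \<Rightarrow> (real \<Rightarrow> real) \<Rightarrow> real" where
  "ip2 \<equiv> ip unit_leb"

text \<open>The interval has mass 1. If the square is not integrable, the integral is 0 by
  convention, so the bound holds for an arbitrary function.\<close>

lemma ip2_bound:
  assumes "\<And>x. x \<in> {0..1} \<Longrightarrow> \<bar>f x\<bar> \<le> B"
  shows "ip2 f f \<le> B\<^sup>2"
proof (cases "integrable unit_leb (\<lambda>x. f x * f x)")
  case True
  have "ip2 f f \<le> (LINT x|unit_leb. B\<^sup>2)"
    unfolding ip_def
  proof (rule integral_mono[OF True])
    fix x :: real assume "x \<in> space unit_leb"
    then have "\<bar>f x\<bar>\<^sup>2 \<le> B\<^sup>2" by (intro power_mono assms) auto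
    then show "f x * f x \<le> B\<^sup>2" by (simp add: power2_eq_square)
  qed simp
  then show ?thesis by (simp add: measure_restrict_space)
next
  case False
  then show ?thesis by (simp add: ip_def not_integrable_integral_eq)
qed

lemma uniform_limit_ip2:
  assumes "\<And>n. continuous_on {0..1} (f n)" "continuous_on {0..1} g"
    and "uniform_limit {0..1} f g sequentially"
  shows "(\<lambda>n. nsq unit_leb (\<lambda>x. f n x - g x)) \<longlonglongrightarrow> 0"
proof (rule LIMSEQ_I)
  fix r :: real assume "0 < r"
  then have "0 < sqrt (r / 2)" by simp
  then have "\<exists>N. \<forall>n\<ge>N. \<forall>x\<in>{0..1}. dist (f n x) (g x) < sqrt (r/2)"
    using assms(3) unfolding uniform_limit_sequentially_iff by blast
  then obtain N where N: "\<forall>n\<ge>N. \<forall>x\<in>{0..1}. dist (f n x) (g x) < sqrt (r/2)" ..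

  have "nsq unit_leb (\<lambda>x. f n x - g x) \<le> (sqrt (r/2))\<^sup>2" if "n \<ge> N" for n
    using N that by (intro ip2_bound) (auto simp: dist_real_def less_imp_le)
  then show "\<exists>N. \<forall>n\<ge>N. norm (nsq unit_leb (\<lambda>x. f n x - g x) - 0) < r"
    using \<open>0 < r\<close> ip_nonneg by (intro exI[of _ N]) (fastforce simp: ip_nonneg)
qed

lemma ip_tendsto:
  assumes "\<And>n. f n \<in> sqint M" "g \<in> sqint M" "h \<in> sqint M"
    and "((\<lambda>n. nsq M (\<lambda>x. f n x - g x)) \<longlongrightarrow> 0) F"
  shows "((\<lambda>n. ip M (f n) h) \<longlongrightarrow> ip M g h) F"
proof -
  have "((\<lambda>n. ip M (f n) h - ip M g h) \<longlongrightarrow> 0) F"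
  proof (rule Lim_null_comparison)
    show "\<forall>\<^sub>F n in F. norm (ip M (f n) h - ip M g h)
        \<le> sqrt (nsq M (\<lambda>x. f n x - g x)) * sqrt (ip M h h)"
      using ip_Cauchy_Schwarz_sqrt[OF sqint_diff[OF assms(1) assms(2)] assms(3)]
      by (simp add: ip_diff_left assms)
    show "((\<lambda>n. sqrt (nsq M (\<lambda>x. f n x - g x)) * sqrt (ip M h h)) \<longlongrightarrow> 0) F"
      using tendsto_mult_right[OF tendsto_real_sqrt[OF assms(4)], of "sqrt (ip M h h)"] by simp
  qed
  then show ?thesis by (simp add: LIM_zero_iff)
qed

lemma ip_self_tendsto:
  assumes "\<And>n. f n \<in> sqint M" "g \<in> sqint M"
    and lim: "((\<lambda>n. nsq M (\<lambda>x. f n x - g x)) \<longlongrightarrow> 0) F"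
  shows "((\<lambda>n. nsq M (f n)) \<longlongrightarrow> ip M g g) F"
proof -
  have "nsq M (f n) = nsq M (\<lambda>x. f n x - g x) + 2 * ip M (f n) g - ip M g g" for n
    using ip_diff_self[OF assms(1,2), of n] by simp
  moreover have "((\<lambda>n. nsq M (\<lambda>x. f n x - g x) + 2 * ip M (f n) g - ip M g g)
      \<longlongrightarrow> 0 + 2 * ip M g g - ip M g g) F"
    by (intro tendsto_intros lim ip_tendsto assms)
  ultimately show ?thesis by simp
qed

section \<open>The energy form\<close>

text \<open>The sum over a non-summable family is 0 by convention, which would make the constant
  vanish, so summability is the real content. Two copies of the naturals cover the nonzero integers,
  and the term at 1 bounds the sum away from 0.\<close>

lemma c_norm_pos:
  assumes "1 < \<gamma>"
  shows "0 < c_norm \<gamma>"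
proof -
  let ?f = "\<lambda>z::int. \<bar>real_of_int z\<bar> powr (-1 - \<gamma>)"
  have "summable (\<lambda>n. real n powr (-1 - \<gamma>))"
    using assms by (simp add: summable_real_powr_iff)
  then have on: "(\<lambda>n. real n powr (-1 - \<gamma>)) summable_on UNIV"
    by (rule summable_nonneg_imp_summable_on) simp
  have "?f summable_on (int ` UNIV)"
    using on by (subst summable_on_reindex) (auto simp: comp_def)
  moreover have "?f summable_on ((\<lambda>n. - int n) ` UNIV)"
    using on by (subst summable_on_reindex) (auto simp: comp_def inj_on_def)
  ultimately have "?f summable_on (int ` UNIV \<union> (\<lambda>n. - int n) ` UNIV)"
    by (rule summable_on_union)
  then have sm: "?f summable_on (UNIV - {0})"
    by (rule summable_on_subset_banach) (auto, metis int_cases2 rangeI)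
  have "(\<Sum>z\<in>{1}. ?f z) \<le> infsum ?f (UNIV - {0})"
    by (intro finite_sum_le_infsum sm) auto
  then have "1 \<le> infsum ?f (UNIV - {0})" by simp
  then show ?thesis by (simp add: c_norm_def)
qed

locale fractional =
  fixes \<gamma> :: real
  assumes \<gamma>1: "1 < \<gamma>" and \<gamma>2: "\<gamma> < 2"
begin

lemma c_pos: "0 < c_norm \<gamma>"
  using \<gamma>1 by (rule c_norm_pos)

text \<open>Half of the normalising constant is absorbed, so that the form below equals the squared
  seminorm without a further factor. On the diagonal the value is 0, by the convention for division
  by zero.\<close>

definition kern :: "real \<Rightarrow> real \<Rightarrow> real" where
  "kern u v = c_norm \<gamma> / 2 / \<bar>u - v\<bar> powr (1 + \<gamma>)"

text \<open>With this measure the energy form is the inner product of increments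
  \<open>dd F\<close>, so every fact about \<open>ip\<close> (Cauchy-Schwarz, parallelogram bound,
  strong convergence) transfers to energies.\<close>

definition km :: "(real \<times> real) measure" where
  "km = density (unit_leb \<Otimes>\<^sub>M unit_leb) (\<lambda>p. ennreal (kern (fst p) (snd p)))"

definition dd :: "(real \<Rightarrow> real) \<Rightarrow> real \<times> real \<Rightarrow> real" where
  "dd F p = F (snd p) - F (fst p)"

definition en :: "(real \<Rightarrow> real) \<Rightarrow> (real \<Rightarrow> real) \<Rightarrow> real" where
  "en F G = ip km (dd F) (dd G)"

abbreviation energy :: "(real \<Rightarrow> real) \<Rightarrow> real" where
  "energy F \<equiv> en F F"

lemma kern_nonneg [simp]: "0 \<le> kern u v"
  using c_pos by (simp add: kern_def)

lemma kern_commute: "kern u v = kern v u"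
  by (simp add: kern_def abs_minus_commute)

lemma kern_measurable_borel [measurable]: "(\<lambda>p. kern (fst p) (snd p)) \<in> borel_measurable (borel \<Otimes>\<^sub>M borel)"
  unfolding kern_def by measurable

lemma kern_measurable [measurable]: "(\<lambda>p. kern (fst p) (snd p)) \<in> borel_measurable (unit_leb \<Otimes>\<^sub>M unit_leb)"
  unfolding kern_def by measurable

lemma sets_km [measurable_cong]: "sets km = sets (unit_leb \<Otimes>\<^sub>M unit_leb)"
  by (simp add: km_def)

lemma space_km: "space km = {0..1} \<times> {0..1}"
  by (simp add: km_def space_pair_measure)

lemma dd_measurable:
  assumes [measurable]: "F \<in> borel_measurable unit_leb"
  shows "dd F \<in> borel_measurable km"
  unfolding dd_def by measurable

lemma nn_integral_km:
  assumes [measurable]: "f \<in> borel_measurable (unit_leb \<Otimes>\<^sub>M unit_leb)"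
  shows "(\<integral>\<^sup>+p. f p \<partial>km) = (\<integral>\<^sup>+u. \<integral>\<^sup>+v. ennreal (kern u v) * f (u, v) \<partial>unit_leb \<partial>unit_leb)"
  unfolding km_def by (subst nn_integral_density) (simp_all add: ul.nn_integral_fst[symmetric])

lemma seminorm_sq_eq:
  assumes [measurable]: "F \<in> borel_measurable unit_leb"
  shows "seminorm_sq \<gamma> F = (\<integral>\<^sup>+p. ennreal ((dd F p)\<^sup>2) \<partial>km)"
proof -
  have [measurable]: "(\<lambda>p. ennreal ((dd F p)\<^sup>2)) \<in> borel_measurable (unit_leb \<Otimes>\<^sub>M unit_leb)"
    unfolding dd_def by measurable
  have "(\<integral>\<^sup>+p. ennreal ((dd F p)\<^sup>2) \<partial>km) =
    (\<integral>\<^sup>+u. \<integral>\<^sup>+v. ennreal (c_norm \<gamma> / 2) * ennreal ((F v - F u)\<^sup>2 / \<bar>u - v\<bar> powr (1 + \<gamma>)) \<partial>unit_leb \<partial>unit_leb)"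
    using c_pos by (subst nn_integral_km) (auto simp: dd_def kern_def ennreal_mult[symmetric] intro!: nn_integral_cong)
  also have "\<dots> = seminorm_sq \<gamma> F"
    unfolding seminorm_sq_def by (simp add: nn_integral_cmult)
  finally show ?thesis ..
qed

lemma sobolev_iff: "F \<in> sobolev \<gamma> \<longleftrightarrow> continuous_on {0..1} F \<and> dd F \<in> sqint km"
  using seminorm_sq_eq[OF continuous_measurable_unit_leb]
    sqint_iff_nn_integral[OF dd_measurable[OF continuous_measurable_unit_leb]]
  unfolding sobolev_def by auto

lemma sobolev_continuous: "F \<in> sobolev \<gamma> \<Longrightarrow> continuous_on {0..1} F"
  by (simp add: sobolev_iff)

lemma sobolev_dd: "F \<in> sobolev \<gamma> \<Longrightarrow> dd F \<in> sqint km"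
  by (simp add: sobolev_iff)

lemma sobolev_measurable: "F \<in> sobolev \<gamma> \<Longrightarrow> F \<in> borel_measurable unit_leb"
  by (intro continuous_measurable_unit_leb sobolev_continuous)

lemma sobolev_sqint: "F \<in> sobolev \<gamma> \<Longrightarrow> F \<in> sqint unit_leb"
  by (intro continuous_sqint sobolev_continuous)

lemma seminorm_sq_en: "F \<in> sobolev \<gamma> \<Longrightarrow> seminorm_sq \<gamma> F = ennreal (en F F)"
  unfolding en_def by (subst seminorm_sq_eq) (auto simp: sobolev_measurable sobolev_dd nn_integral_sq_eq_ip)

lemma dd_add: "dd (\<lambda>x. F x + G x) = (\<lambda>p. dd F p + dd G p)"
  and dd_diff: "dd (\<lambda>x. F x - G x) = (\<lambda>p. dd F p - dd G p)"
  and dd_cmult: "dd (\<lambda>x. a * F x) = (\<lambda>p. a * dd F p)"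
  and dd_sum: "dd (\<lambda>x. \<Sum>i\<in>I. H i x) = (\<lambda>p. \<Sum>i\<in>I. dd (H i) p)"
  by (auto simp: dd_def algebra_simps sum_subtractf)

lemma sobolev_add: "F \<in> sobolev \<gamma> \<Longrightarrow> G \<in> sobolev \<gamma> \<Longrightarrow> (\<lambda>x. F x + G x) \<in> sobolev \<gamma>"
  by (auto simp: sobolev_iff dd_add intro: continuous_intros sqint_add)

lemma sobolev_diff: "F \<in> sobolev \<gamma> \<Longrightarrow> G \<in> sobolev \<gamma> \<Longrightarrow> (\<lambda>x. F x - G x) \<in> sobolev \<gamma>"
  by (auto simp: sobolev_iff dd_diff intro: continuous_intros sqint_diff)

lemma sobolev_cmult: "F \<in> sobolev \<gamma> \<Longrightarrow> (\<lambda>x. a * F x) \<in> sobolev \<gamma>"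
  by (auto simp: sobolev_iff dd_cmult intro: continuous_intros sqint_cmult)

lemma sobolev_const: "(\<lambda>x. a) \<in> sobolev \<gamma>"
proof -
  have "dd (\<lambda>x. a) = (\<lambda>p. 0)" by (auto simp: dd_def)
  then show ?thesis by (simp add: sobolev_iff sqint_zero)
qed

lemma sobolev_sum: "(\<And>i. i \<in> I \<Longrightarrow> H i \<in> sobolev \<gamma>) \<Longrightarrow> (\<lambda>x. \<Sum>i\<in>I. H i x) \<in> sobolev \<gamma>"
  by (induction I rule: infinite_finite_induct) (auto intro: sobolev_const sobolev_add)

lemma en_commute: "en F G = en G F"
  by (simp add: en_def ip_commute)

lemma en_nonneg: "0 \<le> en F F"
  by (simp add: en_def ip_nonneg)

lemma en_add_left: "F \<in> sobolev \<gamma> \<Longrightarrow> G \<in> sobolev \<gamma> \<Longrightarrow> H \<in> sobolev \<gamma> \<Longrightarrow> en (\<lambda>x. F x + G x) H = en F H + en G H"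
  and en_diff_left: "F \<in> sobolev \<gamma> \<Longrightarrow> G \<in> sobolev \<gamma> \<Longrightarrow> H \<in> sobolev \<gamma> \<Longrightarrow> en (\<lambda>x. F x - G x) H = en F H - en G H"
  and en_cmult_left: "en (\<lambda>x. a * F x) H = a * en F H"
  by (auto simp: en_def dd_add dd_diff dd_cmult ip_add_left ip_diff_left ip_cmult_left sobolev_dd)

lemma en_sum_left:
  assumes "\<And>i. i \<in> I \<Longrightarrow> K i \<in> sobolev \<gamma>" "H \<in> sobolev \<gamma>"
  shows "en (\<lambda>x. \<Sum>i\<in>I. K i x) H = (\<Sum>i\<in>I. en (K i) H)"
  unfolding en_def dd_sum using assms by (intro ip_sum_left sobolev_dd)

lemma en_add_right: "F \<in> sobolev \<gamma> \<Longrightarrow> G \<in> sobolev \<gamma> \<Longrightarrow> H \<in> sobolev \<gamma> \<Longrightarrow> en H (\<lambda>x. F x + G x) = en H F + en H G"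
  and en_diff_right: "F \<in> sobolev \<gamma> \<Longrightarrow> G \<in> sobolev \<gamma> \<Longrightarrow> H \<in> sobolev \<gamma> \<Longrightarrow> en H (\<lambda>x. F x - G x) = en H F - en H G"
  and en_cmult_right: "en H (\<lambda>x. a * F x) = a * en H F"
  using en_add_left en_diff_left en_cmult_left by (simp_all add: en_commute[of H])

lemma en_sum_right:
  assumes "\<And>i. i \<in> I \<Longrightarrow> K i \<in> sobolev \<gamma>" "H \<in> sobolev \<gamma>"
  shows "en H (\<lambda>x. \<Sum>i\<in>I. K i x) = (\<Sum>i\<in>I. en H (K i))"
  unfolding en_def dd_sum using assms by (intro ip_sum_right sobolev_dd)

lemma en_Cauchy_Schwarz: "F \<in> sobolev \<gamma> \<Longrightarrow> G \<in> sobolev \<gamma> \<Longrightarrow> (en F G)\<^sup>2 \<le> en F F * en G G"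
  unfolding en_def by (intro ip_Cauchy_Schwarz sobolev_dd)

lemma en_add_self_le: "F \<in> sobolev \<gamma> \<Longrightarrow> G \<in> sobolev \<gamma> \<Longrightarrow>
  energy (\<lambda>x. F x + G x) \<le> 2 * en F F + 2 * en G G"
  unfolding en_def dd_add by (intro ip_add_self_le sobolev_dd)

lemma en_cong:
  assumes "\<And>x. x \<in> {0..1} \<Longrightarrow> F x = F' x" "\<And>x. x \<in> {0..1} \<Longrightarrow> G x = G' x"
  shows "en F G = en F' G'"
  unfolding en_def ip_def by (intro Bochner_Integration.integral_cong) (auto simp: space_km dd_def assms)

lemma sobolev_cong:
  assumes "\<And>x. x \<in> {0..1} \<Longrightarrow> F x = F' x"
  shows "F \<in> sobolev \<gamma> \<longleftrightarrow> F' \<in> sobolev \<gamma>"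
proof -
  have "continuous_on {0..1} F \<longleftrightarrow> continuous_on {0..1} F'"
    using assms by (intro continuous_on_cong) auto
  moreover have "dd F \<in> sqint km \<longleftrightarrow> dd F' \<in> sqint km"
  proof -
    have "dd F \<in> borel_measurable km \<longleftrightarrow> dd F' \<in> borel_measurable km"
      using assms by (intro measurable_cong) (auto simp: space_km dd_def)
    moreover have "integrable km (\<lambda>p. (dd F p)\<^sup>2) \<longleftrightarrow> integrable km (\<lambda>p. (dd F' p)\<^sup>2)"
      using assms by (intro Bochner_Integration.integrable_cong) (auto simp: space_km dd_def)
    ultimately show ?thesis by (simp add: sqint_def)
  qed
  ultimately show ?thesis by (simp add: sobolev_iff)
qed

text \<open>Fatou's lemma for the squared increments. The bounds \<open>\<beta> n\<close> are kept
  apart from the energies so that the lemma serves minimising sequences as well as partial sums of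
  spectral series.\<close>

lemma en_lsc:
  assumes f: "\<And>n. f n \<in> sobolev \<gamma>" and g: "continuous_on {0..1} g"
    and lim: "\<And>x. x \<in> {0..1} \<Longrightarrow> (\<lambda>n. f n x) \<longlonglongrightarrow> g x"
    and le: "\<And>n. energy (f n) \<le> \<beta> n" and \<beta>: "\<beta> \<longlonglongrightarrow> b"
  shows "g \<in> sobolev \<gamma>" "en g g \<le> b"
proof -
  have [measurable]: "dd (f n) \<in> borel_measurable km" for n
    by (intro dd_measurable sobolev_measurable f)
  have gm: "dd g \<in> borel_measurable km"
    by (intro dd_measurable continuous_measurable_unit_leb g)
  have "(\<integral>\<^sup>+p. ennreal ((dd g p)\<^sup>2) \<partial>km) = (\<integral>\<^sup>+p. liminf (\<lambda>n. ennreal ((dd (f n) p)\<^sup>2)) \<partial>km)"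
  proof (rule nn_integral_cong)
    fix p assume "p \<in> space km"
    then have "(\<lambda>n. dd (f n) p) \<longlonglongrightarrow> dd g p"
      unfolding dd_def by (intro tendsto_diff lim) (auto simp: space_km)
    then have "(\<lambda>n. ennreal ((dd (f n) p)\<^sup>2)) \<longlonglongrightarrow> ennreal ((dd g p)\<^sup>2)"
      by (intro tendsto_ennrealI tendsto_power)
    then show "ennreal ((dd g p)\<^sup>2) = liminf (\<lambda>n. ennreal ((dd (f n) p)\<^sup>2))"
      using lim_imp_Liminf[OF sequentially_bot] by metis
  qed
  also have "\<dots> \<le> liminf (\<lambda>n. \<integral>\<^sup>+p. ennreal ((dd (f n) p)\<^sup>2) \<partial>km)"
    by (intro nn_integral_liminf) simp
  also have "\<dots> = liminf (\<lambda>n. ennreal (energy (f n)))"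
    using f by (simp add: nn_integral_sq_eq_ip sobolev_dd en_def)
  also have "\<dots> \<le> liminf (\<lambda>n. ennreal (\<beta> n))"
    by (intro Liminf_mono always_eventually allI ennreal_leI le)
  also have "\<dots> = ennreal b"
    by (intro lim_imp_Liminf tendsto_ennrealI \<beta>) simp
  finally have *: "(\<integral>\<^sup>+p. ennreal ((dd g p)\<^sup>2) \<partial>km) \<le> ennreal b" .
  then have sq: "dd g \<in> sqint km"
    by (subst sqint_iff_nn_integral[OF gm]) (auto intro: le_less_trans)
  then show "g \<in> sobolev \<gamma>" using g by (simp add: sobolev_iff)
  have "0 \<le> b" using le en_nonneg by (intro LIMSEQ_le_const[OF \<beta>]) (meson order_trans)
  then show "en g g \<le> b" using * by (simp add: nn_integral_sq_eq_ip[OF sq] en_def ennreal_le_iff)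
qed

section \<open>Fractional Morrey inequality and compactness\<close>

interpretation ulp2: finite_measure "unit_leb \<Otimes>\<^sub>M unit_leb"
  by (rule finite_measure_pair_measure) (rule finite_measure_unit_leb)+

lemma finite_measure_ulp: "finite_measure (unit_leb \<Otimes>\<^sub>M unit_leb)"
  by (rule ulp2.finite_measure_axioms)

lemma en_eq_lint:
  assumes "F \<in> sobolev \<gamma>"
  shows "integrable (unit_leb \<Otimes>\<^sub>M unit_leb) (\<lambda>p. kern (fst p) (snd p) * (dd F p)\<^sup>2)"
    "en F F = (LINT p|(unit_leb \<Otimes>\<^sub>M unit_leb). kern (fst p) (snd p) * (dd F p)\<^sup>2)"
proof -
  have m: "(\<lambda>p. (dd F p)\<^sup>2) \<in> borel_measurable (unit_leb \<Otimes>\<^sub>M unit_leb)"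
    using sqint_measurable[OF sobolev_dd[OF assms]] measurable_cong_sets[OF sets_km refl] by auto
  have i: "integrable km (\<lambda>p. (dd F p)\<^sup>2)"
    using sobolev_dd[OF assms] by (simp add: sqint_def)
  show "integrable (unit_leb \<Otimes>\<^sub>M unit_leb) (\<lambda>p. kern (fst p) (snd p) * (dd F p)\<^sup>2)"
    using i unfolding km_def by (subst (asm) integrable_real_density) (simp_all add: m)
  show "en F F = (LINT p|(unit_leb \<Otimes>\<^sub>M unit_leb). kern (fst p) (snd p) * (dd F p)\<^sup>2)"
    unfolding en_def ip_def power2_eq_square[symmetric]
    unfolding km_def by (subst integral_real_density) (simp_all add: m)
qed

lemma lint_unit_interval:
  assumes "0 \<le> a" "a \<le> b" "b \<le> 1"
  shows "(LINT u|unit_leb. indicator {a..b} u) = b - a"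
proof -
  have "{a..b} \<in> sets unit_leb"
    using assms by (auto simp: sets_restrict_space intro!: image_eqI[of _ _ "{a..b}"])
  then have "(LINT u|unit_leb. indicator {a..b} u) = measure unit_leb {a..b}"
    using assms by (simp add: measure_def)
  also have "\<dots> = b - a"
    using assms by (subst measure_restrict_space) auto
  finally show ?thesis .
qed

definition avg :: "(real \<Rightarrow> real) \<Rightarrow> real \<Rightarrow> real \<Rightarrow> real" where
  "avg F a b = (LINT u|unit_leb. indicator {a..b} u * F u) / (b - a)"

lemma integrable_indicator_mult:
  fixes F :: "real \<Rightarrow> real"
  assumes "F \<in> borel_measurable unit_leb" "integrable unit_leb F"
  shows "integrable unit_leb (\<lambda>u. indicator {a..b} u * F u)"
proof -
  have "{a..b} \<inter> {0..1} \<in> sets unit_leb"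
    by (auto simp: sets_restrict_space intro!: image_eqI[of _ _ "{a..b}"])
  then have "integrable unit_leb (\<lambda>u. indicator ({a..b} \<inter> {0..1}) u *\<^sub>R F u)"
    by (intro integrable_mult_indicator assms(2))
  then show ?thesis
    by (rule Bochner_Integration.integrable_cong[THEN iffD1, rotated -1]) (auto simp: indicator_def)
qed

lemma continuous_integrable_unit:
  "continuous_on {0..1} (F :: real \<Rightarrow> real) \<Longrightarrow> integrable unit_leb F"
  using sqint_mult_integrable[OF continuous_sqint[of F] continuous_sqint[of "\<lambda>_. 1"]] by simp

text \<open>With t the difference of the averages, the tangent bound 2 t X - t^2 \<le> X^2 is
  integrated over the rectangle, where X is the increment of \<open>F\<close>. Its integral is the
  area times t^2, and on the rectangle the kernel is at least its value at distance
  \<open>l\<close>.\<close>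

lemma avg_diff_sq:
  assumes F: "F \<in> sobolev \<gamma>" and "0 \<le> a" "a < b" "b \<le> 1" "0 \<le> c" "c < d" "d \<le> 1"
    and l: "\<And>u v. u \<in> {a..b} \<Longrightarrow> v \<in> {c..d} \<Longrightarrow> \<bar>u - v\<bar> \<le> l" and "0 < l"
  shows "(b - a) * (d - c) * (avg F c d - avg F a b)\<^sup>2 \<le> 2 / c_norm \<gamma> * l powr (1 + \<gamma>) * en F F"
proof -
  let ?L = "unit_leb \<Otimes>\<^sub>M unit_leb"
  let ?I = "\<lambda>u. indicator {a..b} u :: real" and ?J = "\<lambda>u. indicator {c..d} u :: real"
  define t where "t = avg F c d - avg F a b"
  define k where "k = c_norm \<gamma> / 2 / l powr (1 + \<gamma>)"
  have k: "0 < k" using c_pos \<open>0 < l\<close> by (simp add: k_def)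
  have [measurable]: "F \<in> borel_measurable unit_leb" by (rule sobolev_measurable[OF F])
  have Fc: "continuous_on {0..1} F" by (rule sobolev_continuous[OF F])
  obtain B where B: "\<And>x. x \<in> {0..1} \<Longrightarrow> \<bar>F x\<bar> \<le> B" "0 < B"
    using continuous_bounded_unit[OF Fc] by metis
  have iF: "integrable unit_leb F" by (rule continuous_integrable_unit[OF Fc])
  have i1: "integrable unit_leb (\<lambda>u. 1 :: real)" by simp
  have iI: "integrable unit_leb (\<lambda>u. ?I u * F u)" "integrable unit_leb (\<lambda>u. ?J u * F u)"
    "integrable unit_leb ?I" "integrable unit_leb ?J"
    using integrable_indicator_mult[OF _ iF] integrable_indicator_mult[OF _ i1] by auto
  have AI: "(LINT u|unit_leb. ?I u * F u) = (b - a) * avg F a b" "(LINT u|unit_leb. ?J u * F u) = (d - c) * avg F c d"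
    using assms by (auto simp: avg_def)
  let ?g = "\<lambda>p. ?I (fst p) * ?J (snd p) * (2 * t * (F (snd p) - F (fst p)) - t\<^sup>2)"
  have gi: "integrable ?L ?g"
  proof (rule ulp2.integrable_const_bound[where B = "2 * \<bar>t\<bar> * (2 * B) + t\<^sup>2"])
    show "?g \<in> borel_measurable ?L" by measurable
    show "AE p in ?L. norm (?g p) \<le> 2 * \<bar>t\<bar> * (2 * B) + t\<^sup>2"
    proof (rule AE_I2)
      fix p assume "p \<in> space ?L"
      then have p: "\<bar>F (snd p)\<bar> \<le> B" "\<bar>F (fst p)\<bar> \<le> B" using B by (auto simp: space_pair_measure)
      have "\<bar>2 * t * (F (snd p) - F (fst p)) - t\<^sup>2\<bar> \<le> 2 * \<bar>t\<bar> * \<bar>F (snd p) - F (fst p)\<bar> + t\<^sup>2"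
        using abs_triangle_ineq4[of "2 * t * (F (snd p) - F (fst p))" "t\<^sup>2"] by (simp add: abs_mult)
      also have "\<dots> \<le> 2 * \<bar>t\<bar> * (2 * B) + t\<^sup>2"
        using p by (intro add_right_mono mult_left_mono) auto
      finally show "norm (?g p) \<le> 2 * \<bar>t\<bar> * (2 * B) + t\<^sup>2"
        using B by (auto simp: indicator_def)
    qed
  qed
  have "(LINT p|?L. ?g p) = (LINT u|unit_leb. LINT v|unit_leb. ?g (u, v))"
    by (rule ulp.integral_fst'[symmetric, OF gi])
  also have "\<dots> = (LINT u|unit_leb. 2 * t * (d - c) * avg F c d * ?I u - 2 * t * (d - c) * (?I u * F u) - t\<^sup>2 * (d - c) * ?I u)"
  proof (rule Bochner_Integration.integral_cong)
    fix u
    have "(LINT v|unit_leb. ?g (u, v)) = (LINT v|unit_leb. 2 * t * ?I u * (?J v * F v) - (2 * t * ?I u * F u + t\<^sup>2 * ?I u) * ?J v)"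
      by (intro Bochner_Integration.integral_cong) (auto simp: algebra_simps)
    also have "\<dots> = 2 * t * ?I u * ((d - c) * avg F c d) - (2 * t * ?I u * F u + t\<^sup>2 * ?I u) * (d - c)"
      using assms lint_unit_interval[of c d] by (simp add: iI AI)
    finally show "(LINT v|unit_leb. ?g (u, v)) = 2 * t * (d - c) * avg F c d * ?I u - 2 * t * (d - c) * (?I u * F u) - t\<^sup>2 * (d - c) * ?I u"
      by (simp add: algebra_simps)
  qed simp
  also have "\<dots> = 2 * t * (d - c) * avg F c d * (b - a) - 2 * t * (d - c) * ((b - a) * avg F a b) - t\<^sup>2 * (d - c) * (b - a)"
    using assms lint_unit_interval[of a b] by (simp add: iI AI)
  also have "\<dots> = (b - a) * (d - c) * t\<^sup>2"
    by (simp add: t_def power2_eq_square algebra_simps)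
  finally have gint: "(LINT p|?L. ?g p) = (b - a) * (d - c) * t\<^sup>2" .
  have "k * ((b - a) * (d - c) * t\<^sup>2) = (LINT p|?L. k * ?g p)"
    by (simp add: gint)
  also have "\<dots> \<le> en F F"
    unfolding en_eq_lint(2)[OF F]
  proof (rule integral_mono)
    show "integrable ?L (\<lambda>p. k * ?g p)" using gi by simp
    show "integrable ?L (\<lambda>p. kern (fst p) (snd p) * (dd F p)\<^sup>2)" by (rule en_eq_lint(1)[OF F])
    fix p assume "p \<in> space ?L"
    show "k * ?g p \<le> kern (fst p) (snd p) * (dd F p)\<^sup>2"
    proof (cases "fst p \<in> {a..b} \<and> snd p \<in> {c..d}")
      case True
      let ?X = "F (snd p) - F (fst p)"
      have "0 \<le> (?X - t)\<^sup>2" by simp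
      then have x: "2 * t * ?X - t\<^sup>2 \<le> ?X\<^sup>2" by (simp add: power2_eq_square algebra_simps)
      have "k * ?g p \<le> k * ?X\<^sup>2" using True x k by simp
      also have "k * ?X\<^sup>2 \<le> kern (fst p) (snd p) * ?X\<^sup>2"
      proof (cases "fst p = snd p")
        case False
        have "\<bar>fst p - snd p\<bar> powr (1 + \<gamma>) \<le> l powr (1 + \<gamma>)"
          using l[of "fst p" "snd p"] True \<gamma>1 by (intro powr_mono2) auto
        then have "k \<le> kern (fst p) (snd p)"
          unfolding k_def kern_def using False c_pos \<open>0 < l\<close> by (intro divide_left_mono mult_pos_pos) auto
        then show ?thesis by (intro mult_right_mono) auto
      qed simp
      finally show ?thesis by (simp add: dd_def)
    next
      case False
      then have "?I (fst p) * ?J (snd p) = 0" by (auto simp: indicator_def)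
      then show ?thesis by (simp only: mult_zero_left mult_zero_right) simp
    qed
  qed
  finally have "k * ((b - a) * (d - c) * t\<^sup>2) \<le> en F F" .
  then have "(b - a) * (d - c) * t\<^sup>2 \<le> en F F / k"
    using k by (simp add: pos_le_divide_eq mult.commute)
  also have "en F F / k = 2 / c_norm \<gamma> * l powr (1 + \<gamma>) * en F F"
    by (simp add: k_def)
  finally show ?thesis by (simp add: t_def)
qed

lemma avg_tendsto:
  assumes F: "continuous_on {0..1} F" and z: "z \<in> {0..1}"
    and ab: "\<And>n. 0 \<le> a n" "\<And>n. a n < b n" "\<And>n. b n \<le> 1" "\<And>n. z \<in> {a n..b n}"
    and lim: "(\<lambda>n. b n - a n) \<longlonglongrightarrow> 0"
  shows "(\<lambda>n. avg F (a n) (b n)) \<longlonglongrightarrow> F z"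
proof (rule LIMSEQ_I)
  fix r :: real assume "0 < r"
  then obtain d where d: "0 < d" "\<And>x. x \<in> {0..1} \<Longrightarrow> dist x z < d \<Longrightarrow> dist (F x) (F z) < r / 2"
    using F z unfolding continuous_on_iff by (meson half_gt_zero)
  obtain N where N: "\<And>n. n \<ge> N \<Longrightarrow> \<bar>b n - a n\<bar> < d"
    using LIMSEQ_D[OF lim d(1)] by auto
  have Fi: "integrable unit_leb F" by (rule continuous_integrable_unit[OF F])
  have "norm (avg F (a n) (b n) - F z) < r" if "n \<ge> N" for n
  proof -
    let ?I = "\<lambda>u. indicator {a n..b n} u :: real"
    have iI: "integrable unit_leb (\<lambda>u. ?I u * F u)" "integrable unit_leb ?I"
      using integrable_indicator_mult[OF _ Fi] integrable_indicator_mult[of "\<lambda>_. 1"]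
        continuous_measurable_unit_leb[OF F] by auto
    have L: "(LINT u|unit_leb. ?I u) = b n - a n"
      using ab[of n] by (intro lint_unit_interval) auto
    have "(LINT u|unit_leb. ?I u * (F u - F z)) = (b n - a n) * (avg F (a n) (b n) - F z)"
      using ab[of n] iI L by (simp add: right_diff_distrib avg_def)
    moreover have "\<bar>LINT u|unit_leb. ?I u * (F u - F z)\<bar> \<le> (LINT u|unit_leb. ?I u * (r / 2))"
    proof (rule integral_abs_bound[THEN order_trans], rule integral_mono)
      show "integrable unit_leb (\<lambda>u. \<bar>?I u * (F u - F z)\<bar>)"
        using iI by (auto simp: right_diff_distrib)
      show "integrable unit_leb (\<lambda>u. ?I u * (r / 2))" using iI by simp
      fix u :: real assume "u \<in> space unit_leb"
      have "\<bar>F u - F z\<bar> \<le> r / 2" if "u \<in> {a n..b n}"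
      proof -
        have "\<bar>u - z\<bar> < d" using that N[OF \<open>n \<ge> N\<close>] ab(4)[of n] by auto
        then show ?thesis using d(2)[of u] \<open>u \<in> space unit_leb\<close> by (auto simp: dist_real_def)
      qed
      then show "\<bar>?I u * (F u - F z)\<bar> \<le> ?I u * (r / 2)"
        by (auto simp: indicator_def)
    qed
    ultimately have "(b n - a n) * \<bar>avg F (a n) (b n) - F z\<bar> \<le> (b n - a n) * (r / 2)"
      using ab[of n] L iI by (simp add: abs_mult)
    then have "\<bar>avg F (a n) (b n) - F z\<bar> \<le> r / 2"
      using ab(2)[of n] by simp
    then show ?thesis using \<open>0 < r\<close> by simp
  qed
  then show "\<exists>N. \<forall>n\<ge>N. norm (avg F (a n) (b n) - F z) < r" by blast
qed

text \<open>The square root of 2^(- (\<gamma> - 1)): the factor by which the estimate for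
  consecutive averages shrinks when the length is halved. It is below 1 exactly because \<gamma> >
  1.\<close>

definition mq :: real where "mq = 2 powr (- ((\<gamma> - 1) / 2))"

lemma mq: "0 < mq" "mq < 1"
  using \<gamma>1 by (auto simp: mq_def powr_less_one)

lemma mq_power: "mq ^ k = sqrt ((1 / 2 ^ k) powr (\<gamma> - 1))"
proof -
  have "((1 / 2 ^ k) powr (\<gamma> - 1)) = (mq ^ k)\<^sup>2"
    by (simp add: mq_def powr_realpow[symmetric] powr_powr powr_divide powr_minus_divide[symmetric]
        power2_eq_square powr_add[symmetric] algebra_simps)
  then show ?thesis using mq by simp
qed

text \<open>Consecutive averages over shrinking dyadic intervals around a point form a geometric series.\<close>

lemma avg_point:
  assumes F: "F \<in> sobolev \<gamma>" and z: "z \<in> {0..1}"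
    and ab: "\<And>n. 0 \<le> a n" "\<And>n. b n \<le> 1" "\<And>n. z \<in> {a n..b n}"
    and nest: "\<And>n. a n \<le> a (Suc n)" "\<And>n. b (Suc n) \<le> b n"
    and len: "\<And>n. b n - a n = l / 2 ^ n" and "0 < l"
  shows "\<bar>F z - avg F (a 0) (b 0)\<bar> \<le> sqrt (4 / c_norm \<gamma> * l powr (\<gamma> - 1) * en F F) / (1 - mq)"
proof -
  define D where "D = sqrt (4 / c_norm \<gamma> * l powr (\<gamma> - 1) * en F F)"
  have D: "0 \<le> D" using c_pos en_nonneg[of F] by (simp add: D_def)
  have less: "a n < b n" for n using len[of n] \<open>0 < l\<close> by (metis diff_gt_0_iff_gt divide_pos_pos zero_less_numeral zero_less_power)
  have step: "\<bar>avg F (a (Suc n)) (b (Suc n)) - avg F (a n) (b n)\<bar> \<le> D * mq ^ n" for n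
  proof -
    define m where "m = l / 2 ^ n"
    let ?l = m
    let ?t = "avg F (a (Suc n)) (b (Suc n)) - avg F (a n) (b n)"
    have l: "0 < ?l" using \<open>0 < l\<close> by (simp add: m_def)
    have len': "b n - a n = m" "b (Suc n) - a (Suc n) = m / 2" by (simp_all add: len m_def)
    have "(b n - a n) * (b (Suc n) - a (Suc n)) * ?t\<^sup>2 \<le> 2 / c_norm \<gamma> * ?l powr (1 + \<gamma>) * en F F"
    proof (rule avg_diff_sq[OF F])
      fix u v assume "u \<in> {a n..b n}" "v \<in> {a (Suc n)..b (Suc n)}"
      then show "\<bar>u - v\<bar> \<le> ?l" using nest[of n] len' by auto
    qed (use ab less l in auto)
    \<comment> \<open>The lengths m and m / 2 cancel two powers of m on the right; the remaining
      m^(\<gamma> - 1) decays geometrically in n.\<close>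
    then have "?l * (?l / 2) * ?t\<^sup>2 \<le> 2 / c_norm \<gamma> * ?l powr (1 + \<gamma>) * en F F"
      unfolding len' .
    moreover have "?l powr (1 + \<gamma>) = ?l * ?l * ?l powr (\<gamma> - 1)"
    proof -
      have "?l powr (1 + \<gamma>) = ?l powr (2 + (\<gamma> - 1))" by (simp add: algebra_simps)
      also have "\<dots> = ?l powr 2 * ?l powr (\<gamma> - 1)" by (rule powr_add)
      finally show ?thesis using l by (simp add: power2_eq_square)
    qed
    ultimately have "(?l * ?l / 2) * ?t\<^sup>2 \<le> (?l * ?l / 2) * (4 / c_norm \<gamma> * ?l powr (\<gamma> - 1) * en F F)"
      by (simp add: mult_ac)
    then have "?t\<^sup>2 \<le> 4 / c_norm \<gamma> * ?l powr (\<gamma> - 1) * en F F"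
      by (rule mult_left_le_imp_le) (use l in simp)
    also have "?l powr (\<gamma> - 1) = l powr (\<gamma> - 1) * (1 / 2 ^ n) powr (\<gamma> - 1)"
      using \<open>0 < l\<close> by (subst powr_mult[symmetric]) (auto simp: m_def)
    finally have "sqrt (?t\<^sup>2) \<le> sqrt ((4 / c_norm \<gamma> * l powr (\<gamma> - 1) * en F F) * (1 / 2 ^ n) powr (\<gamma> - 1))"
      by (intro real_sqrt_le_mono) (simp add: mult_ac)
    then show ?thesis by (simp only: real_sqrt_mult real_sqrt_abs D_def mq_power)
  qed
  have "\<bar>avg F (a n) (b n) - avg F (a 0) (b 0)\<bar> \<le> D / (1 - mq)" for n
  proof -
    have "\<bar>avg F (a n) (b n) - avg F (a 0) (b 0)\<bar> \<le> (\<Sum>k<n. D * mq ^ k)"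
    proof (induction n)
      case (Suc n)
      have "\<bar>avg F (a (Suc n)) (b (Suc n)) - avg F (a 0) (b 0)\<bar>
        \<le> \<bar>avg F (a (Suc n)) (b (Suc n)) - avg F (a n) (b n)\<bar> + \<bar>avg F (a n) (b n) - avg F (a 0) (b 0)\<bar>"
        by linarith
      also have "\<dots> \<le> D * mq ^ n + (\<Sum>k<n. D * mq ^ k)" by (intro add_mono step Suc)
      finally show ?case by simp
    qed simp
    also have "\<dots> = D * (\<Sum>k<n. mq ^ k)" by (simp add: sum_distrib_left)
    also have "(\<Sum>k<n. mq ^ k) = (1 - mq ^ n) / (1 - mq)"
      using mq by (simp add: sum_gp_strict)
    also have "D * ((1 - mq ^ n) / (1 - mq)) \<le> D * (1 / (1 - mq))"
      using mq D by (intro mult_left_mono divide_right_mono) auto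
    finally show ?thesis by simp
  qed
  moreover have "(\<lambda>n. avg F (a n) (b n)) \<longlonglongrightarrow> F z"
  proof (rule avg_tendsto[OF sobolev_continuous[OF F] z])
    have "(\<lambda>n. l * (1 / 2) ^ n) \<longlonglongrightarrow> l * 0"
      by (intro tendsto_intros LIMSEQ_realpow_zero) auto
    then show "(\<lambda>n. b n - a n) \<longlonglongrightarrow> 0" unfolding len by (simp add: power_divide)
  qed (use ab less in auto)
  then have "(\<lambda>n. \<bar>avg F (a n) (b n) - avg F (a 0) (b 0)\<bar>) \<longlonglongrightarrow> \<bar>F z - avg F (a 0) (b 0)\<bar>"
    by (intro tendsto_intros)
  ultimately show ?thesis
    unfolding D_def[symmetric] by (intro LIMSEQ_le_const2) auto
qed

text \<open>The geometric series contributes 1 / (1 - mq) at each of two points, and 4 / c is the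
  constant of a single halving step; the first factor is squared since the inequality is for
  squares.\<close>

definition morrey :: real where "morrey = (2 / (1 - mq))\<^sup>2 * (4 / c_norm \<gamma>)"

lemma morrey_pos: "0 < morrey"
  using mq c_pos by (simp add: morrey_def)

text \<open>Both end points are compared with the average over the interval between them: one family
  of intervals shrinks to the left end, the other to the right end, and the two families start from
  the same interval.\<close>

lemma morrey_inequality:
  assumes F: "F \<in> sobolev \<gamma>" and "x \<in> {0..1}" "y \<in> {0..1}"
  shows "(F x - F y)\<^sup>2 \<le> morrey * \<bar>x - y\<bar> powr (\<gamma> - 1) * en F F"
proof -
  have main: "(F x - F y)\<^sup>2 \<le> morrey * \<bar>x - y\<bar> powr (\<gamma> - 1) * en F F"
    if "x < y" "0 \<le> x" "y \<le> 1" for x y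
  proof -
    define l where "l = y - x"
    have l: "0 < l" using that by (simp add: l_def)
    define D where "D = 4 / c_norm \<gamma> * l powr (\<gamma> - 1) * en F F"
    have D: "0 \<le> D" using c_pos en_nonneg[of F] by (simp add: D_def)
    have small: "l / 2 ^ n \<le> l" "l / 2 ^ Suc n \<le> l / 2 ^ n" for n
      using l by (auto simp: field_simps)
    have "\<bar>F x - avg F ((\<lambda>_. x) 0) ((\<lambda>n. x + l / 2 ^ n) 0)\<bar> \<le> sqrt D / (1 - mq)"
      unfolding D_def
    proof (rule avg_point[OF F])
      show "x + l / 2 ^ n \<le> 1" for n using small(1)[of n] that by (simp add: l_def)
    qed (use that l small in auto)
    moreover have "\<bar>F y - avg F ((\<lambda>n. y - l / 2 ^ n) 0) ((\<lambda>_. y) 0)\<bar> \<le> sqrt D / (1 - mq)"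
      unfolding D_def
    proof (rule avg_point[OF F])
      show "0 \<le> y - l / 2 ^ n" for n using small(1)[of n] that by (simp add: l_def)
    qed (use that l small in auto)
    ultimately have "\<bar>F x - F y\<bar> \<le> 2 / (1 - mq) * sqrt D"
      by (simp add: l_def)
    then have "\<bar>F x - F y\<bar>\<^sup>2 \<le> (2 / (1 - mq) * sqrt D)\<^sup>2"
      by (intro power_mono) auto
    also have "\<dots> = (2 / (1 - mq))\<^sup>2 * D" using D by (subst power_mult_distrib) simp
    finally show ?thesis using that by (simp add: D_def morrey_def l_def mult_ac)
  qed
  show ?thesis
  proof (cases x y rule: linorder_cases)
    case less then show ?thesis using main[of x y] assms by auto
  next
    case greater then show ?thesis using main[of y x] assms by (auto simp: power2_commute abs_minus_commute)
  qed simp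
qed

lemma sobolev_bound:
  assumes F: "F \<in> sobolev \<gamma>" and "x \<in> {0..1}"
  shows "(F x - F 0)\<^sup>2 \<le> morrey * en F F"
proof -
  have "(F x - F 0)\<^sup>2 \<le> morrey * \<bar>x - 0\<bar> powr (\<gamma> - 1) * en F F"
    using assms by (intro morrey_inequality) auto
  also have "\<dots> \<le> morrey * 1 * en F F"
  proof (intro mult_right_mono mult_left_mono)
    have "\<bar>x - 0\<bar> powr (\<gamma> - 1) \<le> 1 powr (\<gamma> - 1)"
      using assms \<gamma>1 by (intro powr_mono2) auto
    then show "\<bar>x - 0\<bar> powr (\<gamma> - 1) \<le> 1" by simp
  qed (use morrey_pos en_nonneg in \<open>auto simp: less_imp_le\<close>)
  finally show ?thesis by simp
qed

text \<open>The Morrey inequality gives equicontinuity and, with the bound at 0, a uniform bound, so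
  Arzela-Ascoli applies. Uniform convergence then feeds lower semicontinuity, which preserves the
  limit \<open>b\<close> of the bounds and not only an upper bound for them.\<close>

lemma sobolev_compactness:
  assumes f: "\<And>n. f n \<in> sobolev \<gamma>" and f0: "\<And>n. \<bar>f n 0\<bar> \<le> A"
    and le: "\<And>n. energy (f n) \<le> \<beta> n" and \<beta>: "\<beta> \<longlonglongrightarrow> b"
  obtains g r where "strict_mono (r :: nat \<Rightarrow> nat)" "g \<in> sobolev \<gamma>" "en g g \<le> b"
    "uniform_limit {0..1} (\<lambda>n. f (r n)) g sequentially"
proof -
  obtain B where B: "\<And>n. \<beta> n \<le> B" "0 \<le> B"
  proof -
    have "Bseq \<beta>" using \<beta> convergentI convergent_imp_Bseq by blast
    then obtain B where "\<And>n. norm (\<beta> n) \<le> B" "0 < B" by (auto simp: Bseq_def)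
    then show ?thesis using that[of B] by (smt (verit) real_norm_def)
  qed
  have eB: "energy (f n) \<le> B" for n using le[of n] B(1)[of n] by linarith
  have bd: "norm (f n x) \<le> A + sqrt (morrey * B)" if "x \<in> {0..1}" for n x
  proof -
    have "(f n x - f n 0)\<^sup>2 \<le> morrey * energy (f n)" by (rule sobolev_bound[OF f that])
    also have "\<dots> \<le> morrey * B" using eB morrey_pos by (intro mult_left_mono) auto
    finally have "\<bar>f n x - f n 0\<bar> \<le> sqrt (morrey * B)" by (simp add: real_le_rsqrt)
    then show ?thesis using f0[of n] by simp
  qed
  have eq: "\<exists>d>0. \<forall>n y. y \<in> {0..1} \<and> norm (x - y) < d \<longrightarrow> norm (f n x - f n y) < e"
    if "x \<in> {0..1}" "0 < e" for x e
  proof -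
    \<comment> \<open>Inverts the Morrey modulus: the squared increment is then at most e^2 times mB
      / (mB + 1), with mB the product of \<open>morrey\<close> and \<open>B\<close>. The added 1
      keeps the quotient meaningful for \<open>B = 0\<close> and the inequality strict.\<close>
    define d where "d = (e\<^sup>2 / (morrey * B + 1)) powr (1 / (\<gamma> - 1))"
    have mB: "0 \<le> morrey * B" using morrey_pos B(2) by simp
    have d: "0 < d" using that mB by (simp add: d_def)
    have dp: "d powr (\<gamma> - 1) = e\<^sup>2 / (morrey * B + 1)"
      using \<gamma>1 that mB by (simp add: d_def powr_powr)
    have "norm (f n x - f n y) < e" if y: "y \<in> {0..1}" "norm (x - y) < d" for n y
    proof -
      have "(f n x - f n y)\<^sup>2 \<le> morrey * \<bar>x - y\<bar> powr (\<gamma> - 1) * energy (f n)"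
        using \<open>x \<in> {0..1}\<close> y by (intro morrey_inequality f) auto
      also have "\<dots> \<le> morrey * d powr (\<gamma> - 1) * B"
        using y \<gamma>1 eB morrey_pos en_nonneg by (intro mult_mono mult_left_mono powr_mono2) auto
      also have "\<dots> = (morrey * B) * (e\<^sup>2 / (morrey * B + 1))" by (simp add: dp)
      also have "\<dots> < e\<^sup>2" using \<open>0 < e\<close> mB by (simp add: field_simps)
      finally have "\<bar>f n x - f n y\<bar>\<^sup>2 < e\<^sup>2" by simp
      then show ?thesis using \<open>0 < e\<close> by (auto intro: power2_less_imp_less)
    qed
    then show ?thesis using d by blast
  qed
  obtain g r where g: "continuous_on {0..1} g" "strict_mono (r :: nat \<Rightarrow> nat)"
    and lim: "\<And>e. 0 < e \<Longrightarrow> \<exists>N. \<forall>n x. n \<ge> N \<and> x \<in> {0..1} \<longrightarrow> norm (f (r n) x - g x) < e"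
    using Arzela_Ascoli[of "{0..1::real}" f "A + sqrt (morrey * B)", OF compact_Icc bd eq] by metis
  have u: "uniform_limit {0..1} (\<lambda>n. f (r n)) g sequentially"
    unfolding uniform_limit_sequentially_iff dist_norm using lim by metis
  have b: "(\<lambda>n. \<beta> (r n)) \<longlonglongrightarrow> b"
    using LIMSEQ_subseq_LIMSEQ[OF \<beta> g(2)] by (simp add: comp_def)
  have "g \<in> sobolev \<gamma>" "en g g \<le> b"
    using en_lsc[OF _ g(1) _ _ b, of "\<lambda>n. f (r n)"] f le tendsto_uniform_limitI[OF u] by auto
  then show ?thesis using that g(2) u by blast
qed

text \<open>The direct method. Closedness under uniform limits is the form that suits both
  applications: the unit sphere of L^2 inside a constrained subspace, and the functions with
  prescribed boundary values.\<close>

lemma energy_minimizer: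
  assumes "S \<subseteq> sobolev \<gamma>" "S \<noteq> {}" and b0: "\<And>f. f \<in> S \<Longrightarrow> \<bar>f 0\<bar> \<le> A"
    and closed: "\<And>f g. (\<And>n::nat. f n \<in> S) \<Longrightarrow> g \<in> sobolev \<gamma> \<Longrightarrow> uniform_limit {0..1} f g sequentially \<Longrightarrow> g \<in> S"
  obtains m where "m \<in> S" "\<And>f. f \<in> S \<Longrightarrow> en m m \<le> en f f"
proof -
  define b where "b = (INF f\<in>S. en f f)"
  have bdd: "bdd_below ((\<lambda>f. en f f) ` S)" using en_nonneg by (intro bdd_belowI[of _ 0]) auto
  have "\<exists>f\<in>S. en f f \<le> b + 1 / Suc n" for n
  proof (rule ccontr)
    assume "\<not> ?thesis"
    then have "b + 1 / Suc n \<le> b"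
      unfolding b_def using assms(2) by (intro cINF_greatest) (auto simp: b_def)
    then show False by (simp add: field_simps)
  qed
  then obtain f where f: "\<And>n. f n \<in> S" "\<And>n. energy (f n) \<le> b + 1 / Suc n" by metis
  have "(\<lambda>n. b + 1 / Suc n) \<longlonglongrightarrow> b + 0"
    using LIMSEQ_inverse_real_of_nat by (intro tendsto_intros) (simp add: inverse_eq_divide)
  then have lim: "(\<lambda>n. b + 1 / Suc n) \<longlonglongrightarrow> b" by simp
  have fs: "\<And>n. f n \<in> sobolev \<gamma>" "\<And>n. \<bar>f n 0\<bar> \<le> A" using f(1) assms(1) b0 by auto
  obtain g r where g: "strict_mono (r :: nat \<Rightarrow> nat)" "g \<in> sobolev \<gamma>" "en g g \<le> b"
    "uniform_limit {0..1} (\<lambda>n. f (r n)) g sequentially"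
    using sobolev_compactness[OF fs f(2) lim] by metis
  have "g \<in> S" using closed[OF f(1) g(2) g(4)] .
  moreover have "en g g \<le> en h h" if "h \<in> S" for h
    using g(3) cINF_lower[OF bdd that] by (simp add: b_def)
  ultimately show ?thesis using that by blast
qed

lemma en_quadratic:
  assumes "F \<in> sobolev \<gamma>" "w \<in> sobolev \<gamma>"
  shows "energy (\<lambda>x. F x + t * w x) = en F F + 2 * t * en F w + t\<^sup>2 * en w w"
  using assms
  by (simp add: en_add_left en_add_right sobolev_add sobolev_cmult en_cmult_left en_cmult_right
      en_commute[of w F] power2_eq_square distrib_left)

section \<open>The energy space with zero boundary values\<close>

definition H0 :: "(real \<Rightarrow> real) set" where
  "H0 = {F \<in> sobolev \<gamma>. F 0 = 0 \<and> F 1 = 0}"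

lemma H0_sobolev: "F \<in> H0 \<Longrightarrow> F \<in> sobolev \<gamma>"
  by (simp add: H0_def)

lemma H0_add: "F \<in> H0 \<Longrightarrow> G \<in> H0 \<Longrightarrow> (\<lambda>x. F x + G x) \<in> H0"
  and H0_diff: "F \<in> H0 \<Longrightarrow> G \<in> H0 \<Longrightarrow> (\<lambda>x. F x - G x) \<in> H0"
  and H0_cmult: "F \<in> H0 \<Longrightarrow> (\<lambda>x. a * F x) \<in> H0"
  and H0_zero: "(\<lambda>x. 0) \<in> H0"
  by (auto simp: H0_def sobolev_add sobolev_diff sobolev_cmult sobolev_const)

lemma H0_sum: "(\<And>i. i \<in> I \<Longrightarrow> H i \<in> H0) \<Longrightarrow> (\<lambda>x. \<Sum>i\<in>I. H i x) \<in> H0"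
  by (induction I rule: infinite_finite_induct) (auto intro: H0_zero H0_add)

lemma H0_sqint: "F \<in> H0 \<Longrightarrow> F \<in> sqint unit_leb"
  by (intro sobolev_sqint H0_sobolev)

lemma H0_bound: "F \<in> H0 \<Longrightarrow> x \<in> {0..1} \<Longrightarrow> (F x)\<^sup>2 \<le> morrey * en F F"
  using sobolev_bound[of F x] by (simp add: H0_def)

lemma H0_abs_bound: "F \<in> H0 \<Longrightarrow> x \<in> {0..1} \<Longrightarrow> \<bar>F x\<bar> \<le> sqrt (morrey * en F F)"
  using real_sqrt_le_mono[OF H0_bound] by simp

lemma H0_poincare: "F \<in> H0 \<Longrightarrow> ip2 F F \<le> morrey * en F F"
  using ip2_bound[of F "sqrt (morrey * en F F)"] H0_abs_bound[of F] en_nonneg[of F] morrey_pos by simp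

section \<open>Energy of Lipschitz functions\<close>

lemma nn_integral_powr_interval:
  assumes "a > -1" "0 \<le> r"
  shows "(\<integral>\<^sup>+h. ennreal (\<bar>h\<bar> powr a * indicator {-r..r} h) \<partial>lborel) = ennreal (2 * r powr (a + 1) / (a + 1))"
proof -
  let ?f = "\<lambda>h::real. ennreal (\<bar>h\<bar> powr a * indicator {0..r} h)"
  have half: "(\<integral>\<^sup>+h. ?f h \<partial>lborel) = ennreal (r powr (a + 1) / (a + 1))"
  proof -
    have "((\<lambda>x. x powr a) has_integral (r powr (a + 1) / (a + 1))) {0..r}"
      using assms by (intro has_integral_powr_from_0) auto
    then have "((\<lambda>x. if x \<in> {0..r} then x powr a else 0) has_integral (r powr (a + 1) / (a + 1))) UNIV"
      by (simp only: has_integral_restrict_UNIV)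
    moreover have "(\<lambda>x. if x \<in> {0..r} then x powr a else 0) = (\<lambda>h. h powr a * indicator {0..r} h)"
      by auto
    ultimately have "((\<lambda>h. h powr a * indicator {0..r} h) has_integral (r powr (a + 1) / (a + 1))) UNIV"
      by simp
    then have "(\<integral>\<^sup>+h. ennreal (h powr a * indicator {0..r} h) \<partial>lborel) = ennreal (r powr (a + 1) / (a + 1))"
      by (intro nn_integral_has_integral_lborel) auto
    moreover have "ennreal (h powr a * indicator {0..r} h) = ?f h" for h
      by (auto simp: indicator_def)
    ultimately show ?thesis by simp
  qed
  have "(\<integral>\<^sup>+h. ennreal (\<bar>h\<bar> powr a * indicator {-r..r} h) \<partial>lborel) = (\<integral>\<^sup>+h. ?f h + ?f (- h) \<partial>lborel)"
    by (intro nn_integral_cong) (auto simp: indicator_def)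
  also have "\<dots> = (\<integral>\<^sup>+h. ?f h \<partial>lborel) + (\<integral>\<^sup>+h. ?f (- h) \<partial>lborel)"
    by (intro nn_integral_add) auto
  also have "(\<integral>\<^sup>+h. ?f (- h) \<partial>lborel) = (\<integral>\<^sup>+h. ?f h \<partial>lborel)"
    using nn_integral_real_affine[of ?f "-1" 0] by simp
  finally show ?thesis
    unfolding half using assms by (simp add: ennreal_plus[symmetric] del: ennreal_plus)
qed

text \<open>The kernel constant times 2 / (2 - \<gamma>), the integral of \<bar>h\<bar>^(1 -
  \<gamma>) over [-1, 1].\<close>

definition lipc :: real where "lipc = (c_norm \<gamma> / 2) * (2 / (2 - \<gamma>))"

lemma lipc_pos: "0 < lipc"
  using c_pos \<gamma>2 by (simp add: lipc_def)

text \<open>Two powers of the distance gained from the increments weaken the singularity to \<bar>v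
  - u\<bar>^(1 - \<gamma>), which is integrable because \<gamma> < 2. The explicit dependence on
  \<open>L\<close> makes this the tool for showing that energies are small.\<close>

lemma lipschitz_sobolev:
  assumes lip: "\<And>x y. x \<in> {0..1} \<Longrightarrow> y \<in> {0..1} \<Longrightarrow> \<bar>F x - F y\<bar> \<le> L * \<bar>x - y\<bar>"
  shows "F \<in> sobolev \<gamma>" "en F F \<le> lipc * L\<^sup>2"
proof -
  have L: "0 \<le> L" using lip[of 0 1] by auto
  have c: "continuous_on {0..1} F"
  proof (rule lipschitz_on_continuous_on)
    show "L-lipschitz_on {0..1} F" using lip L by (auto simp: lipschitz_on_def dist_real_def)
  qed
  have m: "F \<in> borel_measurable unit_leb" by (rule continuous_measurable_unit_leb[OF c])
  have [measurable]: "(\<lambda>p. ennreal ((dd F p)\<^sup>2)) \<in> borel_measurable (unit_leb \<Otimes>\<^sub>M unit_leb)"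
    using dd_measurable[OF m] measurable_cong_sets[OF sets_km refl] by auto
  have "(\<integral>\<^sup>+p. ennreal ((dd F p)\<^sup>2) \<partial>km) = (\<integral>\<^sup>+u. \<integral>\<^sup>+v. ennreal (kern u v) * ennreal ((dd F (u, v))\<^sup>2) \<partial>unit_leb \<partial>unit_leb)"
    by (rule nn_integral_km) measurable
  also have "\<dots> \<le> (\<integral>\<^sup>+u. ennreal (lipc * L\<^sup>2) \<partial>unit_leb)"
  proof (rule nn_integral_mono)
    fix u :: real assume u: "u \<in> space unit_leb"
    have "(\<integral>\<^sup>+v. ennreal (kern u v) * ennreal ((dd F (u, v))\<^sup>2) \<partial>unit_leb)
      \<le> (\<integral>\<^sup>+v. ennreal (c_norm \<gamma> / 2 * L\<^sup>2) * ennreal (\<bar>v - u\<bar> powr (1 - \<gamma>)) \<partial>unit_leb)"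
    proof (rule nn_integral_mono)
      fix v :: real assume v: "v \<in> space unit_leb"
      have "kern u v * (dd F (u, v))\<^sup>2 \<le> c_norm \<gamma> / 2 * L\<^sup>2 * \<bar>v - u\<bar> powr (1 - \<gamma>)"
      proof (cases "u = v")
        case False
        have "\<bar>F v - F u\<bar>\<^sup>2 \<le> (L * \<bar>v - u\<bar>)\<^sup>2"
          using u v by (intro power_mono lip) auto
        then have "kern u v * (dd F (u, v))\<^sup>2 \<le> kern u v * (L * \<bar>v - u\<bar>)\<^sup>2"
          by (intro mult_left_mono) (auto simp: dd_def)
        also have "\<dots> = c_norm \<gamma> / 2 * L\<^sup>2 * (\<bar>v - u\<bar> powr 2 / \<bar>v - u\<bar> powr (1 + \<gamma>))"
          using False by (simp add: kern_def power_mult_distrib abs_minus_commute[of u v])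
        also have "\<bar>v - u\<bar> powr 2 / \<bar>v - u\<bar> powr (1 + \<gamma>) = \<bar>v - u\<bar> powr (1 - \<gamma>)"
          by (subst powr_diff[symmetric]) (simp add: algebra_simps)
        finally show ?thesis .
      qed (use c_pos in \<open>simp add: dd_def\<close>)
      then show "ennreal (kern u v) * ennreal ((dd F (u, v))\<^sup>2) \<le> ennreal (c_norm \<gamma> / 2 * L\<^sup>2) * ennreal (\<bar>v - u\<bar> powr (1 - \<gamma>))"
        using c_pos by (simp add: ennreal_mult[symmetric] ennreal_leI)
    qed
    also have "\<dots> = ennreal (c_norm \<gamma> / 2 * L\<^sup>2) * (\<integral>\<^sup>+v. ennreal (\<bar>v - u\<bar> powr (1 - \<gamma>)) \<partial>unit_leb)"
      by (intro nn_integral_cmult) (auto intro!: borel_unit_leb measurable_compose[OF _ measurable_ennreal])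
    also have "\<dots> \<le> ennreal (c_norm \<gamma> / 2 * L\<^sup>2) * (\<integral>\<^sup>+v. ennreal (\<bar>v - u\<bar> powr (1 - \<gamma>) * indicator {-1..1} (v - u)) \<partial>lborel)"
      using u by (intro mult_left_mono) (auto simp: nn_integral_restrict_space indicator_def intro!: nn_integral_mono)
    also have "(\<integral>\<^sup>+v. ennreal (\<bar>v - u\<bar> powr (1 - \<gamma>) * indicator {-1..1} (v - u)) \<partial>lborel) =
        (\<integral>\<^sup>+h. ennreal (\<bar>h\<bar> powr (1 - \<gamma>) * indicator {-1..1} h) \<partial>lborel)"
      by (subst nn_integral_real_affine[where c = 1 and t = u]) auto
    also have "\<dots> = ennreal (2 / (2 - \<gamma>))"
      using nn_integral_powr_interval[of "1 - \<gamma>" 1] \<gamma>2 by simp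
    also have "ennreal (c_norm \<gamma> / 2 * L\<^sup>2) * ennreal (2 / (2 - \<gamma>)) = ennreal (lipc * L\<^sup>2)"
      using c_pos \<gamma>2 by (subst ennreal_mult[symmetric]) (auto simp: lipc_def)
    finally show "(\<integral>\<^sup>+v. ennreal (kern u v) * ennreal ((dd F (u, v))\<^sup>2) \<partial>unit_leb) \<le> ennreal (lipc * L\<^sup>2)" .
  qed
  also have "\<dots> = ennreal (lipc * L\<^sup>2)" by simp
  finally have *: "(\<integral>\<^sup>+p. ennreal ((dd F p)\<^sup>2) \<partial>km) \<le> ennreal (lipc * L\<^sup>2)" .
  then have sq: "dd F \<in> sqint km"
    by (subst sqint_iff_nn_integral[OF dd_measurable[OF m]]) (auto intro: le_less_trans)
  then show "F \<in> sobolev \<gamma>" using c by (simp add: sobolev_iff)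
  show "en F F \<le> lipc * L\<^sup>2"
    using * lipc_pos by (simp add: nn_integral_sq_eq_ip[OF sq] en_def ennreal_le_iff)
qed

end

section \<open>Density in the space of square integrable functions\<close>

text \<open>The dominating function also bounds the limit, so the squared difference is at most 4
  w^2 and ordinary dominated convergence applies.\<close>

lemma ip_dominated:
  assumes f: "\<And>n. f n \<in> borel_measurable M" and g: "g \<in> borel_measurable M" and w: "w \<in> sqint M"
    and lim: "AE x in M. (\<lambda>n. f n x) \<longlonglongrightarrow> g x"
    and bound: "\<And>n. AE x in M. \<bar>f n x\<bar> \<le> w x"
  shows "g \<in> sqint M" "\<And>n. f n \<in> sqint M" "(\<lambda>n. nsq M (\<lambda>x. f n x - g x)) \<longlonglongrightarrow> 0"
proof -
  have w2: "integrable M (\<lambda>x. (w x)\<^sup>2)" using w by (simp add: sqint_def)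
  show "f n \<in> sqint M" for n
  proof -
    have "integrable M (\<lambda>x. (f n x)\<^sup>2)"
    proof (rule Bochner_Integration.integrable_bound[OF w2])
      show "AE x in M. norm ((f n x)\<^sup>2) \<le> norm ((w x)\<^sup>2)"
        using bound[of n] by eventually_elim (auto simp: abs_le_square_iff[symmetric])
    qed (use f in auto)
    then show ?thesis using f by (simp add: sqint_def)
  qed
  have all: "AE x in M. \<forall>n. \<bar>f n x\<bar> \<le> w x"
    using bound by (simp add: AE_all_countable)
  have gw: "AE x in M. \<bar>g x\<bar> \<le> w x"
    using lim all
  proof eventually_elim
    case (elim x)
    then have "(\<lambda>n. \<bar>f n x\<bar>) \<longlonglongrightarrow> \<bar>g x\<bar>" by (intro tendsto_intros)
    then show ?case using elim by (intro LIMSEQ_le_const2) auto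
  qed
  have "integrable M (\<lambda>x. (g x)\<^sup>2)"
  proof (rule Bochner_Integration.integrable_bound[OF w2])
    show "AE x in M. norm ((g x)\<^sup>2) \<le> norm ((w x)\<^sup>2)"
      using gw by eventually_elim (auto simp: abs_le_square_iff[symmetric])
  qed (use g in auto)
  then show "g \<in> sqint M" using g by (simp add: sqint_def)
  have "(\<lambda>n. nsq M (\<lambda>x. f n x - g x)) \<longlonglongrightarrow> (LINT x|M. 0)"
    unfolding ip_def
  proof (rule integral_dominated_convergence)
    show "integrable M (\<lambda>x. 4 * (w x)\<^sup>2)" using w2 by simp
    show "AE x in M. (\<lambda>n. (f n x - g x) * (f n x - g x)) \<longlonglongrightarrow> 0"
      using lim
    proof eventually_elim
      case (elim x)
      then have "(\<lambda>n. (f n x - g x) * (f n x - g x)) \<longlonglongrightarrow> (g x - g x) * (g x - g x)"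
        by (intro tendsto_intros)
      then show ?case by simp
    qed
    show "AE x in M. norm ((f n x - g x) * (f n x - g x)) \<le> 4 * (w x)\<^sup>2" for n
      using bound[of n] gw
    proof eventually_elim
      case (elim x)
      then have "\<bar>f n x - g x\<bar> \<le> 2 * w x" by linarith
      then have "\<bar>f n x - g x\<bar>\<^sup>2 \<le> (2 * w x)\<^sup>2" by (intro power_mono) auto
      then show ?case by (simp add: power2_eq_square)
    qed
  qed (use f g in auto)
  then show "(\<lambda>n. nsq M (\<lambda>x. f n x - g x)) \<longlonglongrightarrow> 0" by simp
qed

lemma ip_cong:
  assumes "\<And>x. x \<in> space M \<Longrightarrow> f x = f' x" "\<And>x. x \<in> space M \<Longrightarrow> g x = g' x"
  shows "ip M f g = ip M f' g'"
  unfolding ip_def using assms by (intro Bochner_Integration.integral_cong) auto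

definition ip_closure :: "'a measure \<Rightarrow> ('a \<Rightarrow> real) set \<Rightarrow> ('a \<Rightarrow> real) set" where
  "ip_closure M S = {f \<in> sqint M. \<forall>e>0. \<exists>w\<in>S. nsq M (\<lambda>x. f x - w x) < e}"

lemma ip_closure_limit:
  assumes S: "S \<subseteq> sqint M" and f: "\<And>n::nat. f n \<in> ip_closure M S" and g: "g \<in> sqint M"
    and lim: "(\<lambda>n. nsq M (\<lambda>x. f n x - g x)) \<longlonglongrightarrow> 0"
  shows "g \<in> ip_closure M S"
proof -
  have "\<exists>w\<in>S. nsq M (\<lambda>x. g x - w x) < e" if e: "0 < e" for e
  proof -
    \<comment> \<open>A quarter for each of the two errors, since \<open>ip_add_self_le\<close>
      doubles both.\<close>
    obtain n where n: "nsq M (\<lambda>x. f n x - g x) < e / 4"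
    proof -
      have "0 < e / 4" using e by simp
      from LIMSEQ_D[OF lim this] show ?thesis using that by (auto simp: ip_nonneg)
    qed
    have fn: "f n \<in> sqint M" using f by (simp add: ip_closure_def)
    obtain w where w: "w \<in> S" "nsq M (\<lambda>x. f n x - w x) < e / 4"
      using f[of n] e unfolding ip_closure_def by (auto dest!: spec[of _ "e / 4"])
    have ws: "w \<in> sqint M" using S w by auto
    have "nsq M (\<lambda>x. (g x - f n x) + (f n x - w x))
      \<le> 2 * nsq M (\<lambda>x. g x - f n x) + 2 * nsq M (\<lambda>x. f n x - w x)"
      by (intro ip_add_self_le sqint_diff g fn ws)
    also have "nsq M (\<lambda>x. g x - f n x) = nsq M (\<lambda>x. f n x - g x)"
      unfolding ip_def by (intro Bochner_Integration.integral_cong) (auto simp: algebra_simps)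
    finally show ?thesis using n w by (intro bexI[of _ w]) auto
  qed
  then show ?thesis using g by (simp add: ip_closure_def)
qed

lemma ip_closure_superset: "S \<subseteq> sqint M \<Longrightarrow> w \<in> S \<Longrightarrow> w \<in> ip_closure M S"
  by (auto simp: ip_closure_def ip_def intro!: bexI[of _ w])

text \<open>A Lebesgue measurable function is an almost everywhere limit of continuous functions;
  clamping the approximants to [-B, B] keeps continuity and convergence and supplies the domination
  needed later.\<close>

lemma bounded_measurable_continuous_limit:
  fixes f :: "real \<Rightarrow> real"
  assumes f: "f \<in> borel_measurable unit_leb" and B: "\<And>x. x \<in> {0..1} \<Longrightarrow> \<bar>f x\<bar> \<le> B"
  obtains g where "\<And>n::nat. continuous_on UNIV (g n)" "\<And>n x. \<bar>g n x\<bar> \<le> B"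
    "AE x in unit_leb. (\<lambda>n. g n x) \<longlonglongrightarrow> f x"
proof -
  have B0: "0 \<le> B" using B[of 0] by auto
  have "f \<in> borel_measurable (lebesgue_on {0..1})"
  proof -
    have "(\<lambda>x. indicator {0..1} x *\<^sub>R f x) \<in> borel_measurable lborel"
      using f by (subst (asm) borel_measurable_restrict_space_iff) auto
    then have "(\<lambda>x. indicator {0..1} x *\<^sub>R f x) \<in> borel_measurable lebesgue"
      by (rule measurable_completion)
    then show ?thesis by (subst borel_measurable_restrict_space_iff) auto
  qed
  then have "f measurable_on {0..1}"
    by (subst measurable_on_iff_borel_measurable) auto
  then obtain N g where N: "negligible N" "\<And>n. continuous_on UNIV (g n)"
    "\<And>x. x \<notin> N \<Longrightarrow> (\<lambda>n. g n x) \<longlonglongrightarrow> (if x \<in> {0..1} then f x else 0)"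
    unfolding measurable_on_def by metis
  define h where "h n x = max (- B) (min B (g n x))" for n x
  have ae: "AE x in lborel. x \<notin> N"
  proof -
    have "N \<in> null_sets lebesgue" using N(1) by (simp add: negligible_iff_null_sets)
    then have "AE x in lebesgue. x \<notin> N" by (rule AE_not_in)
    then show ?thesis by (simp add: AE_completion_iff)
  qed
  show ?thesis
  proof (rule that[of h])
    show "continuous_on UNIV (h n)" for n
      unfolding h_def by (intro continuous_intros N(2))
    show "\<bar>h n x\<bar> \<le> B" for n x using B0 by (auto simp: h_def)
    have "AE x in lborel. x \<in> {0..1} \<longrightarrow> (\<lambda>n. h n x) \<longlonglongrightarrow> f x"
      using ae
    proof eventually_elim
      case (elim x)
      show ?case
      proof
        assume x: "x \<in> {0..1}"
        then have "(\<lambda>n. g n x) \<longlonglongrightarrow> f x" using N(3)[OF elim] by simp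
        then have "(\<lambda>n. h n x) \<longlonglongrightarrow> max (- B) (min B (f x))"
          unfolding h_def by (intro tendsto_intros)
        then show "(\<lambda>n. h n x) \<longlonglongrightarrow> f x" using B[OF x] by (simp add: min_def max_def abs_le_iff split: if_splits)
      qed
    qed
    then show "AE x in unit_leb. (\<lambda>n. h n x) \<longlonglongrightarrow> f x"
      by (subst AE_restrict_space_iff) auto
  qed
qed

lemma sqint_truncate_limit:
  assumes f: "f \<in> sqint M"
  defines "h \<equiv> \<lambda>n x. max (- real n) (min (real n) (f x))"
  shows "\<And>n. h n \<in> sqint M" "(\<lambda>n. nsq M (\<lambda>x. h n x - f x)) \<longlonglongrightarrow> 0"
proof -
  have fm [measurable]: "f \<in> borel_measurable M" by (rule sqint_measurable[OF f])
  have af: "(\<lambda>x. \<bar>f x\<bar>) \<in> sqint M" using f by (simp add: sqint_def)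
  have 1: "h n \<in> borel_measurable M" for n unfolding h_def by measurable
  have 2: "AE x in M. (\<lambda>n. h n x) \<longlonglongrightarrow> f x"
  proof (rule AE_I2)
    fix x
    have "eventually (\<lambda>n. h n x = f x) sequentially"
      using eventually_ge_at_top[of "nat \<lceil>\<bar>f x\<bar>\<rceil>"]
    proof eventually_elim
      case (elim n)
      then have "\<bar>f x\<bar> \<le> real n" by linarith
      then show ?case by (auto simp: h_def)
    qed
    then show "(\<lambda>n. h n x) \<longlonglongrightarrow> f x" by (rule tendsto_eventually)
  qed
  have 3: "AE x in M. \<bar>h n x\<bar> \<le> \<bar>f x\<bar>" for n
    by (rule AE_I2) (auto simp: h_def)
  show "\<And>n. h n \<in> sqint M" "(\<lambda>n. nsq M (\<lambda>x. h n x - f x)) \<longlonglongrightarrow> 0"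
    using ip_dominated[of h M f "\<lambda>x. \<bar>f x\<bar>", OF 1 fm af 2 3] by auto
qed

lemma real_polynomial_function_lipschitz:
  assumes "real_polynomial_function (p :: real \<Rightarrow> real)"
  obtains L where "0 \<le> L" "\<And>x y. x \<in> {0..1} \<Longrightarrow> y \<in> {0..1} \<Longrightarrow> \<bar>p x - p y\<bar> \<le> L * \<bar>x - y\<bar>"
proof -
  obtain p' where p': "real_polynomial_function p'" "\<And>x. (p has_real_derivative p' x) (at x)"
    using has_real_derivative_polynomial_function[OF assms] by blast
  have "continuous_on {0..1} p'"
    using p'(1) continuous_on_polymonial_function real_polynomial_function_eq by blast
  then obtain L where L: "0 < L" "\<And>x. x \<in> {0..1} \<Longrightarrow> \<bar>p' x\<bar> \<le> L"
    using continuous_bounded_unit by blast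
  have "norm (p x - p y) \<le> L * norm (x - y)" if "x \<in> {0..1}" "y \<in> {0..1}" for x y
    by (rule field_differentiable_bound[of "{0..1}" p p'])
      (use that L p'(2) in \<open>auto intro: has_field_derivative_at_within\<close>)
  then show ?thesis using L by (intro that[of L]) auto
qed

context fractional
begin

text \<open>The factor vanishes at both end points, is \<open>k\<close>-Lipschitz because \<bar>1 -
  x - y\<bar> \<le> 1 on the interval, and for growing \<open>k\<close> tends to 1 at every interior
  point.\<close>

lemma cutoff_polynomial_H0:
  assumes "real_polynomial_function (p :: real \<Rightarrow> real)" "0 \<le> k"
  shows "(\<lambda>x. p x * min 1 (k * (x * (1 - x)))) \<in> H0"
proof -
  obtain L where L: "0 \<le> L" "\<And>x y. x \<in> {0..1} \<Longrightarrow> y \<in> {0..1} \<Longrightarrow> \<bar>p x - p y\<bar> \<le> L * \<bar>x - y\<bar>"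
    using real_polynomial_function_lipschitz[OF assms(1)] by blast
  have "continuous_on {0..1} p"
    using assms(1) continuous_on_polymonial_function real_polynomial_function_eq by blast
  then obtain B where B: "0 < B" "\<And>x. x \<in> {0..1} \<Longrightarrow> \<bar>p x\<bar> \<le> B"
    using continuous_bounded_unit by blast
  let ?m = "\<lambda>x. min 1 (k * (x * (1 - x)))"
  have "\<bar>p x * ?m x - p y * ?m y\<bar> \<le> (B * k + L) * \<bar>x - y\<bar>" if xy: "x \<in> {0..1}" "y \<in> {0..1}" for x y
  proof -
    have "\<bar>?m x - ?m y\<bar> \<le> \<bar>k * (x * (1 - x)) - k * (y * (1 - y))\<bar>" by linarith
    also have "k * (x * (1 - x)) - k * (y * (1 - y)) = k * ((x - y) * (1 - x - y))" by (simp add: algebra_simps)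
    also have "\<bar>\<dots>\<bar> = k * (\<bar>x - y\<bar> * \<bar>1 - x - y\<bar>)" using assms by (simp add: abs_mult)
    also have "\<dots> \<le> k * (\<bar>x - y\<bar> * 1)" using assms xy by (intro mult_left_mono) auto
    finally have m: "\<bar>?m x - ?m y\<bar> \<le> k * \<bar>x - y\<bar>" by simp
    have m1: "\<bar>?m y\<bar> \<le> 1" using assms xy by (auto simp: min_def)
    have "p x * ?m x - p y * ?m y = p x * (?m x - ?m y) + ?m y * (p x - p y)" by (simp add: algebra_simps)
    also have "\<bar>\<dots>\<bar> \<le> \<bar>p x\<bar> * \<bar>?m x - ?m y\<bar> + \<bar>?m y\<bar> * \<bar>p x - p y\<bar>"
      by (intro order_trans[OF abs_triangle_ineq]) (simp add: abs_mult)
    also have "\<dots> \<le> B * (k * \<bar>x - y\<bar>) + 1 * (L * \<bar>x - y\<bar>)"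
      using m m1 B L xy by (intro add_mono mult_mono) auto
    finally show ?thesis by (simp add: algebra_simps)
  qed
  from lipschitz_sobolev(1)[OF this] show ?thesis by (simp add: H0_def)
qed

text \<open>The closure absorbs successively larger classes: polynomials by cutting off near the end
  points, continuous functions by Weierstrass, bounded measurable functions as almost everywhere
  limits, and finally everything by truncation.\<close>

lemma H0_dense_sqint:
  assumes "f \<in> sqint unit_leb"
  shows "f \<in> ip_closure unit_leb H0"
proof -
  have sub: "H0 \<subseteq> sqint unit_leb" using H0_sqint by auto
  have poly: "p \<in> ip_closure unit_leb H0" if p: "real_polynomial_function p" for p :: "real \<Rightarrow> real"
  proof -
    have pc: "continuous_on {0..1} p"
      using p continuous_on_polymonial_function real_polynomial_function_eq by blast
    let ?f = "\<lambda>n x. p x * min 1 (real n * (x * (1 - x)))"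
    have fH: "?f n \<in> H0" for n by (intro cutoff_polynomial_H0 p) auto
    have apc: "continuous_on {0..1} (\<lambda>x. \<bar>p x\<bar>)" by (intro continuous_intros pc)
    have lim: "AE x in unit_leb. (\<lambda>n. ?f n x) \<longlonglongrightarrow> p x"
    proof -
      have "AE x in lborel. x \<noteq> 0 \<and> x \<noteq> (1::real)"
        using AE_lborel_singleton[of "0::real"] AE_lborel_singleton[of "1::real"] by eventually_elim auto
      then have "AE x in lborel. x \<in> {0..1} \<longrightarrow> (\<lambda>n. ?f n x) \<longlonglongrightarrow> p x"
      proof eventually_elim
        case (elim x)
        show ?case
        proof
          assume "x \<in> {0..1}"
          then have x: "0 < x * (1 - x)" using elim by (auto intro!: mult_pos_pos)
          have "eventually (\<lambda>n. ?f n x = p x) sequentially"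
            using eventually_ge_at_top[of "nat \<lceil>1 / (x * (1 - x))\<rceil>"]
          proof eventually_elim
            case (elim n)
            then have "1 / (x * (1 - x)) \<le> real n" by linarith
            then have "1 \<le> real n * (x * (1 - x))" using x by (simp only: pos_divide_le_eq)
            then have "min 1 (real n * (x * (1 - x))) = 1" by simp
            then show ?case by simp
          qed
          then show "(\<lambda>n. ?f n x) \<longlonglongrightarrow> p x" by (rule tendsto_eventually)
        qed
      qed
      then show ?thesis by (subst AE_restrict_space_iff) auto
    qed
    have bd: "AE x in unit_leb. \<bar>?f n x\<bar> \<le> \<bar>p x\<bar>" for n
    proof (rule AE_I2)
      fix x assume "x \<in> space unit_leb"
      then have "\<bar>min 1 (real n * (x * (1 - x)))\<bar> \<le> 1" by (auto simp: min_def)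
      then have "\<bar>p x\<bar> * \<bar>min 1 (real n * (x * (1 - x)))\<bar> \<le> \<bar>p x\<bar> * 1" by (intro mult_left_mono) auto
      then show "\<bar>?f n x\<bar> \<le> \<bar>p x\<bar>" by (simp add: abs_mult)
    qed
    have "(\<lambda>n. nsq unit_leb (\<lambda>x. ?f n x - p x)) \<longlonglongrightarrow> 0"
      by (rule ip_dominated(3)[OF _ _ continuous_sqint[OF apc] lim bd])
        (use fH H0_sqint sqint_measurable continuous_measurable_unit_leb[OF pc] in blast)+
    then show ?thesis
      by (rule ip_closure_limit[OF sub ip_closure_superset[OF sub fH] continuous_sqint[OF pc]])
  qed
  have cont: "g \<in> ip_closure unit_leb H0" if g: "continuous_on {0..1} g" for g
  proof -
    have "\<exists>p. real_polynomial_function p \<and> (\<forall>x\<in>{0..1}. \<bar>g x - p x\<bar> < 1 / real (Suc n))" for n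
      using Stone_Weierstrass_real_polynomial_function[OF _ g, of "1 / real (Suc n)"] by (metis compact_Icc of_nat_0_less_iff zero_less_Suc zero_less_divide_1_iff)
    then obtain p where p: "\<And>n. real_polynomial_function (p n)" "\<And>n x. x \<in> {0..1} \<Longrightarrow> \<bar>g x - p n x\<bar> < 1 / real (Suc n)"
      by metis
    have pc: "continuous_on {0..1} (p n)" for n
      using p(1) continuous_on_polymonial_function real_polynomial_function_eq by blast
    have "uniform_limit {0..1} p g sequentially"
      unfolding uniform_limit_sequentially_iff
    proof (intro allI impI)
      fix e :: real assume "0 < e"
      then obtain N where N: "1 / real (Suc N) < e" using nat_approx_posE by blast
      have "dist (p n x) (g x) < e" if "n \<ge> N" "x \<in> {0..1}" for n x
      proof -
        have "dist (p n x) (g x) < 1 / real (Suc n)" using p(2)[OF that(2), of n] by (simp add: dist_real_def abs_minus_commute)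
        also have "\<dots> \<le> 1 / real (Suc N)" using that by (intro divide_left_mono) auto
        finally show ?thesis using N by simp
      qed
      then show "\<exists>N. \<forall>n\<ge>N. \<forall>x\<in>{0..1}. dist (p n x) (g x) < e" by blast
    qed
    from uniform_limit_ip2[OF pc g this] show ?thesis
      by (rule ip_closure_limit[OF sub poly[OF p(1)] continuous_sqint[OF g]])
  qed
  have bdd: "f \<in> ip_closure unit_leb H0" if f: "f \<in> borel_measurable unit_leb" and B: "\<And>x. x \<in> {0..1} \<Longrightarrow> \<bar>f x\<bar> \<le> B" for f B
  proof -
    obtain g where g: "\<And>n::nat. continuous_on UNIV (g n)" "\<And>n x. \<bar>g n x\<bar> \<le> B"
      "AE x in unit_leb. (\<lambda>n. g n x) \<longlonglongrightarrow> f x"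
      using bounded_measurable_continuous_limit[OF f B] by blast
    have gc: "continuous_on {0..1} (g n)" for n using g(1) continuous_on_subset by blast
    have cB: "continuous_on {0..1} (\<lambda>x::real. B)" by simp
    have "(\<lambda>n. nsq unit_leb (\<lambda>x. g n x - f x)) \<longlonglongrightarrow> 0"
      by (rule ip_dominated(3)[OF continuous_measurable_unit_leb[OF gc] f continuous_sqint[OF cB] g(3)]) (simp add: g(2))
    moreover have "f \<in> sqint unit_leb"
      using B by (intro sqint_bounded[OF finite_measure_unit_leb f, where B=B]) auto
    ultimately show ?thesis
      by (intro ip_closure_limit[OF sub cont[OF gc]])
  qed
  show ?thesis
  proof (rule ip_closure_limit[OF sub _ assms sqint_truncate_limit(2)[OF assms]])
    fix n
    show "(\<lambda>x. max (- real n) (min (real n) (f x))) \<in> ip_closure unit_leb H0"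
      by (rule bdd[where B = "real n"]) (auto intro: sqint_measurable[OF sqint_truncate_limit(1)[OF assms]])
  qed
qed

section \<open>The eigenbasis of the energy form\<close>

definition constrained :: "(real \<Rightarrow> real) set \<Rightarrow> (real \<Rightarrow> real) set" where
  "constrained S = {w \<in> H0. \<forall>e\<in>S. ip2 w e = 0}"

text \<open>A normalised minimiser of the Rayleigh quotient on the orthogonal complement of
  \<open>S\<close>. The quotient is cleared of its denominator so that the condition also makes
  sense for \<open>w\<close> of norm zero.\<close>

definition is_ev :: "(real \<Rightarrow> real) set \<Rightarrow> (real \<Rightarrow> real) \<Rightarrow> bool" where
  "is_ev S e \<longleftrightarrow> e \<in> constrained S \<and> ip2 e e = 1 \<and> (\<forall>w\<in>constrained S. en e e * ip2 w w \<le> en w w)"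

text \<open>Uniform convergence implies L^2 convergence, so the normalisation and the orthogonality
  conditions survive in the limit and the sphere is closed in the sense of
  \<open>energy_minimizer\<close>. The function \<open>w0\<close> makes the sphere nonempty.\<close>

lemma ev_exists:
  assumes S: "S \<subseteq> H0" and w0: "w0 \<in> constrained S" "ip2 w0 w0 \<noteq> 0"
  obtains e where "is_ev S e"
proof -
  let ?C = "{w \<in> constrained S. ip2 w w = 1}"
  have normalize: "(\<lambda>x. 1 / sqrt (ip2 w w) * w x) \<in> ?C" if w: "w \<in> constrained S" "ip2 w w \<noteq> 0" for w
  proof -
    have "0 < ip2 w w" using w(2) ip_nonneg[of unit_leb w] by linarith
    then show ?thesis
      using w unfolding constrained_def mem_Collect_eq
      by (intro conjI H0_cmult ballI) (auto simp only: ip_cmult_left ip_cmult_right, auto simp: field_simps)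
  qed
  obtain e where e: "e \<in> ?C" "\<And>f. f \<in> ?C \<Longrightarrow> en e e \<le> en f f"
  proof (rule energy_minimizer[of ?C 0])
    show "?C \<subseteq> sobolev \<gamma>" by (auto simp: constrained_def H0_def)
    show "?C \<noteq> {}" using normalize[OF w0] by blast
    show "\<bar>f 0\<bar> \<le> 0" if "f \<in> ?C" for f using that by (auto simp: constrained_def H0_def)
    fix f g assume f: "\<And>n::nat. f n \<in> ?C" and g: "g \<in> sobolev \<gamma>" and u: "uniform_limit {0..1} f g sequentially"
    have fc: "continuous_on {0..1} (f n)" for n using f by (auto simp: constrained_def H0_def sobolev_continuous)
    have fs: "f n \<in> sqint unit_leb" for n using fc by (rule continuous_sqint)
    have gc: "continuous_on {0..1} g" using g by (rule sobolev_continuous)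
    have gs: "g \<in> sqint unit_leb" using gc by (rule continuous_sqint)
    have lim: "(\<lambda>n. nsq unit_leb (\<lambda>x. f n x - g x)) \<longlonglongrightarrow> 0"
      by (rule uniform_limit_ip2[OF fc gc u])
    have "(\<lambda>n. f n 0) \<longlonglongrightarrow> g 0" "(\<lambda>n. f n 1) \<longlonglongrightarrow> g 1" using tendsto_uniform_limitI[OF u] by auto
    moreover have "f n 0 = 0" "f n 1 = 0" for n using f by (auto simp: constrained_def H0_def)
    ultimately have "g 0 = 0" "g 1 = 0" by (simp_all add: LIMSEQ_const_iff)
    moreover have "ip2 g e = 0" if "e \<in> S" for e
    proof -
      have "(\<lambda>n. ip2 (f n) e) \<longlonglongrightarrow> ip2 g e"
        using S that by (intro ip_tendsto[OF fs gs _ lim] H0_sqint) auto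
      moreover have "ip2 (f n) e = 0" for n using f that by (auto simp: constrained_def)
      ultimately show ?thesis by (simp add: LIMSEQ_const_iff)
    qed
    moreover have "ip2 g g = 1"
    proof -
      have "(\<lambda>n. nsq unit_leb (f n)) \<longlonglongrightarrow> ip2 g g" by (rule ip_self_tendsto[OF fs gs lim])
      moreover have "nsq unit_leb (f n) = 1" for n using f by auto
      ultimately show ?thesis by (simp add: LIMSEQ_const_iff)
    qed
    ultimately show "g \<in> ?C" using g by (simp add: constrained_def H0_def)
  qed blast
  have "en e e * ip2 w w \<le> en w w" if w: "w \<in> constrained S" for w
  proof (cases "ip2 w w = 0")
    case True then show ?thesis by (simp add: en_nonneg)
  next
    case False
    then have "0 < ip2 w w" using ip_nonneg[of unit_leb w] by linarith
    moreover have "en e e \<le> energy (\<lambda>x. 1 / sqrt (ip2 w w) * w x)"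
      by (rule e(2)[OF normalize[OF w False]])
    then have "en e e \<le> 1 / sqrt (ip2 w w) * (1 / sqrt (ip2 w w) * en w w)"
      by (simp only: en_cmult_left en_cmult_right)
    ultimately show ?thesis by (simp add: field_simps)
  qed
  then show ?thesis using e(1) that unfolding is_ev_def by blast
qed

text \<open>Upgrades equality almost everywhere to equality at every point, which is what
  \<open>en_cong\<close> asks for.\<close>

lemma continuous_ip2_eq_0:
  assumes f: "continuous_on {0..1} f" and "ip2 f f = 0" and x: "x \<in> {0..1}"
  shows "f x = 0"
proof -
  have fc: "continuous_on {0..1} (\<lambda>x. f x * f x)" by (intro continuous_intros f)
  have si: "set_integrable lborel {0..1} (\<lambda>x. f x * f x)"
    unfolding set_integrable_def by (intro borel_integrable_compact fc) simp
  have "ip2 f f = (LINT x:{0..1}|lborel. f x * f x)"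
    by (simp add: ip_def integral_restrict_space set_lebesgue_integral_def)
  also have "\<dots> = integral {0..1} (\<lambda>x. f x * f x)"
    by (rule set_borel_integral_eq_integral(2)[OF si])
  finally have "integral {0..1} (\<lambda>x. f x * f x) = 0" using assms by simp
  then have "\<forall>x\<in>{0..1}. f x * f x = 0"
    by (subst (asm) integral_eq_0_iff[OF fc]) auto
  then show ?thesis using x by simp
qed

text \<open>A narrow tent of height 1 has energy at least 1 / morrey by the pointwise bound at its
  peak, while its L^2 mass is at most its width. No multiple of the L^2 norm therefore dominates the
  energy, so \<open>H0\<close> cannot be spanned by finitely many eigenfunctions.\<close>

lemma tall_function:
  assumes "0 < B"
  obtains w where "w \<in> H0" "B * ip2 w w < en w w"
proof -
  \<comment> \<open>The first bound keeps the tent inside the interval; the second makes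
    \<open>B\<close> times the width at most 1 / (2 morrey), half of the lower bound for the
    energy.\<close>
  define h where "h = min (1/2) (1 / (4 * morrey * B))"
  have h: "0 < h" "h \<le> 1/2" using assms morrey_pos by (auto simp: h_def)
  define w where "w x = max 0 (1 - \<bar>x - 1/2\<bar> / h)" for x :: real
  have lip: "\<bar>w x - w y\<bar> \<le> 1 / h * \<bar>x - y\<bar>" for x y
  proof -
    have "\<bar>w x - w y\<bar> \<le> \<bar>\<bar>x - 1/2\<bar> / h - \<bar>y - 1/2\<bar> / h\<bar>" unfolding w_def by linarith
    also have "\<dots> = \<bar>\<bar>x - 1/2\<bar> - \<bar>y - 1/2\<bar>\<bar> / h" using h by (simp add: diff_divide_distrib[symmetric])
    also have "\<dots> \<le> \<bar>x - y\<bar> / h" using h by (intro divide_right_mono) auto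
    finally show ?thesis by simp
  qed
  have ws: "w \<in> sobolev \<gamma>" by (rule lipschitz_sobolev(1)[OF lip])
  have w01: "w 0 = 0" "w 1 = 0" using h by (auto simp: w_def field_simps)
  have wH: "w \<in> H0" using ws w01 by (simp add: H0_def)
  have "w (1/2) = 1" by (simp add: w_def)
  then have one: "1 \<le> morrey * en w w" using H0_bound[OF wH, of "1/2"] by simp
  have "ip2 w w \<le> (LINT x|unit_leb. indicator {1/2 - h..1/2 + h} x)"
    unfolding ip_def
  proof (rule integral_mono)
    show "integrable unit_leb (\<lambda>x. w x * w x)" by (intro sqint_mult_integrable H0_sqint wH)
    show "integrable unit_leb (indicator {1/2 - h..1/2 + h} :: real \<Rightarrow> real)"
      using integrable_indicator_mult[of "\<lambda>_. 1" "1/2 - h" "1/2 + h"] by simp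
    fix x :: real
    show "w x * w x \<le> indicator {1/2 - h..1/2 + h} x"
    proof (cases "x \<in> {1/2 - h..1/2 + h}")
      case True
      have "0 \<le> w x" "w x \<le> 1" using h by (auto simp: w_def)
      then have "w x * w x \<le> 1" by (simp add: mult_le_one)
      then show ?thesis using True by simp
    next
      case False
      then have "1 < \<bar>x - 1/2\<bar> / h" using h by (auto simp: less_divide_eq)
      then show ?thesis using False by (simp add: w_def)
    qed
  qed
  also have "\<dots> = 2 * h" using h lint_unit_interval[of "1/2 - h" "1/2 + h"] by simp
  finally have "B * ip2 w w \<le> B * (2 * h)" using assms by (intro mult_left_mono) auto
  also have "\<dots> \<le> B * (2 * (1 / (4 * morrey * B)))" using assms by (intro mult_left_mono) (auto simp: h_def)
  also have "\<dots> = 1 / (2 * morrey)" using assms by simp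
  also have "\<dots> < en w w" using one morrey_pos by (simp add: field_simps)
  finally show ?thesis using that wH by blast
qed

text \<open>The n-th choice depends on all earlier ones, whereas primitive recursion supplies only
  the previous value; hence the value is the list of all functions chosen so far.\<close>

primrec es :: "nat \<Rightarrow> (real \<Rightarrow> real) list" where
  "es 0 = []"
| "es (Suc n) = es n @ [SOME e. is_ev (set (es n)) e]"

definition ef :: "nat \<Rightarrow> real \<Rightarrow> real" where
  "ef n = (SOME e. is_ev (set (es n)) e)"

definition lam :: "nat \<Rightarrow> real" where
  "lam n = energy (ef n)"

lemma set_es: "set (es n) = ef ` {..<n}"
  by (induction n) (auto simp: ef_def lessThan_Suc)

text \<open>Existence of the next minimiser and the weak eigenvalue equation have to be proved in
  one induction: the equations of the earlier functions are used both to see that the complement is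
  nontrivial and to extend the new equation from the complement to all of \<open>H0\<close>.\<close>

lemma eigen: "is_ev (ef ` {..<n}) (ef n) \<and> (\<forall>w\<in>H0. en (ef n) w = lam n * ip2 (ef n) w)"
proof (induction n rule: less_induct)
  case (less n)
  have eH: "ef i \<in> H0" if "i < n" for i
    using less[OF that] by (auto simp: is_ev_def constrained_def)
  have eS: "ef i \<in> sobolev \<gamma>" "ef i \<in> sqint unit_leb" if "i < n" for i
    using eH[OF that] by (auto simp: H0_sobolev H0_sqint)
  have orth: "ip2 (ef i) (ef j) = (if i = j then 1 else 0)" if "i < n" "j < n" for i j
  proof -
    have "ip2 (ef j) (ef i) = 0" if "i < j" "j < n" for i j
      using less[OF that(2)] that by (auto simp: is_ev_def constrained_def)
    from this[of i j] this[of j i] show ?thesis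
      using less[OF that(1)] that ip_commute[of unit_leb "ef i" "ef j"]
      by (cases i j rule: linorder_cases) (auto simp: is_ev_def)
  qed
  let ?P = "\<lambda>w x. \<Sum>i<n. ip2 w (ef i) * ef i x"
  have PH: "?P w \<in> H0" for w by (intro H0_sum H0_cmult eH) auto
  have Pterm: "(\<lambda>x. ip2 w (ef i) * ef i x) \<in> sobolev \<gamma>" "(\<lambda>x. ip2 w (ef i) * ef i x) \<in> sqint unit_leb" if "i < n" for w i
    using eS[OF that] by (auto intro: sobolev_cmult sqint_cmult)
  have ipP: "ip2 (?P w) v = (\<Sum>i<n. ip2 w (ef i) * ip2 (ef i) v)" if "v \<in> H0" for w v
    using that by (subst ip_sum_left) (auto simp: ip_cmult_left Pterm H0_sqint)
  have enP: "en (?P w) v = (\<Sum>i<n. ip2 w (ef i) * (lam i * ip2 (ef i) v))" if "v \<in> H0" for w v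
  proof -
    have "en (?P w) v = (\<Sum>i<n. en (\<lambda>x. ip2 w (ef i) * ef i x) v)"
      using that by (intro en_sum_left Pterm H0_sobolev) auto
    also have "\<dots> = (\<Sum>i<n. ip2 w (ef i) * (lam i * ip2 (ef i) v))"
      using less that by (intro sum.cong) (auto simp: en_cmult_left)
    finally show ?thesis .
  qed
  let ?R = "\<lambda>w x. w x - ?P w x"
  have RC: "?R w \<in> constrained (ef ` {..<n})" if w: "w \<in> H0" for w
  proof -
    have "ip2 (?R w) (ef j) = 0" if "j < n" for j
    proof -
      have "ip2 (?R w) (ef j) = ip2 w (ef j) - ip2 (?P w) (ef j)"
        using w that by (intro ip_diff_left H0_sqint PH eH)
      also have "ip2 (?P w) (ef j) = (\<Sum>i<n. ip2 w (ef i) * ip2 (ef i) (ef j))"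
        using eH that by (intro ipP) auto
      also have "\<dots> = (\<Sum>i<n. if i = j then ip2 w (ef j) else 0)"
        using that by (intro sum.cong) (auto simp: orth)
      also have "\<dots> = ip2 w (ef j)" using that by simp
      finally show ?thesis by simp
    qed
    then show ?thesis using w PH[of w] unfolding constrained_def by (auto intro!: H0_diff)
  qed
  \<comment> \<open>If the complement had only elements of norm zero, every \<open>w\<close> in
    \<open>H0\<close> would equal its projection on the earlier eigenfunctions. Its energy would
    then be at most \<open>B\<close> times its squared norm, against
    \<open>tall_function\<close>.\<close>
  have "\<exists>w0\<in>constrained (ef ` {..<n}). ip2 w0 w0 \<noteq> 0"
  proof (rule ccontr)
    assume "\<not> ?thesis"
    then have z: "\<And>w. w \<in> constrained (ef ` {..<n}) \<Longrightarrow> ip2 w w = 0" by auto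
    define B where "B = 1 + (\<Sum>i<n. lam i)"
    have lam0: "0 \<le> lam i" for i by (simp add: lam_def en_nonneg)
    have B: "0 < B" "\<And>i. i < n \<Longrightarrow> lam i \<le> B"
    proof -
      have "lam i \<le> (\<Sum>i<n. lam i)" if "i < n" for i
        using that lam0 by (intro member_le_sum) auto
      then show "\<And>i. i < n \<Longrightarrow> lam i \<le> B" by (fastforce simp: B_def)
      show "0 < B" using sum_nonneg[of "{..<n}" lam] lam0 by (simp add: B_def)
    qed
    obtain w where w: "w \<in> H0" "B * ip2 w w < en w w" using tall_function[OF B(1)] by blast
    have R0: "w x = ?P w x" if "x \<in> {0..1}" for x
    proof -
      have "?R w \<in> H0" using RC[OF w(1)] by (simp add: constrained_def)
      then have "continuous_on {0..1} (?R w)" by (intro sobolev_continuous H0_sobolev)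
      from continuous_ip2_eq_0[OF this z[OF RC[OF w(1)]] that] show ?thesis by simp
    qed
    have "en w w = en (?P w) w" using R0 by (intro en_cong) auto
    also have "\<dots> = (\<Sum>i<n. lam i * (ip2 w (ef i))\<^sup>2)"
      by (subst enP[OF w(1)]) (auto intro!: sum.cong simp: ip_commute[of _ "ef _" w] power2_eq_square)
    also have "\<dots> \<le> (\<Sum>i<n. B * (ip2 w (ef i))\<^sup>2)"
      using B by (intro sum_mono mult_right_mono) auto
    also have "\<dots> = B * (\<Sum>i<n. (ip2 w (ef i))\<^sup>2)" by (simp add: sum_distrib_left)
    also have "(\<Sum>i<n. (ip2 w (ef i))\<^sup>2) = ip2 (?P w) w"
      by (subst ipP[OF w(1)]) (auto intro!: sum.cong simp: ip_commute[of _ "ef _" w] power2_eq_square)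
    also have "ip2 (?P w) w = ip2 w w"
      using R0 by (intro ip_cong) auto
    finally show False using w(2) by simp
  qed
  then obtain w0 where w0: "w0 \<in> constrained (ef ` {..<n})" "ip2 w0 w0 \<noteq> 0" by blast
  have "ef ` {..<n} \<subseteq> H0" using eH by auto
  then obtain e where "is_ev (ef ` {..<n}) e" using ev_exists w0 by metis
  then have ev: "is_ev (ef ` {..<n}) (ef n)"
    unfolding ef_def[of n] set_es by (rule someI[of "is_ev (ef ` {..<n})"])
  have nH: "ef n \<in> H0" using ev by (simp add: is_ev_def constrained_def)
  have n1: "nsq unit_leb (ef n) = 1" using ev by (simp add: is_ev_def)
  \<comment> \<open>First variation: along \<open>ef n + t * w\<close> the energy minus
    \<open>lam n\<close> times the squared norm is nonnegative and vanishes at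
    \<open>t = 0\<close>.\<close>
  have eqC: "en (ef n) w = lam n * ip2 (ef n) w" if w: "w \<in> constrained (ef ` {..<n})" for w
  proof -
    have wH: "w \<in> H0" using w by (simp add: constrained_def)
    let ?a = "en w w - lam n * ip2 w w" and ?b = "en (ef n) w - lam n * ip2 (ef n) w"
    have "?b\<^sup>2 \<le> ?a * 0"
    proof (rule quadratic_nonneg_discriminant)
      fix t
      let ?v = "\<lambda>x. ef n x + t * w x"
      have "?v \<in> constrained (ef ` {..<n})"
      proof -
        have "ip2 ?v (ef j) = 0" if "j < n" for j
        proof -
          have "ip2 ?v (ef j) = ip2 (ef n) (ef j) + t * ip2 w (ef j)"
            using nH wH that by (subst ip_add_left) (auto simp: H0_sqint sqint_cmult eS ip_cmult_left)
          then show ?thesis using ev w that by (auto simp: is_ev_def constrained_def)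
        qed
        then show ?thesis using nH wH by (auto simp: constrained_def intro!: H0_add H0_cmult)
      qed
      then have "lam n * ip2 ?v ?v \<le> en ?v ?v" using ev by (simp add: is_ev_def lam_def)
      moreover have "en ?v ?v = lam n + 2 * t * en (ef n) w + t\<^sup>2 * en w w"
        using nH wH by (subst en_quadratic) (auto simp: H0_sobolev lam_def)
      moreover have "ip2 ?v ?v = 1 + 2 * t * ip2 (ef n) w + t\<^sup>2 * ip2 w w"
        using nH wH n1 by (subst ip_add_self) (auto simp: H0_sqint sqint_cmult ip_cmult_left ip_cmult_right power2_eq_square)
      ultimately show "0 \<le> ?a * t\<^sup>2 + 2 * ?b * t + 0" by (simp add: algebra_simps)
    qed
    then show ?thesis by simp
  qed
  \<comment> \<open>The projection part of \<open>w\<close> pairs to zero with \<open>ef n\<close>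
    in both forms, so only the component in the complement matters.\<close>
  have "en (ef n) w = lam n * ip2 (ef n) w" if w: "w \<in> H0" for w
  proof -
    have nj: "ip2 (ef n) (ef j) = 0" if "j < n" for j using ev that by (auto simp: is_ev_def constrained_def)
    have PC: "en (?P w) (ef n) = 0" "ip2 (?P w) (ef n) = 0"
      using nj ip_commute[of unit_leb "ef n"] by (simp_all add: enP[OF nH] ipP[OF nH])
    have "en (ef n) (?R w) = en (ef n) w - en (ef n) (?P w)"
      using w nH PH[of w] by (intro en_diff_right H0_sobolev)
    moreover have "ip2 (ef n) (?R w) = ip2 (ef n) w - ip2 (ef n) (?P w)"
      using w nH PH[of w] by (intro ip_diff_right H0_sqint)
    ultimately show ?thesis
      using eqC[OF RC[OF w]] PC by (simp add: en_commute[of "ef n" "?P w"] ip_commute[of _ "ef n" "?P w"])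
  qed
  then show ?case using ev by blast
qed

lemma ef_H0: "ef n \<in> H0"
  using eigen[of n] by (simp add: is_ev_def constrained_def)

lemma ef_sobolev: "ef n \<in> sobolev \<gamma>"
  by (rule H0_sobolev[OF ef_H0])

lemma ef_sqint: "ef n \<in> sqint unit_leb"
  by (rule H0_sqint[OF ef_H0])

lemma ef_continuous: "continuous_on {0..1} (ef n)"
  by (rule sobolev_continuous[OF ef_sobolev])

lemma en_ef: "w \<in> H0 \<Longrightarrow> en (ef n) w = lam n * ip2 (ef n) w"
  using eigen[of n] by blast

lemma ef_orthonormal: "ip2 (ef i) (ef j) = (if i = j then 1 else 0)"
proof -
  have "ip2 (ef j) (ef i) = 0" if "i < j" for i j
    using eigen[of j] that by (auto simp: is_ev_def constrained_def)
  from this[of i j] this[of j i] show ?thesis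
    using eigen[of i] ip_commute[of unit_leb "ef i" "ef j"]
    by (cases i j rule: linorder_cases) (auto simp: is_ev_def)
qed

lemma en_ef_ef: "en (ef i) (ef j) = (if i = j then lam i else 0)"
  by (simp add: en_ef[OF ef_H0] ef_orthonormal)

lemma lam_constrained: "w \<in> constrained (ef ` {..<n}) \<Longrightarrow> lam n * ip2 w w \<le> en w w"
  using eigen[of n] by (simp add: is_ev_def lam_def)

lemma lam_mono: "i \<le> j \<Longrightarrow> lam i \<le> lam j"
proof -
  assume "i \<le> j"
  then have "ef j \<in> constrained (ef ` {..<i})"
    by (auto simp: constrained_def ef_H0 ef_orthonormal)
  from lam_constrained[OF this] show ?thesis by (simp add: ef_orthonormal en_ef_ef)
qed

lemma lam_pos: "0 < lam n"
  using H0_poincare[OF ef_H0, of n] morrey_pos by (simp add: ef_orthonormal en_ef_ef zero_less_mult_iff not_less[symmetric])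
    (smt (verit) mult_nonneg_nonpos)

section \<open>Expansion in the eigenbasis\<close>

definition prj :: "nat \<Rightarrow> (real \<Rightarrow> real) \<Rightarrow> real \<Rightarrow> real" where
  "prj n f x = (\<Sum>i<n. ip2 f (ef i) * ef i x)"

lemma ef_comb_H0: "(\<lambda>x. \<Sum>i\<in>I. c i * ef i x) \<in> H0"
  by (intro H0_sum H0_cmult ef_H0)

lemma ip_ef_comb:
  assumes "finite I" "v \<in> sqint unit_leb"
  shows "ip2 (\<lambda>x. \<Sum>i\<in>I. c i * ef i x) v = (\<Sum>i\<in>I. c i * ip2 (ef i) v)"
  using assms by (subst ip_sum_left) (auto simp: ip_cmult_left sqint_cmult ef_sqint)

lemma en_ef_comb:
  assumes "finite I" "v \<in> H0"
  shows "en (\<lambda>x. \<Sum>i\<in>I. c i * ef i x) v = (\<Sum>i\<in>I. c i * (lam i * ip2 (ef i) v))"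
  using assms by (subst en_sum_left) (auto simp: en_cmult_left sobolev_cmult ef_sobolev H0_sobolev en_ef)

lemma ip_ef_comb_self:
  assumes "finite I"
  shows "nsq unit_leb (\<lambda>x. \<Sum>i\<in>I. c i * ef i x) = (\<Sum>i\<in>I. (c i)\<^sup>2)"
proof -
  have "ip2 (ef j) (\<lambda>x. \<Sum>i\<in>I. c i * ef i x) = c j" if "j \<in> I" for j
    using assms that by (subst ip_commute, subst ip_ef_comb) (auto simp: ef_sqint ef_orthonormal if_distrib[of "(*) _"] cong: if_cong)
  then show ?thesis
    using assms by (subst ip_ef_comb) (auto simp: power2_eq_square intro!: H0_sqint ef_comb_H0)
qed

lemma en_ef_comb_self:
  assumes "finite I"
  shows "energy (\<lambda>x. \<Sum>i\<in>I. c i * ef i x) = (\<Sum>i\<in>I. lam i * (c i)\<^sup>2)"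
proof -
  have "ip2 (ef j) (\<lambda>x. \<Sum>i\<in>I. c i * ef i x) = c j" if "j \<in> I" for j
    using assms that by (subst ip_commute, subst ip_ef_comb) (auto simp: ef_sqint ef_orthonormal if_distrib[of "(*) _"] cong: if_cong)
  then show ?thesis
    using assms by (subst en_ef_comb) (auto simp: power2_eq_square mult_ac intro!: ef_comb_H0)
qed

lemma prj_residual:
  assumes f: "f \<in> sqint unit_leb"
  shows "nsq unit_leb (\<lambda>x. f x - prj n f x) = ip2 f f - (\<Sum>i<n. (ip2 f (ef i))\<^sup>2)"
proof -
  have P: "prj n f = (\<lambda>x. \<Sum>i<n. ip2 f (ef i) * ef i x)" by (auto simp: prj_def)
  have "ip2 f (prj n f) = (\<Sum>i<n. (ip2 f (ef i))\<^sup>2)"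
    unfolding P using f by (subst ip_commute, subst ip_ef_comb) (auto simp: ip_commute[of _ "ef _" f] power2_eq_square)
  moreover have "nsq unit_leb (prj n f) = (\<Sum>i<n. (ip2 f (ef i))\<^sup>2)"
    unfolding P by (rule ip_ef_comb_self) simp
  ultimately show ?thesis
    using f by (subst ip_diff_self) (auto simp: P intro!: H0_sqint ef_comb_H0)
qed

lemma bessel: "f \<in> sqint unit_leb \<Longrightarrow> (\<Sum>i<n. (ip2 f (ef i))\<^sup>2) \<le> ip2 f f"
  using prj_residual[of f n] ip_nonneg[of unit_leb "\<lambda>x. f x - prj n f x"] by linarith

lemma en_prj_residual:
  assumes w: "w \<in> H0"
  shows "energy (\<lambda>x. w x - prj n w x) = en w w - (\<Sum>i<n. lam i * (ip2 w (ef i))\<^sup>2)"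
proof -
  have P: "prj n w = (\<lambda>x. \<Sum>i<n. ip2 w (ef i) * ef i x)" by (auto simp: prj_def)
  have PH: "prj n w \<in> H0" unfolding P by (rule ef_comb_H0)
  have "en w (prj n w) = (\<Sum>i<n. lam i * (ip2 w (ef i))\<^sup>2)"
    unfolding P using w by (subst en_commute, subst en_ef_comb) (auto simp: ip_commute[of _ "ef _" w] power2_eq_square mult_ac)
  moreover have "energy (prj n w) = (\<Sum>i<n. lam i * (ip2 w (ef i))\<^sup>2)"
    unfolding P by (rule en_ef_comb_self) simp
  moreover have "energy (\<lambda>x. w x - prj n w x) = en w w - 2 * en w (prj n w) + energy (prj n w)"
    unfolding en_def dd_diff using w PH by (intro ip_diff_self sobolev_dd H0_sobolev)
  ultimately show ?thesis by simp
qed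

lemma en_bessel: "w \<in> H0 \<Longrightarrow> (\<Sum>i<n. lam i * (ip2 w (ef i))\<^sup>2) \<le> en w w"
  using en_prj_residual[of w n] en_nonneg[of "\<lambda>x. w x - prj n w x"] by linarith

text \<open>Bounded eigenvalues would give a uniformly convergent subsequence of eigenfunctions, but
  distinct orthonormal functions have squared distance 2.\<close>

lemma lam_at_top: "filterlim lam at_top sequentially"
proof -
  have "\<exists>n. B < lam n" for B
  proof (rule ccontr)
    assume "\<not> ?thesis"
    then have le: "\<And>n. energy (ef n) \<le> B" by (auto simp: en_ef_ef not_less)
    have ef0: "\<bar>ef n 0\<bar> \<le> 0" for n using ef_H0[of n] by (simp add: H0_def)
    obtain g r where g: "strict_mono (r :: nat \<Rightarrow> nat)" "g \<in> sobolev \<gamma>"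
      "uniform_limit {0..1} (\<lambda>n. ef (r n)) g sequentially"
      using sobolev_compactness[of ef 0 "\<lambda>_. B" B, OF ef_sobolev ef0 le tendsto_const] by metis
    let ?d = "\<lambda>n x. ef (r n) x - g x"
    have gs: "g \<in> sqint unit_leb" by (rule sobolev_sqint[OF g(2)])
    have lim: "(\<lambda>n. nsq unit_leb (?d n)) \<longlonglongrightarrow> 0"
      by (rule uniform_limit_ip2[OF ef_continuous sobolev_continuous[OF g(2)] g(3)])
    have ge1: "1 \<le> nsq unit_leb (?d n) + nsq unit_leb (?d (Suc n))" for n
    proof -
      have "r n \<noteq> r (Suc n)" using g(1) by (metis n_not_Suc_n strict_mono_eq)
      then have "2 = nsq unit_leb (\<lambda>x. ef (r n) x - ef (r (Suc n)) x)"
        by (subst ip_diff_self) (auto simp: ef_sqint ef_orthonormal)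
      also have "\<dots> = nsq unit_leb (\<lambda>x. ?d n x + - ?d (Suc n) x)"
        by (intro ip_cong) auto
      also have "\<dots> \<le> 2 * nsq unit_leb (?d n) + 2 * nsq unit_leb (\<lambda>x. - ?d (Suc n) x)"
        by (intro ip_add_self_le sqint_uminus sqint_diff ef_sqint gs)
      also have "nsq unit_leb (\<lambda>x. - ?d (Suc n) x) = nsq unit_leb (?d (Suc n))"
        unfolding ip_def by (intro Bochner_Integration.integral_cong) (auto simp: algebra_simps)
      finally show ?thesis by linarith
    qed
    define D where "D n = nsq unit_leb (?d n)" for n
    have "D \<longlonglongrightarrow> 0" using lim unfolding D_def .
    then obtain N where "\<And>n. n \<ge> N \<Longrightarrow> norm (D n - 0) < 1 / 2"
      using LIMSEQ_D[of D 0 "1 / 2"] by auto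
    from this[of N] this[of "Suc N"] have "D N + D (Suc N) < 1" by simp
    moreover have "1 \<le> D N + D (Suc N)" using ge1[of N] by (simp only: D_def)
    ultimately show False by simp
  qed
  note unb = this
  show ?thesis
    unfolding filterlim_at_top
  proof
    fix Z
    obtain N where N: "Z < lam N" using unb by blast
    show "\<forall>\<^sub>F n in sequentially. Z \<le> lam n"
    proof (rule eventually_sequentiallyI)
      fix n assume "N \<le> n"
      from lam_mono[OF this] N show "Z \<le> lam n" by linarith
    qed
  qed
qed

text \<open>Taking residuals is linear and does not increase the norm, so \<open>f\<close> may be
  replaced by a nearby \<open>w\<close> for which a rate of convergence is known.\<close>

lemma prj_best:
  assumes f: "f \<in> sqint unit_leb" and w: "w \<in> sqint unit_leb"
  shows "nsq unit_leb (\<lambda>x. f x - prj n f x)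
    \<le> 2 * nsq unit_leb (\<lambda>x. f x - w x) + 2 * nsq unit_leb (\<lambda>x. w x - prj n w x)"
proof -
  have P: "prj n w \<in> sqint unit_leb" for w unfolding prj_def by (intro H0_sqint ef_comb_H0)
  have lin: "prj n (\<lambda>x. f x - w x) = (\<lambda>x. prj n f x - prj n w x)"
    using f w by (auto simp: prj_def ip_diff_left ef_sqint sum_subtractf left_diff_distrib)
  have "(\<lambda>x. f x - prj n f x) = (\<lambda>x. ((f x - w x) - prj n (\<lambda>x. f x - w x) x) + (w x - prj n w x))"
    by (simp add: lin)
  then have "nsq unit_leb (\<lambda>x. f x - prj n f x) \<le>
     2 * nsq unit_leb (\<lambda>x. (f x - w x) - prj n (\<lambda>x. f x - w x) x)
     + 2 * nsq unit_leb (\<lambda>x. w x - prj n w x)"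
    using ip_add_self_le[of "\<lambda>x. (f x - w x) - prj n (\<lambda>x. f x - w x) x" unit_leb "\<lambda>x. w x - prj n w x"]
    by (simp add: sqint_diff f w P)
  moreover have "nsq unit_leb (\<lambda>x. (f x - w x) - prj n (\<lambda>x. f x - w x) x)
      \<le> nsq unit_leb (\<lambda>x. f x - w x)"
    using prj_residual[OF sqint_diff[OF f w], of n] by (simp add: sum_nonneg)
  ultimately show ?thesis by linarith
qed

text \<open>The residual of an \<open>H0\<close> function is controlled by its energy and the next eigenvalue.\<close>

lemma prj_tendsto:
  assumes f: "f \<in> sqint unit_leb"
  shows "(\<lambda>n. nsq unit_leb (\<lambda>x. f x - prj n f x)) \<longlonglongrightarrow> 0"
proof (rule LIMSEQ_I)
  fix e :: real assume e: "0 < e"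
  obtain w where w: "w \<in> H0" "nsq unit_leb (\<lambda>x. f x - w x) < e / 4"
  proof -
    have "0 < e / 4" using e by simp
    then show ?thesis using H0_dense_sqint[OF f] that unfolding ip_closure_def by blast
  qed
  \<comment> \<open>Beyond this threshold the squared residual of \<open>w\<close> is at most e / 8,
    so the total stays below 2 (e / 4) + 2 (e / 8). The summand 1 takes care of \<open>w\<close>
    with zero energy.\<close>
  obtain N where N: "\<And>n. n \<ge> N \<Longrightarrow> 8 * en w w / e + 1 \<le> lam n"
    using lam_at_top unfolding filterlim_at_top eventually_sequentially by blast
  have "nsq unit_leb (\<lambda>x. f x - prj n f x) < e" if "n \<ge> N" for n
  proof -
    let ?r = "\<lambda>x. w x - prj n w x"
    have "?r \<in> constrained (ef ` {..<n})"
    proof -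
      have PH: "prj n w \<in> H0" unfolding prj_def by (rule ef_comb_H0)
      have "ip2 ?r (ef j) = 0" if "j < n" for j
      proof -
        have "ip2 (prj n w) (ef j) = (\<Sum>i<n. ip2 w (ef i) * ip2 (ef i) (ef j))"
          unfolding prj_def by (intro ip_ef_comb ef_sqint) simp
        also have "\<dots> = (\<Sum>i<n. if i = j then ip2 w (ef j) else 0)"
          by (intro sum.cong) (auto simp: ef_orthonormal)
        finally have "ip2 (prj n w) (ef j) = ip2 w (ef j)" using that by simp
        then show ?thesis using w(1) PH by (simp add: ip_diff_left H0_sqint ef_sqint)
      qed
      then show ?thesis using w(1) PH by (auto simp: constrained_def intro!: H0_diff)
    qed
    from lam_constrained[OF this] have "lam n * ip2 ?r ?r \<le> en w w"
      using en_prj_residual[OF w(1), of n] lam_pos by (smt (verit) sum_nonneg mult_nonneg_nonneg zero_le_power2 less_imp_le)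
    moreover have "(8 * en w w / e) * ip2 ?r ?r + ip2 ?r ?r \<le> lam n * ip2 ?r ?r"
      using mult_right_mono[OF N[OF that] ip_nonneg[of unit_leb ?r]] by (simp add: algebra_simps)
    ultimately have *: "(8 * en w w / e) * ip2 ?r ?r + ip2 ?r ?r \<le> en w w" by linarith
    have "ip2 ?r ?r \<le> e / 8"
    proof (cases "en w w = 0")
      case True
      then show ?thesis using * e by simp
    next
      case False
      then have p: "0 < en w w" using en_nonneg[of w] by linarith
      have "(8 * en w w / e) * ip2 ?r ?r \<le> en w w" using * ip_nonneg[of unit_leb ?r] by linarith
      then have "en w w * (8 / e * ip2 ?r ?r) \<le> en w w * 1" by (simp add: mult_ac)
      then have "8 / e * ip2 ?r ?r \<le> 1" by (rule mult_left_le_imp_le[OF _ p])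
      then show ?thesis using e by (simp add: field_simps)
    qed
    then show ?thesis using prj_best[OF f H0_sqint[OF w(1)], of n] w(2) e by linarith
  qed
  then show "\<exists>N. \<forall>n\<ge>N. norm (nsq unit_leb (\<lambda>x. f x - prj n f x) - 0) < e"
    by (auto simp: ip_nonneg)
qed

lemma parseval:
  assumes f: "f \<in> sqint unit_leb"
  shows "(\<lambda>i. (ip2 f (ef i))\<^sup>2) sums ip2 f f"
proof -
  have "(\<lambda>n. ip2 f f - nsq unit_leb (\<lambda>x. f x - prj n f x)) \<longlonglongrightarrow> ip2 f f - 0"
    by (intro tendsto_intros prj_tendsto f)
  then show ?thesis unfolding sums_def by (simp add: prj_residual[OF f])
qed

end

section \<open>The regional fractional Laplacian on compactly supported functions\<close>

text \<open>C^2 functions of compact support with quantitative data: \<open>d\<close> is the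
  distance of the support from the end points and \<open>B\<close> bounds the function and its
  second derivative. All estimates on the Laplacian depend on \<open>d\<close> and \<open>B\<close>
  alone, which makes them uniform over the time slices of a space-time test.\<close>

definition c2c :: "real \<Rightarrow> real \<Rightarrow> (real \<Rightarrow> real) \<Rightarrow> bool" where
  "c2c d B G \<longleftrightarrow> 0 < d \<and> (\<exists>G' G''. \<forall>u\<in>{0..1}.
     (G has_real_derivative G' u) (at u within {0..1}) \<and>
     (G' has_real_derivative G'' u) (at u within {0..1}) \<and>
     \<bar>G u\<bar> \<le> B \<and> \<bar>G'' u\<bar> \<le> B \<and> (u < d \<or> 1 - d < u \<longrightarrow> G u = 0))"

text \<open>The first derivative vanishes near the end points, so the bound on the second derivative
  also bounds the first. The remainder lacks the Taylor factor 1 / 2 because it comes from the mean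
  value inequality applied to the function minus its tangent.\<close>

lemma c2c_taylor:
  assumes "c2c d B G"
  obtains G' where
    "\<And>u. u \<in> {0..1} \<Longrightarrow> (G has_real_derivative G' u) (at u within {0..1})"
    "\<And>u v. u \<in> {0..1} \<Longrightarrow> v \<in> {0..1} \<Longrightarrow> \<bar>G v - G u - G' u * (v - u)\<bar> \<le> B * (v - u)\<^sup>2"
    "\<And>u. u \<in> {0..1} \<Longrightarrow> u < d \<or> 1 - d < u \<Longrightarrow> G' u = 0"
    "\<And>u. u \<in> {0..1} \<Longrightarrow> \<bar>G' u\<bar> \<le> B"
    "\<And>u. u \<in> {0..1} \<Longrightarrow> \<bar>G u\<bar> \<le> B"
    "0 \<le> B"
proof -
  obtain G' G'' where D0: "\<forall>u\<in>{0..1}.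
     (G has_real_derivative G' u) (at u within {0..1}) \<and>
     (G' has_real_derivative G'' u) (at u within {0..1}) \<and>
     \<bar>G u\<bar> \<le> B \<and> \<bar>G'' u\<bar> \<le> B \<and> (u < d \<or> 1 - d < u \<longrightarrow> G u = 0)" and d: "0 < d"
    using assms unfolding c2c_def by blast
  have D:
    "\<And>u. u \<in> {0..1} \<Longrightarrow> (G has_real_derivative G' u) (at u within {0..1})"
    "\<And>u. u \<in> {0..1} \<Longrightarrow> (G' has_real_derivative G'' u) (at u within {0..1})"
    "\<And>u. u \<in> {0..1} \<Longrightarrow> \<bar>G u\<bar> \<le> B" "\<And>u. u \<in> {0..1} \<Longrightarrow> \<bar>G'' u\<bar> \<le> B"
    "\<And>u. u \<in> {0..1} \<Longrightarrow> u < d \<or> 1 - d < u \<Longrightarrow> G u = 0"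
    using D0 by blast+
  have B: "0 \<le> B" using D(3)[of 0] by auto
  have lip: "\<bar>G' x - G' y\<bar> \<le> B * \<bar>x - y\<bar>" if "x \<in> {0..1}" "y \<in> {0..1}" for x y
    using field_differentiable_bound[of "{0..1}" G' G'' B x y] D(2,4) that by auto
  have zero: "G' u = 0" if u: "u \<in> {0..1}" "u < d \<or> 1 - d < u" for u
  proof -
    let ?S = "{x. x < d \<or> 1 - d < x}"
    have "open ?S" by (intro open_Collect_disj open_Collect_less continuous_intros)
    moreover have "u \<in> ?S" using u by simp
    ultimately obtain r where r: "0 < r" "ball u r \<subseteq> ?S" using openE by blast
    have "((\<lambda>_. 0) has_real_derivative G' u) (at u within {0..1})"
    proof (rule has_field_derivative_transform_within[OF D(1)[OF u(1)] r(1) u(1)])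
      fix x :: real assume x: "x \<in> {0..1}" "dist x u < r"
      then have "x \<in> ?S" using r(2) by (auto simp: mem_ball dist_commute subset_iff)
      then show "G x = 0" using D(5)[OF x(1)] by auto
    qed
    moreover have "((\<lambda>_. 0) has_real_derivative 0) (at u within {0..1})" by simp
    moreover have "at u within {0..1} \<noteq> bot"
      using u(1) by (simp add: at_within_Icc_at_left trivial_limit_within islimpt_Icc)
    ultimately show ?thesis
      by (simp only: has_real_derivative_iff_has_vector_derivative) (rule vector_derivative_unique_within)
  qed
  show ?thesis
  proof (rule that[of G'])
    fix u v :: real assume uv: "u \<in> {0..1}" "v \<in> {0..1}"
    have seg: "closed_segment u v \<subseteq> {0..1}"
      using uv by (intro closed_segment_subset) auto
    have "norm ((G v - G' u * v) - (G u - G' u * u)) \<le> (B * \<bar>v - u\<bar>) * norm (v - u)"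
    proof (rule field_differentiable_bound[of "closed_segment u v"])
      fix z assume z: "z \<in> closed_segment u v"
      then have z01: "z \<in> {0..1}" using seg by auto
      have "((\<lambda>x. G x - G' u * x) has_real_derivative G' z - G' u) (at z within {0..1})"
        using D(1)[OF z01] by (auto intro!: derivative_eq_intros)
      then show "((\<lambda>x. G x - G' u * x) has_real_derivative G' z - G' u) (at z within closed_segment u v)"
        using seg DERIV_subset by blast
      have "\<bar>z - u\<bar> \<le> \<bar>v - u\<bar>" using z by (auto simp: closed_segment_eq_real_ivl split: if_splits)
      then have "B * \<bar>z - u\<bar> \<le> B * \<bar>v - u\<bar>" using B by (intro mult_left_mono)
      then show "norm (G' z - G' u) \<le> B * \<bar>v - u\<bar>" using lip[OF z01 uv(1)] by simp
    qed auto
    then show "\<bar>G v - G u - G' u * (v - u)\<bar> \<le> B * (v - u)\<^sup>2"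
      by (simp add: algebra_simps power2_eq_square abs_mult[symmetric])
  next
    fix u :: real assume u: "u \<in> {0..1}"
    have "\<bar>G' u - G' 0\<bar> \<le> B * \<bar>u - 0\<bar>" using u by (intro lip) auto
    also have "\<dots> \<le> B * 1" using u B by (intro mult_left_mono) auto
    finally show "\<bar>G' u\<bar> \<le> B" using zero[of 0] d by simp
  qed (use D zero B in auto)
qed

lemma c2c_lipschitz:
  assumes "c2c d B G" "x \<in> {0..1}" "y \<in> {0..1}"
  shows "\<bar>G x - G y\<bar> \<le> B * \<bar>x - y\<bar>"
proof -
  obtain G' where G': "\<And>u. u \<in> {0..1} \<Longrightarrow> (G has_real_derivative G' u) (at u within {0..1})"
    "\<And>u. u \<in> {0..1} \<Longrightarrow> \<bar>G' u\<bar> \<le> B"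
    using c2c_taylor[OF assms(1)] by metis
  show ?thesis using field_differentiable_bound[of "{0..1}" G G' B x y] G' assms by auto
qed

lemma c2c_nonneg: "c2c d B G \<Longrightarrow> 0 \<le> B"
  using c2c_taylor by metis

lemma c2c_bound: "c2c d B G \<Longrightarrow> u \<in> {0..1} \<Longrightarrow> \<bar>G u\<bar> \<le> B"
  by (auto simp: c2c_def)

lemma c2c_continuous: "c2c d B G \<Longrightarrow> continuous_on {0..1} G"
  unfolding c2c_def continuous_on_eq_continuous_within using DERIV_continuous by blast

text \<open>Reflection gives that the integral equals its own negative; this also covers odd
  functions that are not integrable, whose integral is 0 by convention.\<close>

lemma lborel_integral_odd:
  fixes k :: "real \<Rightarrow> real"
  assumes "\<And>h. k (- h) = - (k h :: real)"
  shows "(LINT h|lborel. k h) = 0"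
  using lborel_integral_real_affine[of "-1" k 0] assms by simp

context fractional
begin

lemma c2c_H0:
  assumes "c2c d B G"
  shows "G \<in> H0" "en G G \<le> lipc * B\<^sup>2"
proof -
  have "G 0 = 0" "G 1 = 0" using assms unfolding c2c_def by force+
  then show "G \<in> H0" "en G G \<le> lipc * B\<^sup>2"
    using lipschitz_sobolev[OF c2c_lipschitz[OF assms]] by (auto simp: H0_def)
qed

definition trunc_lap :: "real \<Rightarrow> (real \<Rightarrow> real) \<Rightarrow> real \<Rightarrow> real" where
  "trunc_lap \<epsilon> G u = (LINT v|unit_leb. indicator {v. \<epsilon> \<le> \<bar>u - v\<bar>} v * ((G v - G u) / \<bar>v - u\<bar> powr (1 + \<gamma>)))"

lemma trunc_integrand_bound:
  assumes "\<And>u. u \<in> {0..1} \<Longrightarrow> \<bar>G u\<bar> \<le> B" "0 < \<epsilon>" "u \<in> {0..1}" "v \<in> {0..1}"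
  shows "\<bar>indicator {v. \<epsilon> \<le> \<bar>u - v\<bar>} v * ((G v - G u) / \<bar>v - u\<bar> powr (1 + \<gamma>))\<bar> \<le> 2 * B / \<epsilon> powr (1 + \<gamma>)"
proof (cases "\<epsilon> \<le> \<bar>u - v\<bar>")
  case True
  have "\<bar>G v - G u\<bar> \<le> 2 * B" using assms(1)[OF assms(3)] assms(1)[OF assms(4)] by linarith
  moreover have "\<epsilon> powr (1 + \<gamma>) \<le> \<bar>v - u\<bar> powr (1 + \<gamma>)"
    using True assms \<gamma>1 by (intro powr_mono2) auto
  ultimately have "\<bar>G v - G u\<bar> / \<bar>v - u\<bar> powr (1 + \<gamma>) \<le> 2 * B / \<epsilon> powr (1 + \<gamma>)"
    using assms by (intro frac_le) auto
  then show ?thesis using True by (simp add: abs_divide)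
next
  case False
  have "0 \<le> B" using assms(1)[OF assms(3)] by linarith
  then show ?thesis using False by simp
qed

lemma indicator_dist_measurable:
  "(\<lambda>v. indicator {v. \<epsilon> \<le> \<bar>u - v\<bar>} v :: real) \<in> borel_measurable unit_leb"
  by (rule borel_unit_leb) measurable

lemma powr_dist_measurable:
  "(\<lambda>v. \<bar>v - u\<bar> powr a) \<in> borel_measurable unit_leb"
  by (rule borel_unit_leb) measurable

lemma trunc_integrand_measurable:
  assumes [measurable]: "G \<in> borel_measurable unit_leb"
  shows "(\<lambda>v. indicator {v. \<epsilon> \<le> \<bar>u - v\<bar>} v * ((G v - G u) / \<bar>v - u\<bar> powr (1 + \<gamma>))) \<in> borel_measurable unit_leb"
  using indicator_dist_measurable[of \<epsilon> u] powr_dist_measurable[of u "1 + \<gamma>"] by measurable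

lemma trunc_integrable:
  assumes m: "G \<in> borel_measurable unit_leb" and B: "\<And>u. u \<in> {0..1} \<Longrightarrow> \<bar>G u\<bar> \<le> B" and "0 < \<epsilon>" "u \<in> {0..1}"
  shows "integrable unit_leb (\<lambda>v. indicator {v. \<epsilon> \<le> \<bar>u - v\<bar>} v * ((G v - G u) / \<bar>v - u\<bar> powr (1 + \<gamma>)))"
proof (rule ul.integrable_const_bound[OF _ trunc_integrand_measurable[OF m]])
  show "AE v in unit_leb. norm (indicator {v. \<epsilon> \<le> \<bar>u - v\<bar>} v * ((G v - G u) / \<bar>v - u\<bar> powr (1 + \<gamma>))) \<le> 2 * B / \<epsilon> powr (1 + \<gamma>)"
    unfolding real_norm_def by (intro AE_I2 trunc_integrand_bound B assms(3,4)) auto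
qed

lemma trunc_lap_bound:
  assumes B: "\<And>u. u \<in> {0..1} \<Longrightarrow> \<bar>G u\<bar> \<le> B" and "0 < \<epsilon>" "u \<in> {0..1}"
  shows "\<bar>trunc_lap \<epsilon> G u\<bar> \<le> 2 * B / \<epsilon> powr (1 + \<gamma>)"
proof (cases "integrable unit_leb (\<lambda>v. indicator {v. \<epsilon> \<le> \<bar>u - v\<bar>} v * ((G v - G u) / \<bar>v - u\<bar> powr (1 + \<gamma>)))")
  case True
  then have "\<bar>trunc_lap \<epsilon> G u\<bar> \<le> (LINT v|unit_leb. 2 * B / \<epsilon> powr (1 + \<gamma>))"
    unfolding trunc_lap_def
    by (intro integral_abs_bound[THEN order_trans] integral_mono integrable_abs)
      (use trunc_integrand_bound[of G B \<epsilon> u] B assms(2,3) in \<open>auto simp del: times_divide_eq_right abs_mult abs_divide\<close>)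
  then show ?thesis by simp
next
  case False
  have "0 \<le> B" using B[OF assms(3)] by linarith
  then show ?thesis using False by (simp add: trunc_lap_def not_integrable_integral_eq)
qed

text \<open>The compensated integrand: by symmetry of the window, the linear term does not change the
  truncated integrals, and it makes the integral absolutely convergent.\<close>

lemma trunc_lap_limit:
  assumes G: "c2c d B G"
  obtains L where
    "\<And>\<epsilon> u. 0 < \<epsilon> \<Longrightarrow> \<epsilon> \<le> d \<Longrightarrow> u \<in> {0..1} \<Longrightarrow> \<bar>trunc_lap \<epsilon> G u - L u\<bar> \<le> 2 * B / (2 - \<gamma>) * \<epsilon> powr (2 - \<gamma>)"
proof -
  obtain G' where G':
    "\<And>u v. u \<in> {0..1} \<Longrightarrow> v \<in> {0..1} \<Longrightarrow> \<bar>G v - G u - G' u * (v - u)\<bar> \<le> B * (v - u)\<^sup>2"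
    "\<And>u. u \<in> {0..1} \<Longrightarrow> u < d \<or> 1 - d < u \<Longrightarrow> G' u = 0"
    using c2c_taylor[OF G] by metis
  have d: "0 < d" using G by (simp add: c2c_def)
  have B: "0 \<le> B" by (rule c2c_nonneg[OF G])
  have Gm [measurable]: "G \<in> borel_measurable unit_leb"
    by (intro continuous_measurable_unit_leb c2c_continuous[OF G])
  define k where "k u v = (G v - G u - indicator {v. \<bar>v - u\<bar> < d} v * (G' u * (v - u))) / \<bar>v - u\<bar> powr (1 + \<gamma>)" for u v
  define L where "L u = (LINT v|unit_leb. k u v)" for u
  have "\<bar>trunc_lap \<epsilon> G u - L u\<bar> \<le> 2 * B / (2 - \<gamma>) * \<epsilon> powr (2 - \<gamma>)"
    if e: "0 < \<epsilon>" "\<epsilon> \<le> d" and u: "u \<in> {0..1}" for \<epsilon> u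
  proof -
    let ?I = "\<lambda>v. indicator {v. \<epsilon> \<le> \<bar>u - v\<bar>} v :: real"
    have [measurable]: "?I \<in> borel_measurable unit_leb" by (rule indicator_dist_measurable)
    have [measurable]: "(\<lambda>v. indicator {v. \<bar>v - u\<bar> < d} v :: real) \<in> borel_measurable unit_leb"
      by (rule borel_unit_leb) measurable
    have km [measurable]: "k u \<in> borel_measurable unit_leb"
      unfolding k_def using powr_dist_measurable[of u "1 + \<gamma>"] by measurable
    let ?g = "\<lambda>v. (1 - ?I v) * k u v"
    have gb: "\<bar>?g v\<bar> \<le> B * (\<bar>v - u\<bar> powr (1 - \<gamma>) * indicator {-\<epsilon>..\<epsilon>} (v - u))" if v: "v \<in> {0..1}" for v
    proof (cases "\<epsilon> \<le> \<bar>u - v\<bar> \<or> v = u")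
      case True then show ?thesis using B by (auto simp: k_def)
    next
      case False
      then have "k u v = (G v - G u - G' u * (v - u)) / \<bar>v - u\<bar> powr (1 + \<gamma>)" using e by (auto simp: k_def)
      also have "\<bar>\<dots>\<bar> \<le> B * (v - u)\<^sup>2 / \<bar>v - u\<bar> powr (1 + \<gamma>)"
        unfolding abs_divide using G'(1)[OF u v] by (auto intro!: divide_right_mono)
      also have "(v - u)\<^sup>2 = \<bar>v - u\<bar> powr 2" using False by simp
      also have "B * \<bar>v - u\<bar> powr 2 / \<bar>v - u\<bar> powr (1 + \<gamma>) = B * (\<bar>v - u\<bar> powr 2 / \<bar>v - u\<bar> powr (1 + \<gamma>))" by simp
      also have "\<bar>v - u\<bar> powr 2 / \<bar>v - u\<bar> powr (1 + \<gamma>) = \<bar>v - u\<bar> powr (1 - \<gamma>)"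
        by (subst powr_diff[symmetric]) (simp add: algebra_simps)
      finally have "\<bar>k u v\<bar> \<le> B * \<bar>v - u\<bar> powr (1 - \<gamma>)" .
      moreover have "v - u \<in> {-\<epsilon>..\<epsilon>}" using False by auto
      ultimately show ?thesis using False by simp
    qed
    have nn: "(\<integral>\<^sup>+v. ennreal \<bar>?g v\<bar> \<partial>unit_leb) \<le> ennreal (2 * B / (2 - \<gamma>) * \<epsilon> powr (2 - \<gamma>))"
    proof -
      have "(\<integral>\<^sup>+v. ennreal \<bar>?g v\<bar> \<partial>unit_leb) \<le> (\<integral>\<^sup>+v. ennreal (B * (\<bar>v - u\<bar> powr (1 - \<gamma>) * indicator {-\<epsilon>..\<epsilon>} (v - u))) \<partial>unit_leb)"
        using gb by (intro nn_integral_mono ennreal_leI) auto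
      also have "\<dots> \<le> (\<integral>\<^sup>+v. ennreal (B * (\<bar>v - u\<bar> powr (1 - \<gamma>) * indicator {-\<epsilon>..\<epsilon>} (v - u))) \<partial>lborel)"
        by (subst nn_integral_restrict_space) (auto simp: indicator_def intro!: nn_integral_mono)
      also have "\<dots> = (\<integral>\<^sup>+v. ennreal B * ennreal (\<bar>v - u\<bar> powr (1 - \<gamma>) * indicator {-\<epsilon>..\<epsilon>} (v - u)) \<partial>lborel)"
        using B by (intro nn_integral_cong) (simp add: ennreal_mult)
      also have "\<dots> = ennreal B * (\<integral>\<^sup>+v. ennreal (\<bar>v - u\<bar> powr (1 - \<gamma>) * indicator {-\<epsilon>..\<epsilon>} (v - u)) \<partial>lborel)"
      proof (rule nn_integral_cmult)
        have "(\<lambda>h. ennreal (\<bar>h\<bar> powr (1 - \<gamma>) * indicator {-\<epsilon>..\<epsilon>} h)) \<in> borel_measurable borel" by auto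
        from measurable_compose[OF _ this, of "\<lambda>v. v - u" lborel]
        show "(\<lambda>v. ennreal (\<bar>v - u\<bar> powr (1 - \<gamma>) * indicator {-\<epsilon>..\<epsilon>} (v - u))) \<in> borel_measurable lborel" by simp
      qed
      also have "(\<integral>\<^sup>+v. ennreal (\<bar>v - u\<bar> powr (1 - \<gamma>) * indicator {-\<epsilon>..\<epsilon>} (v - u)) \<partial>lborel) =
          (\<integral>\<^sup>+h. ennreal (\<bar>h\<bar> powr (1 - \<gamma>) * indicator {-\<epsilon>..\<epsilon>} h) \<partial>lborel)"
        by (subst nn_integral_real_affine[where c = 1 and t = u]) auto
      also have "\<dots> = ennreal (2 * \<epsilon> powr (2 - \<gamma>) / (2 - \<gamma>))"
        using nn_integral_powr_interval[of "1 - \<gamma>" \<epsilon>] \<gamma>2 e by simp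
      finally show ?thesis using B \<gamma>2 by (simp add: ennreal_mult[symmetric] mult_ac)
    qed
    have gi: "integrable unit_leb ?g"
    proof (rule integrableI_bounded)
      show "?g \<in> borel_measurable unit_leb" by measurable
      show "(\<integral>\<^sup>+v. ennreal (norm (?g v)) \<partial>unit_leb) < \<infinity>" using nn by (auto intro: le_less_trans)
    qed
    have gle: "\<bar>LINT v|unit_leb. ?g v\<bar> \<le> 2 * B / (2 - \<gamma>) * \<epsilon> powr (2 - \<gamma>)"
    proof -
      have "ennreal \<bar>LINT v|unit_leb. ?g v\<bar> \<le> (\<integral>\<^sup>+v. ennreal (norm (?g v)) \<partial>unit_leb)"
        using integral_norm_bound_ennreal[OF gi] by simp
      also have "\<dots> \<le> ennreal (2 * B / (2 - \<gamma>) * \<epsilon> powr (2 - \<gamma>))" using nn by simp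
      finally show ?thesis using B \<gamma>2 by (subst (asm) ennreal_le_iff) auto
    qed
    let ?o = "\<lambda>h. indicator {h. \<epsilon> \<le> \<bar>h\<bar> \<and> \<bar>h\<bar> < d} h * (h / \<bar>h\<bar> powr (1 + \<gamma>)) :: real"
    let ?t = "\<lambda>v. ?I v * ((G v - G u) / \<bar>v - u\<bar> powr (1 + \<gamma>))"
    have ti: "integrable unit_leb ?t"
      by (rule trunc_integrable[OF Gm c2c_bound[OF G] e(1) u])
    have oi: "integrable unit_leb (\<lambda>v. ?o (v - u))"
    proof (rule ul.integrable_const_bound[where B = "d / \<epsilon> powr (1 + \<gamma>)"])
      show "AE v in unit_leb. norm (?o (v - u)) \<le> d / \<epsilon> powr (1 + \<gamma>)"
      proof (rule AE_I2)
        fix v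
        show "norm (?o (v - u)) \<le> d / \<epsilon> powr (1 + \<gamma>)"
        proof (cases "\<epsilon> \<le> \<bar>v - u\<bar> \<and> \<bar>v - u\<bar> < d")
          case True
          then have "\<bar>v - u\<bar> / \<bar>v - u\<bar> powr (1 + \<gamma>) \<le> d / \<epsilon> powr (1 + \<gamma>)"
            using e \<gamma>1 by (intro frac_le powr_mono2) auto
          then show ?thesis using True by (simp add: abs_divide)
        qed (use d in auto)
      qed
      show "(\<lambda>v. ?o (v - u)) \<in> borel_measurable unit_leb"
        by (rule borel_unit_leb) measurable
    qed
    \<comment> \<open>If \<open>u\<close> is closer than \<open>d\<close> to an end point, the
      window of half-width \<open>d\<close> leaves the interval, but there \<open>G' u = 0\<close>.
      Otherwise the window lies inside [0, 1], and an odd function is integrated over a symmetric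
      set.\<close>
    have o0: "G' u * (LINT v|unit_leb. ?o (v - u)) = 0"
    proof (cases "u < d \<or> 1 - d < u")
      case True then show ?thesis using G'(2)[OF u] by simp
    next
      case False
      have "(LINT v|unit_leb. ?o (v - u)) = (LINT v|lborel. ?o (v - u))"
        using False by (subst integral_restrict_space) (auto simp: indicator_def intro!: Bochner_Integration.integral_cong)
      also have "\<dots> = (LINT h|lborel. ?o h)"
        by (subst lborel_integral_real_affine[where c = 1 and t = u]) auto
      also have "\<dots> = 0" by (rule lborel_integral_odd) (auto simp: indicator_def)
      finally show ?thesis by simp
    qed
    have eq: "k u v = ?t v - G' u * ?o (v - u) + ?g v" for v
      using e by (auto simp: k_def indicator_def diff_divide_distrib right_diff_distrib abs_minus_commute[of u v])
    have "L u = (LINT v|unit_leb. ?t v - G' u * ?o (v - u) + ?g v)"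
      unfolding L_def by (intro Bochner_Integration.integral_cong eq refl)
    also have "\<dots> = (LINT v|unit_leb. ?t v) - G' u * (LINT v|unit_leb. ?o (v - u)) + (LINT v|unit_leb. ?g v)"
      using ti oi gi by (subst Bochner_Integration.integral_add) (auto intro!: Bochner_Integration.integrable_diff simp del: times_divide_eq_right)
    finally have "L u = trunc_lap \<epsilon> G u + (LINT v|unit_leb. ?g v)"
      using o0 by (simp add: trunc_lap_def)
    then show ?thesis using gle by simp
  qed
  then show ?thesis using that by blast
qed

text \<open>\<open>Lim\<close> only picks a value, so convergence must be proved before the
  Laplacian can be used at all. The rate is the integral of \<bar>h\<bar>^(1 - \<gamma>) over the
  omitted window and does not depend on \<open>u\<close>, which yields continuity and uniform
  bounds.\<close>

lemma trunc_lap_frac_lap: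
  assumes G: "c2c d B G" and u: "u \<in> {0..1}" and "0 < \<epsilon>" "\<epsilon> \<le> d"
  shows "\<bar>c_norm \<gamma> * trunc_lap \<epsilon> G u - frac_lap \<gamma> G u\<bar> \<le> c_norm \<gamma> * (2 * B / (2 - \<gamma>) * \<epsilon> powr (2 - \<gamma>))"
proof -
  obtain L where L: "\<And>\<epsilon> u. 0 < \<epsilon> \<Longrightarrow> \<epsilon> \<le> d \<Longrightarrow> u \<in> {0..1} \<Longrightarrow> \<bar>trunc_lap \<epsilon> G u - L u\<bar> \<le> 2 * B / (2 - \<gamma>) * \<epsilon> powr (2 - \<gamma>)"
    using trunc_lap_limit[OF G] by blast
  have d: "0 < d" using G by (simp add: c2c_def)
  have "((\<lambda>\<epsilon>. trunc_lap \<epsilon> G u - L u) \<longlongrightarrow> 0) (at_right 0)"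
  proof (rule Lim_null_comparison)
    show "\<forall>\<^sub>F \<epsilon> in at_right 0. norm (trunc_lap \<epsilon> G u - L u) \<le> 2 * B / (2 - \<gamma>) * \<epsilon> powr (2 - \<gamma>)"
      using L[OF _ _ u] d unfolding eventually_at_right_field by (intro exI[of _ d]) auto
    have "((\<lambda>\<epsilon>. 2 * B / (2 - \<gamma>) * \<epsilon> powr (2 - \<gamma>)) \<longlongrightarrow> 2 * B / (2 - \<gamma>) * 0 powr (2 - \<gamma>)) (at_right 0)"
      using \<gamma>2 by (intro tendsto_intros tendsto_powr2) (auto simp: eventually_at_right_less eventually_mono[OF eventually_at_right_less] less_imp_le)
    then show "((\<lambda>\<epsilon>. 2 * B / (2 - \<gamma>) * \<epsilon> powr (2 - \<gamma>)) \<longlongrightarrow> 0) (at_right 0)" by simp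
  qed
  then have "((\<lambda>\<epsilon>. trunc_lap \<epsilon> G u) \<longlongrightarrow> L u) (at_right 0)" by (simp add: LIM_zero_iff)
  then have "Lim (at_right 0) (\<lambda>\<epsilon>. trunc_lap \<epsilon> G u) = L u"
    by (intro tendsto_Lim) auto
  then have "frac_lap \<gamma> G u = c_norm \<gamma> * L u"
    by (simp add: frac_lap_def trunc_lap_def)
  then have "c_norm \<gamma> * trunc_lap \<epsilon> G u - frac_lap \<gamma> G u = c_norm \<gamma> * (trunc_lap \<epsilon> G u - L u)"
    by (simp add: right_diff_distrib)
  then show ?thesis
    using mult_left_mono[OF L[OF assms(3,4) u], of "c_norm \<gamma>"] c_pos by (simp add: abs_mult)
qed

text \<open>The error of truncating at distance \<open>d\<close> plus the trivial bound for the
  truncated operator, whose integrand is at most 2 B / d^(1 + \<gamma>).\<close>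

definition lapbound :: "real \<Rightarrow> real \<Rightarrow> real" where
  "lapbound d B = c_norm \<gamma> * (2 * B / (2 - \<gamma>) * d powr (2 - \<gamma>)) + c_norm \<gamma> * (2 * B / d powr (1 + \<gamma>))"

lemma frac_lap_bound:
  assumes G: "c2c d B G" and u: "u \<in> {0..1}"
  shows "\<bar>frac_lap \<gamma> G u\<bar> \<le> lapbound d B"
proof -
  have d: "0 < d" using G by (simp add: c2c_def)
  have "\<bar>c_norm \<gamma> * trunc_lap d G u - frac_lap \<gamma> G u\<bar> \<le> c_norm \<gamma> * (2 * B / (2 - \<gamma>) * d powr (2 - \<gamma>))"
    by (rule trunc_lap_frac_lap[OF G u d]) simp
  moreover have "\<bar>c_norm \<gamma> * trunc_lap d G u\<bar> \<le> c_norm \<gamma> * (2 * B / d powr (1 + \<gamma>))"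
    using mult_left_mono[OF trunc_lap_bound[of G B d u], of "c_norm \<gamma>"] c2c_bound[OF G] d u c_pos by (simp add: abs_mult)
  ultimately show ?thesis unfolding lapbound_def by linarith
qed

lemma frac_lap_limit_seq:
  assumes G: "c2c d B G" and u: "u \<in> {0..1}"
  shows "(\<lambda>n. c_norm \<gamma> * trunc_lap (1 / Suc n) G u) \<longlonglongrightarrow> frac_lap \<gamma> G u"
proof -
  have d: "0 < d" using G by (simp add: c2c_def)
  have l0: "(\<lambda>n. 1 / Suc n) \<longlonglongrightarrow> 0" using LIMSEQ_inverse_real_of_nat by (simp add: inverse_eq_divide)
  have "(\<lambda>n. c_norm \<gamma> * trunc_lap (1 / Suc n) G u - frac_lap \<gamma> G u) \<longlonglongrightarrow> 0"
  proof (rule Lim_null_comparison)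
    show "\<forall>\<^sub>F n in sequentially. norm (c_norm \<gamma> * trunc_lap (1 / Suc n) G u - frac_lap \<gamma> G u)
       \<le> c_norm \<gamma> * (2 * B / (2 - \<gamma>) * (1 / Suc n) powr (2 - \<gamma>))"
    proof -
      have "\<forall>\<^sub>F n in sequentially. 1 / real (Suc n) < d" using order_tendstoD(2)[OF l0 d] .
      then show ?thesis by eventually_elim (use trunc_lap_frac_lap[OF G u] in auto)
    qed
    have "(\<lambda>n. c_norm \<gamma> * (2 * B / (2 - \<gamma>) * (1 / Suc n) powr (2 - \<gamma>))) \<longlonglongrightarrow> c_norm \<gamma> * (2 * B / (2 - \<gamma>) * 0 powr (2 - \<gamma>))"
      using \<gamma>2 by (intro tendsto_intros tendsto_powr2 l0) auto
    then show "(\<lambda>n. c_norm \<gamma> * (2 * B / (2 - \<gamma>) * (1 / Suc n) powr (2 - \<gamma>))) \<longlonglongrightarrow> 0" by simp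
  qed
  then show ?thesis by (simp add: LIM_zero_iff)
qed

text \<open>The only jumps of the truncated integrand under a change of the base point a occur at v
  = a - \<epsilon> and v = a + \<epsilon>, a null set, and the truncation provides a constant
  dominating function.\<close>

lemma trunc_lap_continuous:
  assumes G: "c2c d B G" and "0 < \<epsilon>"
  shows "continuous_on {0..1} (trunc_lap \<epsilon> G)"
proof (rule continuous_on_sequentiallyI)
  fix x :: "nat \<Rightarrow> real" and a assume x: "\<forall>n. x n \<in> {0..1}" and a: "a \<in> {0..1}" and lim: "x \<longlonglongrightarrow> a"
  have Gm: "G \<in> borel_measurable unit_leb"
    by (intro continuous_measurable_unit_leb c2c_continuous[OF G])
  have Gl: "(\<lambda>n. G (x n)) \<longlonglongrightarrow> G a"
    using c2c_continuous[OF G] a x lim unfolding continuous_on_sequentially comp_def by blast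
  show "(\<lambda>n. trunc_lap \<epsilon> G (x n)) \<longlonglongrightarrow> trunc_lap \<epsilon> G a"
    unfolding trunc_lap_def
  proof (rule integral_dominated_convergence[where w = "\<lambda>_. 2 * B / \<epsilon> powr (1 + \<gamma>)"])
    have "AE v in lborel. v \<noteq> a - \<epsilon> \<and> v \<noteq> a + \<epsilon>"
      using AE_lborel_singleton[of "a - \<epsilon>"] AE_lborel_singleton[of "a + \<epsilon>"] by eventually_elim auto
    then have "AE v in lborel. v \<in> {0..1} \<longrightarrow> (\<lambda>n. indicator {v. \<epsilon> \<le> \<bar>x n - v\<bar>} v * ((G v - G (x n)) / \<bar>v - x n\<bar> powr (1 + \<gamma>)))
         \<longlonglongrightarrow> indicator {v. \<epsilon> \<le> \<bar>a - v\<bar>} v * ((G v - G a) / \<bar>v - a\<bar> powr (1 + \<gamma>))"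
    proof eventually_elim
      case (elim v)
      have lv: "(\<lambda>n. \<bar>x n - v\<bar>) \<longlonglongrightarrow> \<bar>a - v\<bar>" by (intro tendsto_intros lim)
      show ?case
      proof (intro impI)
        show "(\<lambda>n. indicator {v. \<epsilon> \<le> \<bar>x n - v\<bar>} v * ((G v - G (x n)) / \<bar>v - x n\<bar> powr (1 + \<gamma>)))
         \<longlonglongrightarrow> indicator {v. \<epsilon> \<le> \<bar>a - v\<bar>} v * ((G v - G a) / \<bar>v - a\<bar> powr (1 + \<gamma>))"
        proof (cases "\<epsilon> < \<bar>a - v\<bar>")
          case True
          have "eventually (\<lambda>n. \<epsilon> < \<bar>x n - v\<bar>) sequentially" by (rule order_tendstoD(1)[OF lv True])
          then have "eventually (\<lambda>n. (G v - G (x n)) / \<bar>v - x n\<bar> powr (1 + \<gamma>) =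
              indicator {v. \<epsilon> \<le> \<bar>x n - v\<bar>} v * ((G v - G (x n)) / \<bar>v - x n\<bar> powr (1 + \<gamma>))) sequentially"
            by eventually_elim auto
          moreover have "(\<lambda>n. (G v - G (x n)) / \<bar>v - x n\<bar> powr (1 + \<gamma>)) \<longlonglongrightarrow> (G v - G a) / \<bar>v - a\<bar> powr (1 + \<gamma>)"
            using True assms by (intro tendsto_intros Gl lim) auto
          ultimately show ?thesis using True by (simp add: Lim_transform_eventually)
        next
          case False
          then have "\<bar>a - v\<bar> < \<epsilon>" using elim by auto
          then have "eventually (\<lambda>n. \<bar>x n - v\<bar> < \<epsilon>) sequentially" by (rule order_tendstoD(2)[OF lv])
          then have "eventually (\<lambda>n. indicator {v. \<epsilon> \<le> \<bar>x n - v\<bar>} v * ((G v - G (x n)) / \<bar>v - x n\<bar> powr (1 + \<gamma>)) = 0) sequentially"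
            by eventually_elim auto
          then show ?thesis using \<open>\<bar>a - v\<bar> < \<epsilon>\<close> by (simp add: tendsto_eventually)
        qed
      qed
    qed
    then show "AE v in unit_leb. (\<lambda>n. indicator {v. \<epsilon> \<le> \<bar>x n - v\<bar>} v * ((G v - G (x n)) / \<bar>v - x n\<bar> powr (1 + \<gamma>)))
         \<longlonglongrightarrow> indicator {v. \<epsilon> \<le> \<bar>a - v\<bar>} v * ((G v - G a) / \<bar>v - a\<bar> powr (1 + \<gamma>))"
      by (subst AE_restrict_space_iff) auto
    show "AE v in unit_leb. norm (indicator {v. \<epsilon> \<le> \<bar>x n - v\<bar>} v * ((G v - G (x n)) / \<bar>v - x n\<bar> powr (1 + \<gamma>))) \<le> 2 * B / \<epsilon> powr (1 + \<gamma>)" for n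
      by (rule AE_I2) (use trunc_integrand_bound[of G B \<epsilon> "x n"] c2c_bound[OF G] assms x in \<open>auto simp del: times_divide_eq_right\<close>)
  qed (rule trunc_integrand_measurable[OF Gm] ul.integrable_const)+
qed

lemma frac_lap_continuous:
  assumes G: "c2c d B G"
  shows "continuous_on {0..1} (frac_lap \<gamma> G)"
proof -
  have d: "0 < d" using G by (simp add: c2c_def)
  have "uniform_limit {0..1} (\<lambda>\<epsilon> u. c_norm \<gamma> * trunc_lap \<epsilon> G u) (frac_lap \<gamma> G) (at_right 0)"
    unfolding uniform_limit_iff
  proof (intro allI impI)
    fix e :: real assume e: "0 < e"
    have "((\<lambda>\<epsilon>. c_norm \<gamma> * (2 * B / (2 - \<gamma>) * \<epsilon> powr (2 - \<gamma>))) \<longlongrightarrow> c_norm \<gamma> * (2 * B / (2 - \<gamma>) * 0 powr (2 - \<gamma>))) (at_right 0)"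
      using \<gamma>2 by (intro tendsto_intros tendsto_powr2) (auto simp: eventually_mono[OF eventually_at_right_less] less_imp_le)
    then have "eventually (\<lambda>\<epsilon>. c_norm \<gamma> * (2 * B / (2 - \<gamma>) * \<epsilon> powr (2 - \<gamma>)) < e) (at_right 0)"
      using e by (intro order_tendstoD(2)) auto
    moreover have "eventually (\<lambda>\<epsilon>. 0 < \<epsilon> \<and> \<epsilon> < d) (at_right 0)"
      using d unfolding eventually_at_right_field by (intro exI[of _ d]) auto
    ultimately show "\<forall>\<^sub>F \<epsilon> in at_right 0. \<forall>u\<in>{0..1}. dist (c_norm \<gamma> * trunc_lap \<epsilon> G u) (frac_lap \<gamma> G u) < e"
    proof eventually_elim
      case (elim \<epsilon>)
      then show ?case using trunc_lap_frac_lap[OF G, of _ \<epsilon>] by (fastforce simp: dist_real_def)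
    qed
  qed
  moreover have "\<forall>\<^sub>F \<epsilon> in at_right 0. continuous_on {0..1} (\<lambda>u. c_norm \<gamma> * trunc_lap \<epsilon> G u)"
    using eventually_at_right_less by eventually_elim (intro continuous_intros trunc_lap_continuous[OF G])
  ultimately show ?thesis by (intro uniform_limit_theorem) auto
qed

text \<open>Integration by parts: symmetrise the truncated double integral, then remove the truncation.\<close>

lemma ip_frac_lap:
  assumes F: "F \<in> sobolev \<gamma>" and G: "c2c d B G"
  shows "ip2 F (frac_lap \<gamma> G) = - en F G"
proof -
  let ?L = "unit_leb \<Otimes>\<^sub>M unit_leb"
  have Gs: "G \<in> sobolev \<gamma>" using c2c_H0[OF G] by (simp add: H0_def)
  have Fm [measurable]: "F \<in> borel_measurable unit_leb" and Gm [measurable]: "G \<in> borel_measurable unit_leb"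
    by (auto intro: sobolev_measurable F Gs)
  obtain A where A: "0 < A" "\<And>x. x \<in> {0..1} \<Longrightarrow> \<bar>F x\<bar> \<le> A"
    using continuous_bounded_unit[OF sobolev_continuous[OF F]] by metis
  have B: "0 \<le> B" by (rule c2c_nonneg[OF G])
  let ?I = "\<lambda>n p. (if 1 / real (Suc n) \<le> \<bar>fst p - snd p\<bar> then 1 else 0) :: real"
  have Im [measurable]: "?I n \<in> borel_measurable ?L" for n by measurable
  have key: "(LINT u|unit_leb. F u * (c_norm \<gamma> * trunc_lap (1 / Suc n) G u)) = - (LINT p|km. ?I n p * (dd F p * dd G p))" for n
  proof -
    let ?k = "\<lambda>p. kern (fst p) (snd p)"
    let ?f = "\<lambda>p. 2 * (?I n p * ?k p) * (F (fst p) * (G (snd p) - G (fst p)))"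
    define Q where "Q = c_norm \<gamma> / 2 / (1 / real (Suc n)) powr (1 + \<gamma>)"
    have kb: "\<bar>?I n p * ?k p\<bar> \<le> Q" for p
    proof (cases "1 / real (Suc n) \<le> \<bar>fst p - snd p\<bar>")
      case True
      have "(1 / real (Suc n)) powr (1 + \<gamma>) \<le> \<bar>fst p - snd p\<bar> powr (1 + \<gamma>)"
        using True \<gamma>1 by (intro powr_mono2) auto
      then have "?k p \<le> Q" unfolding Q_def kern_def using c_pos by (intro divide_left_mono mult_pos_pos) (auto intro: less_le_trans)
      then show ?thesis using True by simp
    next
      case False then show ?thesis using c_pos by (simp add: Q_def)
    qed
    have bound: "\<bar>2 * (?I n p * ?k p) * (a * (G (snd p) - G (fst p)))\<bar> \<le> 2 * Q * (C * (2 * B))"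
      if "p \<in> space ?L" "\<bar>a\<bar> \<le> C" for p a C
    proof -
      have "\<bar>G (snd p)\<bar> \<le> B" "\<bar>G (fst p)\<bar> \<le> B" using that c2c_bound[OF G] by (auto simp: space_pair_measure)
      then have "\<bar>G (snd p) - G (fst p)\<bar> \<le> 2 * B" by linarith
      then have "\<bar>a\<bar> * \<bar>G (snd p) - G (fst p)\<bar> \<le> C * (2 * B)" using that by (intro mult_mono) auto
      then have "2 * \<bar>?I n p * ?k p\<bar> * (\<bar>a\<bar> * \<bar>G (snd p) - G (fst p)\<bar>) \<le> 2 * Q * (C * (2 * B))"
        by (rule mult_mono[rotated]) (use kb[of p] order_trans[OF abs_ge_zero kb[of p]] in auto)
      then show ?thesis by (simp only: abs_mult abs_numeral mult.assoc)
    qed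
    have fi: "integrable ?L ?f"
    proof (rule finite_measure.integrable_const_bound[OF finite_measure_ulp, where B = "2 * Q * (A * (2 * B))"])
      show "AE p in ?L. norm (?f p) \<le> 2 * Q * (A * (2 * B))"
        unfolding real_norm_def by (intro AE_I2 bound A(2)) (auto simp: space_pair_measure)
      show "?f \<in> borel_measurable ?L" by measurable
    qed
    have "(LINT u|unit_leb. F u * (c_norm \<gamma> * trunc_lap (1 / Suc n) G u)) = (LINT u|unit_leb. LINT v|unit_leb. ?f (u, v))"
    proof (rule Bochner_Integration.integral_cong[OF refl])
      fix u
      have "F u * (c_norm \<gamma> * trunc_lap (1 / Suc n) G u) = (LINT v|unit_leb. F u * (c_norm \<gamma> *
        (indicator {v. 1 / Suc n \<le> \<bar>u - v\<bar>} v * ((G v - G u) / \<bar>v - u\<bar> powr (1 + \<gamma>)))))"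
        unfolding trunc_lap_def by (simp del: times_divide_eq_right)
      also have "\<dots> = (LINT v|unit_leb. ?f (u, v))"
        by (intro Bochner_Integration.integral_cong refl) (auto simp: kern_def indicator_def abs_minus_commute)
      finally show "F u * (c_norm \<gamma> * trunc_lap (1 / Suc n) G u) = (LINT v|unit_leb. ?f (u, v))" .
    qed
    also have "\<dots> = (LINT p|?L. ?f p)"
      by (rule ulp.integral_fst'[OF fi])
    finally have eqA: "(LINT u|unit_leb. F u * (c_norm \<gamma> * trunc_lap (1 / Suc n) G u)) = (LINT p|?L. ?f p)" .
    \<comment> \<open>Adding the integrand with the variables exchanged turns F(u) (G(v) - G(u))
      into minus the product of the two increments, by symmetry of the kernel.\<close>
    let ?f' = "\<lambda>p. case p of (x, y) \<Rightarrow> ?f (y, x)"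
    have sw: "(LINT p|?L. ?f' p) = (LINT p|?L. ?f p)"
      by (rule ulp.integral_product_swap) (use fi in auto)
    have fi': "integrable ?L ?f'"
      by (rule ulp.integrable_product_swap[OF fi])
    have "2 * (LINT p|?L. ?f p) = (LINT p|?L. ?f p + ?f' p)"
      using fi fi' sw by simp
    also have "\<dots> = (LINT p|?L. - 2 * (?k p * (?I n p * (dd F p * dd G p))))"
      by (intro Bochner_Integration.integral_cong refl)
        (auto simp: dd_def kern_commute abs_minus_commute algebra_simps split: prod.splits)
    also have "\<dots> = - 2 * (LINT p|?L. ?k p * (?I n p * (dd F p * dd G p)))" by simp
    also have "(LINT p|?L. ?k p * (?I n p * (dd F p * dd G p))) = (LINT p|km. ?I n p * (dd F p * dd G p))"
      unfolding km_def by (subst integral_real_density) (auto simp: dd_def)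
    finally show ?thesis using eqA by simp
  qed
  have i: "integrable km (\<lambda>p. dd F p * dd G p)"
    by (intro sqint_mult_integrable sobolev_dd F Gs)
  have m: "(\<lambda>p. ?I n p * (dd F p * dd G p)) \<in> borel_measurable km" for n
    using Im[of n] unfolding dd_def by measurable
  have "(\<lambda>n. LINT p|km. ?I n p * (dd F p * dd G p)) \<longlonglongrightarrow> (LINT p|km. dd F p * dd G p)"
  proof (rule integral_dominated_convergence[where w = "\<lambda>p. norm (dd F p * dd G p)"])
    show "AE p in km. (\<lambda>n. ?I n p * (dd F p * dd G p)) \<longlonglongrightarrow> dd F p * dd G p"
    proof (rule AE_I2)
      fix p
      show "(\<lambda>n. ?I n p * (dd F p * dd G p)) \<longlonglongrightarrow> dd F p * dd G p"
      proof (cases "fst p = snd p")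
        case True then show ?thesis by (simp add: dd_def)
      next
        case False
        then have "0 < \<bar>fst p - snd p\<bar>" by simp
        have l0: "(\<lambda>n. 1 / real (Suc n)) \<longlonglongrightarrow> 0" using LIMSEQ_inverse_real_of_nat by (simp add: inverse_eq_divide)
        have "eventually (\<lambda>n. 1 / real (Suc n) < \<bar>fst p - snd p\<bar>) sequentially"
          by (rule order_tendstoD(2)[OF l0]) fact
        then have "eventually (\<lambda>n. ?I n p * (dd F p * dd G p) = dd F p * dd G p) sequentially"
          by eventually_elim auto
        then show ?thesis by (rule tendsto_eventually)
      qed
    qed
    show "AE p in km. norm (?I n p * (dd F p * dd G p)) \<le> norm (dd F p * dd G p)" for n
      by (rule AE_I2) simp
  qed (use i m in auto)
  then have lim1: "(\<lambda>n. LINT u|unit_leb. F u * (c_norm \<gamma> * trunc_lap (1 / Suc n) G u)) \<longlonglongrightarrow> - en F G"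
    unfolding key en_def ip_def by (rule tendsto_minus)
  have d: "0 < d" using G by (simp add: c2c_def)
  have tm: "trunc_lap \<epsilon> G \<in> borel_measurable unit_leb" if "0 < \<epsilon>" for \<epsilon>
    by (intro continuous_measurable_unit_leb trunc_lap_continuous[OF G that])
  have fm: "frac_lap \<gamma> G \<in> borel_measurable unit_leb"
    by (intro continuous_measurable_unit_leb frac_lap_continuous[OF G])
  have lim2: "(\<lambda>n. LINT u|unit_leb. F u * (c_norm \<gamma> * trunc_lap (1 / Suc n) G u)) \<longlonglongrightarrow> (LINT u|unit_leb. F u * frac_lap \<gamma> G u)"
  proof -
    \<comment> \<open>The uniform error estimate holds only for truncations at distances up to
      \<open>d\<close>, so the sequence is started late enough.\<close>
    obtain N where N: "\<And>n. n \<ge> N \<Longrightarrow> 1 / real (Suc n) \<le> d"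
    proof -
      have l0: "(\<lambda>n. 1 / real (Suc n)) \<longlonglongrightarrow> 0" using LIMSEQ_inverse_real_of_nat by (simp add: inverse_eq_divide)
      show ?thesis using order_tendstoD(2)[OF l0 d] that unfolding eventually_sequentially by (meson less_imp_le)
    qed
    define M where "M = lapbound d B + c_norm \<gamma> * (2 * B / (2 - \<gamma>) * d powr (2 - \<gamma>))"
    have "(\<lambda>n. LINT u|unit_leb. F u * (c_norm \<gamma> * trunc_lap (1 / Suc (n + N)) G u)) \<longlonglongrightarrow> (LINT u|unit_leb. F u * frac_lap \<gamma> G u)"
    proof (rule integral_dominated_convergence[where w = "\<lambda>_. A * M"])
      show "AE u in unit_leb. (\<lambda>n. F u * (c_norm \<gamma> * trunc_lap (1 / Suc (n + N)) G u)) \<longlonglongrightarrow> F u * frac_lap \<gamma> G u"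
      proof (rule AE_I2)
        fix u assume "u \<in> space unit_leb"
        then have "(\<lambda>n. c_norm \<gamma> * trunc_lap (1 / Suc n) G u) \<longlonglongrightarrow> frac_lap \<gamma> G u"
          by (intro frac_lap_limit_seq[OF G]) simp
        from LIMSEQ_ignore_initial_segment[OF this, of N]
        show "(\<lambda>n. F u * (c_norm \<gamma> * trunc_lap (1 / Suc (n + N)) G u)) \<longlonglongrightarrow> F u * frac_lap \<gamma> G u"
          by (intro tendsto_mult_left)
      qed
      show "AE u in unit_leb. norm (F u * (c_norm \<gamma> * trunc_lap (1 / Suc (n + N)) G u)) \<le> A * M" for n
      proof (rule AE_I2)
        fix u assume "u \<in> space unit_leb"
        then have u: "u \<in> {0..1}" by simp
        have "\<bar>c_norm \<gamma> * trunc_lap (1 / Suc (n + N)) G u - frac_lap \<gamma> G u\<bar> \<le> c_norm \<gamma> * (2 * B / (2 - \<gamma>) * (1 / Suc (n + N)) powr (2 - \<gamma>))"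
          using N[of "n + N"] by (intro trunc_lap_frac_lap[OF G u]) auto
        also have "\<dots> \<le> c_norm \<gamma> * (2 * B / (2 - \<gamma>) * d powr (2 - \<gamma>))"
          using N[of "n + N"] c_pos B \<gamma>2 by (intro mult_left_mono powr_mono2) auto
        finally have "\<bar>c_norm \<gamma> * trunc_lap (1 / Suc (n + N)) G u\<bar> \<le> M"
          using frac_lap_bound[OF G u] unfolding M_def by linarith
        then show "norm (F u * (c_norm \<gamma> * trunc_lap (1 / Suc (n + N)) G u)) \<le> A * M"
          unfolding real_norm_def abs_mult[of "F u"] using A u by (intro mult_mono) auto
      qed
    qed (use tm fm in auto)
    then show ?thesis by (rule LIMSEQ_offset)
  qed
  show ?thesis using LIMSEQ_unique[OF lim2 lim1] by (simp add: ip_def)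
qed

end

declare measurable_unit_leb_id [measurable del]

section \<open>Smooth functions of compact support\<close>

lemma DERIV_everywhere_continuous:
  "(\<And>x. (f has_real_derivative f' x) (at x)) \<Longrightarrow> continuous_on S f"
  by (intro continuous_at_imp_continuous_on ballI) (rule DERIV_isCont)

definition bump_q :: "real \<Rightarrow> real \<Rightarrow> real \<Rightarrow> real" where
  "bump_q a b x = (x - a) * (b - x)"

text \<open>The family p / q^n exp(-1 / q), extended by zero, is closed under differentiation.
  Smoothness of all orders thus reduces to one derivative computation, and multiplying the basic
  bump by a polynomial stays inside the family.\<close>

definition sm :: "real \<Rightarrow> real \<Rightarrow> real poly \<Rightarrow> nat \<Rightarrow> real \<Rightarrow> real" where
  "sm a b p n x = (if a < x \<and> x < b then poly p x / bump_q a b x ^ n * exp (- (1 / bump_q a b x)) else 0)"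

definition bump_Q :: "real \<Rightarrow> real \<Rightarrow> real poly" where
  "bump_Q a b = [:-a, 1:] * [:b, -1:]"

text \<open>The numerator over q^(n + 2): p' q^2 comes from the polynomial, - n p q' q from the
  power of q, and p q' from the exponential.\<close>

definition sm_deriv :: "real \<Rightarrow> real \<Rightarrow> real poly \<Rightarrow> nat \<Rightarrow> real poly" where
  "sm_deriv a b p n = pderiv p * bump_Q a b ^ 2 - smult (real n) (p * pderiv (bump_Q a b) * bump_Q a b) + p * pderiv (bump_Q a b)"

lemma poly_bump_Q: "poly (bump_Q a b) x = bump_q a b x"
  by (simp add: bump_Q_def bump_q_def algebra_simps)

lemma bump_q_deriv: "(bump_q a b has_real_derivative poly (pderiv (bump_Q a b)) x) (at x)"
proof -
  have "bump_q a b = poly (bump_Q a b)" by (auto simp: poly_bump_Q)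
  then show ?thesis by (simp add: poly_DERIV)
qed

lemma bump_q_pos: "a < x \<Longrightarrow> x < b \<Longrightarrow> 0 < bump_q a b x"
  by (simp add: bump_q_def)

lemma power_le_fact_exp:
  assumes "0 \<le> (z::real)"
  shows "z ^ n \<le> fact n * exp z"
proof -
  have "z ^ n /\<^sub>R fact n = (\<Sum>k\<in>{n}. z ^ k /\<^sub>R fact k)" by simp
  also have "\<dots> \<le> (\<Sum>k. z ^ k /\<^sub>R fact k)"
    using assms by (intro sum_le_suminf summable_exp_generic) auto
  also have "\<dots> = exp z" by (simp add: exp_def)
  finally show ?thesis by (simp add: field_simps)
qed

text \<open>The inequality z^(n + 2) \<le> (n + 2)! e^z at z = 1 / q gives q^(-n) exp(-1 / q) \<le>
  (n + 2)! q^2, and q vanishes linearly at both end points. A quadratic bound is all that is needed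
  for derivative 0 there.\<close>

lemma sm_quadratic_bound:
  obtains C where "\<And>x. \<bar>sm a b p n x\<bar> \<le> C * (x - a)\<^sup>2" "\<And>x. \<bar>sm a b p n x\<bar> \<le> C * (x - b)\<^sup>2"
proof -
  have "compact (poly p ` {a..b})" by (intro compact_continuous_image continuous_intros) auto
  then obtain M where M: "0 < M" "\<And>x. x \<in> {a..b} \<Longrightarrow> \<bar>poly p x\<bar> \<le> M"
    using compact_imp_bounded bounded_pos by (metis image_eqI real_norm_def)
  define C where "C = M * fact (n + 2) * (b - a)\<^sup>2"
  have main: "\<bar>sm a b p n x\<bar> \<le> M * fact (n + 2) * (bump_q a b x)\<^sup>2" if x: "a < x" "x < b" for x
  proof -
    let ?q = "bump_q a b x"
    have q: "0 < ?q" by (rule bump_q_pos[OF x])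
    have "(1 / ?q) ^ (n + 2) \<le> fact (n + 2) * exp (1 / ?q)" using q by (intro power_le_fact_exp) simp
    then have e1: "1 / ?q ^ n * exp (- (1 / ?q)) \<le> fact (n + 2) * ?q\<^sup>2"
      using q by (simp add: exp_minus field_simps power_add power2_eq_square)
    have "\<bar>poly p x\<bar> * (1 / ?q ^ n * exp (- (1 / ?q))) \<le> M * (fact (n + 2) * ?q\<^sup>2)"
    proof (rule mult_mono)
      show "\<bar>poly p x\<bar> \<le> M" using M x by auto
    qed (use M q e1 in auto)
    moreover have "\<bar>sm a b p n x\<bar> = \<bar>poly p x\<bar> * (1 / ?q ^ n * exp (- (1 / ?q)))"
      using x q by (simp add: sm_def abs_mult)
    ultimately show ?thesis by (simp add: mult.assoc)
  qed
  show ?thesis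
  proof (rule that[of C])
    fix x
    show "\<bar>sm a b p n x\<bar> \<le> C * (x - a)\<^sup>2"
    proof (cases "a < x \<and> x < b")
      case True
      then have "(bump_q a b x)\<^sup>2 \<le> ((x - a) * (b - a))\<^sup>2"
        unfolding bump_q_def by (intro power_mono mult_left_mono) auto
      then have "M * fact (n + 2) * (bump_q a b x)\<^sup>2 \<le> M * fact (n + 2) * ((x - a) * (b - a))\<^sup>2"
        using M by (intro mult_left_mono) auto
      then show ?thesis using main[of x] True by (simp add: C_def power_mult_distrib mult_ac)
    next
      case False
      then have "sm a b p n x = 0" by (auto simp: sm_def)
      then show ?thesis using M by (simp add: C_def)
    qed
    show "\<bar>sm a b p n x\<bar> \<le> C * (x - b)\<^sup>2"
    proof (cases "a < x \<and> x < b")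
      case True
      then have "(bump_q a b x)\<^sup>2 \<le> ((b - a) * (b - x))\<^sup>2"
        unfolding bump_q_def by (intro power_mono mult_right_mono) auto
      then have "M * fact (n + 2) * (bump_q a b x)\<^sup>2 \<le> M * fact (n + 2) * ((b - a) * (b - x))\<^sup>2"
        using M by (intro mult_left_mono) auto
      then show ?thesis using main[of x] True by (simp add: C_def power_mult_distrib mult_ac power2_commute)
    next
      case False
      then have "sm a b p n x = 0" by (auto simp: sm_def)
      then show ?thesis using M by (simp add: C_def)
    qed
  qed
qed

lemma quadratic_zero_deriv:
  fixes f :: "real \<Rightarrow> real"
  assumes "\<And>x. \<bar>f x\<bar> \<le> C * (x - a)\<^sup>2"
  shows "(f has_real_derivative 0) (at a)"
proof -
  have fa: "f a = 0" using assms[of a] by simp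
  have "((\<lambda>x. (f x - f a) / (x - a)) \<longlongrightarrow> 0) (at a)"
  proof (rule Lim_null_comparison)
    show "\<forall>\<^sub>F x in at a. norm ((f x - f a) / (x - a)) \<le> C * \<bar>x - a\<bar>"
    proof (rule always_eventually, rule allI)
      fix x
      have "\<bar>f x\<bar> \<le> C * \<bar>x - a\<bar> * \<bar>x - a\<bar>" using assms[of x] by (simp add: power2_eq_square mult.assoc)
      then show "norm ((f x - f a) / (x - a)) \<le> C * \<bar>x - a\<bar>"
        using fa by (cases "x = a") (auto simp: abs_divide pos_divide_le_eq)
    qed
    have "((\<lambda>x. C * \<bar>x - a\<bar>) \<longlongrightarrow> C * \<bar>a - a\<bar>) (at a)" by (intro tendsto_intros)
    then show "((\<lambda>x. C * \<bar>x - a\<bar>) \<longlongrightarrow> 0) (at a)" by simp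
  qed
  then show ?thesis by (simp add: has_field_derivative_iff)
qed

lemma sm_has_deriv: "(sm a b p n has_real_derivative sm a b (sm_deriv a b p n) (n + 2) x) (at x)"
proof -
  obtain C where C: "\<And>x. \<bar>sm a b p n x\<bar> \<le> C * (x - a)\<^sup>2" "\<And>x. \<bar>sm a b p n x\<bar> \<le> C * (x - b)\<^sup>2"
    using sm_quadratic_bound by blast
  consider "a < x \<and> x < b" | "x = a" | "x = b" | "x < a \<or> b < x" by linarith
  then show ?thesis
  proof cases
    case 1
    let ?q = "bump_q a b"
    have q: "0 < ?q x" using 1 by (intro bump_q_pos) auto
    have "((\<lambda>x. poly p x / ?q x ^ n * exp (- (1 / ?q x))) has_real_derivative sm a b (sm_deriv a b p n) (n + 2) x) (at x)"
    proof (cases n)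
      case 0
      show ?thesis
        using 1 q 0
        by (auto intro!: derivative_eq_intros bump_q_deriv poly_DERIV simp: sm_def sm_deriv_def poly_bump_Q)
          (simp add: field_simps power2_eq_square)
    next
      case (Suc m)
      show ?thesis
        using 1 q Suc
        by (auto intro!: derivative_eq_intros bump_q_deriv poly_DERIV simp: sm_def sm_deriv_def poly_bump_Q simp del: power_Suc)
          (simp add: field_simps power2_eq_square)
    qed
    moreover have "eventually (\<lambda>y. sm a b p n y = poly p y / ?q y ^ n * exp (- (1 / ?q y))) (nhds x)"
    proof -
      have "eventually (\<lambda>y. y \<in> {a<..<b}) (nhds x)" using 1 by (intro eventually_nhds_in_open) auto
      then show ?thesis by eventually_elim (simp add: sm_def)
    qed
    ultimately show ?thesis by (subst DERIV_cong_ev[OF refl _ refl])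
  next
    case 2
    moreover have "sm a b (sm_deriv a b p n) (n + 2) a = 0" by (simp add: sm_def)
    ultimately show ?thesis using quadratic_zero_deriv[OF C(1)] by simp
  next
    case 3
    moreover have "sm a b (sm_deriv a b p n) (n + 2) b = 0" by (simp add: sm_def)
    ultimately show ?thesis using quadratic_zero_deriv[OF C(2)] by simp
  next
    case 4
    have "open {y. y < a \<or> b < y}" by (intro open_Collect_disj open_Collect_less continuous_intros)
    then have "eventually (\<lambda>y. y \<in> {y. y < a \<or> b < y}) (nhds x)" using 4 by (intro eventually_nhds_in_open) auto
    then have "eventually (\<lambda>y. sm a b p n y = 0) (nhds x)" by eventually_elim (auto simp: sm_def)
    then have "(sm a b p n has_real_derivative 0) (at x)" by (subst DERIV_cong_ev[OF refl _ refl]) auto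
    then show ?thesis using 4 by (auto simp: sm_def)
  qed
qed

lemma sm_test_function:
  assumes "0 < a" "b < 1"
  shows "sm a b p n \<in> test_functions"
proof -
  have "\<exists>p' m. (deriv ^^ k) (sm a b p n) = sm a b p' m" for k
  proof (induction k)
    case (Suc k)
    then obtain p' m where "(deriv ^^ k) (sm a b p n) = sm a b p' m" by blast
    then have "(deriv ^^ Suc k) (sm a b p n) = deriv (sm a b p' m)" by simp
    also have "\<dots> = sm a b (sm_deriv a b p' m) (m + 2)" using DERIV_imp_deriv[OF sm_has_deriv] by blast
    finally show ?case by blast
  qed auto
  then have "((deriv ^^ k) (sm a b p n)) differentiable (at x)" for k x
    by (metis sm_has_deriv real_differentiable_def)
  then show ?thesis
    using assms unfolding test_functions_def by (auto intro!: exI[of _ "{a..b}"] simp: sm_def)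
qed

lemma test_function_c2c:
  assumes "G \<in> test_functions"
  obtains d B where "c2c d B G"
proof -
  have D: "((deriv ^^ n) G has_real_derivative (deriv ^^ Suc n) G x) (at x)" for n x
    using assms by (auto simp: test_functions_def real_differentiable_def dest!: spec[of _ n] spec[of _ x] dest: DERIV_imp_deriv)
  have cont: "continuous_on {0..1} ((deriv ^^ n) G)" for n
    by (rule DERIV_continuous_on) (use D has_field_derivative_at_within in blast)
  obtain B1 where B1: "0 < B1" "\<And>x. x \<in> {0..1} \<Longrightarrow> \<bar>G x\<bar> \<le> B1"
    using continuous_bounded_unit[OF cont[of 0]] by auto
  obtain B2 where B2: "0 < B2" "\<And>x. x \<in> {0..1} \<Longrightarrow> \<bar>(deriv ^^ 2) G x\<bar> \<le> B2"
    using continuous_bounded_unit[OF cont[of 2]] by blast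
  obtain K where K: "compact K" "K \<subseteq> {0<..<1}" "\<And>x. x \<notin> K \<Longrightarrow> G x = 0"
    using assms by (auto simp: test_functions_def)
  obtain d where d: "0 < d" "\<And>x. x \<in> K \<Longrightarrow> d \<le> x \<and> x \<le> 1 - d"
  proof (cases "K = {}")
    case True then show ?thesis using that[of 1] by simp
  next
    case False
    obtain m where m: "m \<in> K" "\<And>x. x \<in> K \<Longrightarrow> m \<le> x" using compact_attains_inf[OF K(1) False] by blast
    obtain M where M: "M \<in> K" "\<And>x. x \<in> K \<Longrightarrow> x \<le> M" using compact_attains_sup[OF K(1) False] by blast
    show ?thesis by (rule that[of "min m (1 - M)"]) (use K(2) m M in force)+
  qed
  have "c2c d (max B1 B2) G"
    unfolding c2c_def
  proof (rule conjI[OF d(1)], rule exI[of _ "deriv G"], rule exI[of _ "(deriv ^^ 2) G"], intro conjI ballI)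
    fix u :: real assume u: "u \<in> {0..1}"
    show "(G has_real_derivative deriv G u) (at u within {0..1})"
      using D[of 0 u] by (simp add: has_field_derivative_at_within)
    show "(deriv G has_real_derivative (deriv ^^ 2) G u) (at u within {0..1})"
      using D[of 1 u] by (simp add: has_field_derivative_at_within numeral_2_eq_2)
    show "\<bar>G u\<bar> \<le> max B1 B2" "\<bar>(deriv ^^ 2) G u\<bar> \<le> max B1 B2" using B1(2)[OF u] B2(2)[OF u] by auto
    show "u < d \<or> 1 - d < u \<longrightarrow> G u = 0" using d(2)[of u] K(3)[of u] by force
  qed
  then show ?thesis by (rule that)
qed

text \<open>Fatou's lemma applied to \<open>2f\<^sub>n\<^sup>2 + 2g\<^sup>2 - (f\<^sub>n - g)\<^sup>2\<close>.\<close>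

lemma ip_strong_convergence:
  assumes f: "\<And>n. f n \<in> sqint M" and g: "g \<in> sqint M"
    and lim: "AE x in M. (\<lambda>n. f n x) \<longlonglongrightarrow> g x"
    and le: "\<And>n. nsq M (f n) \<le> ip M g g"
  shows "(\<lambda>n. nsq M (\<lambda>x. f n x - g x)) \<longlonglongrightarrow> 0"
proof (rule ccontr)
  let ?\<delta> = "\<lambda>n. nsq M (\<lambda>x. f n x - g x)"
  assume "\<not> ?thesis"
  then obtain e where e: "0 < e" "\<And>N. \<exists>n\<ge>N. e \<le> ?\<delta> n"
    unfolding LIMSEQ_iff by (force simp: ip_nonneg not_less)
  then obtain r :: "nat \<Rightarrow> nat" where r: "strict_mono r" "\<And>n. e \<le> ?\<delta> (r n)"
    using infinite_enumerate[of "{n. e \<le> ?\<delta> n}"] unfolding infinite_nat_iff_unbounded_le by auto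
  have [measurable]: "f n \<in> borel_measurable M" "g \<in> borel_measurable M" for n
    using f g by (auto intro: sqint_measurable)
  let ?h = "\<lambda>n x. 2 * (f (r n) x)\<^sup>2 + 2 * (g x)\<^sup>2 - (f (r n) x - g x)\<^sup>2"
  have hnn: "0 \<le> ?h n x" for n x
  proof -
    have "?h n x = (f (r n) x + g x)\<^sup>2" by (simp add: power2_eq_square algebra_simps)
    then show ?thesis by simp
  qed
  have i: "integrable M (\<lambda>x. (f n x)\<^sup>2)" "integrable M (\<lambda>x. (g x)\<^sup>2)" "integrable M (\<lambda>x. (f n x - g x)\<^sup>2)" for n
    using f g sqint_diff[OF f g] by (auto simp: sqint_def)
  have hint: "(\<integral>\<^sup>+x. ennreal (?h n x) \<partial>M) \<le> ennreal (4 * ip M g g - e)" for n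
  proof -
    have "(\<integral>\<^sup>+x. ennreal (?h n x) \<partial>M) = ennreal (LINT x|M. ?h n x)"
      using hnn i by (intro nn_integral_eq_integral) auto
    also have "(LINT x|M. ?h n x) = 2 * nsq M (f (r n)) + 2 * ip M g g - ?\<delta> (r n)"
      using i by (simp add: ip_def power2_eq_square[symmetric])
    also have "\<dots> \<le> 4 * ip M g g - e" using le[of "r n"] r(2)[of n] by linarith
    finally show ?thesis by (simp add: ennreal_leI)
  qed
  have "ennreal (4 * ip M g g) = (\<integral>\<^sup>+x. ennreal (4 * (g x)\<^sup>2) \<partial>M)"
    using i by (subst nn_integral_eq_integral) (auto simp: ip_def power2_eq_square)
  also have "\<dots> = (\<integral>\<^sup>+x. liminf (\<lambda>n. ennreal (?h n x)) \<partial>M)"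
  proof (rule nn_integral_cong_AE)
    show "AE x in M. ennreal (4 * (g x)\<^sup>2) = liminf (\<lambda>n. ennreal (?h n x))"
      using lim
    proof eventually_elim
      case (elim x)
      have "(\<lambda>n. f (r n) x) \<longlonglongrightarrow> g x" using LIMSEQ_subseq_LIMSEQ[OF elim r(1)] by (simp add: comp_def)
      then have "(\<lambda>n. ?h n x) \<longlonglongrightarrow> 2 * (g x)\<^sup>2 + 2 * (g x)\<^sup>2 - (g x - g x)\<^sup>2"
        by (intro tendsto_intros)
      then have "(\<lambda>n. ennreal (?h n x)) \<longlonglongrightarrow> ennreal (4 * (g x)\<^sup>2)"
        by (intro tendsto_ennrealI) simp
      from lim_imp_Liminf[OF sequentially_bot this] show ?case by (rule sym)
    qed
  qed
  also have "\<dots> \<le> liminf (\<lambda>n. \<integral>\<^sup>+x. ennreal (?h n x) \<partial>M)"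
    by (intro nn_integral_liminf) measurable
  also have "\<dots> \<le> liminf (\<lambda>n. ennreal (4 * ip M g g - e))"
    by (intro Liminf_mono always_eventually allI hint)
  also have "\<dots> = ennreal (4 * ip M g g - e)" by (intro Liminf_const sequentially_bot)
  finally have *: "ennreal (4 * ip M g g) \<le> ennreal (4 * ip M g g - e)" .
  show False
  proof (cases "0 \<le> 4 * ip M g g - e")
    case True then show False using * e(1) by (simp add: ennreal_le_iff)
  next
    \<comment> \<open>Here \<open>ennreal\<close> cuts the negative bound off at 0, so
      \<open>g\<close> has norm zero, hence so does every \<open>f n\<close>, and the distances
      cannot stay above \<open>e\<close>.\<close>
    case False
    then have "ennreal (4 * ip M g g) = 0" using * by (simp add: ennreal_neg)
    then have g0: "ip M g g = 0" using ip_nonneg[of M g] by (simp add: ennreal_eq_0_iff)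
    have "nsq M (f (r 0)) = 0" using le[of "r 0"] g0 ip_nonneg[of M "f (r 0)"] by simp
    then have "?\<delta> (r 0) \<le> 0"
      using ip_add_self_le[OF f sqint_uminus[OF g], of "r 0"] g0 by (simp add: ip_def)
    then show False using r(2)[of 0] e(1) by linarith
  qed
qed

context fractional
begin

section \<open>Density of the test functions\<close>

text \<open>Subtract the clamp of \<open>F\<close> to a small interval around 0. The difference
  vanishes wherever \<open>F\<close> is small, in particular near the end points. Clamping is a
  contraction, so the increments of the clamp are dominated by those of \<open>F\<close> while they
  tend to 0; its energy tends to 0.\<close>

lemma clamp_approx:
  assumes F: "F \<in> H0" and "0 < e"
  obtains F' d where "F' \<in> H0" "0 < d" "\<And>x. x \<in> {0..1} \<Longrightarrow> x < d \<or> 1 - d < x \<Longrightarrow> F' x = 0"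
    "energy (\<lambda>x. F x - F' x) < e"
proof -
  have Fs: "F \<in> sobolev \<gamma>" and Fc: "continuous_on {0..1} F" using F by (auto simp: H0_def sobolev_continuous)
  let ?c = "\<lambda>n x. max (- (1 / real (Suc n))) (min (1 / real (Suc n)) (F x))"
  have ml: "\<bar>max (- r) (min r s) - max (- r) (min r t)\<bar> \<le> \<bar>s - t\<bar>" for r s t :: real by linarith
  have l0: "(\<lambda>n. 1 / real (Suc n)) \<longlonglongrightarrow> 0" using LIMSEQ_inverse_real_of_nat by (simp add: inverse_eq_divide)
  have cc: "continuous_on {0..1} (?c n)" for n by (intro continuous_intros Fc)
  have cm: "dd (?c n) \<in> borel_measurable km" for n by (intro dd_measurable continuous_measurable_unit_leb cc)
  have [measurable]: "dd F \<in> borel_measurable km" by (intro sqint_measurable sobolev_dd Fs)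
  have w: "(\<lambda>p. \<bar>dd F p\<bar>) \<in> sqint km" using sobolev_dd[OF Fs] by (simp add: sqint_def)
  have bd: "AE p in km. \<bar>dd (?c n) p\<bar> \<le> \<bar>dd F p\<bar>" for n
    by (rule AE_I2) (simp only: dd_def ml)
  have lim: "AE p in km. (\<lambda>n. dd (?c n) p) \<longlonglongrightarrow> 0"
  proof (rule AE_I2)
    fix p
    have "(\<lambda>n. ?c n x) \<longlonglongrightarrow> 0" for x
    proof (rule Lim_null_comparison[OF _ l0])
      show "\<forall>\<^sub>F n in sequentially. norm (?c n x) \<le> 1 / real (Suc n)"
        by (rule always_eventually) (auto simp: max_def min_def)
    qed
    then have "(\<lambda>n. ?c n (snd p) - ?c n (fst p)) \<longlonglongrightarrow> 0 - 0" by (intro tendsto_diff)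
    then show "(\<lambda>n. dd (?c n) p) \<longlonglongrightarrow> 0" by (simp add: dd_def)
  qed
  note dom = ip_dominated[of "\<lambda>n. dd (?c n)" km "\<lambda>_. 0", OF cm _ w lim bd]
  have l: "(\<lambda>n. energy (?c n)) \<longlonglongrightarrow> 0" using dom(3) by (simp add: en_def)
  have "\<exists>n. energy (?c n) < e"
    by (rule eventually_happens'[OF sequentially_bot order_tendstoD(2)[OF l assms(2)]])
  then obtain n where n: "energy (?c n) < e" ..
  have cs: "?c n \<in> sobolev \<gamma>" using dom(2) cc by (auto simp: sobolev_iff)
  define F' where "F' x = F x - ?c n x" for x
  have F'H: "F' \<in> H0" using F cs unfolding F'_def by (intro H0_diff) (auto simp: H0_def)
  have F0: "F 0 = 0" "F 1 = 0" using F by (auto simp: H0_def)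
  have p: "0 < 1 / real (Suc n)" by simp
  obtain d0 where d0: "0 < d0" "\<And>x. x \<in> {0..1} \<Longrightarrow> dist x 0 < d0 \<Longrightarrow> dist (F x) (F 0) < 1 / real (Suc n)"
    using Fc p unfolding continuous_on_iff by (metis atLeastAtMost_iff order_refl zero_le_one)
  obtain d1 where d1: "0 < d1" "\<And>x. x \<in> {0..1} \<Longrightarrow> dist x 1 < d1 \<Longrightarrow> dist (F x) (F 1) < 1 / real (Suc n)"
    using Fc p unfolding continuous_on_iff by (metis atLeastAtMost_iff order_refl zero_le_one)
  have z: "F' x = 0" if "\<bar>F x\<bar> < 1 / real (Suc n)" for x
    using that by (auto simp: F'_def max_def min_def)
  show ?thesis
  proof (rule that[OF F'H, of "min d0 d1"])
    show "0 < min d0 d1" using d0 d1 by simp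
    show "F' x = 0" if "x \<in> {0..1}" "x < min d0 d1 \<or> 1 - min d0 d1 < x" for x
      using that d0(2)[of x] d1(2)[of x] F0 by (intro z) (auto simp: dist_real_def)
    have "(\<lambda>x. F x - F' x) = ?c n" by (auto simp: F'_def)
    then show "energy (\<lambda>x. F x - F' x) < e" using n by simp
  qed
qed

text \<open>A translation invariant kernel on the line that agrees with \<open>kern\<close> on the unit square.
  Cutting it off at distance 1 keeps energies over the line finite.\<close>

definition kr :: "real \<Rightarrow> real \<Rightarrow> real" where
  "kr u v = (if \<bar>u - v\<bar> \<le> 1 then kern u v else 0)"

definition KR :: "(real \<times> real) measure" where
  "KR = density (lborel \<Otimes>\<^sub>M lborel) (\<lambda>p. ennreal (kr (fst p) (snd p)))"

lemma kr_nonneg: "0 \<le> kr u v"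
  by (simp add: kr_def)

lemma kr_shift: "kr (u + s) (v + s) = kr u v"
  by (simp add: kr_def kern_def)

lemma kern_measurable_pair: "(\<lambda>p. kern (fst p) (snd p)) \<in> borel_measurable (lborel \<Otimes>\<^sub>M lborel)"
  unfolding kern_def by measurable

lemma kr_measurable [measurable]: "(\<lambda>p. kr (fst p) (snd p)) \<in> borel_measurable (lborel \<Otimes>\<^sub>M lborel)"
  unfolding kr_def kern_def by measurable

lemma sets_KR [measurable_cong]: "sets KR = sets (lborel \<Otimes>\<^sub>M lborel)"
  by (simp add: KR_def)

lemma nn_integral_KR:
  assumes [measurable]: "f \<in> borel_measurable (lborel \<Otimes>\<^sub>M lborel)"
  shows "(\<integral>\<^sup>+p. f p \<partial>KR) = (\<integral>\<^sup>+u. \<integral>\<^sup>+v. ennreal (kr u v) * f (u, v) \<partial>lborel \<partial>lborel)"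
  unfolding KR_def by (subst nn_integral_density) (simp_all add: lborel.nn_integral_fst[symmetric])

lemma dd_measurable_KR:
  assumes [measurable]: "F \<in> borel_measurable borel"
  shows "dd F \<in> borel_measurable KR"
  unfolding dd_def by measurable

lemma km_le_KR:
  assumes [measurable]: "f \<in> borel_measurable (lborel \<Otimes>\<^sub>M lborel)"
  shows "(\<integral>\<^sup>+p. f p \<partial>km) \<le> (\<integral>\<^sup>+p. f p \<partial>KR)"
proof -
  have "sets (unit_leb \<Otimes>\<^sub>M unit_leb) = sets (restrict_space borel {0..1} \<Otimes>\<^sub>M restrict_space borel {0..1})"
    by (intro sets_pair_measure_cong sets_unit_leb)
  have fu: "f \<in> borel_measurable (unit_leb \<Otimes>\<^sub>M unit_leb)"
  proof -
    have "(\<lambda>p. (fst p, snd p)) \<in> (unit_leb \<Otimes>\<^sub>M unit_leb) \<rightarrow>\<^sub>M (lborel \<Otimes>\<^sub>M lborel)"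
      by (intro measurable_Pair measurable_compose[OF measurable_fst] measurable_compose[OF measurable_snd])
        (auto intro: measurable_restrict_space1)
    from measurable_compose[OF this assms] show ?thesis by simp
  qed
  have "(\<integral>\<^sup>+p. f p \<partial>km) = (\<integral>\<^sup>+u. \<integral>\<^sup>+v. ennreal (kern u v) * f (u, v) \<partial>unit_leb \<partial>unit_leb)"
    by (rule nn_integral_km[OF fu])
  also have "\<dots> = (\<integral>\<^sup>+u. \<integral>\<^sup>+v. ennreal (kr u v) * f (u, v) \<partial>unit_leb \<partial>unit_leb)"
    by (intro nn_integral_cong) (auto simp: kr_def)
  also have "\<dots> \<le> (\<integral>\<^sup>+u. \<integral>\<^sup>+v. ennreal (kr u v) * f (u, v) \<partial>lborel \<partial>unit_leb)"
    by (intro nn_integral_mono) (auto simp: nn_integral_restrict_space indicator_def intro!: nn_integral_mono)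
  also have "\<dots> \<le> (\<integral>\<^sup>+u. \<integral>\<^sup>+v. ennreal (kr u v) * f (u, v) \<partial>lborel \<partial>lborel)"
    by (subst nn_integral_restrict_space) (auto simp: indicator_def intro!: nn_integral_mono)
  also have "\<dots> = (\<integral>\<^sup>+p. f p \<partial>KR)" by (rule nn_integral_KR[symmetric]) measurable
  finally show ?thesis .
qed

text \<open>The forward average of the extension over [x, x + h] is C^1. By Jensen and translation
  invariance of \<open>KR\<close> it does not increase the energy on the line, and it converges
  pointwise; \<open>ip_strong_convergence\<close> turns these two facts into convergence in energy
  without any modulus of continuity for the energy.\<close>

lemma smooth_average:
  assumes F: "F \<in> H0" and d: "0 < d" "\<And>x. x \<in> {0..1} \<Longrightarrow> x < d \<or> 1 - d < x \<Longrightarrow> F x = 0" and "0 < e"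
  obtains f f' a b where "0 < a" "a < b" "b < 1" "\<And>x. (f has_real_derivative f' x) (at x)" "continuous_on UNIV f'"
    "\<And>x. x < a \<or> b < x \<Longrightarrow> f x = 0" "f \<in> sobolev \<gamma>" "energy (\<lambda>x. F x - f x) < e"
proof -
  have Fs: "F \<in> sobolev \<gamma>" and Fc: "continuous_on {0..1} F" using F by (auto simp: H0_def sobolev_continuous)
  have F01: "F 0 = 0" "F 1 = 0" using F by (auto simp: H0_def)
  \<comment> \<open>Constant continuation beyond the end points, which is continuation by zero
    because \<open>F\<close> vanishes there. It is continuous on the line without any case
    distinction.\<close>
  define E where "E x = F (max 0 (min 1 x))" for x
  have EF: "E x = F x" if "x \<in> {0..1}" for x using that by (simp add: E_def)
  have Ez: "E x = 0" if "x < d \<or> 1 - d < x" for x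
  proof (cases "x \<in> {0..1}")
    case True then show ?thesis using d(2)[of x] that EF[OF True] by simp
  next
    case False then show ?thesis using F01 by (auto simp: E_def max_def min_def)
  qed
  have Ec: "continuous_on UNIV E"
    unfolding E_def by (rule continuous_on_compose2[OF Fc]) (auto intro!: continuous_intros)
  have Ei: "isCont E x" for x using Ec by (simp add: continuous_on_eq_continuous_at)
  have Em [measurable]: "E \<in> borel_measurable borel" by (rule borel_measurable_continuous_onI[OF Ec])
  obtain A where A: "0 < A" "\<And>x. x \<in> {0..1} \<Longrightarrow> \<bar>F x\<bar> \<le> A"
    using continuous_bounded_unit[OF Fc] by metis
  have EA: "\<bar>E x\<bar> \<le> A" for x unfolding E_def by (rule A(2)) auto
  obtain P where P: "\<And>x. (P has_real_derivative E x) (at x)"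
  proof -
    have "\<exists>P. \<forall>x :: real. -\<infinity> < ereal x \<longrightarrow> ereal x < \<infinity> \<longrightarrow> (P has_vector_derivative E x) (at x)"
      by (rule einterval_antiderivative) (use Ei in auto)
    then show ?thesis using that by (auto simp: has_real_derivative_iff_has_vector_derivative)
  qed
  define Av where "Av h x = (P (x + h) - P x) / h" for h x
  have AvD: "(Av h has_real_derivative (E (x + h) - E x) / h) (at x)" for h x
  proof -
    have "((\<lambda>x. P (x + h)) has_real_derivative E (x + h)) (at x)"
      using P[of "x + h"] by (simp add: DERIV_shift)
    then have "((\<lambda>x. P (x + h) - P x) has_real_derivative E (x + h) - E x) (at x)" by (intro DERIV_diff P)
    then show ?thesis unfolding Av_def by (rule DERIV_cdivide)
  qed
  have Avm [measurable]: "Av h \<in> borel_measurable borel" for h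
    by (rule borel_measurable_continuous_onI) (rule DERIV_everywhere_continuous[of "Av h", OF AvD])
  have AvI: "integrable lborel (\<lambda>s. indicator {0..h} s * E (x + s))"
    "Av h x = (LINT s|lborel. indicator {0..h} s * E (x + s)) / h" if "0 < h" for h x
  proof -
    have D: "((\<lambda>s. P (x + s)) has_real_derivative E (x + s)) (at s)" for s
      using P[of "x + s"] by (simp add: DERIV_shift add.commute)
    have "continuous_on UNIV (\<lambda>s. E (x + s))"
      by (rule continuous_on_compose2[OF Ec]) (auto intro!: continuous_intros)
    then have c: "isCont (\<lambda>s. E (x + s)) s" for s
      by (simp add: continuous_on_eq_continuous_at)
    have "has_bochner_integral lborel (\<lambda>s. E (x + s) * indicator {0..h} s) (P (x + h) - P (x + 0))"
      by (rule has_bochner_integral_FTC_Icc_real) (use D c that in auto)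
    then have hb: "has_bochner_integral lborel (\<lambda>s. indicator {0..h} s * E (x + s)) (P (x + h) - P x)"
      by (simp add: mult.commute)
    then show "integrable lborel (\<lambda>s. indicator {0..h} s * E (x + s))" by (rule integrable.intros)
    show "Av h x = (LINT s|lborel. indicator {0..h} s * E (x + s)) / h"
      using has_bochner_integral_integral_eq[OF hb] by (simp add: Av_def)
  qed
  \<comment> \<open>Cauchy-Schwarz against the constant 1 on an interval of length
    \<open>h\<close>.\<close>
  have jensen: "ennreal ((dd (Av h) (u, v))\<^sup>2) \<le> ennreal (1 / h) * (\<integral>\<^sup>+s. ennreal (indicator {0..h} s) * ennreal ((E (v + s) - E (u + s))\<^sup>2) \<partial>lborel)"
    if h: "0 < h" for h u v
  proof -
    let ?m = "restrict_space lborel {0..h}"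
    let ?g = "\<lambda>s. E (v + s) - E (u + s)"
    interpret m: finite_measure ?m by (rule finite_measureI) (simp add: emeasure_restrict_space emeasure_lborel_Icc_eq)
    have gm: "?g \<in> borel_measurable ?m" by (intro measurable_restrict_space1) measurable
    have gb: "\<bar>?g s\<bar> \<le> 2 * A" for s using EA[of "v + s"] EA[of "u + s"] by linarith
    have gs: "?g \<in> sqint ?m" by (rule sqint_bounded[OF _ gm gb]) unfold_locales
    have os: "(\<lambda>_. 1) \<in> sqint ?m" by (rule sqint_bounded[of _ _ 1]) (unfold_locales, auto)
    have "dd (Av h) (u, v) = (LINT s|lborel. indicator {0..h} s * ?g s) / h"
      using AvI[OF h] by (simp add: dd_def right_diff_distrib diff_divide_distrib)
    also have "(LINT s|lborel. indicator {0..h} s * ?g s) = ip ?m ?g (\<lambda>_. 1)"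
      by (simp add: ip_def integral_restrict_space)
    finally have dde: "dd (Av h) (u, v) = ip ?m ?g (\<lambda>_. 1) / h" .
    have "(ip ?m ?g (\<lambda>_. 1))\<^sup>2 \<le> ip ?m ?g ?g * ip ?m (\<lambda>_. 1) (\<lambda>_. 1)"
      by (rule ip_Cauchy_Schwarz[OF gs os])
    also have "ip ?m (\<lambda>_. 1) (\<lambda>_. 1) = h" using h by (simp add: ip_def measure_restrict_space)
    finally have "(dd (Av h) (u, v))\<^sup>2 \<le> 1 / h * ip ?m ?g ?g"
      using h by (simp add: dde power_divide field_simps power2_eq_square)
    then have "ennreal ((dd (Av h) (u, v))\<^sup>2) \<le> ennreal (1 / h) * ennreal (ip ?m ?g ?g)"
      using h by (subst ennreal_mult[symmetric]) (auto simp: ip_nonneg ennreal_leI)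
    also have "ennreal (ip ?m ?g ?g) = (\<integral>\<^sup>+s. ennreal ((?g s)\<^sup>2) \<partial>?m)"
      by (rule nn_integral_sq_eq_ip[OF gs, symmetric])
    also have "\<dots> = (\<integral>\<^sup>+s. ennreal (indicator {0..h} s) * ennreal ((?g s)\<^sup>2) \<partial>lborel)"
      by (subst nn_integral_restrict_space) (auto simp: indicator_def intro!: nn_integral_cong)
    finally show ?thesis .
  qed
  let ?ER = "\<integral>\<^sup>+p. ennreal ((dd E p)\<^sup>2) \<partial>KR"
  have mE: "(\<lambda>p. ennreal ((dd E p)\<^sup>2)) \<in> borel_measurable (lborel \<Otimes>\<^sub>M lborel)"
    unfolding dd_def by measurable
  have mAv: "(\<lambda>p. ennreal ((dd (Av h) p)\<^sup>2)) \<in> borel_measurable (lborel \<Otimes>\<^sub>M lborel)" for h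
    unfolding dd_def by measurable
  \<comment> \<open>Fubini moves the averaging variable s outermost; for fixed s both space
    variables are shifted by s, which leaves \<open>kr\<close> unchanged. What remains is the energy
    of \<open>E\<close> integrated over an interval of length \<open>h\<close>.\<close>
  have contract: "(\<integral>\<^sup>+p. ennreal ((dd (Av h) p)\<^sup>2) \<partial>KR) \<le> ?ER" if h: "0 < h" for h
  proof -
    let ?t = "\<lambda>u v s. ennreal (kr u v) * (ennreal (indicator {0..h} s) * ennreal ((E (v + s) - E (u + s))\<^sup>2))"
    have t3 [measurable]: "(\<lambda>q. ?t (fst (fst q)) (snd (fst q)) (snd q)) \<in> borel_measurable ((lborel \<Otimes>\<^sub>M lborel) \<Otimes>\<^sub>M lborel)"
    proof -
      have "(\<lambda>q. kr (fst (fst q)) (snd (fst q))) \<in> borel_measurable ((lborel \<Otimes>\<^sub>M lborel) \<Otimes>\<^sub>M lborel)"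
        using measurable_compose[OF measurable_fst kr_measurable] by simp
      then show ?thesis by measurable
    qed
    have t2: "(\<lambda>(v, s). ?t u v s) \<in> borel_measurable (lborel \<Otimes>\<^sub>M lborel)" for u
      using measurable_compose[OF _ t3, of "\<lambda>p. ((u, fst p), snd p)" "lborel \<Otimes>\<^sub>M lborel"] by (simp add: split_beta')
    have t2': "(\<lambda>(u, s). \<integral>\<^sup>+v. ?t u v s \<partial>lborel) \<in> borel_measurable (lborel \<Otimes>\<^sub>M lborel)"
    proof -
      have "(\<lambda>q. ?t (fst (fst q)) (snd q) (snd (fst q))) \<in> borel_measurable ((lborel \<Otimes>\<^sub>M lborel) \<Otimes>\<^sub>M lborel)"
        using measurable_compose[OF _ t3, of "\<lambda>q. ((fst (fst q), snd q), snd (fst q))" "(lborel \<Otimes>\<^sub>M lborel) \<Otimes>\<^sub>M lborel"] by simp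
      then show ?thesis
        using lborel.borel_measurable_nn_integral_fst[of "\<lambda>q. ?t (fst (fst q)) (snd q) (snd (fst q))" "lborel \<Otimes>\<^sub>M lborel"]
        by (simp add: split_beta')
    qed
    have "(\<integral>\<^sup>+p. ennreal ((dd (Av h) p)\<^sup>2) \<partial>KR) = (\<integral>\<^sup>+u. \<integral>\<^sup>+v. ennreal (kr u v) * ennreal ((dd (Av h) (u, v))\<^sup>2) \<partial>lborel \<partial>lborel)"
      by (rule nn_integral_KR[OF mAv])
    also have "\<dots> \<le> (\<integral>\<^sup>+u. \<integral>\<^sup>+v. ennreal (1 / h) * (\<integral>\<^sup>+s. ?t u v s \<partial>lborel) \<partial>lborel \<partial>lborel)"
    proof (intro nn_integral_mono)
      fix u v :: real
      have "ennreal (kr u v) * ennreal ((dd (Av h) (u, v))\<^sup>2) \<le>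
         ennreal (kr u v) * (ennreal (1 / h) * (\<integral>\<^sup>+s. ennreal (indicator {0..h} s) * ennreal ((E (v + s) - E (u + s))\<^sup>2) \<partial>lborel))"
        by (intro mult_left_mono jensen h) simp
      also have "\<dots> = ennreal (1 / h) * (\<integral>\<^sup>+s. ?t u v s \<partial>lborel)"
        by (subst nn_integral_cmult) (auto simp: mult_ac)
      finally show "ennreal (kr u v) * ennreal ((dd (Av h) (u, v))\<^sup>2) \<le> ennreal (1 / h) * (\<integral>\<^sup>+s. ?t u v s \<partial>lborel)" .
    qed
    also have "\<dots> = ennreal (1 / h) * (\<integral>\<^sup>+u. \<integral>\<^sup>+v. \<integral>\<^sup>+s. ?t u v s \<partial>lborel \<partial>lborel \<partial>lborel)"
    proof -
      have a: "(\<lambda>v. \<integral>\<^sup>+s. ?t u v s \<partial>lborel) \<in> borel_measurable lborel" for u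
        using lborel.borel_measurable_nn_integral_fst[OF t2[of u]] by simp
      have b: "(\<lambda>p. \<integral>\<^sup>+s. ?t (fst p) (snd p) s \<partial>lborel) \<in> borel_measurable (lborel \<Otimes>\<^sub>M lborel)"
        using lborel.borel_measurable_nn_integral_fst[OF t3] by simp
      have c: "(\<lambda>u. \<integral>\<^sup>+v. \<integral>\<^sup>+s. ?t u v s \<partial>lborel \<partial>lborel) \<in> borel_measurable lborel"
        using lborel.borel_measurable_nn_integral_fst[OF b] by simp
      show ?thesis by (simp only: nn_integral_cmult[OF a] nn_integral_cmult[OF c])
    qed
    also have "(\<integral>\<^sup>+u. \<integral>\<^sup>+v. \<integral>\<^sup>+s. ?t u v s \<partial>lborel \<partial>lborel \<partial>lborel) = (\<integral>\<^sup>+u. \<integral>\<^sup>+s. \<integral>\<^sup>+v. ?t u v s \<partial>lborel \<partial>lborel \<partial>lborel)"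
      by (intro nn_integral_cong lborel_pair.Fubini'[symmetric] t2)
    also have "\<dots> = (\<integral>\<^sup>+s. \<integral>\<^sup>+u. \<integral>\<^sup>+v. ?t u v s \<partial>lborel \<partial>lborel \<partial>lborel)"
      by (intro lborel_pair.Fubini'[symmetric] t2')
    also have "\<dots> = (\<integral>\<^sup>+s. ennreal (indicator {0..h} s) * ?ER \<partial>lborel)"
    proof (rule nn_integral_cong)
      fix s :: real
      let ?w = "\<lambda>u v. ennreal (kr u v) * ennreal ((E v - E u)\<^sup>2)"
      have w [measurable]: "(\<lambda>p. ?w (fst p) (snd p)) \<in> borel_measurable (lborel \<Otimes>\<^sub>M lborel)" by measurable
      have wu: "?w u \<in> borel_measurable borel" for u
        using measurable_compose[OF _ w, of "\<lambda>v. (u, v)" lborel] by simp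
      have wi: "(\<lambda>u. \<integral>\<^sup>+v. ?w u v \<partial>lborel) \<in> borel_measurable borel"
        using lborel.borel_measurable_nn_integral_fst[OF w] by simp
      have sh: "?t u v s = ennreal (indicator {0..h} s) * ?w (s + u) (s + v)" for u v
        using kr_shift[of u s v] by (simp only: add.commute[of s] mult.left_commute)
      have "(\<integral>\<^sup>+u. \<integral>\<^sup>+v. ?t u v s \<partial>lborel \<partial>lborel) = (\<integral>\<^sup>+u. \<integral>\<^sup>+v. ennreal (indicator {0..h} s) * ?w (s + u) (s + v) \<partial>lborel \<partial>lborel)"
        by (simp only: sh)
      also have "\<dots> = (\<integral>\<^sup>+u. ennreal (indicator {0..h} s) * (\<integral>\<^sup>+v. ?w (s + u) v \<partial>lborel) \<partial>lborel)"
      proof (rule nn_integral_cong)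
        fix u
        have "(\<integral>\<^sup>+v. ennreal (indicator {0..h} s) * ?w (s + u) (s + v) \<partial>lborel) = ennreal (indicator {0..h} s) * (\<integral>\<^sup>+v. ?w (s + u) (s + v) \<partial>lborel)"
          using measurable_compose[OF _ wu, of "\<lambda>v. s + v" lborel "s + u"] by (intro nn_integral_cmult) simp
        also have "(\<integral>\<^sup>+v. ?w (s + u) (s + v) \<partial>lborel) = (\<integral>\<^sup>+v. ?w (s + u) v \<partial>lborel)"
          using nn_integral_real_affine[OF wu, of 1 "s + u" s] by simp
        finally show "(\<integral>\<^sup>+v. ennreal (indicator {0..h} s) * ?w (s + u) (s + v) \<partial>lborel) = ennreal (indicator {0..h} s) * (\<integral>\<^sup>+v. ?w (s + u) v \<partial>lborel)" .
      qed
      also have "\<dots> = ennreal (indicator {0..h} s) * (\<integral>\<^sup>+u. \<integral>\<^sup>+v. ?w (s + u) v \<partial>lborel \<partial>lborel)"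
        using measurable_compose[OF _ wi, of "\<lambda>u. s + u" lborel] by (intro nn_integral_cmult) simp
      also have "(\<integral>\<^sup>+u. \<integral>\<^sup>+v. ?w (s + u) v \<partial>lborel \<partial>lborel) = (\<integral>\<^sup>+u. \<integral>\<^sup>+v. ?w u v \<partial>lborel \<partial>lborel)"
        using nn_integral_real_affine[OF wi, of 1 s] by simp
      also have "\<dots> = ?ER" by (subst nn_integral_KR[OF mE]) (simp add: dd_def)
      finally show "(\<integral>\<^sup>+u. \<integral>\<^sup>+v. ?t u v s \<partial>lborel \<partial>lborel) = ennreal (indicator {0..h} s) * ?ER" .
    qed
    also have "\<dots> = ennreal h * ?ER"
      using h by (subst nn_integral_multc) (auto simp: ennreal_indicator)
    also have "ennreal (1 / h) * (ennreal h * ?ER) = ?ER"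
      using h by (simp add: mult.assoc[symmetric] ennreal_mult[symmetric])
    finally show ?thesis .
  qed
  \<comment> \<open>Inside the unit square the integrand is that of the energy of \<open>F\<close>.
    Elsewhere a nonzero increment forces \<bar>u - v\<bar> \<ge> d, since \<open>E\<close> vanishes
    on margins of width \<open>d\<close>, and the cutoff of the kernel keeps both points in [-1, 2];
    a bounded integrand on a square of area 9 remains.\<close>
  have ERfin: "?ER < \<infinity>"
  proof -
    define Q where "Q = c_norm \<gamma> / 2 / d powr (1 + \<gamma>) * (2 * A)\<^sup>2"
    have Q: "0 \<le> Q" using c_pos by (simp add: Q_def)
    let ?J = "\<lambda>x::real. indicator {-1..2} x :: real" and ?I = "\<lambda>x::real. indicator {0..1} x :: real"
    have pt: "kr u v * (dd E (u, v))\<^sup>2 \<le> ?I u * (?I v * (kern u v * (dd F (u, v))\<^sup>2)) + Q * (?J u * ?J v)" for u v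
    proof (cases "u \<in> {0..1} \<and> v \<in> {0..1}")
      case True
      then have "kr u v * (dd E (u, v))\<^sup>2 = kern u v * (dd F (u, v))\<^sup>2" by (auto simp: kr_def dd_def EF)
      then show ?thesis using True Q by simp
    next
      case False
      show ?thesis
      proof (cases "\<bar>u - v\<bar> \<le> 1 \<and> E u \<noteq> E v")
        case True
        have dist: "d \<le> \<bar>u - v\<bar>"
        proof (rule ccontr)
          assume c: "\<not> d \<le> \<bar>u - v\<bar>"
          have "E u = 0" using False c by (intro Ez) auto
          moreover have "E v = 0" using False c by (intro Ez) auto
          ultimately show False using True by simp
        qed
        have uv: "u \<in> {-1..2}" "v \<in> {-1..2}"
        proof -
          have "E u \<noteq> 0 \<or> E v \<noteq> 0" using True by auto
          then have "(d \<le> u \<and> u \<le> 1 - d) \<or> (d \<le> v \<and> v \<le> 1 - d)" using Ez[of u] Ez[of v] by force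
          then show "u \<in> {-1..2}" "v \<in> {-1..2}" using True d(1) by auto
        qed
        have "\<bar>E v - E u\<bar> \<le> 2 * A" using EA[of u] EA[of v] by linarith
        then have "\<bar>E v - E u\<bar>\<^sup>2 \<le> (2 * A)\<^sup>2" by (intro power_mono) auto
        moreover have "kern u v \<le> c_norm \<gamma> / 2 / d powr (1 + \<gamma>)"
          unfolding kern_def using dist d(1) c_pos \<gamma>1 by (intro divide_left_mono powr_mono2 mult_pos_pos) auto
        ultimately have "kern u v * (E v - E u)\<^sup>2 \<le> Q"
          unfolding Q_def using c_pos by (intro mult_mono) auto
        then show ?thesis using True False uv by (auto simp: kr_def dd_def indicator_def)
      next
        case False2: False
        then show ?thesis using Q by (auto simp: kr_def dd_def intro!: add_nonneg_nonneg mult_nonneg_nonneg)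
      qed
    qed
    have "?ER = (\<integral>\<^sup>+u. \<integral>\<^sup>+v. ennreal (kr u v) * ennreal ((dd E (u, v))\<^sup>2) \<partial>lborel \<partial>lborel)"
      by (rule nn_integral_KR[OF mE])
    also have "\<dots> \<le> (\<integral>\<^sup>+u. \<integral>\<^sup>+v. ennreal (?I u * (?I v * (kern u v * (dd E (u, v))\<^sup>2))) + ennreal (Q * (?J u * ?J v)) \<partial>lborel \<partial>lborel)"
    proof (intro nn_integral_mono)
      fix u v
      let ?X = "?I u * (?I v * (kern u v * (dd E (u, v))\<^sup>2))" and ?Y = "Q * (?J u * ?J v)"
      have XF: "?I u * (?I v * (kern u v * (dd F (u, v))\<^sup>2)) = ?X"
        by (auto simp: indicator_def dd_def EF)
      have "kr u v * (dd E (u, v))\<^sup>2 \<le> ?X + ?Y" using pt[of u v] by (simp only: XF)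
      then have "ennreal (kr u v * (dd E (u, v))\<^sup>2) \<le> ennreal (?X + ?Y)" by (rule ennreal_leI)
      also have "ennreal (?X + ?Y) = ennreal ?X + ennreal ?Y" by (rule ennreal_plus) (use Q in auto)
      finally show "ennreal (kr u v) * ennreal ((dd E (u, v))\<^sup>2) \<le> ennreal ?X + ennreal ?Y"
        by (simp add: ennreal_mult[symmetric] kr_nonneg)
    qed
    also have "\<dots> = (\<integral>\<^sup>+u. \<integral>\<^sup>+v. ennreal (?I u * (?I v * (kern u v * (dd E (u, v))\<^sup>2))) \<partial>lborel \<partial>lborel)
       + (\<integral>\<^sup>+u. \<integral>\<^sup>+v. ennreal (Q * (?J u * ?J v)) \<partial>lborel \<partial>lborel)"
    proof -
      have m1 [measurable]: "(\<lambda>p. ennreal (?I (fst p) * (?I (snd p) * (kern (fst p) (snd p) * (dd E p)\<^sup>2)))) \<in> borel_measurable (lborel \<Otimes>\<^sub>M lborel)"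
        using kern_measurable_pair unfolding dd_def by measurable
      have m2 [measurable]: "(\<lambda>p. ennreal (Q * (?J (fst p) * ?J (snd p)))) \<in> borel_measurable (lborel \<Otimes>\<^sub>M lborel)"
        by measurable
      have a: "(\<lambda>v. ennreal (?I u * (?I v * (kern u v * (dd E (u, v))\<^sup>2)))) \<in> borel_measurable lborel" for u
        using measurable_compose[OF _ m1, of "\<lambda>v. (u, v)" lborel] by simp
      have b: "(\<lambda>v. ennreal (Q * (?J u * ?J v))) \<in> borel_measurable lborel" for u by measurable
      have a': "(\<lambda>u. \<integral>\<^sup>+v. ennreal (?I u * (?I v * (kern u v * (dd E (u, v))\<^sup>2))) \<partial>lborel) \<in> borel_measurable lborel"
        using lborel.borel_measurable_nn_integral_fst[OF m1] by simp
      have b': "(\<lambda>u. \<integral>\<^sup>+v. ennreal (Q * (?J u * ?J v)) \<partial>lborel) \<in> borel_measurable lborel"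
        using lborel.borel_measurable_nn_integral_fst[OF m2] by simp
      show ?thesis by (simp only: nn_integral_add[OF a b] nn_integral_add[OF a' b'])
    qed
    also have "(\<integral>\<^sup>+u. \<integral>\<^sup>+v. ennreal (?I u * (?I v * (kern u v * (dd E (u, v))\<^sup>2))) \<partial>lborel \<partial>lborel) = ennreal (en F F)"
    proof -
      have "(\<integral>\<^sup>+u. \<integral>\<^sup>+v. ennreal (?I u * (?I v * (kern u v * (dd E (u, v))\<^sup>2))) \<partial>lborel \<partial>lborel)
        = (\<integral>\<^sup>+u. \<integral>\<^sup>+v. ennreal (kern u v) * ennreal ((dd F (u, v))\<^sup>2) \<partial>unit_leb \<partial>unit_leb)"
        by (auto simp: nn_integral_restrict_space indicator_def dd_def EF ennreal_mult intro!: nn_integral_cong)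
      also have "\<dots> = (\<integral>\<^sup>+p. ennreal ((dd F p)\<^sup>2) \<partial>km)"
      proof (rule nn_integral_km[symmetric])
        show "(\<lambda>p. ennreal ((dd F p)\<^sup>2)) \<in> borel_measurable (unit_leb \<Otimes>\<^sub>M unit_leb)"
          using dd_measurable[OF sobolev_measurable[OF Fs]] measurable_cong_sets[OF sets_km refl] by auto
      qed
      also have "\<dots> = ennreal (en F F)" unfolding en_def by (rule nn_integral_sq_eq_ip[OF sobolev_dd[OF Fs]])
      finally show ?thesis .
    qed
    also have "(\<integral>\<^sup>+u. \<integral>\<^sup>+v. ennreal (Q * (?J u * ?J v)) \<partial>lborel \<partial>lborel) = ennreal (9 * Q)"
    proof -
      have "(\<integral>\<^sup>+v. ennreal (Q * (?J u * ?J v)) \<partial>lborel) = ennreal (3 * Q * ?J u)" for u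
      proof -
        have "(\<integral>\<^sup>+v. ennreal (Q * (?J u * ?J v)) \<partial>lborel) = (\<integral>\<^sup>+v. ennreal (Q * ?J u) * indicator {-1..(2::real)} v \<partial>lborel)"
          using Q by (intro nn_integral_cong) (auto simp: indicator_def)
        also have "\<dots> = ennreal (Q * ?J u) * ennreal 3" by (subst nn_integral_cmult_indicator) auto
        also have "\<dots> = ennreal (3 * Q * ?J u)"
          by (subst ennreal_mult[symmetric]) (use Q in \<open>auto simp: mult_ac simp del: ennreal_numeral\<close>)
        finally show ?thesis .
      qed
      then have "(\<integral>\<^sup>+u. \<integral>\<^sup>+v. ennreal (Q * (?J u * ?J v)) \<partial>lborel \<partial>lborel) = (\<integral>\<^sup>+u. ennreal (3 * Q) * indicator {-1..(2::real)} u \<partial>lborel)"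
        using Q by (auto simp: indicator_def intro!: nn_integral_cong)
      also have "\<dots> = ennreal (3 * Q) * ennreal 3" by (subst nn_integral_cmult_indicator) auto
      also have "\<dots> = ennreal (9 * Q)"
        by (subst ennreal_mult[symmetric]) (use Q in \<open>auto simp: mult_ac simp del: ennreal_numeral\<close>)
      finally show ?thesis .
    qed
    finally show ?thesis by (auto intro: le_less_trans)
  qed
  have ddE: "dd E \<in> sqint KR"
    using ERfin by (subst sqint_iff_nn_integral[OF dd_measurable_KR[OF Em]])
  have ddAv: "dd (Av h) \<in> sqint KR" if "0 < h" for h
    using contract[OF that] ERfin by (subst sqint_iff_nn_integral[OF dd_measurable_KR[OF Avm]]) auto
  let ?h = "\<lambda>n. 1 / real (Suc n)"
  have l0: "?h \<longlonglongrightarrow> 0" using LIMSEQ_inverse_real_of_nat by (simp add: inverse_eq_divide)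
  have Avlim: "(\<lambda>n. Av (?h n) x) \<longlonglongrightarrow> E x" for x
  proof -
    have "((\<lambda>h. (P (x + h) - P x) / h) \<longlongrightarrow> E x) (at 0)" using P[of x] by (simp add: DERIV_def)
    moreover have "filterlim ?h (at 0) sequentially"
      unfolding filterlim_at using l0 by (auto intro!: always_eventually)
    ultimately show ?thesis unfolding Av_def by (rule filterlim_compose)
  qed
  have l5: "(\<lambda>n. nsq KR (\<lambda>p. dd (Av (?h n)) p - dd E p)) \<longlonglongrightarrow> 0"
  proof (rule ip_strong_convergence[OF ddAv ddE])
    show "AE p in KR. (\<lambda>n. dd (Av (?h n)) p) \<longlonglongrightarrow> dd E p"
      unfolding dd_def by (intro AE_I2 tendsto_diff Avlim)
    show "nsq KR (dd (Av (?h n))) \<le> nsq KR (dd E)" for n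
    proof -
      have "ennreal (nsq KR (dd (Av (?h n)))) \<le> ennreal (nsq KR (dd E))"
        using contract[of "?h n"] nn_integral_sq_eq_ip[OF ddAv[of "?h n"]] nn_integral_sq_eq_ip[OF ddE] by simp
      then show ?thesis by (simp add: ennreal_le_iff ip_nonneg)
    qed
  qed simp
  have "eventually (\<lambda>n. ?h n < d / 2) sequentially"
    by (rule order_tendstoD(2)[OF l0]) (use d in simp)
  with order_tendstoD(2)[OF l5 \<open>0 < e\<close>]
  have "eventually (\<lambda>n. nsq KR (\<lambda>p. dd (Av (?h n)) p - dd E p) < e \<and> ?h n < d / 2) sequentially"
    by (rule eventually_conj)
  then have "\<exists>n. nsq KR (\<lambda>p. dd (Av (?h n)) p - dd E p) < e \<and> ?h n < d / 2"
    by (rule eventually_happens'[OF sequentially_bot])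
  then obtain n where n: "nsq KR (\<lambda>p. dd (Av (?h n)) p - dd E p) < e" "?h n < d / 2"
    by (elim exE conjE)
  define h where "h = ?h n"
  have h: "0 < h" "h < d / 2" using n by (auto simp: h_def)
  have kmle: "(\<integral>\<^sup>+p. ennreal ((dd G p)\<^sup>2) \<partial>km) \<le> ennreal (nsq KR (dd G))"
    if "dd G \<in> sqint KR" "G \<in> borel_measurable borel" for G
  proof -
    have "(\<lambda>p. ennreal ((dd G p)\<^sup>2)) \<in> borel_measurable (lborel \<Otimes>\<^sub>M lborel)"
      using that(2) unfolding dd_def by measurable
    from km_le_KR[OF this] show ?thesis using nn_integral_sq_eq_ip[OF that(1)] by simp
  qed
  have Avc: "continuous_on X (Av h)" for X
    by (rule DERIV_everywhere_continuous[of "Av h", OF AvD])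
  have AvS: "Av h \<in> sobolev \<gamma>"
  proof -
    have "dd (Av h) \<in> sqint km"
      using kmle[OF ddAv[OF h(1)] Avm]
      by (subst sqint_iff_nn_integral[OF dd_measurable[OF continuous_measurable_unit_leb[OF Avc]]]) (auto intro: le_less_trans)
    then show ?thesis by (simp add: sobolev_iff Avc)
  qed
  have enle: "energy (\<lambda>x. F x - Av h x) < e"
  proof -
    let ?D = "\<lambda>x. Av h x - E x"
    have Ds: "dd ?D \<in> sqint KR" unfolding dd_diff by (intro sqint_diff ddAv[OF h(1)] ddE)
    have "energy (\<lambda>x. F x - Av h x) = energy (\<lambda>x. - 1 * ?D x)"
      by (intro en_cong) (auto simp: EF)
    also have "\<dots> = en ?D ?D" by (simp only: en_cmult_left en_cmult_right)
    finally have eq: "energy (\<lambda>x. F x - Av h x) = en ?D ?D" .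
    have "?D \<in> sobolev \<gamma>"
      using sobolev_diff[OF AvS Fs] by (rule sobolev_cong[THEN iffD1, rotated]) (auto simp: EF)
    then have "ennreal (en ?D ?D) = (\<integral>\<^sup>+p. ennreal ((dd ?D p)\<^sup>2) \<partial>km)"
      unfolding en_def by (intro nn_integral_sq_eq_ip[symmetric] sobolev_dd)
    also have "\<dots> \<le> ennreal (nsq KR (dd ?D))" by (intro kmle Ds) measurable
    finally have "en ?D ?D \<le> nsq KR (dd ?D)" by (simp add: ennreal_le_iff ip_nonneg)
    also have "\<dots> < e" using n(1) by (simp add: dd_diff h_def)
    finally show ?thesis using eq by simp
  qed
  \<comment> \<open>For d > 1 / 2 the two margins cover the line, so \<open>E\<close> is identically
    zero; this degenerate case receives an arbitrary support interval at the end.\<close>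
  have dd1: "d \<le> 1/2 \<or> (\<forall>x. E x = 0)"
  proof (rule disjCI)
    assume "\<not> (\<forall>x. E x = 0)"
    then obtain x where "E x \<noteq> 0" by blast
    then show "d \<le> 1/2" using Ez[of x] by force
  qed
  \<comment> \<open>The average at x looks forward over [x, x + h] with h < d / 2: the left margin
    shrinks to d / 2 at worst, the right one is preserved.\<close>
  have Avz: "Av h x = 0" if x: "x < d / 2 \<or> 1 - d < x" for x
  proof -
    have "P (x + h) = P x"
    proof (rule DERIV_isconst_end[of x "x + h" P])
      show "x < x + h" using h by simp
      show "continuous_on {x..x + h} P" by (rule DERIV_everywhere_continuous[of P, OF P])
      fix y assume "x < y" "y < x + h"
      then have "E y = 0" using x h by (intro Ez) auto
      then show "(P has_real_derivative 0) (at y)" using P[of y] by simp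
    qed
    then show ?thesis by (simp add: Av_def)
  qed
  have Dc: "continuous_on UNIV (\<lambda>x. (E (x + h) - E x) / h)"
  proof -
    have "continuous_on UNIV (\<lambda>x. E (x + h))"
      by (rule continuous_on_compose2[OF Ec]) (auto intro!: continuous_intros)
    then show ?thesis using h Ec by (intro continuous_intros) auto
  qed
  show ?thesis
  proof (cases "d \<le> 1/2")
    case True
    show ?thesis
    proof (rule that[of "d / 2" "1 - d / 2" "Av h"])
      show "Av h x = 0" if "x < d / 2 \<or> 1 - d / 2 < x" for x using that d by (intro Avz) auto
    qed (use True d AvD Dc AvS enle in auto)
  next
    case False
    then have E0: "\<And>x. E x = 0" using dd1 by blast
    have Av0: "Av h x = 0" for x
    proof -
      have "P (x + h) = P x"
        by (rule DERIV_isconst_all) (use P E0 in metis)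
      then show ?thesis by (simp add: Av_def)
    qed
    show ?thesis
      by (rule that[of "1/4" "3/4" "Av h"]) (use AvD Dc AvS enle Av0 in auto)
  qed
qed

text \<open>Write f = X g with a smooth bump X positive on the support of f, approximate g'
  uniformly by a polynomial, and let p be its primitive. Then X p is a test function, and f - X p =
  X (g - p) is Lipschitz with a small constant, hence of small energy.\<close>

lemma C1_test_approx:
  assumes ab: "0 < a" "a < b" "b < 1" and D: "\<And>x. (f has_real_derivative f' x) (at x)" and c: "continuous_on UNIV f'"
    and z: "\<And>x. x < a \<or> b < x \<Longrightarrow> f x = 0" and "0 < e"
  obtains G where "G \<in> test_functions" "energy (\<lambda>x. f x - G x) < e"
proof -
  \<comment> \<open>The bump lives on a strictly larger interval, so dividing by it is harmless on
    the support of \<open>f\<close>.\<close>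
  define a' where "a' = a / 2"
  define b' where "b' = (1 + b) / 2"
  have ab': "0 < a'" "a' < a" "b < b'" "b' < 1" "a' < b'" using ab by (auto simp: a'_def b'_def)
  let ?q = "bump_q a' b'" and ?Q' = "\<lambda>x. poly (pderiv (bump_Q a' b')) x"
  have z': "f' x = 0" if x: "x < a \<or> b < x" for x
  proof -
    have "open {y. y < a \<or> b < y}" by (intro open_Collect_disj open_Collect_less continuous_intros)
    then have "eventually (\<lambda>y. y \<in> {y. y < a \<or> b < y}) (nhds x)" using x by (intro eventually_nhds_in_open) auto
    then have "eventually (\<lambda>y. f y = 0) (nhds x)" by eventually_elim (use z in auto)
    then have "(f has_real_derivative 0) (at x)" by (subst DERIV_cong_ev[OF refl _ refl]) auto
    then show ?thesis using D DERIV_unique by blast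
  qed
  \<comment> \<open>The quotient of \<open>f\<close> by the bump exp(-1 / q), continued by
    zero.\<close>
  define g where "g x = (if a' < x \<and> x < b' then f x * exp (1 / ?q x) else 0)" for x
  define g' where "g' x = (if a' < x \<and> x < b' then f' x * exp (1 / ?q x) - f x * (exp (1 / ?q x) * (?Q' x / (?q x)\<^sup>2)) else 0)" for x
  \<comment> \<open>Every point has a neighbourhood inside \<open>{a'<..<b'}\<close> or one on which
    \<open>f\<close> and \<open>f'\<close> vanish. The quotient is therefore C^1 although 1 / q
    blows up at \<open>a'\<close> and \<open>b'\<close>.\<close>
  have local: "(\<exists>S. open S \<and> x \<in> S \<and> S \<subseteq> {a'<..<b'}) \<or> (\<exists>S. open S \<and> x \<in> S \<and> (\<forall>y\<in>S. f y = 0 \<and> f' y = 0))" for x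
  proof (cases "a' < x \<and> x < b'")
    case True then show ?thesis by (intro disjI1 exI[of _ "{a'<..<b'}"]) auto
  next
    case False
    have "open {y. y < a \<or> b < y}" by (intro open_Collect_disj open_Collect_less continuous_intros)
    then show ?thesis using False ab' z z' by (intro disjI2 exI[of _ "{y. y < a \<or> b < y}"]) auto
  qed
  have gD: "(g has_real_derivative g' x) (at x)" for x
    using local[of x]
  proof (elim disjE exE conjE)
    fix S assume S: "open S" "x \<in> S" "S \<subseteq> {a'<..<b'}"
    then have x: "a' < x" "x < b'" by auto
    have q: "0 < ?q x" by (rule bump_q_pos[OF x])
    have "((\<lambda>x. f x * exp (1 / ?q x)) has_real_derivative g' x) (at x)"
      using x q by (auto intro!: derivative_eq_intros D bump_q_deriv simp: g'_def power2_eq_square)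
    moreover have "eventually (\<lambda>y. g y = f y * exp (1 / ?q y)) (nhds x)"
      using eventually_nhds_in_open[OF S(1,2)] by eventually_elim (use S(3) in \<open>auto simp: g_def\<close>)
    ultimately show ?thesis by (subst DERIV_cong_ev[OF refl _ refl])
  next
    fix S assume S: "open S" "x \<in> S" "\<forall>y\<in>S. f y = 0 \<and> f' y = 0"
    have "eventually (\<lambda>y. g y = 0) (nhds x)"
      using eventually_nhds_in_open[OF S(1,2)] by eventually_elim (use S(3) in \<open>auto simp: g_def\<close>)
    then have "(g has_real_derivative 0) (at x)" by (subst DERIV_cong_ev[OF refl _ refl]) auto
    then show ?thesis using S by (simp add: g'_def)
  qed
  have g'c: "isCont g' x" for x
    using local[of x]
  proof (elim disjE exE conjE)
    fix S assume S: "open S" "x \<in> S" "S \<subseteq> {a'<..<b'}"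
    then have x: "a' < x" "x < b'" by auto
    have q: "0 < ?q x" by (rule bump_q_pos[OF x])
    have f'c: "isCont f' x" using c by (simp add: continuous_on_eq_continuous_at)
    have "isCont (\<lambda>x. f' x * exp (1 / ?q x) - f x * (exp (1 / ?q x) * (?Q' x / (?q x)\<^sup>2))) x"
      using q by (intro continuous_intros f'c DERIV_isCont[OF D] DERIV_isCont[OF bump_q_deriv]) auto
    moreover have "eventually (\<lambda>y. g' y = f' y * exp (1 / ?q y) - f y * (exp (1 / ?q y) * (?Q' y / (?q y)\<^sup>2))) (nhds x)"
      using eventually_nhds_in_open[OF S(1,2)] by eventually_elim (use S(3) in \<open>auto simp: g'_def\<close>)
    ultimately show ?thesis by (subst isCont_cong)
  next
    fix S assume S: "open S" "x \<in> S" "\<forall>y\<in>S. f y = 0 \<and> f' y = 0"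
    have "eventually (\<lambda>y. g' y = 0) (nhds x)"
      using eventually_nhds_in_open[OF S(1,2)] by eventually_elim (use S(3) in \<open>auto simp: g'_def\<close>)
    then show ?thesis by (subst isCont_cong) auto
  qed
  let ?X = "sm a' b' 1 0" and ?X' = "sm a' b' (sm_deriv a' b' 1 0) 2"
  have XD: "(?X has_real_derivative ?X' x) (at x)" for x using sm_has_deriv[of a' b' 1 0 x] by (simp add: numeral_2_eq_2)
  have fg: "f x = ?X x * g x" for x
    using z[of x] ab' by (auto simp: sm_def g_def exp_minus field_simps)
  have X'D: "(?X' has_real_derivative sm a' b' (sm_deriv a' b' (sm_deriv a' b' 1 0) 2) 4 x) (at x)" for x
    using sm_has_deriv[of a' b' "sm_deriv a' b' 1 0" 2 x] by simp
  obtain M where M: "0 < M" "\<And>x. x \<in> {0..1} \<Longrightarrow> \<bar>?X x\<bar> \<le> M"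
    using continuous_bounded_unit[OF DERIV_everywhere_continuous[of ?X, OF XD]] by metis
  obtain M' where M': "0 < M'" "\<And>x. x \<in> {0..1} \<Longrightarrow> \<bar>?X' x\<bar> \<le> M'"
    using continuous_bounded_unit[OF DERIV_everywhere_continuous[of ?X', OF X'D]] by metis
  \<comment> \<open>By the product rule the Lipschitz constant of the error is at most (M + M')
    \<epsilon>; this choice makes the energy bound equal to e / 2.\<close>
  define \<epsilon> where "\<epsilon> = sqrt (e / 2 / lipc) / (M + M')"
  have \<epsilon>: "0 < \<epsilon>" using \<open>0 < e\<close> lipc_pos M M' by (simp add: \<epsilon>_def)
  have "continuous_on {0..1} g'" using g'c continuous_at_imp_continuous_on by blast
  then obtain q0 where q0: "real_polynomial_function q0" "\<And>x. x \<in> {0..1} \<Longrightarrow> \<bar>g' x - q0 x\<bar> < \<epsilon>"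
    using Stone_Weierstrass_real_polynomial_function[OF compact_Icc _ \<epsilon>] by blast
  obtain co n where co: "q0 = (\<lambda>x. \<Sum>i\<le>n. co i * x ^ i)"
    using q0(1) unfolding real_polynomial_function_iff_sum by blast
  \<comment> \<open>The primitive of \<open>q0\<close> without constant term; it agrees with
    \<open>g\<close> at 0, where both vanish, so closeness of the derivatives passes to the
    functions.\<close>
  define p where "p = (\<Sum>i\<le>n. monom (co i / real (Suc i)) (Suc i))"
  have pD: "(poly p has_real_derivative q0 x) (at x)" for x
  proof -
    have "((\<lambda>x. co i / real (Suc i) * x ^ Suc i) has_real_derivative co i * x ^ i) (at x)" for i
      by (auto intro!: derivative_eq_intros simp del: of_nat_Suc power_Suc)
    then have "((\<lambda>x. \<Sum>i\<le>n. co i / real (Suc i) * x ^ Suc i) has_real_derivative (\<Sum>i\<le>n. co i * x ^ i)) (at x)"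
      by (intro DERIV_sum)
    moreover have "poly p = (\<lambda>x. \<Sum>i\<le>n. co i / real (Suc i) * x ^ Suc i)"
      by (auto simp: p_def poly_sum poly_monom simp del: of_nat_Suc power_Suc)
    ultimately show ?thesis by (simp add: co)
  qed
  have p0: "poly p 0 = 0" by (simp add: p_def poly_sum poly_monom)
  have g0: "g 0 = 0" using ab' by (simp add: g_def)
  have gp: "\<bar>g x - poly p x\<bar> \<le> \<epsilon>" if x: "x \<in> {0..1}" for x
  proof -
    have "norm ((g x - poly p x) - (g 0 - poly p 0)) \<le> \<epsilon> * norm (x - 0)"
    proof (rule field_differentiable_bound[of "{0..1}"])
      fix y :: real assume y: "y \<in> {0..1}"
      show "((\<lambda>x. g x - poly p x) has_real_derivative g' y - q0 y) (at y within {0..1})"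
        by (rule has_field_derivative_at_within[OF DERIV_diff[OF gD pD]])
      show "norm (g' y - q0 y) \<le> \<epsilon>" using q0(2)[OF y] by simp
    qed (use x in auto)
    then have "\<bar>g x - poly p x\<bar> \<le> \<epsilon> * \<bar>x\<bar>" using p0 g0 by simp
    also have "\<dots> \<le> \<epsilon> * 1" using x \<epsilon> by (intro mult_left_mono) auto
    finally show ?thesis by simp
  qed
  have smp: "sm a' b' p 0 x = ?X x * poly p x" for x by (simp add: sm_def)
  let ?L = "(M + M') * \<epsilon>"
  have lip: "\<bar>(f x - sm a' b' p 0 x) - (f y - sm a' b' p 0 y)\<bar> \<le> ?L * \<bar>x - y\<bar>" if "x \<in> {0..1}" "y \<in> {0..1}" for x y
  proof -
    have "norm ((?X x * (g x - poly p x)) - (?X y * (g y - poly p y))) \<le> ?L * norm (x - y)"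
    proof (rule field_differentiable_bound[of "{0..1}"])
      fix t :: real assume t: "t \<in> {0..1}"
      show "((\<lambda>x. ?X x * (g x - poly p x)) has_real_derivative ?X' t * (g t - poly p t) + (g' t - q0 t) * ?X t) (at t within {0..1})"
        by (rule has_field_derivative_at_within[OF DERIV_mult[OF XD[of t] DERIV_diff[OF gD[of t] pD[of t]]]])
      have "\<bar>?X' t * (g t - poly p t) + (g' t - q0 t) * ?X t\<bar> \<le> \<bar>?X' t\<bar> * \<bar>g t - poly p t\<bar> + \<bar>g' t - q0 t\<bar> * \<bar>?X t\<bar>"
        by (intro order_trans[OF abs_triangle_ineq]) (simp add: abs_mult)
      also have "\<dots> \<le> M' * \<epsilon> + \<epsilon> * M"
        using M M' t gp q0(2)[OF t] \<epsilon> by (intro add_mono mult_mono) auto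
      finally show "norm (?X' t * (g t - poly p t) + (g' t - q0 t) * ?X t) \<le> ?L" by (simp add: algebra_simps)
    qed (use that in auto)
    then show ?thesis by (simp add: fg smp right_diff_distrib)
  qed
  have "energy (\<lambda>x. f x - sm a' b' p 0 x) \<le> lipc * ?L\<^sup>2"
    by (rule lipschitz_sobolev(2)[OF lip])
  also have "?L = sqrt (e / 2 / lipc)" using M M' by (simp add: \<epsilon>_def)
  also have "lipc * (sqrt (e / 2 / lipc))\<^sup>2 = e / 2" using \<open>0 < e\<close> lipc_pos by simp
  also have "e / 2 < e" using \<open>0 < e\<close> by simp
  finally show ?thesis using that sm_test_function[OF ab'(1,4)] by blast
qed

text \<open>Clamping, averaging and polynomial approximation contribute three errors. The two
  splittings weight them by 2, 4 and 4, so e / 16 for each stays below e.\<close>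

lemma test_functions_dense:
  assumes F: "F \<in> H0" and e: "0 < e"
  obtains G where "G \<in> test_functions" "energy (\<lambda>x. F x - G x) < e"
proof -
  have "0 < e / 16" using e by simp
  have "\<exists>G. G \<in> test_functions \<and> energy (\<lambda>x. F x - G x) < e"
  proof (rule clamp_approx[of F "e / 16"])
    show "F \<in> H0" "0 < e / 16" by fact+
    fix F' d
    assume F': "F' \<in> H0" "0 < d" "\<And>x. x \<in> {0..1} \<Longrightarrow> x < d \<or> 1 - d < x \<Longrightarrow> F' x = 0"
      "energy (\<lambda>x. F x - F' x) < e / 16"
    show ?thesis
    proof (rule smooth_average[of F' d "e / 16"])
      show "F' \<in> H0" "0 < d" "0 < e / 16" by fact+
      show "\<And>x. x \<in> {0..1} \<Longrightarrow> x < d \<or> 1 - d < x \<Longrightarrow> F' x = 0" by (rule F'(3))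
      fix f f' a b
      assume f: "0 < a" "a < b" "b < 1" "\<And>x. (f has_real_derivative f' x) (at x)" "continuous_on UNIV f'"
        "\<And>x. x < a \<or> b < x \<Longrightarrow> f x = 0" "f \<in> sobolev \<gamma>" "energy (\<lambda>x. F' x - f x) < e / 16"
      show ?thesis
      proof (rule C1_test_approx[of a b f f' "e / 16"])
        show "0 < a" "a < b" "b < 1" "continuous_on UNIV f'" "0 < e / 16" by fact+
        show "\<And>x. (f has_real_derivative f' x) (at x)" by (rule f(4))
        show "\<And>x. x < a \<or> b < x \<Longrightarrow> f x = 0" by (rule f(6))
        fix G assume G: "G \<in> test_functions" "energy (\<lambda>x. f x - G x) < e / 16"
        obtain dG BG where "c2c dG BG G" using test_function_c2c[OF G(1)] by blast
        then have Gs: "G \<in> sobolev \<gamma>" using c2c_H0 H0_sobolev by blast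
        have e1: "energy (\<lambda>x. F x - G x)
          = energy (\<lambda>x. (F x - F' x) + ((F' x - f x) + (f x - G x)))"
          by (intro en_cong) auto
        have e2: "energy (\<lambda>x. (F x - F' x) + ((F' x - f x) + (f x - G x)))
          \<le> 2 * energy (\<lambda>x. F x - F' x) + 2 * energy (\<lambda>x. (F' x - f x) + (f x - G x))"
          by (intro en_add_self_le sobolev_diff sobolev_add H0_sobolev F F'(1) f(7) Gs)
        have e3: "energy (\<lambda>x. (F' x - f x) + (f x - G x))
          \<le> 2 * energy (\<lambda>x. F' x - f x) + 2 * energy (\<lambda>x. f x - G x)"
          by (intro en_add_self_le sobolev_diff H0_sobolev F'(1) f(7) Gs)
        have "energy (\<lambda>x. F x - G x) < e" using e e1 e2 e3 F'(4) f(8) G(2) by linarith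
        then show ?thesis using G(1) by blast
      qed
    qed
  qed
  then show ?thesis using that by blast
qed

section \<open>The stationary profile\<close>

lemma test_function_H0: "G \<in> test_functions \<Longrightarrow> G \<in> H0"
  using test_function_c2c c2c_H0(1) by metis

lemma ip_frac_lap_test:
  assumes "F \<in> sobolev \<gamma>" "G \<in> test_functions"
  shows "ip2 F (frac_lap \<gamma> G) = - en F G"
  using test_function_c2c[OF assms(2)] ip_frac_lap[OF assms(1)] by metis

lemma en_self_zero_H0:
  assumes "w \<in> H0" "en w w = 0" "x \<in> {0..1}"
  shows "w x = 0"
  using H0_bound[OF assms(1,3)] assms(2) by simp

text \<open>The Dirichlet principle: minimise the energy among functions with the given boundary
  values, an affine function showing that there are some; perturbing by elements of
  \<open>H0\<close> gives orthogonality. Cutting off outside the interval matches the normalisation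
  of the profile.\<close>

lemma harmonic_exists:
  obtains F where "F \<in> sobolev \<gamma>" "F 0 = p" "F 1 = q" "\<forall>w\<in>H0. en F w = 0" "\<forall>u. u \<notin> {0..1} \<longrightarrow> F u = 0"
proof -
  let ?S = "{F \<in> sobolev \<gamma>. F 0 = p \<and> F 1 = q}"
  obtain m where m: "m \<in> ?S" "\<And>f. f \<in> ?S \<Longrightarrow> en m m \<le> en f f"
  proof (rule energy_minimizer[of ?S "\<bar>p\<bar>"])
    have "\<bar>(p + (q - p) * x) - (p + (q - p) * y)\<bar> \<le> \<bar>q - p\<bar> * \<bar>x - y\<bar>" for x y :: real
    proof -
      have "(p + (q - p) * x) - (p + (q - p) * y) = (q - p) * (x - y)" by (simp add: algebra_simps)
      then show ?thesis by (simp add: abs_mult)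
    qed
    from lipschitz_sobolev(1)[OF this] have "(\<lambda>x. p + (q - p) * x) \<in> ?S" by simp
    then show "?S \<noteq> {}" by blast
    fix f g assume f: "\<And>n::nat. f n \<in> ?S" and g: "g \<in> sobolev \<gamma>" and u: "uniform_limit {0..1} f g sequentially"
    have "(\<lambda>n. f n 0) \<longlonglongrightarrow> g 0" "(\<lambda>n. f n 1) \<longlonglongrightarrow> g 1" using tendsto_uniform_limitI[OF u] by auto
    moreover have "f n 0 = p" "f n 1 = q" for n using f by auto
    ultimately have "g 0 = p" "g 1 = q" by (simp_all add: LIMSEQ_const_iff)
    then show "g \<in> ?S" using g by simp
  qed auto
  have ms: "m \<in> sobolev \<gamma>" using m by simp
  have orth: "en m w = 0" if w: "w \<in> H0" for w
  proof -
    have "(en m w)\<^sup>2 \<le> en w w * 0"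
    proof (rule quadratic_nonneg_discriminant)
      fix t
      have ws: "w \<in> sobolev \<gamma>" by (rule H0_sobolev[OF w])
      have "(\<lambda>x. m x + t * w x) \<in> ?S"
        using m(1) w ws by (auto intro!: sobolev_add sobolev_cmult simp: H0_def)
      from m(2)[OF this] show "0 \<le> en w w * t\<^sup>2 + 2 * en m w * t + 0"
        by (simp add: en_quadratic[OF ms ws] mult_ac)
    qed
    then show ?thesis by simp
  qed
  let ?F = "\<lambda>u. if u \<in> {0..1} then m u else 0"
  show ?thesis
  proof (rule that[of ?F])
    show "?F \<in> sobolev \<gamma>" using ms by (rule sobolev_cong[THEN iffD1, rotated]) auto
    show "\<forall>w\<in>H0. en ?F w = 0"
    proof
      fix w assume "w \<in> H0"
      moreover have "en ?F w = en m w" by (intro en_cong) auto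
      ultimately show "en ?F w = 0" using orth by simp
    qed
  qed (use m in auto)
qed

text \<open>The difference lies in \<open>H0\<close> and is orthogonal to all test functions.
  Approximating it by test functions and Cauchy-Schwarz make its energy zero.\<close>

lemma harmonic_unique:
  assumes F: "F \<in> sobolev \<gamma>" "F 0 = p" "F 1 = q" "\<And>G. G \<in> test_functions \<Longrightarrow> en F G = 0" "\<And>u. u \<notin> {0..1} \<Longrightarrow> F u = 0"
    and F': "F' \<in> sobolev \<gamma>" "F' 0 = p" "F' 1 = q" "\<And>G. G \<in> test_functions \<Longrightarrow> en F' G = 0" "\<And>u. u \<notin> {0..1} \<Longrightarrow> F' u = 0"
  shows "F = F'"
proof -
  let ?w = "\<lambda>x. F x - F' x"
  have w: "?w \<in> H0" using F F' by (simp add: H0_def sobolev_diff)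
  have ws: "?w \<in> sobolev \<gamma>" by (rule H0_sobolev[OF w])
  have small: "(en ?w ?w)\<^sup>2 \<le> en ?w ?w * e" if e: "0 < e" for e
  proof -
    obtain G where G: "G \<in> test_functions" "energy (\<lambda>x. ?w x - G x) < e"
      by (rule test_functions_dense[OF w e])
    have Gs: "G \<in> sobolev \<gamma>" by (rule H0_sobolev[OF test_function_H0[OF G(1)]])
    have "en ?w G = 0" using F(1,4) F'(1,4) G(1) Gs by (simp add: en_diff_left)
    then have "en ?w ?w = en ?w (\<lambda>x. ?w x - G x)"
      using en_diff_right[OF ws Gs ws] by simp
    then have "(en ?w ?w)\<^sup>2 \<le> en ?w ?w * energy (\<lambda>x. ?w x - G x)"
      using en_Cauchy_Schwarz[OF ws sobolev_diff[OF ws Gs]] by simp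
    also have "\<dots> \<le> en ?w ?w * e" using G(2) en_nonneg by (intro mult_left_mono) auto
    finally show ?thesis .
  qed
  have "en ?w ?w = 0"
  proof (rule ccontr)
    assume "en ?w ?w \<noteq> 0"
    then have p: "0 < en ?w ?w" using en_nonneg[of ?w] by linarith
    have "en ?w ?w * en ?w ?w \<le> en ?w ?w * (en ?w ?w / 2)" using small[of "en ?w ?w / 2"] p by (simp add: power2_eq_square)
    then have "en ?w ?w \<le> en ?w ?w / 2" by (rule mult_left_le_imp_le[OF _ p])
    then show False using p by simp
  qed
  then have "?w x = 0" if "x \<in> {0..1}" for x by (rule en_self_zero_H0[OF w _ that])
  show ?thesis
  proof
    fix x
    show "F x = F' x"
    proof (cases "x \<in> {0..1}")
      case True
      from \<open>\<And>x. x \<in> {0..1} \<Longrightarrow> ?w x = 0\<close>[OF True] show ?thesis by simp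
    qed (use F(5) F'(5) in auto)
  qed
qed

text \<open>Justifies the definite description. By construction the minimiser is orthogonal to the
  whole of \<open>H0\<close>, not only to the smooth functions of the definition, and this stronger
  form is what the dynamical estimates use.\<close>

lemma stationary_profile:
  fixes p q :: real
  defines "\<Phi> \<equiv> stationary_profile \<gamma> p q"
  shows "\<Phi> \<in> sobolev \<gamma>" "\<Phi> 0 = p" "\<Phi> 1 = q" "\<And>w. w \<in> H0 \<Longrightarrow> en \<Phi> w = 0"
proof -
  let ?P = "\<lambda>\<Phi>. \<Phi> \<in> sobolev \<gamma> \<and> \<Phi> 0 = p \<and> \<Phi> 1 = q \<and>
     (\<forall>G\<in>test_functions. (LINT u|unit_leb. \<Phi> u * frac_lap \<gamma> G u) = 0) \<and>
     (\<forall>u. u \<notin> {0..1} \<longrightarrow> \<Phi> u = 0)"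
  obtain F where F: "F \<in> sobolev \<gamma>" "F 0 = p" "F 1 = q" "\<forall>w\<in>H0. en F w = 0" "\<forall>u. u \<notin> {0..1} \<longrightarrow> F u = 0"
    by (rule harmonic_exists[of p q])
  have PF: "?P F"
    using F ip_frac_lap_test[OF F(1)] test_function_H0 by (auto simp: ip_def)
  have uniq: "F' = F" if P: "?P F'" for F'
  proof (rule harmonic_unique[of F' p q F])
    fix G assume "G \<in> test_functions"
    then show "en F' G = 0" "en F G = 0"
      using P ip_frac_lap_test[of F' G] F(4) test_function_H0[of G] by (auto simp: ip_def)
  qed (use P F in auto)
  have "\<Phi> = F"
    unfolding \<Phi>_def stationary_profile_def using PF uniq by (rule the_equality)
  then show "\<Phi> \<in> sobolev \<gamma>" "\<Phi> 0 = p" "\<Phi> 1 = q" "\<And>w. w \<in> H0 \<Longrightarrow> en \<Phi> w = 0"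
    using F by auto
qed

end

section \<open>Signed measures and their pairings\<close>

lemma sigma_algebra_unit: "sigma_algebra {0..1} (sets unit_leb)"
  using sets.sigma_algebra_axioms[of unit_leb] by simp

lemma sets_upper_variation [simp, measurable_cong]: "sets (upper_variation \<mu>) = sets unit_leb"
  unfolding upper_variation_def by (rule sigma_algebra.sets_measure_of_eq[OF sigma_algebra_unit])

lemma sets_lower_variation [simp, measurable_cong]: "sets (lower_variation \<mu>) = sets unit_leb"
  unfolding lower_variation_def by simp

lemma space_upper_variation [simp]: "space (upper_variation \<mu>) = {0..1}"
  using sets_eq_imp_space_eq[OF sets_upper_variation] by simp

lemma space_lower_variation [simp]: "space (lower_variation \<mu>) = {0..1}"
  unfolding lower_variation_def by simp

lemma signed_measures_sums:
  "\<mu> \<in> signed_measures \<Longrightarrow> range A \<subseteq> sets unit_leb \<Longrightarrow> disjoint_family A \<Longrightarrow> (\<lambda>i::nat. \<mu> (A i)) sums \<mu> (\<Union>i. A i)"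
  by (simp add: signed_measures_def)

lemma signed_measures_empty: "\<mu> \<in> signed_measures \<Longrightarrow> \<mu> {} = 0"
proof -
  assume "\<mu> \<in> signed_measures"
  then have "(\<lambda>i::nat. \<mu> {}) sums \<mu> {}"
    using signed_measures_sums[of \<mu> "\<lambda>_. {}"] by (simp add: disjoint_family_on_def)
  then show "\<mu> {} = 0" using sums_summable summable_const_iff by blast
qed

lemma signed_measures_add:
  assumes "\<mu> \<in> signed_measures" "B \<in> sets unit_leb" "C \<in> sets unit_leb" "B \<inter> C = {}"
  shows "\<mu> (B \<union> C) = \<mu> B + \<mu> C"
proof -
  have "(\<lambda>i. \<mu> (binaryset B C i)) sums \<mu> (\<Union>i. binaryset B C i)"
    using assms by (intro signed_measures_sums) (auto simp: range_binaryset_eq disjoint_family_on_def binaryset_def)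
  moreover have "(\<lambda>i. \<mu> (binaryset B C i)) sums (\<mu> B + \<mu> C)"
    using binaryset_sums[of \<mu> B C] signed_measures_empty[OF assms(1)] by blast
  ultimately show ?thesis by (metis UN_binaryset_eq sums_unique2)
qed

lemma signed_measures_Diff:
  assumes "\<mu> \<in> signed_measures" "B \<in> sets unit_leb" "C \<in> sets unit_leb" "C \<subseteq> B"
  shows "\<mu> (B - C) = \<mu> B - \<mu> C"
proof -
  have "\<mu> (C \<union> (B - C)) = \<mu> C + \<mu> (B - C)" using assms by (intro signed_measures_add) auto
  moreover have "C \<union> (B - C) = B" using assms by auto
  ultimately show ?thesis by simp
qed

lemma signed_measures_uminus: "\<mu> \<in> signed_measures \<Longrightarrow> (\<lambda>A. - \<mu> A) \<in> signed_measures"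
  by (simp add: signed_measures_def sums_minus)

lemma upper_variation_ge:
  assumes "\<mu> \<in> signed_measures" "A \<in> sets unit_leb" "B \<in> sets unit_leb" "B \<subseteq> A"
  shows "ennreal (\<mu> B) \<le> emeasure (upper_variation \<mu>) A"
  using assms by (subst emeasure_upper_variation) (auto intro!: SUP_upper)

text \<open>Otherwise one finds nested sets of infinite upper variation on which the measure is unbounded.\<close>

lemma upper_variation_finite:
  assumes \<mu>: "\<mu> \<in> signed_measures"
  shows "emeasure (upper_variation \<mu>) {0..1} < \<infinity>"
proof (rule ccontr)
  assume "\<not> ?thesis"
  then have inf: "emeasure (upper_variation \<mu>) {0..1} = \<infinity>" by (simp add: not_less top_unique)
  let ?S = "sets unit_leb" and ?U = "emeasure (upper_variation \<mu>)"
  have X: "{0..1} \<in> ?S" using sets.top[of unit_leb] by simp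
  \<comment> \<open>Pick \<open>B\<close> whose measure exceeds \<open>n\<close> plus the absolute
    measure of \<open>A\<close>. Then both \<open>B\<close> and its complement in \<open>A\<close>
    have measure at least \<open>n\<close> in absolute value, and by additivity one of the two
    inherits infinite variation.\<close>
  have step: "\<exists>A'. A' \<in> ?S \<and> A' \<subseteq> A \<and> ?U A' = \<infinity> \<and> real n \<le> \<bar>\<mu> A'\<bar>" if A: "A \<in> ?S" "?U A = \<infinity>" for A n
  proof -
    have "ennreal (\<bar>\<mu> A\<bar> + real n) < (SUP B\<in>{B \<in> ?S. B \<subseteq> A}. ennreal (\<mu> B))"
    proof -
      have "(SUP B\<in>{B \<in> ?S. B \<subseteq> A}. ennreal (\<mu> B)) = \<infinity>"
        using A(2) unfolding emeasure_upper_variation[OF \<mu> A(1)] .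
      then show ?thesis by (simp only: infinity_ennreal_def ennreal_less_top)
    qed
    then obtain B where B: "B \<in> ?S" "B \<subseteq> A" "ennreal (\<bar>\<mu> A\<bar> + real n) < ennreal (\<mu> B)"
      by (auto simp: less_SUP_iff)
    then have b: "\<bar>\<mu> A\<bar> + real n < \<mu> B" by (simp add: ennreal_less_iff del: ennreal_plus)
    have d: "\<mu> (A - B) = \<mu> A - \<mu> B" by (rule signed_measures_Diff[OF \<mu> A(1) B(1,2)])
    have "?U (B \<union> (A - B)) = ?U B + ?U (A - B)"
      using A B by (intro plus_emeasure[symmetric]) auto
    moreover have "B \<union> (A - B) = A" using B by auto
    ultimately have "?U B = \<infinity> \<or> ?U (A - B) = \<infinity>" using A(2) by (metis ennreal_add_eq_top infinity_ennreal_def)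
    then show ?thesis
    proof
      assume "?U B = \<infinity>"
      then show ?thesis using B b by (intro exI[of _ B]) auto
    next
      assume "?U (A - B) = \<infinity>"
      then show ?thesis using A B b d by (intro exI[of _ "A - B"]) auto
    qed
  qed
  have "\<exists>A. \<forall>n. (A n \<in> ?S \<and> ?U (A n) = \<infinity>) \<and> (A (Suc n) \<subseteq> A n \<and> real (Suc n) \<le> \<bar>\<mu> (A (Suc n))\<bar>)"
  proof (rule dependent_nat_choice)
    show "\<exists>A. A \<in> ?S \<and> ?U A = \<infinity>" using X inf by blast
    fix A n assume "A \<in> ?S \<and> ?U A = \<infinity>"
    then show "\<exists>y. (y \<in> ?S \<and> ?U y = \<infinity>) \<and> y \<subseteq> A \<and> real (Suc n) \<le> \<bar>\<mu> y\<bar>"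
      using step[of A "Suc n"] by blast
  qed
  then obtain A where A: "\<And>n. A n \<in> ?S" "\<And>n. A (Suc n) \<subseteq> A n" "\<And>n. real (Suc n) \<le> \<bar>\<mu> (A (Suc n))\<bar>"
    by metis
  have dec: "A n \<subseteq> A m" if "m \<le> n" for m n
    using that A(2) by (metis lift_Suc_antimono_le)
  \<comment> \<open>Countable additivity on the disjoint differences telescopes, so the measures of
    the \<open>A n\<close> converge and are bounded, contrary to their growth.\<close>
  let ?D = "\<lambda>i. A i - A (Suc i)"
  have "disjoint_family ?D"
    unfolding disjoint_family_on_def
  proof (intro ballI impI)
    fix m n :: nat
    assume mn: "m \<noteq> n"
    have "?D m \<inter> ?D n = {}" if "m < n" for m n using dec[of "Suc m" n] that by auto
    then show "?D m \<inter> ?D n = {}" using mn by (metis inf_commute nat_neq_iff)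
  qed
  moreover have "range ?D \<subseteq> ?S" using A(1) by auto
  ultimately have "(\<lambda>i. \<mu> (?D i)) sums \<mu> (\<Union>i. ?D i)" using signed_measures_sums[OF \<mu>] by blast
  moreover have "\<mu> (?D i) = \<mu> (A i) - \<mu> (A (Suc i))" for i
    using signed_measures_Diff[OF \<mu> A(1) A(1) A(2)] .
  ultimately have "(\<lambda>n. \<Sum>i<n. \<mu> (A i) - \<mu> (A (Suc i))) \<longlonglongrightarrow> \<mu> (\<Union>i. ?D i)" by (simp add: sums_def)
  moreover have "(\<Sum>i<n. \<mu> (A i) - \<mu> (A (Suc i))) = \<mu> (A 0) - \<mu> (A n)" for n
    by (induction n) auto
  ultimately have "(\<lambda>n. \<mu> (A 0) - \<mu> (A n)) \<longlonglongrightarrow> \<mu> (\<Union>i. ?D i)" by (simp only:)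
  then have "(\<lambda>n. \<mu> (A 0) - (\<mu> (A 0) - \<mu> (A n))) \<longlonglongrightarrow> \<mu> (A 0) - \<mu> (\<Union>i. ?D i)" by (intro tendsto_intros)
  then have "Bseq (\<lambda>n. \<mu> (A n))" by (intro convergent_imp_Bseq convergentI) simp
  then obtain K where K: "\<And>n. \<bar>\<mu> (A n)\<bar> \<le> K" unfolding Bseq_def by auto
  obtain n where "K < real n" using reals_Archimedean2 by blast
  then show False using K[of "Suc n"] A(3)[of n] by simp
qed

lemma finite_upper_variation: "\<mu> \<in> signed_measures \<Longrightarrow> finite_measure (upper_variation \<mu>)"
  using upper_variation_finite by (intro finite_measureI) (auto simp: less_top)

lemma finite_lower_variation: "\<mu> \<in> signed_measures \<Longrightarrow> finite_measure (lower_variation \<mu>)"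
  unfolding lower_variation_def by (intro finite_upper_variation signed_measures_uminus)

text \<open>For C inside B, the value on C is the value on B minus the value on the rest, and the
  latter is controlled by the lower variation. Taking the supremum gives one inequality; the other
  is the same statement for the negative measure.\<close>

lemma jordan_decomposition:
  assumes \<mu>: "\<mu> \<in> signed_measures" and B: "B \<in> sets unit_leb"
  shows "\<mu> B = measure (upper_variation \<mu>) B - measure (lower_variation \<mu>) B"
proof -
  have le: "measure (upper_variation \<nu>) B \<le> \<nu> B + measure (lower_variation \<nu>) B" if \<nu>: "\<nu> \<in> signed_measures" for \<nu>
  proof -
    interpret u: finite_measure "upper_variation \<nu>" by (rule finite_upper_variation[OF \<nu>])
    interpret l: finite_measure "lower_variation \<nu>" by (rule finite_lower_variation[OF \<nu>])
    have c: "\<nu> C \<le> \<nu> B + measure (lower_variation \<nu>) B" if C: "C \<in> sets unit_leb" "C \<subseteq> B" for C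
    proof -
      have "ennreal (- \<nu> (B - C)) \<le> emeasure (lower_variation \<nu>) B"
        unfolding lower_variation_def using B C by (intro upper_variation_ge signed_measures_uminus \<nu>) auto
      then have "- \<nu> (B - C) \<le> measure (lower_variation \<nu>) B"
        by (simp add: l.emeasure_eq_measure ennreal_le_iff)
      then show ?thesis using signed_measures_Diff[OF \<nu> B C] by simp
    qed
    have "0 \<le> \<nu> B + measure (lower_variation \<nu>) B"
      using c[of "{}"] signed_measures_empty[OF \<nu>] by simp
    moreover have "emeasure (upper_variation \<nu>) B \<le> ennreal (\<nu> B + measure (lower_variation \<nu>) B)"
      unfolding emeasure_upper_variation[OF \<nu> B] using c by (intro SUP_least ennreal_leI) auto
    ultimately show ?thesis by (simp add: u.emeasure_eq_measure ennreal_le_iff)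
  qed
  have "measure (lower_variation \<mu>) B \<le> - \<mu> B + measure (upper_variation \<mu>) B"
    using le[OF signed_measures_uminus[OF \<mu>]] by (simp add: lower_variation_def)
  then show ?thesis using le[OF \<mu>] by simp
qed

lemma lint_unit_indicator:
  assumes "A \<in> sets unit_leb"
  shows "(LINT u:A|unit_leb. f u) = (LINT u|unit_leb. indicator A u * (f u :: real))"
  by (simp add: set_lebesgue_integral_def)

lemma integrable_indicator_unit:
  fixes f :: "real \<Rightarrow> real"
  assumes "integrable unit_leb f" "A \<in> sets unit_leb"
  shows "integrable unit_leb (\<lambda>u. indicator A u * f u)"
  using integrable_mult_indicator[OF assms(2,1)] by simp

lemma sums_set_integral_Union:
  fixes f :: "'a \<Rightarrow> real"
  assumes A: "\<And>i. A i \<in> sets M" "disjoint_family A" and f: "set_integrable M (\<Union>i. A i) f"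
  shows "(\<lambda>i. LINT u:A i|M. f u) sums (LINT u:(\<Union>i. A i)|M. f u)"
  unfolding sums_def
proof -
  have U: "(\<Union>n. \<Union>i<n. A i) = (\<Union>i. A i)" by auto
  have "(\<lambda>n. LINT u:(\<Union>i<n. A i)|M. f u) \<longlonglongrightarrow> (LINT u:(\<Union>n. \<Union>i<n. A i)|M. f u)"
  proof (rule set_integral_cont_up)
    show "incseq (\<lambda>n. \<Union>i<n. A i)" by (intro incseq_SucI UN_mono) auto
  qed (use A f in \<open>auto simp: U\<close>)
  moreover have "(LINT u:(\<Union>i<n. A i)|M. f u) = (\<Sum>i<n. LINT u:A i|M. f u)" for n
    by (rule set_integral_finite_Union)
      (use A in \<open>auto intro: set_integrable_subset[OF f] disjoint_family_on_mono\<close>)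
  ultimately show "(\<lambda>n. \<Sum>i<n. LINT u:A i|M. f u) \<longlonglongrightarrow> (LINT u:(\<Union>i. A i)|M. f u)" by (simp add: U)
qed

section \<open>Signed measures with a density\<close>

lemma density_signed_measures:
  assumes f: "integrable unit_leb f"
  shows "density_measure f \<in> signed_measures"
proof -
  have "(\<lambda>i. density_measure f (A i)) sums density_measure f (\<Union>i. A i)"
    if A: "range A \<subseteq> sets unit_leb" "disjoint_family A" for A :: "nat \<Rightarrow> real set"
  proof -
    have AU: "(\<Union>i. A i) \<in> sets unit_leb" using A by auto
    have "set_integrable unit_leb (\<Union>i. A i) f"
      unfolding set_integrable_def by (rule integrable_mult_indicator[OF AU f])
    then have "(\<lambda>i. LINT u:A i|unit_leb. f u) sums (LINT u:(\<Union>i. A i)|unit_leb. f u)"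
      using A by (intro sums_set_integral_Union) auto
    then show ?thesis using A AU by (auto simp: density_measure_def)
  qed
  then show ?thesis by (auto simp: signed_measures_def density_measure_def)
qed

lemma density_measure_uminus: "(\<lambda>A. - density_measure f A) = density_measure (\<lambda>u. - f u)"
  by (auto simp: density_measure_def set_lebesgue_integral_def)

text \<open>\<open>ennreal\<close> already takes the positive part of the density, and the supremum
  over subsets of A is attained where the density is positive.\<close>

lemma upper_variation_density:
  assumes f: "integrable unit_leb f"
  shows "upper_variation (density_measure f) = density unit_leb (\<lambda>u. ennreal (f u))"
proof (rule measure_eqI)
  show "sets (upper_variation (density_measure f)) = sets (density unit_leb (\<lambda>u. ennreal (f u)))" by simp
  fix A assume "A \<in> sets (upper_variation (density_measure f))"
  then have A: "A \<in> sets unit_leb" by simp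
  have fm [measurable]: "f \<in> borel_measurable unit_leb" using f by simp
  have D: "emeasure (density unit_leb (\<lambda>u. ennreal (f u))) A = (\<integral>\<^sup>+u. ennreal (f u) * indicator A u \<partial>unit_leb)"
    using A by (intro emeasure_density) auto
  show "emeasure (upper_variation (density_measure f)) A = emeasure (density unit_leb (\<lambda>u. ennreal (f u))) A"
    unfolding emeasure_upper_variation[OF density_signed_measures[OF f] A] D
  proof (rule antisym)
    show "(SUP B\<in>{B \<in> sets unit_leb. B \<subseteq> A}. ennreal (density_measure f B)) \<le> (\<integral>\<^sup>+u. ennreal (f u) * indicator A u \<partial>unit_leb)"
    proof (rule SUP_least)
      fix B assume "B \<in> {B \<in> sets unit_leb. B \<subseteq> A}"
      then have B: "B \<in> sets unit_leb" "B \<subseteq> A" by auto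
      let ?g = "\<lambda>u. indicator B u * max 0 (f u)"
      have gi: "integrable unit_leb ?g" by (intro integrable_indicator_unit integrable_max f B) simp
      have "density_measure f B \<le> (LINT u|unit_leb. ?g u)"
        unfolding density_measure_def using B gi integrable_indicator_unit[OF f B(1)]
        by (auto simp: lint_unit_indicator intro!: integral_mono) (auto simp: indicator_def)
      then have "ennreal (density_measure f B) \<le> ennreal (LINT u|unit_leb. ?g u)" by (rule ennreal_leI)
      also have "\<dots> = (\<integral>\<^sup>+u. ennreal (?g u) \<partial>unit_leb)"
        by (rule nn_integral_eq_integral[symmetric, OF gi]) auto
      also have "\<dots> \<le> (\<integral>\<^sup>+u. ennreal (f u) * indicator A u \<partial>unit_leb)"
        using B by (intro nn_integral_mono) (auto simp: indicator_def max_def ennreal_neg)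
      finally show "ennreal (density_measure f B) \<le> (\<integral>\<^sup>+u. ennreal (f u) * indicator A u \<partial>unit_leb)" .
    qed
    let ?B = "A \<inter> {u \<in> space unit_leb. 0 < f u}"
    have B: "?B \<in> sets unit_leb" using A by measurable
    have "(\<integral>\<^sup>+u. ennreal (f u) * indicator A u \<partial>unit_leb) = (\<integral>\<^sup>+u. ennreal (indicator ?B u * f u) \<partial>unit_leb)"
      by (intro nn_integral_cong) (auto simp: indicator_def ennreal_neg not_less)
    also have "\<dots> = ennreal (LINT u|unit_leb. indicator ?B u * f u)"
      by (intro nn_integral_eq_integral integrable_indicator_unit f B) (auto simp: indicator_def)
    also have "\<dots> = ennreal (density_measure f ?B)"
      using B by (simp add: density_measure_def lint_unit_indicator)
    also have "\<dots> \<le> (SUP B\<in>{B \<in> sets unit_leb. B \<subseteq> A}. ennreal (density_measure f B))"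
      using B by (intro SUP_upper) auto
    finally show "(\<integral>\<^sup>+u. ennreal (f u) * indicator A u \<partial>unit_leb) \<le> (SUP B\<in>{B \<in> sets unit_leb. B \<subseteq> A}. ennreal (density_measure f B))" .
  qed
qed

lemma lower_variation_density:
  assumes f: "integrable unit_leb f"
  shows "lower_variation (density_measure f) = density unit_leb (\<lambda>u. ennreal (- f u))"
  using assms unfolding lower_variation_def density_measure_uminus by (intro upper_variation_density) auto

lemma ennreal_max_0: "ennreal x = ennreal (max 0 x)"
  by (simp add: max_def ennreal_neg)

lemma pairing_density:
  assumes f: "integrable unit_leb f" and g [measurable]: "g \<in> borel_measurable unit_leb"
    and fg: "integrable unit_leb (\<lambda>u. f u * g u)"
  shows "pairing (density_measure f) g = (LINT u|unit_leb. f u * g u)"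
proof -
  have fm [measurable]: "f \<in> borel_measurable unit_leb" using f by simp
  have i: "integrable unit_leb (\<lambda>u. max 0 (f u) * g u)" "integrable unit_leb (\<lambda>u. max 0 (- f u) * g u)"
  proof -
    show "integrable unit_leb (\<lambda>u. max 0 (f u) * g u)"
      by (rule Bochner_Integration.integrable_bound[OF fg]) (auto simp: abs_mult intro!: AE_I2 mult_right_mono)
    show "integrable unit_leb (\<lambda>u. max 0 (- f u) * g u)"
      by (rule Bochner_Integration.integrable_bound[OF fg]) (auto simp: abs_mult intro!: AE_I2 mult_right_mono)
  qed
  have d: "(LINT u|density unit_leb (\<lambda>u. ennreal (k u)). g u) = (LINT u|unit_leb. max 0 (k u) * g u)"
    if [measurable]: "k \<in> borel_measurable unit_leb" for k
  proof -
    have "density unit_leb (\<lambda>u. ennreal (k u)) = density unit_leb (\<lambda>u. ennreal (max 0 (k u)))"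
      by (simp only: ennreal_max_0[symmetric])
    moreover have "(LINT u|density unit_leb (\<lambda>u. ennreal (max 0 (k u))). g u) = (LINT u|unit_leb. max 0 (k u) * g u)"
      by (intro integral_real_density) auto
    ultimately show ?thesis by simp
  qed
  have "pairing (density_measure f) g = (LINT u|unit_leb. max 0 (f u) * g u) - (LINT u|unit_leb. max 0 (- f u) * g u)"
    unfolding pairing_def upper_variation_density[OF f] lower_variation_density[OF f]
    using d[of f] d[of "\<lambda>u. - f u"] by simp
  also have "\<dots> = (LINT u|unit_leb. max 0 (f u) * g u - max 0 (- f u) * g u)"
    by (rule Bochner_Integration.integral_diff[symmetric, OF i])
  also have "\<dots> = (LINT u|unit_leb. f u * g u)"
    by (intro Bochner_Integration.integral_cong) (auto simp: max_def)
  finally show ?thesis .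
qed

lemma sqint_unit_integrable: "f \<in> sqint unit_leb \<Longrightarrow> integrable unit_leb f"
  using sqint_mult_integrable[of f unit_leb "\<lambda>_. 1"] sqint_bounded[OF finite_measure_unit_leb, of "\<lambda>_. 1" 1] by simp

lemma pairing_density_ip:
  assumes "f \<in> sqint unit_leb" "g \<in> sqint unit_leb"
  shows "pairing (density_measure f) g = ip2 f g"
  using pairing_density[OF sqint_unit_integrable[OF assms(1)] sqint_measurable[OF assms(2)] sqint_mult_integrable[OF assms]]
  by (simp add: ip_def)

lemma tv_norm_density:
  assumes f: "integrable unit_leb f"
  shows "tv_norm (density_measure f) = (\<integral>\<^sup>+u. ennreal \<bar>f u\<bar> \<partial>unit_leb)"
proof -
  have fm [measurable]: "f \<in> borel_measurable unit_leb" using f by simp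
  have X: "{0..1} \<in> sets unit_leb" using sets.top[of unit_leb] by simp
  have "tv_norm (density_measure f) = (\<integral>\<^sup>+u. ennreal (f u) * indicator {0..1} u \<partial>unit_leb) + (\<integral>\<^sup>+u. ennreal (- f u) * indicator {0..1} u \<partial>unit_leb)"
    unfolding tv_norm_def upper_variation_density[OF f] lower_variation_density[OF f]
    using X by (simp add: emeasure_density)
  also have "\<dots> = (\<integral>\<^sup>+u. ennreal (f u) * indicator {0..1} u + ennreal (- f u) * indicator {0..1} u \<partial>unit_leb)"
    using X by (intro nn_integral_add[symmetric]) auto
  also have "\<dots> = (\<integral>\<^sup>+u. ennreal \<bar>f u\<bar> \<partial>unit_leb)"
    by (intro nn_integral_cong) (auto simp: abs_if ennreal_neg)
  finally show ?thesis .
qed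

text \<open>Cauchy-Schwarz against the constant 1. A bound in L^2 thereby keeps a whole path inside
  a single total variation ball.\<close>

lemma tv_norm_density_le:
  assumes f: "f \<in> sqint unit_leb"
  shows "tv_norm (density_measure f) \<le> ennreal (sqrt (ip2 f f))"
proof -
  have o: "(\<lambda>_. 1) \<in> sqint unit_leb" by (rule sqint_bounded[OF finite_measure_unit_leb, of _ 1]) auto
  have [measurable]: "f \<in> borel_measurable unit_leb" by (rule sqint_measurable[OF f])
  have af: "(\<lambda>u. \<bar>f u\<bar>) \<in> sqint unit_leb" using f by (simp add: sqint_def)
  have i: "integrable unit_leb f" by (rule sqint_unit_integrable[OF f])
  have "tv_norm (density_measure f) = ennreal (LINT u|unit_leb. \<bar>f u\<bar>)"
    unfolding tv_norm_density[OF i] using i by (intro nn_integral_eq_integral) auto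
  also have "(LINT u|unit_leb. \<bar>f u\<bar>) = ip2 (\<lambda>u. \<bar>f u\<bar>) (\<lambda>_. 1)" by (simp add: ip_def)
  also have "\<dots> \<le> sqrt (nsq unit_leb (\<lambda>u. \<bar>f u\<bar>)) * sqrt (nsq unit_leb (\<lambda>_. 1))"
    using ip_Cauchy_Schwarz_sqrt[OF af o] by linarith
  also have "\<dots> = sqrt (ip2 f f)" by (simp add: ip_def)
  finally show ?thesis by (simp add: ennreal_leI)
qed

section \<open>Pairings with continuous functions\<close>

lemma continuous_integrable_variation:
  assumes "\<mu> \<in> signed_measures" and f: "continuous_on {0..1} (f :: real \<Rightarrow> real)"
  shows "integrable (upper_variation \<mu>) f" "integrable (lower_variation \<mu>) f"
proof -
  obtain B where B: "\<And>x. x \<in> {0..1} \<Longrightarrow> \<bar>f x\<bar> \<le> B" using continuous_bounded_unit[OF f] by metis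
  have m: "f \<in> borel_measurable (upper_variation \<mu>)" "f \<in> borel_measurable (lower_variation \<mu>)"
    using continuous_measurable_unit_leb[OF f] by (auto simp: measurable_cong_sets[OF sets_upper_variation refl] measurable_cong_sets[OF sets_lower_variation refl])
  show "integrable (upper_variation \<mu>) f"
    by (rule finite_measure.integrable_const_bound[OF finite_upper_variation[OF assms(1)] _ m(1), where B=B]) (use B in auto)
  show "integrable (lower_variation \<mu>) f"
    by (rule finite_measure.integrable_const_bound[OF finite_lower_variation[OF assms(1)] _ m(2), where B=B]) (use B in auto)
qed

lemma pairing_add:
  assumes "\<mu> \<in> signed_measures" "continuous_on {0..1} f" "continuous_on {0..1} g"
  shows "pairing \<mu> (\<lambda>x. f x + g x) = pairing \<mu> f + pairing \<mu> g"
  unfolding pairing_def using continuous_integrable_variation[OF assms(1)] assms by simp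

lemma pairing_diff:
  assumes "\<mu> \<in> signed_measures" "continuous_on {0..1} f" "continuous_on {0..1} g"
  shows "pairing \<mu> (\<lambda>x. f x - g x) = pairing \<mu> f - pairing \<mu> g"
  unfolding pairing_def using continuous_integrable_variation[OF assms(1)] assms by simp

lemma pairing_cmult: "pairing \<mu> (\<lambda>x. c * f x) = c * pairing \<mu> f"
  unfolding pairing_def by (simp add: right_diff_distrib)

lemma pairing_cong: "(\<And>x. x \<in> {0..1} \<Longrightarrow> f x = g x) \<Longrightarrow> pairing \<mu> f = pairing \<mu> g"
  unfolding pairing_def by (intro arg_cong2[where f = "(-)"] Bochner_Integration.integral_cong) auto

lemma pairing_zero: "pairing \<mu> (\<lambda>x. 0) = 0"
  by (simp add: pairing_def)

lemma pairing_sum: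
  assumes "\<mu> \<in> signed_measures" "\<And>i. i \<in> I \<Longrightarrow> continuous_on {0..1} (f i)"
  shows "pairing \<mu> (\<lambda>x. \<Sum>i\<in>I. f i x) = (\<Sum>i\<in>I. pairing \<mu> (f i))"
  using assms(2)
proof (induction I rule: infinite_finite_induct)
  case (insert i I)
  then have "pairing \<mu> (\<lambda>x. f i x + (\<Sum>i\<in>I. f i x)) = pairing \<mu> (f i) + pairing \<mu> (\<lambda>x. \<Sum>i\<in>I. f i x)"
    by (intro pairing_add assms(1) continuous_on_sum) auto
  then show ?case using insert by simp
qed (auto simp: pairing_zero)

lemma pairing_bound:
  assumes \<mu>: "\<mu> \<in> tv_ball a" and f: "continuous_on {0..1} (f :: real \<Rightarrow> real)" and B: "\<And>x. x \<in> {0..1} \<Longrightarrow> \<bar>f x\<bar> \<le> B"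
  shows "\<bar>pairing \<mu> f\<bar> \<le> real a * B"
proof -
  have s: "\<mu> \<in> signed_measures" and tv: "tv_norm \<mu> \<le> of_nat a" using \<mu> by (auto simp: tv_ball_def)
  interpret u: finite_measure "upper_variation \<mu>" by (rule finite_upper_variation[OF s])
  interpret l: finite_measure "lower_variation \<mu>" by (rule finite_lower_variation[OF s])
  note i = continuous_integrable_variation[OF s f]
  have B0: "0 \<le> B" using B[of 0] by auto
  have b: "\<bar>LINT x|upper_variation \<mu>. f x\<bar> \<le> (LINT x|upper_variation \<mu>. B)" "\<bar>LINT x|lower_variation \<mu>. f x\<bar> \<le> (LINT x|lower_variation \<mu>. B)"
    by (rule integral_abs_bound[THEN order_trans], rule integral_mono; use i B in auto)+
  have "ennreal (measure (upper_variation \<mu>) {0..1} + measure (lower_variation \<mu>) {0..1}) \<le> ennreal (real a)"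
    using tv unfolding tv_norm_def by (simp add: u.emeasure_eq_measure l.emeasure_eq_measure ennreal_plus ennreal_of_nat_eq_real_of_nat)
  then have m: "measure (upper_variation \<mu>) {0..1} + measure (lower_variation \<mu>) {0..1} \<le> real a"
    by (simp only: ennreal_le_iff of_nat_0_le_iff)
  have "\<bar>pairing \<mu> f\<bar> \<le> \<bar>LINT x|upper_variation \<mu>. f x\<bar> + \<bar>LINT x|lower_variation \<mu>. f x\<bar>"
    unfolding pairing_def by linarith
  also have "\<dots> \<le> (measure (upper_variation \<mu>) {0..1} + measure (lower_variation \<mu>) {0..1}) * B"
    using b by (simp add: algebra_simps)
  also have "\<dots> \<le> real a * B" using m B0 by (intro mult_right_mono)
  finally show ?thesis .
qed

section \<open>Weakly continuous paths\<close>

text \<open>Continuity into a generated topology is checked on the generating sets, and these are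
  preimages of open sets under the pairings. Below, paths are handled only through this
  description.\<close>

lemma paths_iff:
  "\<pi> \<in> paths T \<longleftrightarrow> (\<exists>a. (\<forall>t\<in>{0..T}. \<pi> t \<in> tv_ball a) \<and>
     (\<forall>f. continuous_on {0..1} f \<longrightarrow> continuous_on {0..T} (\<lambda>t. pairing (\<pi> t) f)))"
proof -
  have "continuous_map (top_of_set {0..T}) (weak_topology a) \<pi> \<longleftrightarrow> (\<forall>t\<in>{0..T}. \<pi> t \<in> tv_ball a) \<and>
     (\<forall>f. continuous_on {0..1} f \<longrightarrow> continuous_on {0..T} (\<lambda>t. pairing (\<pi> t) f))" for a
  proof
    assume "continuous_map (top_of_set {0..T}) (weak_topology a) \<pi>"
    then have c: "\<And>U. U \<in> {{\<mu> \<in> tv_ball a. pairing \<mu> f \<in> U} | f U. continuous_on {0..1} f \<and> open U} \<Longrightarrow>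
        openin (top_of_set {0..T}) (\<pi> -` U \<inter> {0..T})"
      and sub: "\<pi> ` {0..T} \<subseteq> \<Union>{{\<mu> \<in> tv_ball a. pairing \<mu> f \<in> U} | f U. continuous_on {0..1} f \<and> open U}"
      unfolding weak_topology_def continuous_on_generated_topo_iff by auto
    have ball: "\<forall>t\<in>{0..T}. \<pi> t \<in> tv_ball a" using sub by blast
    moreover have "continuous_on {0..T} (\<lambda>t. pairing (\<pi> t) f)" if f: "continuous_on {0..1} f" for f
      unfolding continuous_openin_preimage_eq
    proof (intro allI impI)
      fix U :: "real set" assume "open U"
      then have "openin (top_of_set {0..T}) (\<pi> -` {\<mu> \<in> tv_ball a. pairing \<mu> f \<in> U} \<inter> {0..T})"
        using f by (intro c) blast
      moreover have "\<pi> -` {\<mu> \<in> tv_ball a. pairing \<mu> f \<in> U} \<inter> {0..T} = {0..T} \<inter> (\<lambda>t. pairing (\<pi> t) f) -` U"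
        using ball by auto
      ultimately show "openin (top_of_set {0..T}) ({0..T} \<inter> (\<lambda>t. pairing (\<pi> t) f) -` U)" by simp
    qed
    ultimately show "(\<forall>t\<in>{0..T}. \<pi> t \<in> tv_ball a) \<and>
     (\<forall>f. continuous_on {0..1} f \<longrightarrow> continuous_on {0..T} (\<lambda>t. pairing (\<pi> t) f))" by blast
  next
    assume as: "(\<forall>t\<in>{0..T}. \<pi> t \<in> tv_ball a) \<and>
     (\<forall>f. continuous_on {0..1} f \<longrightarrow> continuous_on {0..T} (\<lambda>t. pairing (\<pi> t) f))"
    show "continuous_map (top_of_set {0..T}) (weak_topology a) \<pi>"
      unfolding weak_topology_def continuous_on_generated_topo_iff
    proof (intro conjI allI impI)
      fix U assume "U \<in> {{\<mu> \<in> tv_ball a. pairing \<mu> f \<in> U} | f U. continuous_on {0..1} f \<and> open U}"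
      then obtain f V where U: "U = {\<mu> \<in> tv_ball a. pairing \<mu> f \<in> V}" "continuous_on {0..1} f" "open V" by auto
      have "openin (top_of_set {0..T}) ({0..T} \<inter> (\<lambda>t. pairing (\<pi> t) f) -` V)"
        using as U(2,3) unfolding continuous_openin_preimage_eq by blast
      moreover have "\<pi> -` U \<inter> {0..T} = {0..T} \<inter> (\<lambda>t. pairing (\<pi> t) f) -` V"
        using as U(1) by auto
      ultimately show "openin (top_of_set {0..T}) (\<pi> -` U \<inter> topspace (top_of_set {0..T}))" by simp
    next
      \<comment> \<open>The zero function with the full line as target exhibits the whole ball as a
        generating set, so the topology lives on all of it.\<close>
      have "tv_ball a \<in> {{\<mu> \<in> tv_ball a. pairing \<mu> f \<in> U} | f U. continuous_on {0..1} f \<and> open U}"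
        by (intro CollectI exI[of _ "\<lambda>_::real. 0::real"] exI[of _ "UNIV :: real set"]) auto
      then show "\<pi> ` topspace (top_of_set {0..T}) \<subseteq> \<Union>{{\<mu> \<in> tv_ball a. pairing \<mu> f \<in> U} | f U. continuous_on {0..1} f \<and> open U}"
        using as by (intro image_subsetI UnionI) auto
    qed
  qed
  then show ?thesis unfolding paths_def by blast
qed

text \<open>Scaling the test shows that \<rho> - h is bounded as a functional with respect to the
  L^2 norm. A Riesz representation is avoided: absolute continuity follows by testing with functions
  that concentrate on compact null sets, Radon-Nikodym yields a density, and testing with
  truncations of the density bounds its norm with the sharp constant.\<close>

lemma sqint_of_finite_rate:
  assumes \<rho>: "\<rho> \<in> signed_measures" and h: "h \<in> sqint unit_leb"
    and W: "\<And>G. continuous_on {0..1} G \<Longrightarrow> pairing \<rho> G - ip2 h G - ip2 G G / 2 \<le> W"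
  obtains r where "r \<in> sqint unit_leb" "\<rho> = density_measure r" "nsq unit_leb (\<lambda>x. r x - h x) \<le> 2 * W"
proof -
  let ?u = "upper_variation \<rho>" and ?l = "lower_variation \<rho>"
  interpret u: finite_measure ?u by (rule finite_upper_variation[OF \<rho>])
  interpret l: finite_measure ?l by (rule finite_lower_variation[OF \<rho>])
  have W0: "0 \<le> W" using W[of "\<lambda>_. 0"] by (simp add: pairing_zero ip_def)
  \<comment> \<open>Replacing G by t G makes the bound a quadratic in t that is nonnegative for all
    t.\<close>
  have key: "(pairing \<rho> G - ip2 h G)\<^sup>2 \<le> 2 * W * ip2 G G" if G: "continuous_on {0..1} G" for G
  proof -
    have "(- ((pairing \<rho> G - ip2 h G) / 2))\<^sup>2 \<le> ip2 G G / 2 * W"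
    proof (rule quadratic_nonneg_discriminant)
      fix t
      have "pairing \<rho> (\<lambda>x. t * G x) - ip2 h (\<lambda>x. t * G x) - nsq unit_leb (\<lambda>x. t * G x) / 2 \<le> W"
        by (intro W continuous_intros G)
      then show "0 \<le> ip2 G G / 2 * t\<^sup>2 + 2 * - ((pairing \<rho> G - ip2 h G) / 2) * t + W"
        by (simp add: pairing_cmult ip_cmult_left ip_cmult_right power2_eq_square algebra_simps)
    qed
    then show ?thesis by (simp add: power2_eq_square mult_ac)
  qed
  \<comment> \<open>Continuous functions of the distance to K decrease to its indicator; their L^2
    norms tend to 0 while their pairings tend to the measure of K.\<close>
  have compact0: "\<rho> K = 0" if K: "compact K" "K \<subseteq> {0..1}" "emeasure lborel K = 0" for K
  proof (cases "K = {}")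
    case True then show ?thesis using signed_measures_empty[OF \<rho>] by simp
  next
    case False
    have Kb: "K \<in> sets borel" using K(1) by (simp add: compact_imp_closed)
    have KS: "K \<in> sets unit_leb" using Kb K(2) by (auto simp: sets_restrict_space intro!: image_eqI[of _ _ K])
    define g where "g n x = max 0 (1 - real n * infdist x K)" for n x
    have gc: "continuous_on S (g n)" for n S unfolding g_def by (intro continuous_intros)
    have g01: "0 \<le> g n x" "g n x \<le> 1" for n x by (auto simp: g_def infdist_nonneg)
    have glim: "(\<lambda>n. g n x) \<longlonglongrightarrow> indicator K x" for x
    proof (cases "x \<in> K")
      case True then show ?thesis by (simp add: g_def)
    next
      case False
      then have p: "0 < infdist x K"
        using K(1) \<open>K \<noteq> {}\<close> by (metis compact_imp_closed in_closed_iff_infdist_zero infdist_nonneg less_eq_real_def)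
      have "eventually (\<lambda>n. g n x = 0) sequentially"
        using eventually_ge_at_top[of "nat \<lceil>1 / infdist x K\<rceil>"]
      proof eventually_elim
        case (elim n)
        then have "1 / infdist x K \<le> real n" by linarith
        then have "1 \<le> real n * infdist x K" using p by (simp only: pos_divide_le_eq)
        then show ?case by (simp add: g_def)
      qed
      then show ?thesis using False by (simp add: tendsto_eventually)
    qed
    have gm: "g n \<in> borel_measurable unit_leb" for n by (intro continuous_measurable_unit_leb gc)
    have lint: "(\<lambda>n. LINT x|M. g n x) \<longlonglongrightarrow> measure M K" if M: "finite_measure M" "sets M = sets unit_leb" for M
    proof -
      have "(\<lambda>n. LINT x|M. g n x) \<longlonglongrightarrow> (LINT x|M. indicator K x)"
      proof (rule integral_dominated_convergence[where w = "\<lambda>_. 1"])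
        show "integrable M (\<lambda>_. 1::real)" by (rule finite_measure.integrable_const[OF M(1)])
        show "(indicator K :: real \<Rightarrow> real) \<in> borel_measurable M" using KS M(2) by simp
        show "g n \<in> borel_measurable M" for n using gm[of n] measurable_cong_sets[OF M(2) refl] by auto
      qed (use glim g01 in auto)
      moreover have "(LINT x|M. indicator K x) = measure M K"
        using KS M finite_measure.emeasure_finite[OF M(1)] by simp
      ultimately show ?thesis by simp
    qed
    have "(\<lambda>n. pairing \<rho> (g n)) \<longlonglongrightarrow> measure ?u K - measure ?l K"
      unfolding pairing_def using u.finite_measure_axioms l.finite_measure_axioms by (intro tendsto_diff lint) auto
    then have l1: "(\<lambda>n. pairing \<rho> (g n)) \<longlonglongrightarrow> \<rho> K" using jordan_decomposition[OF \<rho> KS] by simp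
    have K0: "AE x in unit_leb. x \<notin> K"
    proof -
      have "K \<in> null_sets lborel" using Kb K(3) by (simp add: null_sets_def)
      then have "AE x in lborel. x \<notin> K" by (rule AE_not_in)
      then show ?thesis by (subst AE_restrict_space_iff) auto
    qed
    have one: "(\<lambda>_. 1) \<in> sqint unit_leb" by (rule sqint_bounded[OF finite_measure_unit_leb, of _ 1]) auto
    have "(\<lambda>n. nsq unit_leb (\<lambda>x. g n x - 0)) \<longlonglongrightarrow> 0"
    proof (rule ip_dominated(3)[OF gm _ one])
      show "AE x in unit_leb. (\<lambda>n. g n x) \<longlonglongrightarrow> 0"
        using K0 by eventually_elim (use glim in \<open>metis indicator_simps(2)\<close>)
    qed (use g01 in auto)
    then have l2: "(\<lambda>n. nsq unit_leb (g n)) \<longlonglongrightarrow> 0" by simp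
    have gs: "g n \<in> sqint unit_leb" for n by (intro continuous_sqint gc)
    have l3: "(\<lambda>n. ip2 (g n) h) \<longlonglongrightarrow> ip2 (\<lambda>_. 0) h"
      by (rule ip_tendsto[OF gs sqint_zero h]) (use l2 in simp)
    have "(\<lambda>n. (pairing \<rho> (g n) - ip2 (g n) h)\<^sup>2) \<longlonglongrightarrow> (\<rho> K - ip2 (\<lambda>_. 0) h)\<^sup>2"
      by (intro tendsto_intros l1 l3)
    moreover have "(\<lambda>n. 2 * W * nsq unit_leb (g n)) \<longlonglongrightarrow> 2 * W * 0" by (intro tendsto_intros l2)
    ultimately have "(\<rho> K - ip2 (\<lambda>_. 0) h)\<^sup>2 \<le> 2 * W * 0"
      by (rule LIMSEQ_le) (use key[OF gc] in \<open>auto simp: ip_commute[of _ h]\<close>)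
    then show ?thesis by (simp add: ip_def)
  qed
  \<comment> \<open>Inner regularity is taken from a Borel measure on the line, so the measure is
    pushed forward along the inclusion of the interval.\<close>
  have inner: "\<exists>K. compact K \<and> K \<subseteq> B \<and> measure M B \<le> measure M K + e"
    if M: "finite_measure M" "sets M = sets unit_leb" and B: "B \<in> sets unit_leb" and e: "0 < e" for M B e
  proof -
    interpret M: finite_measure M by (rule M(1))
    have spM: "space M = {0..1}" using sets_eq_imp_space_eq[OF M(2)] by simp
    let ?D = "distr M borel (\<lambda>x. x)"
    have id: "(\<lambda>x. x) \<in> M \<rightarrow>\<^sub>M borel"
      using measurable_unit_leb_id measurable_cong_sets[OF M(2) refl] by auto
    have Bb: "B \<in> sets borel" "B \<subseteq> {0..1}" using B by (auto simp: sets_restrict_space)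
    have em: "emeasure ?D C = emeasure M (C \<inter> {0..1})" if "C \<in> sets borel" for C
      using that id by (simp add: emeasure_distr spM)
    have reg: "emeasure ?D B = (SUP K \<in> {K. K \<subseteq> B \<and> compact K}. emeasure ?D K)"
      using Bb by (intro inner_regular) (auto simp: em)
    have "\<exists>K. K \<subseteq> B \<and> compact K \<and> emeasure ?D B \<le> emeasure ?D K + ennreal e"
    proof -
      have "(SUP K \<in> {K. K \<subseteq> B \<and> compact K}. emeasure ?D K) < \<infinity>"
        using reg[symmetric] Bb by (simp add: em M.emeasure_eq_measure)
      then have ni: "(SUP K \<in> {K. K \<subseteq> B \<and> compact K}. emeasure ?D K) \<noteq> \<infinity>" by (rule less_imp_neq)
      have "\<exists>K\<in>{K. K \<subseteq> B \<and> compact K}. (SUP K \<in> {K. K \<subseteq> B \<and> compact K}. emeasure ?D K) < emeasure ?D K + ennreal e"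
        by (rule SUP_approx_ennreal[OF e _ refl ni]) auto
      then obtain K where K: "K \<subseteq> B" "compact K" "(SUP K \<in> {K. K \<subseteq> B \<and> compact K}. emeasure ?D K) < emeasure ?D K + ennreal e"
        by blast
      have "emeasure ?D B \<le> emeasure ?D K + ennreal e" unfolding reg using K(3) by (rule less_imp_le)
      then show ?thesis using K(1,2) by blast
    qed
    then obtain K where K: "K \<subseteq> B" "compact K" "emeasure ?D B \<le> emeasure ?D K + ennreal e" by blast
    have Kb: "K \<in> sets borel" using K(2) by (simp add: compact_imp_closed)
    have "B \<inter> {0..1} = B" "K \<inter> {0..1} = K" using Bb K(1) by auto
    then have "ennreal (measure M B) \<le> ennreal (measure M K + e)"
      using K(3) e Kb Bb by (simp add: em M.emeasure_eq_measure ennreal_plus)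
    then have "measure M B \<le> measure M K + e" using e by (subst (asm) ennreal_le_iff) (auto intro: add_nonneg_nonneg)
    then show ?thesis using K by blast
  qed
  \<comment> \<open>One compact set is chosen for each of the two variations. Their union is a
    compact null set that exhausts B up to e for both variations simultaneously, and on it the
    signed measure vanishes.\<close>
  have null0: "\<rho> B = 0" if B: "B \<in> sets unit_leb" "emeasure unit_leb B = 0" for B
  proof -
    have Bb: "B \<in> sets borel" "B \<subseteq> {0..1}" using B by (auto simp: sets_restrict_space)
    have B0: "emeasure lborel B = 0" using B Bb by (simp add: emeasure_restrict_space)
    have "\<bar>\<rho> B\<bar> \<le> 2 * e" if e: "0 < e" for e
    proof -
      obtain K1 where K1: "compact K1" "K1 \<subseteq> B" "measure ?u B \<le> measure ?u K1 + e"
        using inner[OF u.finite_measure_axioms sets_upper_variation B(1) e] by blast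
      obtain K2 where K2: "compact K2" "K2 \<subseteq> B" "measure ?l B \<le> measure ?l K2 + e"
        using inner[OF l.finite_measure_axioms sets_lower_variation B(1) e] by blast
      let ?K = "K1 \<union> K2"
      have K: "compact ?K" "?K \<subseteq> B" using K1 K2 by auto
      have KS: "C \<in> sets unit_leb" if "compact C" "C \<subseteq> B" for C
        using that Bb by (auto simp: sets_restrict_space compact_imp_closed intro!: image_eqI[of _ _ C])
      have "emeasure lborel ?K \<le> emeasure lborel B" using K Bb by (intro emeasure_mono) auto
      then have r0: "\<rho> ?K = 0" using compact0[OF K(1)] K(2) Bb B0 by auto
      have m: "measure ?u K1 \<le> measure ?u ?K" "measure ?l K2 \<le> measure ?l ?K" "measure ?u ?K \<le> measure ?u B" "measure ?l ?K \<le> measure ?l B"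
        using K B(1) KS[OF K] by (auto intro!: u.finite_measure_mono l.finite_measure_mono)
      show ?thesis
        using r0 m K1(3) K2(3) jordan_decomposition[OF \<rho> B(1)] jordan_decomposition[OF \<rho> KS[OF K]] by linarith
    qed
    from this[of "\<bar>\<rho> B\<bar> / 4"] show ?thesis by force
  qed
  have ac: "absolutely_continuous unit_leb (upper_variation \<nu>)" if \<nu>: "\<nu> \<in> signed_measures" "\<And>B. B \<in> sets unit_leb \<Longrightarrow> emeasure unit_leb B = 0 \<Longrightarrow> \<nu> B = 0" for \<nu>
    unfolding absolutely_continuous_def
  proof
    fix N assume "N \<in> null_sets unit_leb"
    then have N: "N \<in> sets unit_leb" "emeasure unit_leb N = 0" by (auto simp: null_sets_def)
    have "emeasure (upper_variation \<nu>) N \<le> 0"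
      unfolding emeasure_upper_variation[OF \<nu>(1) N(1)]
    proof (rule SUP_least)
      fix B assume "B \<in> {B \<in> sets unit_leb. B \<subseteq> N}"
      moreover from this have "emeasure unit_leb B \<le> emeasure unit_leb N" using N by (intro emeasure_mono) auto
      ultimately have "\<nu> B = 0" using N(2) by (intro \<nu>(2)) auto
      then show "ennreal (\<nu> B) \<le> 0" by simp
    qed
    then show "N \<in> null_sets (upper_variation \<nu>)" using N by (auto simp: null_sets_def)
  qed
  have ex: "\<exists>f. integrable unit_leb f \<and> (\<forall>B\<in>sets unit_leb. measure (upper_variation \<nu>) B = (LINT u|unit_leb. indicator B u * f u))"
    if \<nu>: "\<nu> \<in> signed_measures" "\<And>B. B \<in> sets unit_leb \<Longrightarrow> emeasure unit_leb B = 0 \<Longrightarrow> \<nu> B = 0" for \<nu>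
  proof -
    interpret n: finite_measure "upper_variation \<nu>" by (rule finite_upper_variation[OF \<nu>(1)])
    obtain f where f: "f \<in> borel_measurable unit_leb" "density unit_leb f = upper_variation \<nu>"
      using ul.Radon_Nikodym_finite_measure[OF n.finite_measure_axioms sets_upper_variation ac[OF \<nu>]] by blast
    note [measurable] = f(1)
    have em: "emeasure (upper_variation \<nu>) B = (\<integral>\<^sup>+u. f u * indicator B u \<partial>unit_leb)" if "B \<in> sets unit_leb" for B
      unfolding f(2)[symmetric] using that by (intro emeasure_density) auto
    have X: "{0..1} \<in> sets unit_leb" using sets.top[of unit_leb] by simp
    have "(\<integral>\<^sup>+u. f u \<partial>unit_leb) = (\<integral>\<^sup>+u. f u * indicator {0..1} u \<partial>unit_leb)"
      by (intro nn_integral_cong) auto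
    then have fin: "(\<integral>\<^sup>+u. f u \<partial>unit_leb) \<noteq> \<infinity>"
      using em[OF X] upper_variation_finite[OF \<nu>(1)] by (simp add: less_top)
    then have ae: "AE u in unit_leb. f u \<noteq> \<infinity>" by (intro nn_integral_PInf_AE) auto
    let ?r = "\<lambda>u. enn2real (f u)"
    have eq: "(\<integral>\<^sup>+u. ennreal (?r u) * indicator B u \<partial>unit_leb) = (\<integral>\<^sup>+u. f u * indicator B u \<partial>unit_leb)" for B
      by (intro nn_integral_cong_AE) (use ae in \<open>eventually_elim, auto simp: less_top\<close>)
    have ri: "integrable unit_leb ?r"
    proof (rule integrableI_nonneg)
      have "(\<integral>\<^sup>+u. ennreal (?r u) \<partial>unit_leb) = (\<integral>\<^sup>+u. f u \<partial>unit_leb)"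
        by (intro nn_integral_cong_AE) (use ae in \<open>eventually_elim, auto simp: less_top\<close>)
      then show "(\<integral>\<^sup>+u. ennreal (?r u) \<partial>unit_leb) < \<infinity>" using fin by (simp add: less_top)
    qed auto
    moreover have "measure (upper_variation \<nu>) B = (LINT u|unit_leb. indicator B u * ?r u)" if B: "B \<in> sets unit_leb" for B
    proof -
      have "ennreal (measure (upper_variation \<nu>) B) = (\<integral>\<^sup>+u. ennreal (indicator B u * ?r u) \<partial>unit_leb)"
        using em[OF B] eq[of B] by (auto simp: n.emeasure_eq_measure ennreal_mult'' ennreal_indicator mult.commute intro!: nn_integral_cong)
      also have "\<dots> = ennreal (LINT u|unit_leb. indicator B u * ?r u)"
        by (intro nn_integral_eq_integral integrable_indicator_unit ri B) auto
      finally show ?thesis by (simp add: integral_nonneg_AE)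
    qed
    ultimately show ?thesis by (intro exI[of _ ?r]) auto
  qed
  obtain p where p: "integrable unit_leb p" "\<And>B. B \<in> sets unit_leb \<Longrightarrow> measure ?u B = (LINT u|unit_leb. indicator B u * p u)"
    using ex[OF \<rho> null0] by blast
  obtain q where q: "integrable unit_leb q" "\<And>B. B \<in> sets unit_leb \<Longrightarrow> measure ?l B = (LINT u|unit_leb. indicator B u * q u)"
    using ex[OF signed_measures_uminus[OF \<rho>]] null0 unfolding lower_variation_def by (metis neg_0_equal_iff_equal)
  define r where "r u = p u - q u" for u
  have ri: "integrable unit_leb r" unfolding r_def using p q by simp
  have \<rho>r: "\<rho> = density_measure r"
  proof
    fix B
    show "\<rho> B = density_measure r B"
    proof (cases "B \<in> sets unit_leb")
      case True
      have "(LINT u|unit_leb. indicator B u * r u) = (LINT u|unit_leb. indicator B u * p u) - (LINT u|unit_leb. indicator B u * q u)"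
        unfolding r_def right_diff_distrib by (intro Bochner_Integration.integral_diff integrable_indicator_unit p q True)
      then show ?thesis
        using True jordan_decomposition[OF \<rho> True] p(2)[OF True] q(2)[OF True] by (simp add: density_measure_def lint_unit_indicator)
    next
      case False then show ?thesis using \<rho> by (simp add: density_measure_def signed_measures_def)
    qed
  qed
  let ?\<psi> = "\<lambda>u. r u - h u"
  have hi: "integrable unit_leb h" by (rule sqint_unit_integrable[OF h])
  have \<psi>i: "integrable unit_leb ?\<psi>" using ri hi by simp
  have [measurable]: "r \<in> borel_measurable unit_leb" "h \<in> borel_measurable unit_leb" using ri hi by auto
  \<comment> \<open>The truncation c of r - h is reached by continuous tests. Since c^2 \<le> (r -
    h) c, the bound at c leaves half its squared norm below \<open>W\<close>; the constant does not
    depend on the truncation level.\<close>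
  have trunc: "nsq unit_leb (\<lambda>u. max (- real n) (min (real n) (?\<psi> u))) \<le> 2 * W" for n
  proof -
    let ?c = "\<lambda>u. max (- real n) (min (real n) (?\<psi> u))"
    have cm: "?c \<in> borel_measurable unit_leb" by measurable
    have cb: "\<bar>?c u\<bar> \<le> real n" for u by auto
    obtain g where g: "\<And>k::nat. continuous_on UNIV (g k)" "\<And>k x. \<bar>g k x\<bar> \<le> real n" "AE x in unit_leb. (\<lambda>k. g k x) \<longlonglongrightarrow> ?c x"
      using bounded_measurable_continuous_limit[OF cm cb] by blast
    have gc: "continuous_on {0..1} (g k)" for k using g(1) continuous_on_subset by blast
    have gm [measurable]: "g k \<in> borel_measurable unit_leb" for k by (intro continuous_measurable_unit_leb gc)
    have gs: "g k \<in> sqint unit_leb" for k by (intro continuous_sqint gc)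
    have nB: "(\<lambda>_. real n) \<in> sqint unit_leb" by (rule sqint_bounded[OF finite_measure_unit_leb, of _ "real n"]) auto
    have dm: "?c \<in> sqint unit_leb" "(\<lambda>k. nsq unit_leb (\<lambda>x. g k x - ?c x)) \<longlonglongrightarrow> 0"
      using ip_dominated[OF gm cm nB g(3)] g(2) by auto
    have l1: "(\<lambda>k. nsq unit_leb (g k)) \<longlonglongrightarrow> ip2 ?c ?c" by (rule ip_self_tendsto[OF gs dm])
    have l2: "(\<lambda>k. LINT u|unit_leb. ?\<psi> u * g k u) \<longlonglongrightarrow> (LINT u|unit_leb. ?\<psi> u * ?c u)"
    proof (rule integral_dominated_convergence[where w = "\<lambda>u. \<bar>?\<psi> u\<bar> * real n"])
      show "AE u in unit_leb. (\<lambda>k. ?\<psi> u * g k u) \<longlonglongrightarrow> ?\<psi> u * ?c u"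
        using g(3) by eventually_elim (rule tendsto_mult_left)
      show "AE u in unit_leb. norm (?\<psi> u * g k u) \<le> \<bar>?\<psi> u\<bar> * real n" for k
        using g(2) by (intro AE_I2) (simp add: abs_mult mult_left_mono)
    qed (use \<psi>i cm in auto)
    have le: "(LINT u|unit_leb. ?\<psi> u * g k u) - nsq unit_leb (g k) / 2 \<le> W" for k
    proof -
      have i: "integrable unit_leb (\<lambda>u. r u * g k u)"
        by (rule Bochner_Integration.integrable_bound[where f = "\<lambda>u. r u * real n"])
          (use ri g(2) in \<open>auto simp: abs_mult intro!: AE_I2 mult_left_mono\<close>)
      have "pairing \<rho> (g k) = (LINT u|unit_leb. r u * g k u)"
        unfolding \<rho>r by (rule pairing_density[OF ri gm i])
      moreover have "(LINT u|unit_leb. ?\<psi> u * g k u) = (LINT u|unit_leb. r u * g k u) - ip2 h (g k)"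
        unfolding ip_def left_diff_distrib by (intro Bochner_Integration.integral_diff i sqint_mult_integrable h gs)
      ultimately show ?thesis using W[OF gc, of k] by simp
    qed
    have "(LINT u|unit_leb. ?\<psi> u * ?c u) - ip2 ?c ?c / 2 \<le> W"
      by (rule LIMSEQ_le_const2[OF tendsto_diff[OF l2 tendsto_divide[OF l1 tendsto_const]]]) (use le in auto)
    moreover have "ip2 ?c ?c \<le> (LINT u|unit_leb. ?\<psi> u * ?c u)"
      unfolding ip_def
    proof (rule integral_mono)
      show "integrable unit_leb (\<lambda>u. ?c u * ?c u)" by (intro sqint_mult_integrable dm)
      show "integrable unit_leb (\<lambda>u. ?\<psi> u * ?c u)"
        by (rule Bochner_Integration.integrable_bound[where f = "\<lambda>u. ?\<psi> u * real n"])
          (use \<psi>i cb cm in \<open>auto simp: abs_mult intro!: AE_I2 mult_left_mono\<close>)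
      fix u
      have "y * y \<le> x * y" if "y = max (- b) (min b x)" "0 \<le> b" for x y b :: real
      proof -
        have "0 \<le> (x - y) * y"
          using that by (cases "x < - b"; cases "b < x") (auto simp: max_def min_def mult_nonneg_nonneg mult_nonpos_nonpos mult_nonpos_nonneg)
        then show ?thesis by (simp add: algebra_simps)
      qed
      then show "?c u * ?c u \<le> ?\<psi> u * ?c u" by simp
    qed
    ultimately show ?thesis by linarith
  qed
  have \<psi>nn: "(\<integral>\<^sup>+u. ennreal ((?\<psi> u)\<^sup>2) \<partial>unit_leb) \<le> ennreal (2 * W)"
  proof -
    let ?c = "\<lambda>n u. max (- real n) (min (real n) (?\<psi> u))"
    have cs: "?c n \<in> sqint unit_leb" for n
      by (rule sqint_bounded[OF finite_measure_unit_leb, of _ "real n"]) (auto intro!: borel_measurable_max borel_measurable_min)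
    have "(\<integral>\<^sup>+u. ennreal ((?\<psi> u)\<^sup>2) \<partial>unit_leb) = (\<integral>\<^sup>+u. liminf (\<lambda>n. ennreal ((?c n u)\<^sup>2)) \<partial>unit_leb)"
    proof (rule nn_integral_cong)
      fix u
      have "eventually (\<lambda>n. ennreal ((?c n u)\<^sup>2) = ennreal ((?\<psi> u)\<^sup>2)) sequentially"
        using eventually_ge_at_top[of "nat \<lceil>\<bar>?\<psi> u\<bar>\<rceil>"]
      proof eventually_elim
        case (elim n)
        then have "\<bar>?\<psi> u\<bar> \<le> real n" by linarith
        then have "?c n u = ?\<psi> u" by auto
        then show ?case by simp
      qed
      then have "(\<lambda>n. ennreal ((?c n u)\<^sup>2)) \<longlonglongrightarrow> ennreal ((?\<psi> u)\<^sup>2)" by (rule tendsto_eventually)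
      from lim_imp_Liminf[OF sequentially_bot this] show "ennreal ((?\<psi> u)\<^sup>2) = liminf (\<lambda>n. ennreal ((?c n u)\<^sup>2))" by (rule sym)
    qed
    also have "\<dots> \<le> liminf (\<lambda>n. \<integral>\<^sup>+u. ennreal ((?c n u)\<^sup>2) \<partial>unit_leb)"
      by (intro nn_integral_liminf) measurable
    also have "\<dots> \<le> liminf (\<lambda>n. ennreal (2 * W))"
      by (intro Liminf_mono always_eventually allI) (simp add: nn_integral_sq_eq_ip[OF cs] ennreal_leI trunc)
    also have "\<dots> = ennreal (2 * W)" by (intro Liminf_const sequentially_bot)
    finally show ?thesis .
  qed
  have \<psi>s: "?\<psi> \<in> sqint unit_leb"
    using \<psi>nn by (subst sqint_iff_nn_integral) (measurable, auto intro: le_less_trans)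
  have "(\<lambda>u. ?\<psi> u + h u) \<in> sqint unit_leb" by (rule sqint_add[OF \<psi>s h])
  then have "r \<in> sqint unit_leb" by simp
  moreover have "ip2 ?\<psi> ?\<psi> \<le> 2 * W"
    using \<psi>nn W0 by (simp add: nn_integral_sq_eq_ip[OF \<psi>s] ennreal_le_iff)
  ultimately show ?thesis using that \<rho>r by blast
qed

context fractional
begin

section \<open>Finite sums of products as test functions\<close>

lemma c2c_mono: "c2c d B G \<Longrightarrow> 0 < d' \<Longrightarrow> d' \<le> d \<Longrightarrow> B \<le> B' \<Longrightarrow> c2c d' B' G"
  unfolding c2c_def by (elim conjE exE, intro conjI exI, assumption, intro ballI) (fastforce)

lemma c2c_add:
  assumes "c2c d B F" "c2c d B' G"
  shows "c2c d (B + B') (\<lambda>x. F x + G x)"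
proof -
  obtain F' F'' where F: "\<forall>u\<in>{0..1}.
     (F has_real_derivative F' u) (at u within {0..1}) \<and>
     (F' has_real_derivative F'' u) (at u within {0..1}) \<and>
     \<bar>F u\<bar> \<le> B \<and> \<bar>F'' u\<bar> \<le> B \<and> (u < d \<or> 1 - d < u \<longrightarrow> F u = 0)" and d: "0 < d"
    using assms(1) unfolding c2c_def by blast
  obtain G' G'' where G: "\<forall>u\<in>{0..1}.
     (G has_real_derivative G' u) (at u within {0..1}) \<and>
     (G' has_real_derivative G'' u) (at u within {0..1}) \<and>
     \<bar>G u\<bar> \<le> B' \<and> \<bar>G'' u\<bar> \<le> B' \<and> (u < d \<or> 1 - d < u \<longrightarrow> G u = 0)"
    using assms(2) unfolding c2c_def by blast
  show ?thesis
    unfolding c2c_def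
  proof (rule conjI[OF d], rule exI[of _ "\<lambda>x. F' x + G' x"], rule exI[of _ "\<lambda>x. F'' x + G'' x"], intro ballI conjI)
    fix u :: real assume u: "u \<in> {0..1}"
    note f = F[rule_format, OF u] and g = G[rule_format, OF u]
    show "((\<lambda>x. F x + G x) has_real_derivative F' u + G' u) (at u within {0..1})"
      "((\<lambda>x. F' x + G' x) has_real_derivative F'' u + G'' u) (at u within {0..1})"
      using f g by (auto intro: DERIV_add)
    show "\<bar>F u + G u\<bar> \<le> B + B'" "\<bar>F'' u + G'' u\<bar> \<le> B + B'" "u < d \<or> 1 - d < u \<longrightarrow> F u + G u = 0"
      using f g by auto
  qed
qed

lemma c2c_cmult:
  assumes "c2c d B F"
  shows "c2c d (\<bar>c\<bar> * B) (\<lambda>x. c * F x)"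
proof -
  obtain F' F'' where F: "\<forall>u\<in>{0..1}.
     (F has_real_derivative F' u) (at u within {0..1}) \<and>
     (F' has_real_derivative F'' u) (at u within {0..1}) \<and>
     \<bar>F u\<bar> \<le> B \<and> \<bar>F'' u\<bar> \<le> B \<and> (u < d \<or> 1 - d < u \<longrightarrow> F u = 0)" and d: "0 < d"
    using assms unfolding c2c_def by blast
  show ?thesis
    unfolding c2c_def
  proof (rule conjI[OF d], rule exI[of _ "\<lambda>x. c * F' x"], rule exI[of _ "\<lambda>x. c * F'' x"], intro ballI conjI)
    fix u :: real assume u: "u \<in> {0..1}"
    note f = F[rule_format, OF u]
    show "((\<lambda>x. c * F x) has_real_derivative c * F' u) (at u within {0..1})"
      "((\<lambda>x. c * F' x) has_real_derivative c * F'' u) (at u within {0..1})"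
      using f by (auto intro: DERIV_cmult)
    show "\<bar>c * F u\<bar> \<le> \<bar>c\<bar> * B" "\<bar>c * F'' u\<bar> \<le> \<bar>c\<bar> * B" "u < d \<or> 1 - d < u \<longrightarrow> c * F u = 0"
      using f by (auto simp: abs_mult mult_left_mono)
  qed
qed

lemma c2c_zero: "c2c 1 0 (\<lambda>x. 0)"
  unfolding c2c_def by (intro conjI exI[of _ "\<lambda>x. 0"]) auto

lemma c2c_sum:
  fixes n :: nat
  assumes "\<And>k. k < n \<Longrightarrow> \<exists>d B. c2c d B (E k)"
  shows "\<exists>d B. c2c d B (\<lambda>x. \<Sum>k<n. b k * E k x)"
  using assms
proof (induction n)
  case 0
  then show ?case using c2c_zero by auto
next
  case (Suc n)
  obtain d B where 1: "c2c d B (\<lambda>x. \<Sum>k<n. b k * E k x)" using Suc by auto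
  obtain d' B' where 2: "c2c d' B' (E n)" using Suc.prems[of n] by auto
  have dd: "0 < d" "0 < d'" using 1 2 by (auto simp: c2c_def)
  have "c2c (min d d') B (\<lambda>x. \<Sum>k<n. b k * E k x)" using dd by (intro c2c_mono[OF 1]) auto
  moreover have "c2c (min d d') (\<bar>b n\<bar> * B') (\<lambda>x. b n * E n x)"
    using dd by (intro c2c_cmult c2c_mono[OF 2]) auto
  ultimately have "c2c (min d d') (B + \<bar>b n\<bar> * B') (\<lambda>x. (\<Sum>k<n. b k * E k x) + b n * E n x)"
    by (rule c2c_add)
  then show ?case by auto
qed

section \<open>Linearity of the fractional Laplacian on compactly supported functions\<close>

lemma trunc_lap_add:
  assumes "c2c d B F" "c2c d' B' G" "0 < \<epsilon>" "u \<in> {0..1}"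
  shows "trunc_lap \<epsilon> (\<lambda>x. F x + G x) u = trunc_lap \<epsilon> F u + trunc_lap \<epsilon> G u"
proof -
  have i: "integrable unit_leb (\<lambda>v. indicator {v. \<epsilon> \<le> \<bar>u - v\<bar>} v * ((F v - F u) / \<bar>v - u\<bar> powr (1 + \<gamma>)))"
    by (rule trunc_integrable[OF continuous_measurable_unit_leb[OF c2c_continuous[OF assms(1)]] c2c_bound[OF assms(1)] assms(3,4)])
  have j: "integrable unit_leb (\<lambda>v. indicator {v. \<epsilon> \<le> \<bar>u - v\<bar>} v * ((G v - G u) / \<bar>v - u\<bar> powr (1 + \<gamma>)))"
    by (rule trunc_integrable[OF continuous_measurable_unit_leb[OF c2c_continuous[OF assms(2)]] c2c_bound[OF assms(2)] assms(3,4)])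
  show ?thesis
    unfolding trunc_lap_def Bochner_Integration.integral_add[OF i j, symmetric]
    by (intro Bochner_Integration.integral_cong refl) (simp add: diff_divide_distrib add_divide_distrib algebra_simps)
qed

lemma trunc_lap_cmult: "trunc_lap \<epsilon> (\<lambda>x. c * F x) u = c * trunc_lap \<epsilon> F u"
proof -
  have "trunc_lap \<epsilon> (\<lambda>x. c * F x) u = (LINT v|unit_leb. c * (indicator {v. \<epsilon> \<le> \<bar>u - v\<bar>} v * ((F v - F u) / \<bar>v - u\<bar> powr (1 + \<gamma>))))"
    unfolding trunc_lap_def by (intro Bochner_Integration.integral_cong refl) (simp add: right_diff_distrib[symmetric])
  then show ?thesis unfolding trunc_lap_def by (simp del: times_divide_eq_right)
qed

text \<open>\<open>Lim\<close> respects sums only where both limits exist, so additivity is read off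
  from the convergent truncated sequences.\<close>

lemma frac_lap_add:
  assumes F: "c2c d B F" and G: "c2c d' B' G" and u: "u \<in> {0..1}"
  shows "frac_lap \<gamma> (\<lambda>x. F x + G x) u = frac_lap \<gamma> F u + frac_lap \<gamma> G u"
proof -
  have dd: "0 < d" "0 < d'" using F G by (auto simp: c2c_def)
  have FG: "c2c (min d d') (B + B') (\<lambda>x. F x + G x)"
    using dd by (intro c2c_add c2c_mono[OF F] c2c_mono[OF G]) auto
  have "(\<lambda>n. c_norm \<gamma> * trunc_lap (1 / Suc n) (\<lambda>x. F x + G x) u) \<longlonglongrightarrow> frac_lap \<gamma> F u + frac_lap \<gamma> G u"
    using tendsto_add[OF frac_lap_limit_seq[OF F u] frac_lap_limit_seq[OF G u]]
    by (simp add: trunc_lap_add[OF F G _ u] distrib_left)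
  with frac_lap_limit_seq[OF FG u] show ?thesis by (rule LIMSEQ_unique)
qed

lemma frac_lap_cmult:
  assumes F: "c2c d B F" and u: "u \<in> {0..1}"
  shows "frac_lap \<gamma> (\<lambda>x. c * F x) u = c * frac_lap \<gamma> F u"
proof -
  have "(\<lambda>n. c_norm \<gamma> * trunc_lap (1 / Suc n) (\<lambda>x. c * F x) u) \<longlonglongrightarrow> c * frac_lap \<gamma> F u"
    using tendsto_mult_left[OF frac_lap_limit_seq[OF F u], of c] by (simp add: trunc_lap_cmult mult.left_commute)
  with frac_lap_limit_seq[OF c2c_cmult[OF F] u] show ?thesis by (rule LIMSEQ_unique)
qed

lemma frac_lap_sum:
  fixes n :: nat
  assumes E: "\<And>k. k < n \<Longrightarrow> \<exists>d B. c2c d B (E k)" and u: "u \<in> {0..1}"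
  shows "frac_lap \<gamma> (\<lambda>x. \<Sum>k<n. b k * E k x) u = (\<Sum>k<n. b k * frac_lap \<gamma> (E k) u)"
  using E
proof (induction n)
  case 0
  have "frac_lap \<gamma> (\<lambda>x. 0 * (0::real)) u = 0 * frac_lap \<gamma> (\<lambda>x. 0) u" by (rule frac_lap_cmult[OF c2c_zero u])
  then show ?case by simp
next
  case (Suc n)
  obtain d B where 1: "c2c d B (\<lambda>x. \<Sum>k<n. b k * E k x)" using c2c_sum[of n E b] Suc.prems by auto
  obtain d' B' where 2: "c2c d' B' (E n)" using Suc.prems[of n] by auto
  have "frac_lap \<gamma> (\<lambda>x. (\<Sum>k<n. b k * E k x) + b n * E n x) u = (\<Sum>k<n. b k * frac_lap \<gamma> (E k) u) + b n * frac_lap \<gamma> (E n) u"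
    using Suc by (subst frac_lap_add[OF 1 c2c_cmult[OF 2] u]) (auto simp: frac_lap_cmult[OF 2 u])
  then show ?case by simp
qed

section \<open>Sums of time coefficients times smooth profiles\<close>

lemma test_function_derivs:
  assumes "G \<in> test_functions"
  shows "((deriv ^^ n) G has_real_derivative (deriv ^^ Suc n) G x) (at x)" "continuous_on S ((deriv ^^ n) G)"
proof -
  show D: "((deriv ^^ n) G has_real_derivative (deriv ^^ Suc n) G x) (at x)" for n x
    using assms by (auto simp: test_functions_def real_differentiable_def dest!: spec[of _ n] spec[of _ x] dest: DERIV_imp_deriv)
  show "continuous_on S ((deriv ^^ n) G)" by (rule DERIV_everywhere_continuous[OF D])
qed

lemma continuous_on_sum_products:
  fixes b :: "nat \<Rightarrow> real \<Rightarrow> real"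
  assumes "\<And>k. k < n \<Longrightarrow> continuous_on X (b k)" "\<And>k. k < n \<Longrightarrow> continuous_on Y (E k)"
  shows "continuous_on (X \<times> Y) (\<lambda>(t, u). \<Sum>k<n. b k t * E k (u::real))"
proof -
  have "continuous_on (X \<times> Y) (\<lambda>p. \<Sum>k<n. b k (fst p) * E k (snd p))"
    using assms
    by (intro continuous_intros continuous_on_compose2[OF assms(1)] continuous_on_compose2[OF assms(2)]) auto
  then show ?thesis by (simp add: split_beta')
qed

lemma sum_space_time_test:
  fixes n :: nat
  assumes T: "0 < T" and E: "\<And>k. k < n \<Longrightarrow> E k \<in> test_functions"
    and b: "\<And>k s. k < n \<Longrightarrow> s \<in> {0..T} \<Longrightarrow> (b k has_real_derivative b' k s) (at s within {0..T})"
    and b': "\<And>k. k < n \<Longrightarrow> continuous_on {0..T} (b' k)"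
  shows "(\<lambda>s u. \<Sum>k<n. b k s * E k u) \<in> space_time_tests T"
    "\<And>s u. s \<in> {0..T} \<Longrightarrow> time_deriv T (\<lambda>s u. \<Sum>k<n. b k s * E k u) s u = (\<Sum>k<n. b' k s * E k u)"
proof -
  let ?H = "\<lambda>s u. \<Sum>k<n. b k s * E k u"
  let ?Ht = "\<lambda>s u. \<Sum>k<n. b' k s * E k u"
  let ?Hu = "\<lambda>s u. \<Sum>k<n. b k s * (deriv ^^ 1) (E k) u"
  let ?Huu = "\<lambda>s u. \<Sum>k<n. b k s * (deriv ^^ 2) (E k) u"
  have D1: "((\<lambda>s. ?H s u) has_real_derivative ?Ht t u) (at t within {0..T})" if "t \<in> {0..T}" for t u
    using that by (intro DERIV_sum) (auto intro!: DERIV_cmult_right b)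
  show "time_deriv T ?H s u = ?Ht s u" if "s \<in> {0..T}" for s u
    unfolding time_deriv_def
    by (rule vector_derivative_within_cbox[of 0 T, simplified])
      (use T that D1[OF that] in \<open>auto simp: has_real_derivative_iff_has_vector_derivative\<close>)
  have Ed: "((deriv ^^ m) (E k) has_real_derivative (deriv ^^ Suc m) (E k) u) (at u within {0..1})" if "k < n" for m k u
    by (rule has_field_derivative_at_within[OF test_function_derivs(1)[OF E[OF that]]])
  have D2: "(?H t has_real_derivative ?Hu t u) (at u within {0..1})" for t u
    using Ed[of _ 0] by (intro DERIV_sum DERIV_cmult) auto
  have D3: "(?Hu t has_real_derivative ?Huu t u) (at u within {0..1})" for t u
    using Ed[of _ 1] by (intro DERIV_sum DERIV_cmult) (auto simp: numeral_2_eq_2)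
  have bc: "continuous_on {0..T} (b k)" if "k < n" for k
    by (rule DERIV_continuous_on) (use b[OF that] in auto)
  have Ec: "continuous_on {0..1} ((deriv ^^ m) (E k))" if "k < n" for k m
    by (rule test_function_derivs(2)[OF E[OF that]])
  have C: "\<forall>F\<in>{?H, ?Ht, ?Hu, ?Huu}. continuous_on ({0..T} \<times> {0..1}) (\<lambda>(t, u). F t u)"
    using continuous_on_sum_products[of n "{0..T}" b "{0..1}" E] continuous_on_sum_products[of n "{0..T}" b' "{0..1}" E]
      continuous_on_sum_products[of n "{0..T}" b "{0..1}" "\<lambda>k. (deriv ^^ 1) (E k)"]
      continuous_on_sum_products[of n "{0..T}" b "{0..1}" "\<lambda>k. (deriv ^^ 2) (E k)"] bc b' Ec[of _ 0] Ec[of _ 1] Ec[of _ 2]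
    by auto
  have "\<exists>K. compact K \<and> K \<subseteq> {0<..<1} \<and> (\<forall>x. x \<notin> K \<longrightarrow> E k x = 0)" if "k < n" for k
    using E[OF that] by (simp add: test_functions_def)
  then obtain K where K: "\<And>k. k < n \<Longrightarrow> compact (K k)" "\<And>k. k < n \<Longrightarrow> K k \<subseteq> {0<..<1}" "\<And>k x. k < n \<Longrightarrow> x \<notin> K k \<Longrightarrow> E k x = 0"
    by metis
  have "compact (\<Union>k<n. K k)" using K(1) by (intro compact_UN) auto
  moreover have "(\<Union>k<n. K k) \<subseteq> {0<..<1}" using K(2) by blast
  moreover have "\<forall>t\<in>{0..T}. \<forall>u\<in>{0..1} - (\<Union>k<n. K k). ?H t u = 0"
    using K(3) by (auto intro!: sum.neutral)
  ultimately have "\<exists>K. compact K \<and> K \<subseteq> {0<..<1} \<and> (\<forall>t\<in>{0..T}. \<forall>u\<in>{0..1} - K. ?H t u = 0)" by blast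
  moreover have "\<exists>Ht Hu Huu.
        (\<forall>t\<in>{0..T}. \<forall>u\<in>{0..1}.
           ((\<lambda>s. ?H s u) has_real_derivative Ht t u) (at t within {0..T}) \<and>
           (?H t has_real_derivative Hu t u) (at u within {0..1}) \<and>
           (Hu t has_real_derivative Huu t u) (at u within {0..1})) \<and>
        (\<forall>F\<in>{?H, Ht, Hu, Huu}. continuous_on ({0..T} \<times> {0..1}) (\<lambda>(t, u). F t u))"
    by (rule exI[of _ ?Ht], rule exI[of _ ?Hu], rule exI[of _ ?Huu], intro conjI ballI D1 D2 D3 C[rule_format])
  ultimately show "?H \<in> space_time_tests T" unfolding space_time_tests_def by blast
qed

section \<open>Lower bound for the dynamical rate function\<close>

abbreviation (in -) time_leb :: "real \<Rightarrow> real measure" where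
  "time_leb T \<equiv> restrict_space lborel {0..T}"

lemma (in -) finite_measure_time_leb: "finite_measure (time_leb T)"
  by (rule finite_measureI) (simp add: emeasure_restrict_space emeasure_lborel_Icc_eq)

lemma (in -) set_integral_time_leb: "(LINT s:{0..T}|lborel. f s) = (LINT s|time_leb T. (f s :: real))"
  by (simp add: set_lebesgue_integral_def integral_restrict_space)

lemma (in -) continuous_measurable_time_leb:
  assumes "continuous_on {0..T} (f :: real \<Rightarrow> real)"
  shows "f \<in> borel_measurable (time_leb T)"
proof -
  have eq: "sets (time_leb T) = sets (restrict_space borel {0..T})" by (intro sets_restrict_space_cong) simp
  show ?thesis
    unfolding measurable_cong_sets[OF eq refl] by (rule borel_measurable_continuous_on_restrict[OF assms])
qed

lemma (in -) continuous_sqint_time_leb: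
  assumes "continuous_on {0..T} (f :: real \<Rightarrow> real)"
  shows "f \<in> sqint (time_leb T)"
proof -
  have "bounded (f ` {0..T})" by (intro compact_imp_bounded compact_continuous_image assms) simp
  then obtain B where "\<forall>x\<in>{0..T}. \<bar>f x\<bar> \<le> B" by (auto simp: bounded_iff)
  then show ?thesis
    by (intro sqint_bounded[where B=B] finite_measure_time_leb continuous_measurable_time_leb assms) (auto simp: space_restrict_space)
qed

lemma (in -) sqint_integrable:
  assumes "finite_measure M" "f \<in> sqint M"
  shows "integrable M f"
  using sqint_mult_integrable[OF assms(2) sqint_bounded[OF assms(1), of "\<lambda>_. 1" 1]] by simp

lemma (in -) continuous_integrable_time_leb:
  "continuous_on {0..T} (f :: real \<Rightarrow> real) \<Longrightarrow> integrable (time_leb T) f"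
  by (rule sqint_integrable[OF finite_measure_time_leb continuous_sqint_time_leb])

lemma (in -) ip_uniform_tendsto:
  assumes M: "finite_measure M" and f: "\<And>n. f n \<in> sqint M" and g: "g \<in> sqint M"
    and le: "\<And>n x. x \<in> space M \<Longrightarrow> \<bar>f n x - g x\<bar> \<le> \<epsilon> n" and lim: "\<epsilon> \<longlonglongrightarrow> 0"
  shows "(\<lambda>n. nsq M (\<lambda>x. f n x - g x)) \<longlonglongrightarrow> 0"
proof (rule tendsto_sandwich[of "\<lambda>_. 0" _ _ "\<lambda>n. (\<epsilon> n)\<^sup>2 * measure M (space M)"])
  show "\<forall>\<^sub>F n in sequentially. 0 \<le> nsq M (\<lambda>x. f n x - g x)"
    by (simp add: ip_nonneg)
  show "\<forall>\<^sub>F n in sequentially. nsq M (\<lambda>x. f n x - g x) \<le> (\<epsilon> n)\<^sup>2 * measure M (space M)"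
  proof (rule always_eventually, rule allI)
    fix n
    have "nsq M (\<lambda>x. f n x - g x) \<le> (LINT x|M. (\<epsilon> n)\<^sup>2)"
      unfolding ip_def
    proof (rule integral_mono)
      show "integrable M (\<lambda>x. (f n x - g x) * (f n x - g x))" by (intro sqint_mult_integrable sqint_diff f g)
      show "integrable M (\<lambda>x. (\<epsilon> n)\<^sup>2)" by (rule finite_measure.integrable_const[OF M])
      fix x assume "x \<in> space M"
      then have "\<bar>f n x - g x\<bar>\<^sup>2 \<le> (\<epsilon> n)\<^sup>2" by (intro power_mono le) auto
      then show "(f n x - g x) * (f n x - g x) \<le> (\<epsilon> n)\<^sup>2" by (simp add: power2_eq_square)
    qed
    then show "nsq M (\<lambda>x. f n x - g x) \<le> (\<epsilon> n)\<^sup>2 * measure M (space M)" by (simp add: mult.commute)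
  qed
  have "(\<lambda>n. (\<epsilon> n)\<^sup>2 * measure M (space M)) \<longlonglongrightarrow> 0\<^sup>2 * measure M (space M)" by (intro tendsto_intros lim)
  then show "(\<lambda>n. (\<epsilon> n)\<^sup>2 * measure M (space M)) \<longlonglongrightarrow> 0" by simp
qed simp

lemma (in -) FTC_time_leb:
  assumes "0 \<le> T" "\<And>s. s \<in> {0..T} \<Longrightarrow> (f has_real_derivative f' s) (at s within {0..T})" "continuous_on {0..T} f'"
  shows "(LINT s|time_leb T. f' s) = f T - f 0"
proof -
  have "(f' has_integral (f T - f 0)) {0..T}"
    using assms by (intro fundamental_theorem_of_calculus) (auto simp: has_real_derivative_iff_has_vector_derivative)
  moreover have "set_integrable lborel {0..T} f'"
    unfolding set_integrable_def by (intro borel_integrable_compact assms) simp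
  ultimately show ?thesis
    using set_borel_integral_eq_integral(2)[of "{0..T}" f'] by (simp add: set_integral_time_leb[symmetric] integral_unique)
qed

text \<open>The eigenfunctions are not admissible tests, but their approximations by smooth functions are.\<close>

lemma rate_eigen_inequality:
  fixes p q :: real
  defines "\<Phi> \<equiv> stationary_profile \<gamma> p q"
  assumes T: "0 < T" and \<pi>: "\<pi> \<in> ac_paths \<gamma> p q T"
    and I: "\<And>H. H \<in> space_time_tests T \<Longrightarrow> J_functional \<gamma> T H \<pi> \<Phi> \<le> I"
    and b: "\<And>k s. k < n \<Longrightarrow> s \<in> {0..T} \<Longrightarrow> (b k has_real_derivative b' k s) (at s within {0..T})"
    and b': "\<And>k. k < n \<Longrightarrow> continuous_on {0..T} (b' k)"
    and bT: "\<And>k. k < n \<Longrightarrow> b k T = 0"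
  defines "P \<equiv> \<lambda>k s. pairing (\<pi> s) (ef k) - ip2 \<Phi> (ef k)"
  shows "(\<Sum>k<n. lam k * ip (time_leb T) (b k) (P k) - ip (time_leb T) (b' k) (P k) - lam k * ip (time_leb T) (b k) (b k)) \<le> I"
proof -
  let ?M = "time_leb T"
  note \<Phi> = stationary_profile[where p = p and q = q, folded \<Phi>_def]
  have "\<pi> \<in> paths T" using \<pi> by (simp add: ac_paths_def)
  then obtain a where a: "\<And>t. t \<in> {0..T} \<Longrightarrow> \<pi> t \<in> tv_ball a"
    and ac: "\<And>f. continuous_on {0..1} f \<Longrightarrow> continuous_on {0..T} (\<lambda>t. pairing (\<pi> t) f)"
    unfolding paths_iff by blast
  have as: "\<pi> t \<in> signed_measures" if "t \<in> {0..T}" for t using a[OF that] by (simp add: tv_ball_def)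
  obtain \<Psi> :: "real \<Rightarrow> real \<Rightarrow> real" where \<Psi>:
     "AE t in ?M. \<Psi> t \<in> sobolev \<gamma> \<and> \<Psi> t 0 = p \<and> \<Psi> t 1 = q \<and> \<pi> t = density_measure (\<Psi> t)"
     "(\<integral>\<^sup>+t. sobolev_norm_sq \<gamma> (\<Psi> t) \<partial>?M) < \<infinity>"
    using \<pi> unfolding ac_paths_def by blast
  have "\<exists>G. G \<in> test_functions \<and> energy (\<lambda>x. ef k x - G x) < 1 / real (Suc m)" for k m
    using test_functions_dense[OF ef_H0, of "1 / real (Suc m)" k] by auto
  then have "\<forall>m k. \<exists>G. G \<in> test_functions \<and> energy (\<lambda>x. ef k x - G x) < 1 / real (Suc m)" by (intro allI)
  then obtain E where "\<forall>m k. E m k \<in> test_functions \<and> energy (\<lambda>x. ef k x - E m k x) < 1 / real (Suc m)"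
    unfolding choice_iff by (rule exE)
  then have E: "E m k \<in> test_functions" "energy (\<lambda>x. ef k x - E m k x) < 1 / real (Suc m)" for m k
    by simp_all
  have E2: "\<exists>d B. c2c d B (E m k)" for m k using test_function_c2c[OF E(1)] by metis
  have EH: "E m k \<in> H0" for m k by (rule test_function_H0[OF E(1)])
  have Es: "E m k \<in> sobolev \<gamma>" for m k by (rule H0_sobolev[OF EH])
  have Ec: "continuous_on {0..1} (E m k)" for m k by (rule sobolev_continuous[OF Es])
  have Lc: "continuous_on {0..1} (frac_lap \<gamma> (E m k))" for m k using E2 frac_lap_continuous by blast
  have bc: "continuous_on {0..T} (b k)" if "k < n" for k
    by (rule DERIV_continuous_on) (use b[OF that] in auto)
  let ?Pm = "\<lambda>m k s. pairing (\<pi> s) (E m k) - ip2 \<Phi> (E m k)"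
  let ?Q = "\<lambda>m k s. pairing (\<pi> s) (frac_lap \<gamma> (E m k))"
  have Pc: "continuous_on {0..T} (P k)" for k unfolding P_def by (intro continuous_intros ac ef_continuous)
  have Pmc: "continuous_on {0..T} (?Pm m k)" for m k by (intro continuous_intros ac Ec)
  have Qc: "continuous_on {0..T} (?Q m k)" for m k by (intro ac Lc)
  note sq = continuous_sqint_time_leb
  have J: "(\<Sum>k<n. - ip ?M (?Pm m k) (b' k) - ip ?M (?Q m k) (b k))
     - (\<Sum>j<n. \<Sum>k<n. ip ?M (b j) (b k) * en (E m j) (E m k)) \<le> I" for m
  proof -
    let ?H = "\<lambda>s u. \<Sum>k<n. b k s * E m k u"
    note Ht = sum_space_time_test[where T = T and n = n and E = "E m" and b = b and b' = b', OF T E(1) b b']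
    have HT: "pairing (\<pi> T) (?H T) = 0" using bT by (simp add: pairing_zero)
    \<comment> \<open>As the coefficients vanish at the final time, their initial values are minus
      the integrals of their derivatives. The initial term of the functional thus merges with the
      time integral and recentres the pairings at the stationary profile.\<close>
    have b0: "b k 0 = - (LINT s|?M. b' k s)" if "k < n" for k
      using FTC_time_leb[of T "b k" "b' k"] T b[OF that] b'[OF that] bT[OF that] by simp
    have \<Phi>s: "\<Phi> \<in> sqint unit_leb" by (rule sobolev_sqint[OF \<Phi>(1)])
    have "(LINT u|unit_leb. \<Phi> u * ?H 0 u) = ip2 \<Phi> (?H 0)" by (simp add: ip_def)
    also have "\<dots> = (\<Sum>k<n. b k 0 * ip2 \<Phi> (E m k))"
      by (subst ip_sum_right) (auto simp: ip_cmult_right sqint_cmult continuous_sqint[OF Ec] \<Phi>s)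
    also have "\<dots> = - (\<Sum>k<n. ip2 \<Phi> (E m k) * (LINT s|?M. b' k s))"
      using b0 by (simp add: sum_negf[symmetric] mult.commute)
    finally have H0: "(LINT u|unit_leb. \<Phi> u * ?H 0 u) = - (\<Sum>k<n. ip2 \<Phi> (E m k) * (LINT s|?M. b' k s))" .
    have "(LINT s:{0..T}|lborel. pairing (\<pi> s) (\<lambda>u. time_deriv T ?H s u + frac_lap \<gamma> (?H s) u)) =
        (LINT s|?M. (\<Sum>k<n. b' k s * pairing (\<pi> s) (E m k) + b k s * ?Q m k s))"
      unfolding set_integral_time_leb
    proof (rule Bochner_Integration.integral_cong[OF refl])
      fix s assume "s \<in> space ?M"
      then have s: "s \<in> {0..T}" by (simp add: space_restrict_space)
      have "pairing (\<pi> s) (\<lambda>u. time_deriv T ?H s u + frac_lap \<gamma> (?H s) u) =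
        pairing (\<pi> s) (\<lambda>u. \<Sum>k<n. b' k s * E m k u + b k s * frac_lap \<gamma> (E m k) u)"
        using Ht(2)[OF _ _ _ s] frac_lap_sum[of n "E m" _ "\<lambda>k. b k s"] E2 by (intro pairing_cong) (simp add: sum.distrib)
      also have "\<dots> = (\<Sum>k<n. pairing (\<pi> s) (\<lambda>u. b' k s * E m k u + b k s * frac_lap \<gamma> (E m k) u))"
        by (intro pairing_sum as s continuous_intros Ec Lc)
      also have "\<dots> = (\<Sum>k<n. b' k s * pairing (\<pi> s) (E m k) + b k s * ?Q m k s)"
        by (intro sum.cong refl, subst pairing_add[OF as[OF s]]) (auto intro!: continuous_intros Ec Lc simp: pairing_cmult)
      finally show "pairing (\<pi> s) (\<lambda>u. time_deriv T ?H s u + frac_lap \<gamma> (?H s) u) = (\<Sum>k<n. b' k s * pairing (\<pi> s) (E m k) + b k s * ?Q m k s)" .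
    qed
    also have "\<dots> = (\<Sum>k<n. LINT s|?M. b' k s * pairing (\<pi> s) (E m k) + b k s * ?Q m k s)"
      using b' bc by (intro Bochner_Integration.integral_sum continuous_integrable_time_leb continuous_intros ac Ec Lc) auto
    also have "\<dots> = (\<Sum>k<n. (ip ?M (?Pm m k) (b' k) + ip2 \<Phi> (E m k) * (LINT s|?M. b' k s)) + ip ?M (?Q m k) (b k))"
    proof (intro sum.cong refl)
      fix k assume "k \<in> {..<n}"
      then have k: "k < n" by simp
      have i: "integrable ?M (\<lambda>s. ?Pm m k s * b' k s)" "integrable ?M (\<lambda>s. ip2 \<Phi> (E m k) * b' k s)" "integrable ?M (\<lambda>s. ?Q m k s * b k s)"
        by (intro continuous_integrable_time_leb continuous_intros Pmc b' k Qc bc)+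
      have "(LINT s|?M. b' k s * pairing (\<pi> s) (E m k) + b k s * ?Q m k s) = (LINT s|?M. (?Pm m k s * b' k s + ip2 \<Phi> (E m k) * b' k s) + ?Q m k s * b k s)"
        by (intro Bochner_Integration.integral_cong refl) (simp add: algebra_simps)
      also have "\<dots> = (ip ?M (?Pm m k) (b' k) + ip2 \<Phi> (E m k) * (LINT s|?M. b' k s)) + ip ?M (?Q m k) (b k)"
        unfolding ip_def[of ?M] by (subst Bochner_Integration.integral_add[OF Bochner_Integration.integrable_add[OF i(1,2)] i(3)],
            subst Bochner_Integration.integral_add[OF i(1,2)]) simp
      finally show "(LINT s|?M. b' k s * pairing (\<pi> s) (E m k) + b k s * ?Q m k s) = (ip ?M (?Pm m k) (b' k) + ip2 \<Phi> (E m k) * (LINT s|?M. b' k s)) + ip ?M (?Q m k) (b k)" .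
    qed
    finally have M1: "(LINT s:{0..T}|lborel. pairing (\<pi> s) (\<lambda>u. time_deriv T ?H s u + frac_lap \<gamma> (?H s) u)) =
      (\<Sum>k<n. (ip ?M (?Pm m k) (b' k) + ip2 \<Phi> (E m k) * (LINT s|?M. b' k s)) + ip ?M (?Q m k) (b k))" .
    have "(LINT s:{0..T}|lborel. enn2real (seminorm_sq \<gamma> (?H s))) = (LINT s|?M. (\<Sum>j<n. \<Sum>k<n. (b j s * b k s) * en (E m j) (E m k)))"
      unfolding set_integral_time_leb
    proof (rule Bochner_Integration.integral_cong[OF refl])
      fix s
      have bEs: "(\<lambda>u. b k s * E m k u) \<in> sobolev \<gamma>" for k by (intro sobolev_cmult Es)
      have Hs: "?H s \<in> sobolev \<gamma>" by (intro sobolev_sum bEs)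
      have "enn2real (seminorm_sq \<gamma> (?H s)) = energy (?H s)" by (simp add: seminorm_sq_en[OF Hs] en_nonneg)
      also have "\<dots> = (\<Sum>j<n. en (\<lambda>u. b j s * E m j u) (?H s))" by (intro en_sum_left bEs Hs)
      also have "\<dots> = (\<Sum>j<n. \<Sum>k<n. en (\<lambda>u. b j s * E m j u) (\<lambda>u. b k s * E m k u))"
        by (intro sum.cong refl en_sum_right bEs)
      also have "\<dots> = (\<Sum>j<n. \<Sum>k<n. (b j s * b k s) * en (E m j) (E m k))"
        by (simp add: en_cmult_left en_cmult_right mult.assoc)
      finally show "enn2real (seminorm_sq \<gamma> (?H s)) = (\<Sum>j<n. \<Sum>k<n. (b j s * b k s) * en (E m j) (E m k))" .
    qed
    also have "\<dots> = (\<Sum>j<n. LINT s|?M. (\<Sum>k<n. (b j s * b k s) * en (E m j) (E m k)))"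
      using bc by (intro Bochner_Integration.integral_sum continuous_integrable_time_leb continuous_intros) auto
    also have "\<dots> = (\<Sum>j<n. \<Sum>k<n. LINT s|?M. (b j s * b k s) * en (E m j) (E m k))"
      using bc by (intro sum.cong refl Bochner_Integration.integral_sum continuous_integrable_time_leb continuous_intros) auto
    also have "\<dots> = (\<Sum>j<n. \<Sum>k<n. ip ?M (b j) (b k) * en (E m j) (E m k))"
      by (simp add: ip_def)
    finally have M2: "(LINT s:{0..T}|lborel. enn2real (seminorm_sq \<gamma> (?H s))) = (\<Sum>j<n. \<Sum>k<n. ip ?M (b j) (b k) * en (E m j) (E m k))" .
    have "J_functional \<gamma> T ?H \<pi> \<Phi> \<le> I" by (intro I Ht(1))
    then show ?thesis
      unfolding J_functional_def HT H0 M1 M2 by (simp add: sum.distrib sum_subtractf sum_negf)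
  qed
  have l0: "(\<lambda>m. 1 / real (Suc m)) \<longlonglongrightarrow> 0" using LIMSEQ_inverse_real_of_nat by (simp add: inverse_eq_divide)
  have dH: "(\<lambda>x. ef k x - E m k x) \<in> H0" for m k by (intro H0_diff ef_H0 EH)
  have sup: "\<bar>ef k x - E m k x\<bar> \<le> sqrt (morrey * (1 / real (Suc m)))" if "x \<in> {0..1}" for k m x
    using H0_abs_bound[OF dH that, of k m] E(2)[of k m] morrey_pos
    by (smt (verit) mult_left_mono real_sqrt_le_mono)
  have sup0: "(\<lambda>m. sqrt (morrey * (1 / real (Suc m)))) \<longlonglongrightarrow> 0"
    using tendsto_real_sqrt[OF tendsto_mult_left[OF l0, of morrey]] by simp
  have \<Phi>lim: "(\<lambda>m. ip2 \<Phi> (E m k)) \<longlonglongrightarrow> ip2 \<Phi> (ef k)" for k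
  proof -
    have "(\<lambda>m. nsq unit_leb (\<lambda>x. E m k x - ef k x)) \<longlonglongrightarrow> 0"
      by (rule ip_uniform_tendsto[OF finite_measure_unit_leb continuous_sqint[OF Ec] ef_sqint _ sup0])
        (use sup in \<open>auto simp: abs_minus_commute\<close>)
    from ip_tendsto[OF continuous_sqint[OF Ec] ef_sqint sobolev_sqint[OF \<Phi>(1)] this]
    show ?thesis by (simp add: ip_commute[of _ \<Phi>])
  qed
  \<comment> \<open>Convergence is uniform in time: the path stays in one total variation ball, and
    small energy in \<open>H0\<close> makes the approximation of the eigenfunction uniformly
    small.\<close>
  have Plim: "(\<lambda>m. ip ?M (?Pm m k) (b' k)) \<longlonglongrightarrow> ip ?M (P k) (b' k)" if k: "k < n" for k
  proof (rule ip_tendsto[OF sq[OF Pmc] sq[OF Pc] sq[OF b'[OF k]]])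
    let ?e = "\<lambda>m. real a * sqrt (morrey * (1 / real (Suc m))) + \<bar>ip2 \<Phi> (E m k) - ip2 \<Phi> (ef k)\<bar>"
    show "(\<lambda>m. nsq ?M (\<lambda>s. ?Pm m k s - P k s)) \<longlonglongrightarrow> 0"
    proof (rule ip_uniform_tendsto[OF finite_measure_time_leb sq[OF Pmc] sq[OF Pc]])
      fix m s assume "s \<in> space ?M"
      then have s: "s \<in> {0..T}" by (simp add: space_restrict_space)
      have "\<bar>pairing (\<pi> s) (\<lambda>x. ef k x - E m k x)\<bar> \<le> real a * sqrt (morrey * (1 / real (Suc m)))"
        by (intro pairing_bound a s continuous_intros ef_continuous Ec sup)
      then have "\<bar>pairing (\<pi> s) (ef k) - pairing (\<pi> s) (E m k)\<bar> \<le> real a * sqrt (morrey * (1 / real (Suc m)))"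
        by (simp add: pairing_diff[OF as[OF s] ef_continuous Ec])
      then show "\<bar>?Pm m k s - P k s\<bar> \<le> ?e m" unfolding P_def by linarith
    next
      have "?e \<longlonglongrightarrow> real a * 0 + \<bar>ip2 \<Phi> (ef k) - ip2 \<Phi> (ef k)\<bar>"
        by (intro tendsto_intros sup0 \<Phi>lim)
      then show "?e \<longlonglongrightarrow> 0" by simp
    qed
  qed
  define N where "N = enn2real (\<integral>\<^sup>+t. sobolev_norm_sq \<gamma> (\<Psi> t) \<partial>?M)"
  have N: "(\<integral>\<^sup>+t. sobolev_norm_sq \<gamma> (\<Psi> t) \<partial>?M) = ennreal N" "0 \<le> N"
    using \<Psi>(2) by (auto simp: N_def less_top)
  \<comment> \<open>The Laplacians of the approximants are not controlled in sup norm, so the total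
    variation bound is of no use here. For almost every time the density has finite energy, and
    integration by parts moves the problem to the energy form; Cauchy-Schwarz and the integrated
    energy of the path give a rate in L^2 over time.\<close>
  have Qlim: "(\<lambda>m. ip ?M (?Q m k) (b k)) \<longlonglongrightarrow> ip ?M (\<lambda>s. - lam k * P k s) (b k)" if k: "k < n" for k
  proof -
    have gc: "continuous_on {0..T} (\<lambda>s. - lam k * P k s)" by (intro continuous_intros Pc)
    show ?thesis
    proof (rule ip_tendsto[OF sq[OF Qc] sq[OF gc] sq[OF bc[OF k]]])
      let ?f = "\<lambda>m s. ?Q m k s - - lam k * P k s"
      have fc: "continuous_on {0..T} (?f m)" for m by (intro continuous_intros Qc Pc)
      have le: "nsq ?M (?f m) \<le> N * (1 / real (Suc m))" for m
      proof -
        have ae: "AE s in ?M. ennreal (real (Suc m)) * ennreal ((?f m s)\<^sup>2) \<le> sobolev_norm_sq \<gamma> (\<Psi> s)"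
          using \<Psi>(1)
        proof eventually_elim
          case (elim s)
          have \<Psi>s: "\<Psi> s \<in> sobolev \<gamma>" and \<pi>s: "\<pi> s = density_measure (\<Psi> s)" using elim by auto
          have dif: "(\<lambda>x. \<Psi> s x - \<Phi> x) \<in> H0" using elim \<Phi> by (simp add: H0_def sobolev_diff)
          obtain d B where c: "c2c d B (E m k)" using E2 by blast
          have "?Q m k s = ip2 (\<Psi> s) (frac_lap \<gamma> (E m k))"
            unfolding \<pi>s by (rule pairing_density_ip[OF sobolev_sqint[OF \<Psi>s] continuous_sqint[OF Lc]])
          also have "\<dots> = - en (\<Psi> s) (E m k)" by (rule ip_frac_lap[OF \<Psi>s c])
          finally have Qe: "?Q m k s = - en (\<Psi> s) (E m k)" .
          have "P k s = ip2 (\<Psi> s) (ef k) - ip2 \<Phi> (ef k)"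
            unfolding P_def \<pi>s by (subst pairing_density_ip[OF sobolev_sqint[OF \<Psi>s] ef_sqint]) simp
          also have "\<dots> = ip2 (ef k) (\<lambda>x. \<Psi> s x - \<Phi> x)"
            by (subst ip_diff_right[OF sobolev_sqint[OF \<Psi>s] sobolev_sqint[OF \<Phi>(1)] ef_sqint]) (simp add: ip_commute)
          finally have "lam k * P k s = en (ef k) (\<lambda>x. \<Psi> s x - \<Phi> x)" by (simp add: en_ef[OF dif])
          also have "\<dots> = en (ef k) (\<Psi> s) - en (ef k) \<Phi>" by (rule en_diff_right[OF \<Psi>s \<Phi>(1) ef_sobolev])
          \<comment> \<open>This is where harmonicity enters: the coordinate of the fluctuation from
            the profile can be computed from the density alone.\<close>
          also have "en (ef k) \<Phi> = 0" using \<Phi>(4)[OF ef_H0] by (simp add: en_commute)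
          finally have Pe: "lam k * P k s = en (\<Psi> s) (ef k)" by (simp add: en_commute)
          have "?f m s = en (\<Psi> s) (\<lambda>x. ef k x - E m k x)"
            using Qe Pe by (simp add: en_diff_right[OF ef_sobolev Es \<Psi>s])
          then have "(?f m s)\<^sup>2 \<le> energy (\<Psi> s) * energy (\<lambda>x. ef k x - E m k x)"
            using en_Cauchy_Schwarz[OF \<Psi>s H0_sobolev[OF dH]] by simp
          also have "\<dots> \<le> energy (\<Psi> s) * (1 / real (Suc m))"
            using E(2)[of k m] en_nonneg by (intro mult_left_mono) auto
          finally have "real (Suc m) * (?f m s)\<^sup>2 \<le> energy (\<Psi> s)" by (simp add: field_simps)
          then have "ennreal (real (Suc m)) * ennreal ((?f m s)\<^sup>2) \<le> ennreal (energy (\<Psi> s))"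
            by (subst ennreal_mult[symmetric]) (auto intro: ennreal_leI)
          also have "\<dots> \<le> sobolev_norm_sq \<gamma> (\<Psi> s)"
            unfolding sobolev_norm_sq_def seminorm_sq_en[OF \<Psi>s] by simp
          finally show ?case .
        qed
        have "ennreal (real (Suc m)) * ennreal (nsq ?M (?f m)) = ennreal (real (Suc m)) * (\<integral>\<^sup>+s. ennreal ((?f m s)\<^sup>2) \<partial>?M)"
          by (simp only: nn_integral_sq_eq_ip[OF sq[OF fc]])
        also have "\<dots> = (\<integral>\<^sup>+s. ennreal (real (Suc m)) * ennreal ((?f m s)\<^sup>2) \<partial>?M)"
        proof (rule nn_integral_cmult[symmetric])
          show "(\<lambda>s. ennreal ((?f m s)\<^sup>2)) \<in> borel_measurable ?M"
            by (rule measurable_compose[OF continuous_measurable_time_leb[OF fc[of m]], of "\<lambda>x. ennreal (x\<^sup>2)" borel]) measurable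
        qed
        also have "\<dots> \<le> (\<integral>\<^sup>+s. sobolev_norm_sq \<gamma> (\<Psi> s) \<partial>?M)" by (rule nn_integral_mono_AE[OF ae])
        finally have "ennreal (real (Suc m) * nsq ?M (?f m)) \<le> ennreal N"
          using N(1) by (subst ennreal_mult) (auto simp: ip_nonneg)
        then have "real (Suc m) * nsq ?M (?f m) \<le> N" using N(2) by (simp add: ennreal_le_iff)
        then show ?thesis by (simp add: field_simps)
      qed
      show "(\<lambda>m. nsq ?M (?f m)) \<longlonglongrightarrow> 0"
      proof (rule tendsto_sandwich[of "\<lambda>_. 0"])
        show "(\<lambda>m. N * (1 / real (Suc m))) \<longlonglongrightarrow> 0" using tendsto_mult_left[OF l0, of N] by simp
        show "\<forall>\<^sub>F m in sequentially. nsq ?M (?f m) \<le> N * (1 / real (Suc m))" using le by (intro always_eventually allI)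
        show "\<forall>\<^sub>F m in sequentially. 0 \<le> nsq ?M (?f m)" by (simp add: ip_nonneg)
      qed simp
    qed
  qed
  have Elim: "(\<lambda>m. en (E m j) (E m k)) \<longlonglongrightarrow> (if j = k then lam k else 0)" for j k
  proof -
    have d0: "(\<lambda>m. nsq km (\<lambda>x. dd (E m i) x - dd (ef i) x)) \<longlonglongrightarrow> 0" for i
    proof (rule tendsto_sandwich[of "\<lambda>_. 0" _ _ "\<lambda>m. 1 / real (Suc m)"])
      have "nsq km (\<lambda>x. dd (E m i) x - dd (ef i) x) = energy (\<lambda>x. ef i x - E m i x)" for m
        unfolding en_def dd_diff ip_def by (intro Bochner_Integration.integral_cong refl) (simp add: algebra_simps)
      then show "\<forall>\<^sub>F m in sequentially. nsq km (\<lambda>x. dd (E m i) x - dd (ef i) x) \<le> 1 / real (Suc m)"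
        using E(2)[of i] by (intro always_eventually allI) (simp add: less_imp_le)
    qed (use l0 in \<open>auto simp: ip_nonneg\<close>)
    have "(\<lambda>m. ip km (dd (E m j)) (dd (ef k)) + ip km (dd (E m j)) (\<lambda>x. dd (E m k) x - dd (ef k) x)) \<longlonglongrightarrow> ip km (dd (ef j)) (dd (ef k)) + 0"
    proof (rule tendsto_add)
      show "(\<lambda>m. ip km (dd (E m j)) (dd (ef k))) \<longlonglongrightarrow> ip km (dd (ef j)) (dd (ef k))"
        by (rule ip_tendsto[OF sobolev_dd[OF Es] sobolev_dd[OF ef_sobolev] sobolev_dd[OF ef_sobolev] d0])
      have js: "(\<lambda>m. nsq km (dd (E m j))) \<longlonglongrightarrow> nsq km (dd (ef j))"
        by (rule ip_self_tendsto[OF sobolev_dd[OF Es] sobolev_dd[OF ef_sobolev] d0])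
      show "(\<lambda>m. ip km (dd (E m j)) (\<lambda>x. dd (E m k) x - dd (ef k) x)) \<longlonglongrightarrow> 0"
      proof (rule Lim_null_comparison)
        show "\<forall>\<^sub>F m in sequentially. norm (ip km (dd (E m j)) (\<lambda>x. dd (E m k) x - dd (ef k) x))
           \<le> sqrt (nsq km (dd (E m j))) * sqrt (nsq km (\<lambda>x. dd (E m k) x - dd (ef k) x))"
          unfolding real_norm_def
          by (intro always_eventually allI ip_Cauchy_Schwarz_sqrt sqint_diff sobolev_dd Es ef_sobolev)
        have "(\<lambda>m. sqrt (nsq km (dd (E m j))) * sqrt (nsq km (\<lambda>x. dd (E m k) x - dd (ef k) x)))
           \<longlonglongrightarrow> sqrt (nsq km (dd (ef j))) * sqrt 0"
          by (rule tendsto_mult[OF tendsto_real_sqrt[OF js] tendsto_real_sqrt[OF d0]])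
        then show "(\<lambda>m. sqrt (nsq km (dd (E m j))) * sqrt (nsq km (\<lambda>x. dd (E m k) x - dd (ef k) x))) \<longlonglongrightarrow> 0" by simp
      qed
    qed
    moreover have "ip km (dd (E m j)) (dd (ef k)) + ip km (dd (E m j)) (\<lambda>x. dd (E m k) x - dd (ef k) x) = en (E m j) (E m k)" for m
      unfolding en_def by (subst ip_diff_right[OF sobolev_dd[OF Es] sobolev_dd[OF ef_sobolev] sobolev_dd[OF Es]]) simp
    moreover have "ip km (dd (ef j)) (dd (ef k)) = (if j = k then lam k else 0)"
      using en_ef_ef[of j k] by (auto simp: en_def)
    ultimately show ?thesis by simp
  qed
  have "(\<lambda>m. (\<Sum>k<n. - ip ?M (?Pm m k) (b' k) - ip ?M (?Q m k) (b k))
     - (\<Sum>j<n. \<Sum>k<n. ip ?M (b j) (b k) * en (E m j) (E m k))) \<longlonglongrightarrow>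
     (\<Sum>k<n. - ip ?M (P k) (b' k) - ip ?M (\<lambda>s. - lam k * P k s) (b k))
     - (\<Sum>j<n. \<Sum>k<n. ip ?M (b j) (b k) * (if j = k then lam k else 0))"
    by (intro tendsto_diff tendsto_sum tendsto_minus tendsto_mult_left Plim Qlim Elim) auto
  then have "(\<Sum>k<n. - ip ?M (P k) (b' k) - ip ?M (\<lambda>s. - lam k * P k s) (b k))
     - (\<Sum>j<n. \<Sum>k<n. ip ?M (b j) (b k) * (if j = k then lam k else 0)) \<le> I"
    by (rule LIMSEQ_le_const2) (use J in blast)
  moreover have "(\<Sum>j<n. \<Sum>k<n. ip ?M (b j) (b k) * (if j = k then lam k else 0)) = (\<Sum>k<n. lam k * nsq ?M (b k))"
  proof (intro sum.cong refl)
    fix j assume j: "j \<in> {..<n}"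
    have "(\<Sum>k<n. ip ?M (b j) (b k) * (if j = k then lam k else 0)) = (\<Sum>k<n. if j = k then ip ?M (b j) (b k) * lam k else 0)"
      by (intro sum.cong refl) simp
    also have "\<dots> = lam j * nsq ?M (b j)" using j by (subst sum.delta') auto
    finally show "(\<Sum>k<n. ip ?M (b j) (b k) * (if j = k then lam k else 0)) = lam j * nsq ?M (b j)" .
  qed
  moreover have "ip ?M (\<lambda>s. - lam k * P k s) (b k) = - lam k * ip ?M (b k) (P k)" for k
    by (simp only: ip_cmult_left ip_commute[of _ "P k" "b k"])
  ultimately show ?thesis
    by (simp add: sum_subtractf sum_negf sum.distrib ip_commute[of _ "P _" "b' _"] algebra_simps)
qed

text \<open>No null set contains an interval. This finds times just before the horizon at which the
  path has a density of finite energy.\<close>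

lemma (in -) AE_lborel_exists_in_interval:
  assumes "AE x in lborel. P x" "(a::real) < b"
  obtains x where "a < x" "x < b" "P x"
proof -
  obtain N where N: "{x. \<not> P x} \<subseteq> N" "emeasure lborel N = 0" "N \<in> sets lborel"
    using assms(1) by (auto elim!: AE_E)
  have "\<exists>x\<in>{a<..<b}. P x"
  proof (rule ccontr)
    assume "\<not> ?thesis"
    then have "{a<..<b} \<subseteq> N" using N(1) by auto
    then have "emeasure lborel {a<..<b} \<le> emeasure lborel N" using N(3) by (intro emeasure_mono)
    then show False using N(2) assms(2) by simp
  qed
  then show ?thesis using that by auto
qed

text \<open>\<open>h = -cut'\<close> is an approximate identity at \<open>t\<close> from the left.\<close>

lemma (in -) time_cutoff:
  assumes "0 \<le> t0" "t0 < t" "t \<le> T"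
  obtains cut h where "\<forall>s\<in>{0..T}. (cut has_real_derivative (- h s)) (at s within {0..T})"
    "continuous_on UNIV h" "\<forall>s. 0 \<le> h s" "\<forall>s. s \<notin> {t0..t} \<longrightarrow> h s = 0" "(LINT s|time_leb T. h s) = 1"
    "\<forall>s\<in>{0..T}. 0 \<le> cut s \<and> cut s \<le> 1" "\<forall>s\<in>{t..T}. cut s = 0"
proof -
  \<comment> \<open>A parabola that is positive exactly on the open interval from \<open>t0\<close>
    to \<open>t\<close>; dividing by its total mass \<open>A T\<close> gives the approximate
    identity, and one minus its normalised primitive is the cutoff.\<close>
  define k where "k s = max 0 ((s - t0) * (t - s))" for s :: real
  have kc: "continuous_on S k" for S unfolding k_def by (intro continuous_intros)
  have k0: "0 \<le> k s" for s by (simp add: k_def)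
  have kz: "k s = 0" if "s \<notin> {t0..t}" for s
  proof -
    have "(s - t0) * (t - s) \<le> 0" using that assms(2) by (auto intro: mult_nonpos_nonneg mult_nonneg_nonpos)
    then show ?thesis by (simp add: k_def)
  qed
  define A where "A s = integral {0..s} k" for s
  have kI: "k integrable_on {a..b}" for a b by (intro integrable_continuous_real kc)
  have A: "(A has_real_derivative k s) (at s within {0..T})" if "s \<in> {0..T}" for s
    unfolding A_def by (rule integral_has_real_derivative[OF kc that])
  have A0: "A 0 = 0" by (simp add: A_def)
  have Amono: "A s \<le> A s'" if "s \<le> s'" for s s'
    unfolding A_def using that k0 by (intro integral_subset_le kI) auto
  have Aconst: "A s = A T" if "s \<in> {t..T}" for s
  proof -
    have "integral {0..s} k + integral {s..T} k = integral {0..T} k"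
      using that assms by (intro Henstock_Kurzweil_Integration.integral_combine kI) auto
    moreover have "integral {s..T} k = integral {s..T} (\<lambda>_. 0)"
    proof (rule integral_cong)
      fix x assume "x \<in> {s..T}"
      then have "(x - t0) * (t - x) \<le> 0" using that assms by (intro mult_nonneg_nonpos) auto
      then show "k x = 0" by (simp add: k_def)
    qed
    ultimately show ?thesis by (simp add: A_def)
  qed
  have Apos: "0 < A T"
  proof (rule ccontr)
    assume "\<not> 0 < A T"
    then have "integral {0..T} k = 0" using Amono[of 0 T] A0 assms by (simp add: A_def)
    moreover have "0 < T" using assms by simp
    ultimately have "\<forall>x\<in>{0..T}. k x = 0"
      using integral_eq_0_iff[OF kc, of 0 T] k0 by simp
    moreover have "(t0 + t) / 2 \<in> {0..T}" using assms by simp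
    ultimately have "k ((t0 + t) / 2) = 0" by blast
    moreover have "0 < ((t0 + t) / 2 - t0) * (t - (t0 + t) / 2)" using assms by (intro mult_pos_pos) auto
    ultimately show False by (simp add: k_def)
  qed
  show ?thesis
  proof (rule that[of "\<lambda>s. 1 - A s / A T" "\<lambda>s. k s / A T"])
    show "\<forall>s\<in>{0..T}. ((\<lambda>s. 1 - A s / A T) has_real_derivative - (k s / A T)) (at s within {0..T})"
      using Apos by (auto intro!: derivative_eq_intros A)
    show "continuous_on UNIV (\<lambda>s. k s / A T)" using Apos by (intro continuous_intros kc) auto
    show "\<forall>s. 0 \<le> k s / A T" using k0 Apos by simp
    show "\<forall>s. s \<notin> {t0..t} \<longrightarrow> k s / A T = 0" using kz by simp
    have "(LINT s|time_leb T. k s) = A T - A 0"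
      using assms by (intro FTC_time_leb A kc) auto
    then show "(LINT s|time_leb T. k s / A T) = 1" using Apos A0 by simp
    show "\<forall>s\<in>{0..T}. 0 \<le> 1 - A s / A T \<and> 1 - A s / A T \<le> 1"
    proof
      fix s assume "s \<in> {0..T}"
      then show "0 \<le> 1 - A s / A T \<and> 1 - A s / A T \<le> 1"
        using Apos Amono[of s T] Amono[of 0 s] A0 by simp
    qed
    show "\<forall>s\<in>{t..T}. 1 - A s / A T = 0"
    proof
      fix s assume "s \<in> {t..T}"
      then have "A s = A T" by (rule Aconst)
      then show "1 - A s / A T = 0" using Apos by simp
    qed
  qed
qed

text \<open>The coefficients solve the backward equation a' = lam a up to a cutoff. In the
  inequality for the eigenmodes the drift then cancels and only the derivative of the cutoff
  survives, which concentrates at time t, while the quadratic cost is at most half the square of the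
  final value.\<close>

lemma rate_eigen_pointwise:
  fixes p q :: real
  defines "\<Phi> \<equiv> stationary_profile \<gamma> p q"
  assumes T: "0 < T" and \<pi>: "\<pi> \<in> ac_paths \<gamma> p q T"
    and I: "\<And>H. H \<in> space_time_tests T \<Longrightarrow> J_functional \<gamma> T H \<pi> \<Phi> \<le> I"
    and t: "0 < t" "t \<le> T"
  defines "P \<equiv> \<lambda>k s. pairing (\<pi> s) (ef k) - ip2 \<Phi> (ef k)"
  shows "(\<Sum>k<n. g k * P k t) - (\<Sum>k<n. (g k)\<^sup>2) / 2 \<le> I"
proof (rule field_le_epsilon)
  fix \<epsilon> :: real assume \<epsilon>: "0 < \<epsilon>"
  let ?M = "time_leb T"
  have "\<pi> \<in> paths T" using \<pi> by (simp add: ac_paths_def)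
  then have ac: "\<And>f. continuous_on {0..1} f \<Longrightarrow> continuous_on {0..T} (\<lambda>t. pairing (\<pi> t) f)"
    unfolding paths_iff by blast
  have Pc: "continuous_on {0..T} (P k)" for k unfolding P_def by (intro continuous_intros ac ef_continuous)
  define a where "a k s = g k * exp (lam k * (s - t))" for k s
  have aD: "(a k has_real_derivative lam k * a k s) (at s within S)" for k s S
    unfolding a_def by (auto intro!: derivative_eq_intros)
  have ac': "continuous_on S (a k)" for k S unfolding a_def by (intro continuous_intros)
  define f where "f s = (\<Sum>k<n. a k s * P k s)" for s
  have fc: "continuous_on {0..T} f" unfolding f_def by (intro continuous_intros ac' Pc)
  have ft: "f t = (\<Sum>k<n. g k * P k t)" by (simp add: f_def a_def)
  obtain \<delta> where \<delta>: "0 < \<delta>" "\<And>s. s \<in> {0..T} \<Longrightarrow> dist s t < \<delta> \<Longrightarrow> dist (f s) (f t) < \<epsilon>"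
    using fc \<epsilon> t unfolding continuous_on_iff by (metis atLeastAtMost_iff less_imp_le)
  define t0 where "t0 = max 0 (t - \<delta> / 2)"
  have t0: "0 \<le> t0" "t0 < t" "t - t0 < \<delta>" using t \<delta>(1) by (auto simp: t0_def)
  obtain cut h where cut0: "\<forall>s\<in>{0..T}. (cut has_real_derivative (- h s)) (at s within {0..T})"
    "continuous_on UNIV h" "\<forall>s. 0 \<le> h s" "\<forall>s. s \<notin> {t0..t} \<longrightarrow> h s = 0" "(LINT s|time_leb T. h s) = 1"
    "\<forall>s\<in>{0..T}. 0 \<le> cut s \<and> cut s \<le> 1" "\<forall>s\<in>{t..T}. cut s = 0"
    by (rule time_cutoff[OF t0(1,2) t(2)])
  note cut = cut0(1)[rule_format] cut0(2) cut0(3-4)[rule_format] cut0(5) cut0(6-7)[rule_format]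
  have hc: "continuous_on S h" for S using cut(2) continuous_on_subset by blast
  have cutc: "continuous_on {0..T} cut" by (rule DERIV_continuous_on) (use cut(1) in auto)
  let ?b = "\<lambda>k s. cut s * a k s" and ?b' = "\<lambda>k s. - h s * a k s + cut s * (lam k * a k s)"
  have bD: "(?b k has_real_derivative ?b' k s) (at s within {0..T})" if "s \<in> {0..T}" for k s
    using that by (auto intro!: derivative_eq_intros cut(1) aD simp: algebra_simps)
  have b'c: "continuous_on {0..T} (?b' k)" for k by (intro continuous_intros hc cutc ac')
  have bc: "continuous_on {0..T} (?b k)" for k by (intro continuous_intros cutc ac')
  have hac: "continuous_on {0..T} (\<lambda>s. h s * a k s)" for k by (intro continuous_intros hc ac')
  have bT: "?b k T = 0" for k using cut(7)[of T] t by simp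
  have key: "(\<Sum>k<n. lam k * ip ?M (?b k) (P k) - ip ?M (?b' k) (P k) - lam k * nsq ?M (?b k)) \<le> I"
    unfolding P_def \<Phi>_def
    by (rule rate_eigen_inequality[OF T \<pi> I[unfolded \<Phi>_def] bD b'c bT])
  note sq = continuous_sqint_time_leb
  \<comment> \<open>The derivative of the coefficient is \<open>lam k\<close> times the coefficient
    minus \<open>h\<close> times the exponential, so the two terms with \<open>lam k\<close>
    cancel.\<close>
  have 1: "lam k * ip ?M (?b k) (P k) - ip ?M (?b' k) (P k) = ip ?M (\<lambda>s. h s * a k s) (P k)" for k
  proof -
    have "?b' k = (\<lambda>s. lam k * ?b k s - h s * a k s)" by (auto simp: algebra_simps)
    then have "ip ?M (?b' k) (P k) = lam k * ip ?M (?b k) (P k) - ip ?M (\<lambda>s. h s * a k s) (P k)"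
      by (simp only: ip_diff_left[OF sqint_cmult[OF sq[OF bc]] sq[OF hac] sq[OF Pc]] ip_cmult_left)
    then show ?thesis by simp
  qed
  \<comment> \<open>The square of the exponential integrates over [0, t] to (1 - exp(- 2 lam t)) /
    (2 lam); with the prefactor \<open>lam k\<close> this stays below one half, whatever the
    eigenvalue.\<close>
  have 2: "lam k * nsq ?M (?b k) \<le> (g k)\<^sup>2 / 2" for k
  proof -
    let ?F = "\<lambda>s. (g k)\<^sup>2 / 2 * exp (2 * lam k * (s - t))"
    have "lam k * nsq ?M (?b k) = (LINT s|?M. lam k * (?b k s * ?b k s))" by (simp add: ip_def)
    also have "\<dots> \<le> (LINT s|?M. indicator {0..t} s * (lam k * (a k s)\<^sup>2))"
    proof (rule integral_mono)
      show "integrable ?M (\<lambda>s. lam k * (?b k s * ?b k s))"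
        by (intro continuous_integrable_time_leb continuous_intros cutc ac')
      have "integrable ?M (\<lambda>s. lam k * (a k s)\<^sup>2)"
        by (intro continuous_integrable_time_leb continuous_intros ac')
      moreover have "{0..t} \<in> sets ?M" using t by (auto simp: sets_restrict_space intro!: image_eqI[of _ _ "{0..t}"])
      ultimately show "integrable ?M (\<lambda>s. indicator {0..t} s * (lam k * (a k s)\<^sup>2))"
        using integrable_mult_indicator[of "{0..t}" ?M "\<lambda>s. lam k * (a k s)\<^sup>2"] by simp
      fix s assume "s \<in> space ?M"
      then have s: "s \<in> {0..T}" by (simp add: space_restrict_space)
      show "lam k * (?b k s * ?b k s) \<le> indicator {0..t} s * (lam k * (a k s)\<^sup>2)"
      proof (cases "s \<le> t")
        case True
        have "(cut s)\<^sup>2 \<le> 1" using cut(6)[OF s] by (simp add: power_le_one)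
        then have "lam k * ((cut s)\<^sup>2 * (a k s)\<^sup>2) \<le> lam k * (1 * (a k s)\<^sup>2)"
          using lam_pos[of k] by (intro mult_left_mono mult_right_mono) auto
        then show ?thesis using True s by (simp add: power2_eq_square mult_ac)
      next
        case False
        then show ?thesis using cut(7)[of s] s by simp
      qed
    qed
    also have "\<dots> = (LINT s|lborel. indicator {0..T} s *\<^sub>R (indicator {0..t} s * (lam k * (a k s)\<^sup>2)))"
      by (rule integral_restrict_space) simp
    also have "\<dots> = (LINT s|lborel. indicator {0..t} s *\<^sub>R (lam k * (a k s)\<^sup>2))"
      using t by (intro Bochner_Integration.integral_cong refl) (auto simp: indicator_def)
    also have "\<dots> = (LINT s|time_leb t. lam k * (a k s)\<^sup>2)"
      by (rule integral_restrict_space[symmetric]) simp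
    also have "\<dots> = ?F t - ?F 0"
    proof (rule FTC_time_leb)
      show "(?F has_real_derivative lam k * (a k s)\<^sup>2) (at s within {0..t})" for s
        by (auto intro!: derivative_eq_intros simp: a_def power_mult_distrib exp_double[symmetric] mult_ac)
      show "continuous_on {0..t} (\<lambda>s. lam k * (a k s)\<^sup>2)" by (intro continuous_intros ac')
    qed (use t in auto)
    also have "\<dots> \<le> (g k)\<^sup>2 / 2" by simp
    finally show ?thesis .
  qed
  \<comment> \<open>\<open>h\<close> is a probability density supported within \<delta> to the left
    of t, where \<open>f\<close> differs from its value at t by less than \<epsilon>.\<close>
  have 3: "f t - \<epsilon> \<le> (\<Sum>k<n. ip ?M (\<lambda>s. h s * a k s) (P k))"
  proof -
    have hi: "integrable ?M h" by (intro continuous_integrable_time_leb hc)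
    have "f t - \<epsilon> = (LINT s|?M. h s * (f t - \<epsilon>))" using hi cut(5) by simp
    also have "\<dots> \<le> (LINT s|?M. h s * f s)"
    proof (rule integral_mono)
      show "integrable ?M (\<lambda>s. h s * (f t - \<epsilon>))" using hi by simp
      show "integrable ?M (\<lambda>s. h s * f s)" by (intro continuous_integrable_time_leb continuous_intros hc fc)
      fix s assume "s \<in> space ?M"
      then have s: "s \<in> {0..T}" by (simp add: space_restrict_space)
      show "h s * (f t - \<epsilon>) \<le> h s * f s"
      proof (cases "s \<in> {t0..t}")
        case True
        then have "dist s t < \<delta>" using t0 by (auto simp: dist_real_def)
        from \<delta>(2)[OF s this] have "f t - \<epsilon> \<le> f s" by (simp add: dist_real_def)
        then show ?thesis using cut(3) by (intro mult_left_mono)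
      qed (simp add: cut(4))
    qed
    also have "\<dots> = (LINT s|?M. (\<Sum>k<n. h s * a k s * P k s))" by (simp add: f_def sum_distrib_left mult.assoc)
    also have "\<dots> = (\<Sum>k<n. ip ?M (\<lambda>s. h s * a k s) (P k))"
      unfolding ip_def by (intro Bochner_Integration.integral_sum sqint_mult_integrable sq hac Pc)
    finally show ?thesis .
  qed
  have "(\<Sum>k<n. ip ?M (\<lambda>s. h s * a k s) (P k) - lam k * nsq ?M (?b k)) \<le> I"
    using key by (simp only: 1)
  then have "(\<Sum>k<n. ip ?M (\<lambda>s. h s * a k s) (P k)) - (\<Sum>k<n. lam k * nsq ?M (?b k)) \<le> I"
    by (simp only: sum_subtractf)
  moreover have "(\<Sum>k<n. lam k * nsq ?M (?b k)) \<le> (\<Sum>k<n. (g k)\<^sup>2 / 2)"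
    by (intro sum_mono 2)
  ultimately have "(\<Sum>k<n. ip ?M (\<lambda>s. h s * a k s) (P k)) - (\<Sum>k<n. (g k)\<^sup>2 / 2) \<le> I" by linarith
  then show "(\<Sum>k<n. g k * P k t) - (\<Sum>k<n. (g k)\<^sup>2) / 2 \<le> I + \<epsilon>"
    using 3 ft by (simp add: sum_divide_distrib)
qed

text \<open>The final time may belong to the exceptional null set, so the measure at T need not have
  a density. The inequality is proved at nearby times with a density, where the eigenexpansion of
  \<open>G\<close> converges, and a violation at T would persist there by weak continuity.\<close>

lemma rate_lower_bound:
  fixes p q :: real
  defines "\<Phi> \<equiv> stationary_profile \<gamma> p q"
  assumes T: "0 < T" and \<pi>: "\<pi> \<in> ac_paths \<gamma> p q T"
    and I: "\<And>H. H \<in> space_time_tests T \<Longrightarrow> J_functional \<gamma> T H \<pi> \<Phi> \<le> I"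
    and G: "continuous_on {0..1} G"
  shows "pairing (\<pi> T) G - ip2 \<Phi> G - ip2 G G / 2 \<le> I"
proof (rule ccontr)
  let ?v = "\<lambda>t. pairing (\<pi> t) G - ip2 \<Phi> G - ip2 G G / 2"
  assume "\<not> ?v T \<le> I"
  then have gt: "0 < ?v T - I" by simp
  note \<Phi> = stationary_profile[where p = p and q = q, folded \<Phi>_def]
  have "\<pi> \<in> paths T" using \<pi> by (simp add: ac_paths_def)
  then have ac: "continuous_on {0..T} (\<lambda>t. pairing (\<pi> t) G)"
    unfolding paths_iff using G by blast
  have vc: "continuous_on {0..T} ?v" by (intro continuous_intros ac)
  have "T \<in> {0..T}" using T by simp
  with vc gt obtain \<delta> where \<delta>: "0 < \<delta>" "\<And>s. s \<in> {0..T} \<Longrightarrow> dist s T < \<delta> \<Longrightarrow> dist (?v s) (?v T) < ?v T - I"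
    unfolding continuous_on_iff by blast
  obtain \<Psi> :: "real \<Rightarrow> real \<Rightarrow> real" where \<Psi>:
     "AE t in time_leb T. \<Psi> t \<in> sobolev \<gamma> \<and> \<Psi> t 0 = p \<and> \<Psi> t 1 = q \<and> \<pi> t = density_measure (\<Psi> t)"
    using \<pi> unfolding ac_paths_def by blast
  have ae: "AE t in lborel. t \<in> {0..T} \<longrightarrow> \<Psi> t \<in> sobolev \<gamma> \<and> \<pi> t = density_measure (\<Psi> t)"
    using \<Psi> by (subst (asm) AE_restrict_space_iff) (auto elim: eventually_mono)
  have "max 0 (T - \<delta>) < T" using T \<delta> by simp
  then obtain t where t: "max 0 (T - \<delta>) < t" "t < T" "t \<in> {0..T} \<longrightarrow> \<Psi> t \<in> sobolev \<gamma> \<and> \<pi> t = density_measure (\<Psi> t)"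
    by (rule AE_lborel_exists_in_interval[OF ae])
  have \<Psi>s: "\<Psi> t \<in> sqint unit_leb" and \<pi>t: "\<pi> t = density_measure (\<Psi> t)" using t sobolev_sqint by auto
  have \<Phi>s: "\<Phi> \<in> sqint unit_leb" by (rule sobolev_sqint[OF \<Phi>(1)])
  have Gs: "G \<in> sqint unit_leb" by (rule continuous_sqint[OF G])
  let ?w = "\<lambda>x. \<Psi> t x - \<Phi> x"
  have ws: "?w \<in> sqint unit_leb" by (intro sqint_diff \<Psi>s \<Phi>s)
  \<comment> \<open>Bessel's inequality replaces the finite sum of squares by the full norm of
    \<open>G\<close>, so only the linear term still depends on n.\<close>
  have le: "ip2 (prj n G) ?w - ip2 G G / 2 \<le> I" for n
  proof -
    have "(\<Sum>k<n. ip2 G (ef k) * (pairing (\<pi> t) (ef k) - ip2 \<Phi> (ef k))) - (\<Sum>k<n. (ip2 G (ef k))\<^sup>2) / 2 \<le> I"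
      unfolding \<Phi>_def using t by (intro rate_eigen_pointwise[OF T \<pi> I[unfolded \<Phi>_def]]) auto
    moreover have "ip2 (prj n G) ?w = (\<Sum>k<n. ip2 G (ef k) * (pairing (\<pi> t) (ef k) - ip2 \<Phi> (ef k)))"
      unfolding prj_def
      by (subst ip_ef_comb)
        (auto simp: ws \<pi>t pairing_density_ip \<Psi>s \<Phi>s ef_sqint ip_diff_left ip_commute[of unit_leb "ef _" "\<lambda>x. \<Psi> t x - \<Phi> x"])
    moreover have "(\<Sum>k<n. (ip2 G (ef k))\<^sup>2) \<le> ip2 G G" by (rule bessel[OF Gs])
    ultimately show ?thesis by linarith
  qed
  have Ps: "prj n G \<in> sqint unit_leb" for n unfolding prj_def by (intro H0_sqint ef_comb_H0)
  have "(\<lambda>n. nsq unit_leb (\<lambda>x. prj n G x - G x)) \<longlonglongrightarrow> 0"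
  proof -
    have "nsq unit_leb (\<lambda>x. prj n G x - G x) = nsq unit_leb (\<lambda>x. G x - prj n G x)" for n
      unfolding ip_def by (intro Bochner_Integration.integral_cong refl) (simp add: algebra_simps)
    then show ?thesis using prj_tendsto[OF Gs] by simp
  qed
  from ip_tendsto[OF Ps Gs ws this] have "(\<lambda>n. ip2 (prj n G) ?w) \<longlonglongrightarrow> ip2 G ?w" .
  then have "(\<lambda>n. ip2 (prj n G) ?w - ip2 G G / 2) \<longlonglongrightarrow> ip2 G ?w - ip2 G G / 2" by (intro tendsto_intros)
  then have "ip2 G ?w - ip2 G G / 2 \<le> I" by (rule LIMSEQ_le_const2) (use le in blast)
  moreover have "ip2 G ?w = pairing (\<pi> t) G - ip2 \<Phi> G"
    by (subst ip_commute) (simp add: \<pi>t pairing_density_ip[OF \<Psi>s Gs] ip_diff_left[OF \<Psi>s \<Phi>s Gs])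
  ultimately have "?v t \<le> I" by simp
  moreover have "dist (?v t) (?v T) < ?v T - I" using t by (intro \<delta>(2)) (auto simp: dist_real_def)
  ultimately show False by (simp add: dist_real_def)
qed

end

section \<open>The optimal relaxation profile\<close>

text \<open>The time reversal of the decay \<open>exp (- l t)\<close>, corrected so as to vanish at time \<open>0\<close>:
  \<open>prof l T t = sinh (l t) / sinh (l T)\<close>.\<close>

definition prof :: "real \<Rightarrow> real \<Rightarrow> real \<Rightarrow> real" where
  "prof l T t = (exp (l * t) - exp (- (l * t))) / (exp (l * T) - exp (- (l * T)))"

text \<open>The derivative of \<open>prof\<close> plus \<open>l\<close> times \<open>prof\<close>:
  the force needed to move a mode along the profile against its relaxation.\<close>

definition drive :: "real \<Rightarrow> real \<Rightarrow> real \<Rightarrow> real" where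
  "drive l T t = 2 * l * exp (l * t) / (exp (l * T) - exp (- (l * T)))"

lemma prof_denominator_pos: "0 < l \<Longrightarrow> 0 < T \<Longrightarrow> 0 < exp (l * T) - exp (- (l * T))" for l T :: real
  by (simp add: less_trans[of "- (l * T)" 0])

lemma prof_0: "prof l T 0 = 0"
  by (simp add: prof_def)

lemma prof_T: "0 < l \<Longrightarrow> 0 < T \<Longrightarrow> prof l T T = 1"
  using prof_denominator_pos[of l T] by (simp add: prof_def)

lemma prof_nonneg:
  assumes "0 < l" "0 < T" "0 \<le> t"
  shows "0 \<le> prof l T t"
proof -
  have "- (l * t) \<le> l * t" using assms by simp
  then have "0 \<le> exp (l * t) - exp (- (l * t))" by (simp only: exp_le_cancel_iff diff_ge_0_iff_ge)
  then show ?thesis using prof_denominator_pos[OF assms(1,2)] by (simp add: prof_def)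
qed

lemma prof_le:
  assumes "0 < l" "0 < T" "t \<le> T"
  shows "prof l T t \<le> exp (- (l * (T - t)))"
proof -
  have "exp (- (l * (T - t))) * (exp (l * T) - exp (- (l * T))) = exp (l * t) - exp (l * t - 2 * (l * T))"
    by (simp add: right_diff_distrib exp_add[symmetric] algebra_simps)
  moreover have "exp (l * t - 2 * (l * T)) \<le> exp (- (l * t))"
    using assms mult_left_mono[of t T l] by (simp add: algebra_simps)
  ultimately show ?thesis
    unfolding prof_def pos_divide_le_eq[OF prof_denominator_pos[OF assms(1,2)]] by linarith
qed

lemma prof_sq_le:
  assumes "0 < l" "0 < T" "0 \<le> t" "t \<le> T"
  shows "l * (prof l T t)\<^sup>2 \<le> l * exp (- (2 * l * (T - t)))"
proof -
  have "(prof l T t)\<^sup>2 \<le> (exp (- (l * (T - t))))\<^sup>2"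
    using assms by (intro power_mono prof_le prof_nonneg)
  also have "\<dots> = exp (- (2 * l * (T - t)))"
    by (simp add: power2_eq_square exp_add[symmetric])
  finally show ?thesis using assms(1) by (intro mult_left_mono) auto
qed

lemma prof_le_1:
  assumes "0 < l" "0 < T" "t \<le> T"
  shows "prof l T t \<le> 1"
  using prof_le[OF assms] assms by (meson exp_le_one_iff mult_nonneg_nonneg diff_ge_0_iff_ge less_imp_le neg_le_0_iff_le order_trans)

text \<open>From z exp(-z) \<le> 1 with z = 2 l (T - t). The bound does not involve
  \<open>l\<close>, so strictly before T the series of energies is controlled by the squared
  coordinates alone.\<close>

lemma prof_sq_bound:
  assumes "0 < l" "0 < T" "0 \<le> t" "t < T"
  shows "l * (prof l T t)\<^sup>2 \<le> 1 / (2 * (T - t))"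
proof -
  let ?z = "2 * l * (T - t)"
  have "?z \<le> exp ?z" using exp_ge_add_one_self[of ?z] by linarith
  then have "?z * exp (- ?z) \<le> exp ?z * exp (- ?z)" by (intro mult_right_mono) auto
  also have "\<dots> = 1" by (simp add: exp_add[symmetric])
  finally have "l * exp (- ?z) \<le> 1 / (2 * (T - t))" using assms by (simp add: field_simps)
  moreover have "l * (prof l T t)\<^sup>2 \<le> l * exp (- ?z)"
    by (rule prof_sq_le) (use assms in auto)
  ultimately show ?thesis by (rule order_trans[rotated])
qed

lemma prof_deriv:
  assumes "0 < l" "0 < T"
  shows "(prof l T has_real_derivative drive l T t - l * prof l T t) (at t within S)"
proof -
  have "((\<lambda>t. (exp (l * t) - exp (- (l * t))) / (exp (l * T) - exp (- (l * T)))) has_real_derivative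
      (l * exp (l * t) + l * exp (- (l * t))) / (exp (l * T) - exp (- (l * T)))) (at t within S)"
    by (rule DERIV_cdivide) (auto intro!: derivative_eq_intros)
  moreover have "(l * exp (l * t) + l * exp (- (l * t))) / (exp (l * T) - exp (- (l * T))) = drive l T t - l * prof l T t"
    unfolding drive_def prof_def times_divide_eq_right diff_divide_distrib[symmetric] by (simp add: algebra_simps)
  ultimately show ?thesis unfolding prof_def[abs_def] by simp
qed

lemma prof_continuous: "continuous_on S (prof l T)"
  unfolding prof_def[abs_def] divide_inverse by (intro continuous_intros)

lemma drive_continuous: "continuous_on S (drive l T)"
  unfolding drive_def[abs_def] divide_inverse by (intro continuous_intros)

text \<open>The bound of \<open>prof_sq_bound\<close> is not integrable up to T; integrating the
  exponential first gives a bound uniform in \<open>l\<close>. This is why a final datum that is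
  merely square integrable can be reached with finite total energy.\<close>

lemma prof_energy:
  assumes "0 < l" "0 < T"
  shows "(\<integral>\<^sup>+t. ennreal (l * (prof l T t)\<^sup>2) \<partial>time_leb T) \<le> ennreal (1 / 2)"
proof -
  let ?g = "\<lambda>t. l * exp (- (2 * l * (T - t)))"
  have gi: "integrable (time_leb T) ?g"
    by (intro continuous_integrable_time_leb continuous_intros)
  have "(\<integral>\<^sup>+t. ennreal (l * (prof l T t)\<^sup>2) \<partial>time_leb T) \<le> (\<integral>\<^sup>+t. ennreal (?g t) \<partial>time_leb T)"
    using assms by (intro nn_integral_mono ennreal_leI prof_sq_le) (auto simp: space_restrict_space)
  also have "\<dots> = ennreal (LINT t|time_leb T. ?g t)"
    using assms by (intro nn_integral_eq_integral gi) auto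
  also have "(LINT t|time_leb T. ?g t) = exp (- (2 * l * (T - T))) / 2 - exp (- (2 * l * (T - 0))) / 2"
    by (rule FTC_time_leb) (use assms in \<open>auto intro!: derivative_eq_intros continuous_intros\<close>)
  also have "ennreal (exp (- (2 * l * (T - T))) / 2 - exp (- (2 * l * (T - 0))) / 2) \<le> ennreal (1 / 2)"
    by (intro ennreal_leI) simp
  finally show ?thesis .
qed

text \<open>Divided by 4 l this is the cost of a unit mode, 1 / (2 (1 - exp(- 2 l T))), which
  decreases to one half as T grows.\<close>

lemma drive_action:
  assumes "0 < l" "0 < T"
  shows "(LINT t|time_leb T. (drive l T t)\<^sup>2) = 2 * l / (1 - exp (- (2 * l * T)))"
proof -
  let ?E = "exp (l * T)" and ?D = "exp (l * T) - exp (- (l * T))"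
  let ?F = "\<lambda>t. 2 * l / ?D\<^sup>2 * exp (2 * l * t)"
  have D: "0 < ?D" by (rule prof_denominator_pos[OF assms])
  have E: "1 < ?E" using assms by simp
  have "(LINT t|time_leb T. (drive l T t)\<^sup>2) = ?F T - ?F 0"
  proof (rule FTC_time_leb)
    show "(?F has_real_derivative (drive l T s)\<^sup>2) (at s within {0..T})" for s
    proof -
      have "(?F has_real_derivative 2 * l / ?D\<^sup>2 * (2 * l * exp (2 * l * s))) (at s within {0..T})"
        by (rule DERIV_cmult) (auto intro!: derivative_eq_intros)
      moreover have "exp (2 * l * s) = (exp (l * s))\<^sup>2" by (simp add: power2_eq_square exp_add[symmetric])
      ultimately show ?thesis by (simp add: drive_def power_divide power_mult_distrib power2_eq_square mult_ac)
    qed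
    show "continuous_on {0..T} (\<lambda>s. (drive l T s)\<^sup>2)" by (intro continuous_intros drive_continuous)
  qed (use assms in auto)
  also have "\<dots> = 2 * l / ?D\<^sup>2 * (?E\<^sup>2 - 1)"
    by (simp add: right_diff_distrib power2_eq_square exp_add[symmetric])
  also have "\<dots> = 2 * l / (1 - exp (- (2 * l * T)))"
  proof -
    have e1: "exp (- (l * T)) = 1 / ?E" by (simp add: exp_minus field_simps)
    have e2: "exp (- (2 * l * T)) = 1 / ?E\<^sup>2"
      by (simp add: exp_minus power2_eq_square exp_add[symmetric] field_simps)
    have "x\<^sup>2 - 1 \<noteq> 0" if "1 < x" for x :: real
      using one_less_power[OF that, of 2] by linarith
    then have "2 * l / (x - 1 / x)\<^sup>2 * (x\<^sup>2 - 1) = 2 * l / (1 - 1 / x\<^sup>2)" if "1 < x" for x :: real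
    proof -
      have x: "x\<^sup>2 - 1 \<noteq> 0" "x \<noteq> 0" using that \<open>\<And>x. 1 < x \<Longrightarrow> x\<^sup>2 - 1 \<noteq> 0\<close> by auto
      have "x - 1 / x = (x\<^sup>2 - 1) / x" "1 - 1 / x\<^sup>2 = (x\<^sup>2 - 1) / x\<^sup>2"
        using x by (auto simp: field_simps power2_eq_square)
      then show ?thesis using x by (simp add: power_divide power2_eq_square)
    qed
    then show ?thesis using E unfolding e1 e2 by blast
  qed
  finally show ?thesis .
qed

section \<open>Limits with explicit error bounds\<close>

lemma continuous_on_uniform_bound:
  fixes f :: "nat \<Rightarrow> 'a::topological_space \<Rightarrow> real"
  assumes f: "\<And>n. continuous_on S (f n)" and le: "\<And>n x. x \<in> S \<Longrightarrow> \<bar>f n x - g x\<bar> \<le> \<epsilon> n" and lim: "\<epsilon> \<longlonglongrightarrow> 0"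
  shows "continuous_on S g" "uniform_limit S f g sequentially"
proof -
  show u: "uniform_limit S f g sequentially"
  proof (rule uniform_limitI)
    fix e :: real assume "0 < e"
    from order_tendstoD(2)[OF lim this] show "\<forall>\<^sub>F n in sequentially. \<forall>x\<in>S. dist (f n x) (g x) < e"
      by (rule eventually_mono) (use le in \<open>auto simp: dist_real_def intro: le_less_trans\<close>)
  qed
  show "continuous_on S g"
    by (rule uniform_limit_theorem[OF always_eventually u]) (use f in auto)
qed

lemma limit_of_tail_bound:
  fixes q :: "nat \<Rightarrow> real"
  assumes q: "\<And>n m. n \<le> m \<Longrightarrow> \<bar>q m - q n\<bar> \<le> \<epsilon> n" and \<epsilon>: "\<epsilon> \<longlonglongrightarrow> 0"
  shows "q \<longlonglongrightarrow> lim q" "\<bar>q n - lim q\<bar> \<le> \<epsilon> n"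
proof -
  have "Cauchy q"
  proof (rule metric_CauchyI)
    fix e :: real assume "0 < e"
    then have "\<forall>\<^sub>F n in sequentially. \<epsilon> n < e / 2" by (intro order_tendstoD(2)[OF \<epsilon>]) simp
    then obtain N where N: "\<epsilon> N < e / 2" using eventually_happens'[OF sequentially_bot] by metis
    have "dist (q m) (q n) < e" if "N \<le> m" "N \<le> n" for m n
      using q[OF that(1)] q[OF that(2)] N by (simp add: dist_real_def)
    then show "\<exists>M. \<forall>m\<ge>M. \<forall>n\<ge>M. dist (q m) (q n) < e" by blast
  qed
  then show l: "q \<longlonglongrightarrow> lim q" by (simp add: Cauchy_convergent_iff convergent_LIMSEQ_iff)
  have "(\<lambda>m. \<bar>q m - q n\<bar>) \<longlonglongrightarrow> \<bar>lim q - q n\<bar>" by (rule tendsto_rabs[OF tendsto_diff[OF l tendsto_const]])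
  then have "\<bar>lim q - q n\<bar> \<le> \<epsilon> n" by (rule LIMSEQ_le_const2) (use q in blast)
  then show "\<bar>q n - lim q\<bar> \<le> \<epsilon> n" by (simp add: abs_minus_commute)
qed

context fractional
begin

context
  fixes T :: real and \<psi> :: "real \<Rightarrow> real"
  assumes T: "0 < T" and psi: "\<psi> \<in> sqint unit_leb"
begin

section \<open>The relaxation path as a limit of spectral sums\<close>

definition approx :: "nat \<Rightarrow> real \<Rightarrow> real \<Rightarrow> real" where
  "approx n t u = (\<Sum>k<n. prof (lam k) T t * ip2 \<psi> (ef k) * ef k u)"

text \<open>Before T the sums converge uniformly in space, so the pointwise limit is the continuous
  representative on the interval. At T only L^2 convergence is available, and the path is given its
  prescribed value.\<close>

definition relax :: "real \<Rightarrow> real \<Rightarrow> real" where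
  "relax t u = (if t < T then lim (\<lambda>n. approx n t u) else \<psi> u)"

text \<open>The remainder in Parseval's identity. As \<open>prof\<close> is at most 1, it bounds the
  squared L^2 error uniformly in time.\<close>

definition tail :: "nat \<Rightarrow> real" where
  "tail n = ip2 \<psi> \<psi> - (\<Sum>k<n. (ip2 \<psi> (ef k))\<^sup>2)"

lemma tail_nonneg: "0 \<le> tail n"
  using bessel[OF psi] by (simp add: tail_def)

lemma tail_lim: "tail \<longlonglongrightarrow> 0"
  using tendsto_diff[OF tendsto_const parseval[OF psi, unfolded sums_def], of "ip2 \<psi> \<psi>"] by (simp add: tail_def[abs_def])

lemma tail_sum:
  assumes "n \<le> m"
  shows "(\<Sum>k\<in>{n..<m}. (ip2 \<psi> (ef k))\<^sup>2) \<le> tail n"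
  using sum_diff_nat_ivl[of 0 n m "\<lambda>k. (ip2 \<psi> (ef k))\<^sup>2"] assms tail_nonneg[of m]
  by (simp add: tail_def lessThan_atLeast0)

lemma approx_H0: "approx n t \<in> H0"
  unfolding approx_def[abs_def] by (rule ef_comb_H0)

lemma approx_sqint: "approx n t \<in> sqint unit_leb"
  by (rule H0_sqint[OF approx_H0])

lemma approx_diff:
  assumes "n \<le> m"
  shows "(\<lambda>u. approx m t u - approx n t u) = (\<lambda>u. \<Sum>k\<in>{n..<m}. (prof (lam k) T t * ip2 \<psi> (ef k)) * ef k u)"
  unfolding approx_def lessThan_atLeast0 using assms by (intro ext sum_diff_nat_ivl) auto

lemma coeff_sq_le:
  assumes "t \<in> {0..T}"
  shows "(prof (lam k) T t * ip2 \<psi> (ef k))\<^sup>2 \<le> (ip2 \<psi> (ef k))\<^sup>2"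
proof -
  have "(prof (lam k) T t)\<^sup>2 \<le> 1"
    using prof_nonneg[OF lam_pos T] prof_le_1[OF lam_pos T] assms by (simp add: power_le_one)
  then have "(prof (lam k) T t)\<^sup>2 * (ip2 \<psi> (ef k))\<^sup>2 \<le> 1 * (ip2 \<psi> (ef k))\<^sup>2"
    by (intro mult_right_mono) auto
  then show ?thesis by (simp add: power_mult_distrib)
qed

lemma approx_ip:
  assumes "t \<in> {0..T}" "n \<le> m"
  shows "nsq unit_leb (\<lambda>u. approx m t u - approx n t u) \<le> tail n"
proof -
  have "nsq unit_leb (\<lambda>u. approx m t u - approx n t u)
      = (\<Sum>k\<in>{n..<m}. (prof (lam k) T t * ip2 \<psi> (ef k))\<^sup>2)"
    unfolding approx_diff[OF assms(2)] by (rule ip_ef_comb_self) simp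
  also have "\<dots> \<le> (\<Sum>k\<in>{n..<m}. (ip2 \<psi> (ef k))\<^sup>2)" by (intro sum_mono coeff_sq_le assms)
  also have "\<dots> \<le> tail n" by (rule tail_sum[OF assms(2)])
  finally show ?thesis .
qed

lemma lam_coeff_sq_le:
  assumes "t \<in> {0..<T}"
  shows "lam k * (prof (lam k) T t * ip2 \<psi> (ef k))\<^sup>2 \<le> (ip2 \<psi> (ef k))\<^sup>2 / (2 * (T - t))"
proof -
  have "lam k * (prof (lam k) T t)\<^sup>2 * (ip2 \<psi> (ef k))\<^sup>2 \<le> 1 / (2 * (T - t)) * (ip2 \<psi> (ef k))\<^sup>2"
    using assms by (intro mult_right_mono prof_sq_bound lam_pos T) auto
  then show ?thesis by (simp add: power_mult_distrib mult.assoc)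
qed

lemma approx_en:
  assumes "t \<in> {0..<T}" "n \<le> m"
  shows "energy (\<lambda>u. approx m t u - approx n t u) \<le> tail n / (2 * (T - t))"
proof -
  have "energy (\<lambda>u. approx m t u - approx n t u)
      = (\<Sum>k\<in>{n..<m}. lam k * (prof (lam k) T t * ip2 \<psi> (ef k))\<^sup>2)"
    unfolding approx_diff[OF assms(2)] by (rule en_ef_comb_self) simp
  also have "\<dots> \<le> (\<Sum>k\<in>{n..<m}. (ip2 \<psi> (ef k))\<^sup>2 / (2 * (T - t)))"
    by (intro sum_mono lam_coeff_sq_le assms)
  also have "\<dots> = (\<Sum>k\<in>{n..<m}. (ip2 \<psi> (ef k))\<^sup>2) / (2 * (T - t))" by (simp add: sum_divide_distrib)
  also have "\<dots> \<le> tail n / (2 * (T - t))"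
    using assms by (intro divide_right_mono tail_sum) auto
  finally show ?thesis .
qed

text \<open>The energy bound for differences of partial sums becomes a uniform bound through the
  Morrey estimate on \<open>H0\<close>; it degenerates as t approaches T.\<close>

lemma relax_pointwise:
  assumes t: "t \<in> {0..<T}" and u: "u \<in> {0..1}"
  shows "(\<lambda>n. approx n t u) \<longlonglongrightarrow> relax t u" "\<bar>approx n t u - relax t u\<bar> \<le> sqrt (morrey * (tail n / (2 * (T - t))))"
proof -
  let ?e = "\<lambda>n. sqrt (morrey * (tail n / (2 * (T - t))))"
  have b: "\<bar>approx m t u - approx n t u\<bar> \<le> ?e n" if "n \<le> m" for n m
  proof -
    have "\<bar>approx m t u - approx n t u\<bar> \<le> sqrt (morrey * energy (\<lambda>u. approx m t u - approx n t u))"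
      by (rule H0_abs_bound[OF H0_diff[OF approx_H0 approx_H0] u])
    also have "\<dots> \<le> ?e n"
      using approx_en[OF t that] morrey_pos by (intro real_sqrt_le_mono mult_left_mono) auto
    finally show ?thesis .
  qed
  have "?e \<longlonglongrightarrow> sqrt (morrey * (0 / (2 * (T - t))))"
    using t by (intro tendsto_real_sqrt tendsto_mult_left tendsto_divide tail_lim tendsto_const) auto
  then have l: "?e \<longlonglongrightarrow> 0" by simp
  have r: "relax t u = lim (\<lambda>n. approx n t u)" using t by (simp add: relax_def)
  show "(\<lambda>n. approx n t u) \<longlonglongrightarrow> relax t u"
    unfolding r by (rule limit_of_tail_bound(1)[where q = "\<lambda>n. approx n t u" and \<epsilon> = ?e]) (use b l in auto)
  show "\<bar>approx n t u - relax t u\<bar> \<le> ?e n"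
    unfolding r by (rule limit_of_tail_bound(2)[where q = "\<lambda>n. approx n t u" and \<epsilon> = ?e]) (use b l in auto)
qed

lemma coeff_summable:
  assumes t: "t \<in> {0..<T}"
  shows "summable (\<lambda>k. lam k * (prof (lam k) T t * ip2 \<psi> (ef k))\<^sup>2)"
proof (rule summable_comparison_test')
  show "summable (\<lambda>k. (ip2 \<psi> (ef k))\<^sup>2 / (2 * (T - t)))"
    by (intro summable_divide sums_summable[OF parseval[OF psi]])
  show "norm (lam k * (prof (lam k) T t * ip2 \<psi> (ef k))\<^sup>2) \<le> (ip2 \<psi> (ef k))\<^sup>2 / (2 * (T - t))" if "0 \<le> k" for k
    using lam_coeff_sq_le[OF t, of k] lam_pos[of k] by simp
qed

text \<open>The energy is bounded by a series of explicit functions of time, so that it can be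
  integrated termwise; lower semicontinuity is enough for this.\<close>

lemma relax_H0:
  assumes t: "t \<in> {0..<T}"
  shows "relax t \<in> H0" "ennreal (energy (relax t)) \<le> (\<Sum>k. ennreal (lam k * (prof (lam k) T t * ip2 \<psi> (ef k))\<^sup>2))"
proof -
  have l: "(\<lambda>n. sqrt (morrey * (tail n / (2 * (T - t))))) \<longlonglongrightarrow> 0"
  proof -
    have "(\<lambda>n. sqrt (morrey * (tail n / (2 * (T - t))))) \<longlonglongrightarrow> sqrt (morrey * (0 / (2 * (T - t))))"
      using t by (intro tendsto_real_sqrt tendsto_mult_left tendsto_divide tail_lim tendsto_const) auto
    then show ?thesis by simp
  qed
  have c: "continuous_on {0..1} (relax t)"
  proof (rule continuous_on_uniform_bound(1)[where f = "\<lambda>n. approx n t" and \<epsilon> = "\<lambda>n. sqrt (morrey * (tail n / (2 * (T - t))))"])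
    show "continuous_on {0..1} (approx n t)" for n by (rule sobolev_continuous[OF H0_sobolev[OF approx_H0]])
    show "\<bar>approx n t u - relax t u\<bar> \<le> sqrt (morrey * (tail n / (2 * (T - t))))" if "u \<in> {0..1}" for n u
      by (rule relax_pointwise(2)[OF t that])
  qed (rule l)
  note s = coeff_summable[OF t]
  have e: "energy (approx n t) = (\<Sum>k<n. lam k * (prof (lam k) T t * ip2 \<psi> (ef k))\<^sup>2)" for n
    unfolding approx_def[abs_def] by (rule en_ef_comb_self) simp
  have lim: "(\<lambda>n. \<Sum>k<n. lam k * (prof (lam k) T t * ip2 \<psi> (ef k))\<^sup>2) \<longlonglongrightarrow> (\<Sum>k. lam k * (prof (lam k) T t * ip2 \<psi> (ef k))\<^sup>2)"
    using summable_LIMSEQ[OF s] .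
  let ?s = "\<lambda>n. \<Sum>k<n. lam k * (prof (lam k) T t * ip2 \<psi> (ef k))\<^sup>2"
  have as: "approx n t \<in> sobolev \<gamma>" for n by (rule H0_sobolev[OF approx_H0])
  have ptw: "(\<lambda>n. approx n t x) \<longlonglongrightarrow> relax t x" if "x \<in> {0..1}" for x by (rule relax_pointwise(1)[OF t that])
  have le: "energy (approx n t) \<le> ?s n" for n by (simp only: e order_refl)
  have lsc: "relax t \<in> sobolev \<gamma>" "energy (relax t) \<le> (\<Sum>k. lam k * (prof (lam k) T t * ip2 \<psi> (ef k))\<^sup>2)"
  proof -
    show "relax t \<in> sobolev \<gamma>"
      by (rule en_lsc(1)[where f = "\<lambda>n. approx n t" and \<beta> = ?s, OF as c ptw le lim])
    show "energy (relax t) \<le> (\<Sum>k. lam k * (prof (lam k) T t * ip2 \<psi> (ef k))\<^sup>2)"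
      by (rule en_lsc(2)[where f = "\<lambda>n. approx n t" and \<beta> = ?s, OF as c ptw le lim])
  qed
  have z: "approx n t x = 0" if "x \<in> {0, 1}" for n x
    using approx_H0[of n t] that by (auto simp: H0_def)
  have "relax t x = 0" if x: "x \<in> {0, 1}" for x
  proof -
    have "(\<lambda>n. approx n t x) \<longlonglongrightarrow> relax t x" using x by (intro relax_pointwise t) auto
    then show ?thesis using z[OF x] by (simp add: LIMSEQ_const_iff)
  qed
  then show "relax t \<in> H0" using lsc(1) by (simp add: H0_def)
  have "0 \<le> lam k * (prof (lam k) T t * ip2 \<psi> (ef k))\<^sup>2" for k using lam_pos[of k] by simp
  from suminf_ennreal2[OF this s] show "ennreal (energy (relax t)) \<le> (\<Sum>k. ennreal (lam k * (prof (lam k) T t * ip2 \<psi> (ef k))\<^sup>2))"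
    using lsc(2) by (simp add: ennreal_leI)
qed

lemma relax_T: "relax T = \<psi>"
  by (simp add: relax_def[abs_def])

lemma relax_0: "u \<in> {0..1} \<Longrightarrow> relax 0 u = 0"
  using T by (simp add: relax_def approx_def prof_0)

lemma relax_sqint:
  assumes "t \<in> {0..T}"
  shows "relax t \<in> sqint unit_leb"
proof (cases "t = T")
  case True then show ?thesis using psi by (simp add: relax_T)
next
  case False then show ?thesis using assms by (intro H0_sqint relax_H0(1)) auto
qed

text \<open>At T the error is the projection residual of the datum, before T a limit of differences
  of partial sums. That both obey the same bound gives weak continuity up to and including
  T.\<close>

lemma relax_error:
  assumes t: "t \<in> {0..T}"
  shows "nsq unit_leb (\<lambda>u. approx n t u - relax t u) \<le> tail n"
proof (cases "t = T")
  case True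
  have "approx n T u = prj n \<psi> u" for u
    by (simp add: approx_def prj_def prof_T[OF lam_pos T])
  then have "nsq unit_leb (\<lambda>u. approx n T u - \<psi> u) = nsq unit_leb (\<lambda>u. \<psi> u - prj n \<psi> u)"
    unfolding ip_def by (intro Bochner_Integration.integral_cong refl) (simp add: algebra_simps)
  then show ?thesis using prj_residual[OF psi, of n] by (simp add: True relax_T tail_def)
next
  case False
  then have t': "t \<in> {0..<T}" using t by auto
  have l: "(\<lambda>n. sqrt (morrey * (tail n / (2 * (T - t))))) \<longlonglongrightarrow> 0"
  proof -
    have "(\<lambda>n. sqrt (morrey * (tail n / (2 * (T - t))))) \<longlonglongrightarrow> sqrt (morrey * (0 / (2 * (T - t))))"
      using t' by (intro tendsto_real_sqrt tendsto_mult_left tendsto_divide tail_lim tendsto_const) auto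
    then show ?thesis by simp
  qed
  have u: "(\<lambda>m. nsq unit_leb (\<lambda>x. approx m t x - relax t x)) \<longlonglongrightarrow> 0"
    by (rule ip_uniform_tendsto[where f = "\<lambda>m. approx m t" and g = "relax t", OF finite_measure_unit_leb approx_sqint relax_sqint[OF t] _ l])
      (use relax_pointwise(2)[OF t'] in simp)
  have "(\<lambda>m. nsq unit_leb (\<lambda>x. approx m t x - approx n t x))
      \<longlonglongrightarrow> nsq unit_leb (\<lambda>x. relax t x - approx n t x)"
  proof (rule ip_self_tendsto[where f = "\<lambda>m x. approx m t x - approx n t x" and g = "\<lambda>x. relax t x - approx n t x"])
    show "(\<lambda>m. nsq unit_leb (\<lambda>x. approx m t x - approx n t x - (relax t x - approx n t x))) \<longlonglongrightarrow> 0"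
      using u by simp
  qed (intro sqint_diff approx_sqint relax_sqint t)+
  then have "nsq unit_leb (\<lambda>x. relax t x - approx n t x) \<le> tail n"
    by (rule LIMSEQ_le_const2) (use approx_ip[OF t] in blast)
  moreover have "nsq unit_leb (\<lambda>x. relax t x - approx n t x) = nsq unit_leb (\<lambda>u. approx n t u - relax t u)"
    unfolding ip_def by (intro Bochner_Integration.integral_cong refl) (simp add: algebra_simps)
  ultimately show ?thesis by simp
qed

lemma relax_ip_le: "t \<in> {0..T} \<Longrightarrow> nsq unit_leb (relax t) \<le> ip2 \<psi> \<psi>"
  using relax_error[of t 0] by (simp add: approx_def tail_def ip_def)

lemma relax_ip_approx:
  assumes t: "t \<in> {0..T}" and w: "w \<in> sqint unit_leb"
  shows "\<bar>(\<Sum>k<n. prof (lam k) T t * ip2 \<psi> (ef k) * ip2 (ef k) w) - ip2 (relax t) w\<bar> \<le> sqrt (tail n) * sqrt (ip2 w w)"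
proof -
  have "(\<Sum>k<n. prof (lam k) T t * ip2 \<psi> (ef k) * ip2 (ef k) w) = ip2 (approx n t) w"
    unfolding approx_def[abs_def] by (rule ip_ef_comb[OF _ w, symmetric]) simp
  then have eq: "(\<Sum>k<n. prof (lam k) T t * ip2 \<psi> (ef k) * ip2 (ef k) w) - ip2 (relax t) w = ip2 (\<lambda>u. approx n t u - relax t u) w"
    by (simp add: ip_diff_left[OF approx_sqint relax_sqint[OF t] w])
  have "\<bar>ip2 (\<lambda>u. approx n t u - relax t u) w\<bar> \<le> sqrt (nsq unit_leb (\<lambda>u. approx n t u - relax t u)) * sqrt (ip2 w w)"
    by (intro ip_Cauchy_Schwarz_sqrt sqint_diff approx_sqint relax_sqint t w)
  also have "\<dots> \<le> sqrt (tail n) * sqrt (ip2 w w)"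
    by (intro mult_right_mono real_sqrt_le_mono relax_error t) (simp add: ip_nonneg)
  finally show ?thesis by (simp only: eq)
qed

lemma sqrt_tail_lim: "(\<lambda>n. sqrt (tail n) * c) \<longlonglongrightarrow> 0"
  using tendsto_mult_right[OF tendsto_real_sqrt[OF tail_lim], of c] by simp

lemma relax_continuous:
  assumes w: "w \<in> sqint unit_leb"
  shows "continuous_on {0..T} (\<lambda>t. ip2 (relax t) w)"
proof (rule continuous_on_uniform_bound(1)[where \<epsilon> = "\<lambda>n. sqrt (tail n) * sqrt (ip2 w w)"
      and f = "\<lambda>n t. \<Sum>k<n. prof (lam k) T t * ip2 \<psi> (ef k) * ip2 (ef k) w"])
  show "continuous_on {0..T} (\<lambda>t. \<Sum>k<n. prof (lam k) T t * ip2 \<psi> (ef k) * ip2 (ef k) w)" for n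
    by (intro continuous_intros prof_continuous)
  show "\<bar>(\<Sum>k<n. prof (lam k) T t * ip2 \<psi> (ef k) * ip2 (ef k) w) - ip2 (relax t) w\<bar> \<le> sqrt (tail n) * sqrt (ip2 w w)"
    if "t \<in> {0..T}" for n t by (rule relax_ip_approx[OF that w])
qed (rule sqrt_tail_lim)

lemma relax_path:
  assumes \<Phi>: "\<Phi> \<in> sqint unit_leb"
  shows "(\<lambda>t. density_measure (\<lambda>u. \<Phi> u + relax t u)) \<in> paths T"
  unfolding paths_iff
proof (intro exI conjI allI ballI impI)
  let ?a = "nat \<lceil>sqrt (ip2 \<Phi> \<Phi>) + sqrt (ip2 \<psi> \<psi>)\<rceil>"
  fix t assume t: "t \<in> {0..T}"
  have s: "(\<lambda>u. \<Phi> u + relax t u) \<in> sqint unit_leb" by (intro sqint_add \<Phi> relax_sqint t)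
  have "sqrt (nsq unit_leb (\<lambda>u. \<Phi> u + relax t u)) \<le> sqrt (ip2 \<Phi> \<Phi>) + sqrt (nsq unit_leb (relax t))"
    by (rule ip_sqrt_triangle[OF \<Phi> relax_sqint[OF t]])
  also have "\<dots> \<le> sqrt (ip2 \<Phi> \<Phi>) + sqrt (ip2 \<psi> \<psi>)" using relax_ip_le[OF t] by simp
  also have "\<dots> \<le> real ?a" by (rule real_nat_ceiling_ge)
  finally have "ennreal (sqrt (nsq unit_leb (\<lambda>u. \<Phi> u + relax t u))) \<le> of_nat ?a"
    by (simp add: ennreal_of_nat_eq_real_of_nat ennreal_leI)
  with tv_norm_density_le[OF s] have "tv_norm (density_measure (\<lambda>u. \<Phi> u + relax t u)) \<le> of_nat ?a" by (rule order_trans)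
  then show "density_measure (\<lambda>u. \<Phi> u + relax t u) \<in> tv_ball ?a"
    using density_signed_measures[OF sqint_unit_integrable[OF s]] by (simp add: tv_ball_def)
next
  fix f :: "real \<Rightarrow> real" assume "continuous_on {0..1} f"
  then have f: "f \<in> sqint unit_leb" by (rule continuous_sqint)
  have "continuous_on {0..T} (\<lambda>t. ip2 \<Phi> f + ip2 (relax t) f)" by (intro continuous_intros relax_continuous f)
  moreover have "pairing (density_measure (\<lambda>u. \<Phi> u + relax t u)) f = ip2 \<Phi> f + ip2 (relax t) f" if "t \<in> {0..T}" for t
    by (simp add: pairing_density_ip[OF sqint_add[OF \<Phi> relax_sqint[OF that]] f] ip_add_left[OF \<Phi> relax_sqint[OF that] f])
  ultimately show "continuous_on {0..T} (\<lambda>t. pairing (density_measure (\<lambda>u. \<Phi> u + relax t u)) f)"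
    by (subst continuous_on_cong[OF refl]) auto
qed

text \<open>Tonelli exchanges sum and integral; each mode contributes at most half its squared
  coordinate, and Parseval adds these up.\<close>

lemma relax_energy:
  "(\<integral>\<^sup>+t. (\<Sum>k. ennreal (lam k * (prof (lam k) T t * ip2 \<psi> (ef k))\<^sup>2)) \<partial>time_leb T) \<le> ennreal (ip2 \<psi> \<psi> / 2)"
proof -
  have m: "(\<lambda>t. ennreal (lam k * (prof (lam k) T t)\<^sup>2)) \<in> borel_measurable (time_leb T)" for k
    by (rule measurable_compose[OF continuous_measurable_time_leb measurable_ennreal]) (intro continuous_intros prof_continuous)
  have eq: "ennreal (lam k * (prof (lam k) T t * ip2 \<psi> (ef k))\<^sup>2) = ennreal ((ip2 \<psi> (ef k))\<^sup>2) * ennreal (lam k * (prof (lam k) T t)\<^sup>2)" for k t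
    using lam_pos[of k] by (simp add: ennreal_mult[symmetric] power_mult_distrib mult_ac)
  have "(\<integral>\<^sup>+t. (\<Sum>k. ennreal (lam k * (prof (lam k) T t * ip2 \<psi> (ef k))\<^sup>2)) \<partial>time_leb T)
      = (\<Sum>k. \<integral>\<^sup>+t. ennreal ((ip2 \<psi> (ef k))\<^sup>2) * ennreal (lam k * (prof (lam k) T t)\<^sup>2) \<partial>time_leb T)"
    unfolding eq by (intro nn_integral_suminf borel_measurable_times_ennreal m) simp
  also have "\<dots> = (\<Sum>k. ennreal ((ip2 \<psi> (ef k))\<^sup>2) * (\<integral>\<^sup>+t. ennreal (lam k * (prof (lam k) T t)\<^sup>2) \<partial>time_leb T))"
    by (simp only: nn_integral_cmult[OF m])
  also have "\<dots> \<le> (\<Sum>k. ennreal ((ip2 \<psi> (ef k))\<^sup>2) * ennreal (1 / 2))"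
    by (intro suminf_le mult_left_mono prof_energy lam_pos T) auto
  also have "\<dots> = (\<Sum>k. ennreal ((ip2 \<psi> (ef k))\<^sup>2 / 2))"
    by (simp only: ennreal_mult[symmetric] zero_le_power2) (simp add: ennreal_mult''[symmetric])
  also have "\<dots> = ennreal (\<Sum>k. (ip2 \<psi> (ef k))\<^sup>2 / 2)"
    by (intro suminf_ennreal2 summable_divide sums_summable[OF parseval[OF psi]]) simp
  also have "(\<Sum>k. (ip2 \<psi> (ef k))\<^sup>2 / 2) = ip2 \<psi> \<psi> / 2"
    by (rule sums_unique[symmetric]) (intro sums_divide parseval psi)
  finally show ?thesis .
qed

lemma relax_ac:
  assumes \<Phi>: "\<Phi> \<in> sobolev \<gamma>" "\<Phi> 0 = p" "\<Phi> 1 = q"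
  shows "(\<lambda>t. density_measure (\<lambda>u. \<Phi> u + relax t u)) \<in> ac_paths \<gamma> p q T"
proof -
  \<comment> \<open>The profile uses the limit formula at every time and so may differ from the path
    at T, a null set. As a limit of jointly continuous functions its joint measurability is
    immediate.\<close>
  let ?\<Psi> = "\<lambda>t u. \<Phi> u + lim (\<lambda>n. approx n t u)"
  let ?X = "{0..T} \<times> {0..1::real}"
  note \<Phi>s = sobolev_sqint[OF \<Phi>(1)]
  have eq: "?\<Psi> t = (\<lambda>u. \<Phi> u + relax t u)" if "t < T" for t using that by (simp add: relax_def)
  have ae: "AE t in time_leb T. t \<in> {0..<T}"
    using AE_lborel_singleton[of T] by (subst AE_restrict_space_iff) auto
  have meas: "(\<lambda>(t, u). ?\<Psi> t u) \<in> borel_measurable (restrict_space borel ?X)"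
  proof -
    have "continuous_on ?X (\<lambda>p. \<Phi> (snd p))"
      by (rule continuous_on_compose2[OF sobolev_continuous[OF \<Phi>(1)]]) (auto intro!: continuous_intros)
    then have 1: "(\<lambda>p. \<Phi> (snd p)) \<in> borel_measurable (restrict_space borel ?X)"
      by (rule borel_measurable_continuous_on_restrict)
    have "continuous_on ?X (\<lambda>(t, u). \<Sum>k<n. prof (lam k) T t * ip2 \<psi> (ef k) * ef k u)" for n
      by (rule continuous_on_sum_products) (intro continuous_intros prof_continuous ef_continuous)+
    then have 2: "(\<lambda>p. approx n (fst p) (snd p)) \<in> borel_measurable (restrict_space borel ?X)" for n
      unfolding approx_def by (intro borel_measurable_continuous_on_restrict) (simp add: split_beta')
    show ?thesis
      unfolding split_beta' by (intro borel_measurable_add 1 borel_measurable_lim_metric 2)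
  qed
  have ae2: "AE t in time_leb T. ?\<Psi> t \<in> sobolev \<gamma> \<and> ?\<Psi> t 0 = p \<and> ?\<Psi> t 1 = q \<and> density_measure (\<lambda>u. \<Phi> u + relax t u) = density_measure (?\<Psi> t)"
    using ae
  proof eventually_elim
    case (elim t)
    then have e: "?\<Psi> t = (\<lambda>u. \<Phi> u + relax t u)" by (intro eq) auto
    have e': "?\<Psi> t u = \<Phi> u + relax t u" for u using fun_cong[OF e, of u] .
    have "relax t \<in> H0" by (rule relax_H0(1)[OF elim])
    then show ?case unfolding e unfolding e' using \<Phi> by (simp add: H0_def sobolev_add)
  qed
  let ?S = "\<lambda>t. \<Sum>k. ennreal (lam k * (prof (lam k) T t * ip2 \<psi> (ef k))\<^sup>2)"
  let ?C = "2 * ip2 \<Phi> \<Phi> + 2 * ip2 \<psi> \<psi> + 2 * en \<Phi> \<Phi>"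
  have C0: "0 \<le> ?C" using ip_nonneg[of unit_leb] en_nonneg by (intro add_nonneg_nonneg) auto
  have "AE t in time_leb T. sobolev_norm_sq \<gamma> (?\<Psi> t) \<le> ennreal ?C + 2 * ?S t"
    using ae
  proof eventually_elim
    case (elim t)
    then have t: "t \<in> {0..T}" by auto
    have e: "?\<Psi> t = (\<lambda>u. \<Phi> u + relax t u)" using elim by (intro eq) auto
    note r = relax_H0[OF elim]
    have rs: "relax t \<in> sobolev \<gamma>" by (rule H0_sobolev[OF r(1)])
    let ?F = "\<lambda>u. \<Phi> u + relax t u"
    have F: "?F \<in> sobolev \<gamma>" by (rule sobolev_add[OF \<Phi>(1) rs])
    have "ip2 ?F ?F \<le> 2 * ip2 \<Phi> \<Phi> + 2 * nsq unit_leb (relax t)" by (rule ip_add_self_le[OF \<Phi>s relax_sqint[OF t]])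
    moreover have "en ?F ?F \<le> 2 * en \<Phi> \<Phi> + 2 * energy (relax t)" by (rule en_add_self_le[OF \<Phi>(1) rs])
    ultimately have le: "ip2 ?F ?F + en ?F ?F \<le> ?C + 2 * energy (relax t)"
      using relax_ip_le[OF t] by linarith
    have "sobolev_norm_sq \<gamma> ?F = ennreal (ip2 ?F ?F) + ennreal (en ?F ?F)"
      unfolding sobolev_norm_sq_def seminorm_sq_en[OF F] nn_integral_sq_eq_ip[OF sobolev_sqint[OF F]] ..
    also have "\<dots> = ennreal (ip2 ?F ?F + en ?F ?F)" by (rule ennreal_plus[symmetric]) (auto simp: ip_nonneg en_nonneg)
    also have "\<dots> \<le> ennreal (?C + 2 * energy (relax t))" by (rule ennreal_leI[OF le])
    also have "\<dots> = ennreal ?C + ennreal (2 * energy (relax t))" by (rule ennreal_plus[OF C0]) (simp add: en_nonneg)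
    also have "ennreal (2 * energy (relax t)) = 2 * ennreal (energy (relax t))" by (simp add: ennreal_mult en_nonneg)
    also have "\<dots> \<le> 2 * ?S t" using r(2) by (rule mult_left_mono) simp
    finally show ?case unfolding e by simp
  qed
  then have "(\<integral>\<^sup>+t. sobolev_norm_sq \<gamma> (?\<Psi> t) \<partial>time_leb T) \<le> (\<integral>\<^sup>+t. ennreal ?C + 2 * ?S t \<partial>time_leb T)"
    by (rule nn_integral_mono_AE)
  also have "\<dots> = ennreal ?C * emeasure (time_leb T) (space (time_leb T)) + 2 * (\<integral>\<^sup>+t. ?S t \<partial>time_leb T)"
  proof -
    have m: "(\<lambda>t. ennreal (lam k * (prof (lam k) T t * ip2 \<psi> (ef k))\<^sup>2)) \<in> borel_measurable (time_leb T)" for k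
      by (rule measurable_compose[OF continuous_measurable_time_leb measurable_ennreal]) (intro continuous_intros prof_continuous)
    have S: "?S \<in> borel_measurable (time_leb T)" by (rule borel_measurable_suminf_order) (rule m)
    have S2: "(\<lambda>t. 2 * ?S t) \<in> borel_measurable (time_leb T)" by (intro borel_measurable_times_ennreal S) simp
    show ?thesis by (subst nn_integral_add[OF _ S2]) (simp_all add: nn_integral_cmult[OF S])
  qed
  also have "\<dots> \<le> ennreal ?C * ennreal T + 2 * ennreal (ip2 \<psi> \<psi> / 2)"
    using T relax_energy
    by (intro add_mono mult_left_mono) (auto simp: emeasure_restrict_space space_restrict_space)
  also have "\<dots> < \<infinity>" by (simp add: ennreal_mult_less_top)
  finally show ?thesis
    unfolding ac_paths_def using relax_path[OF \<Phi>s] meas ae2 by blast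
qed

end

end

section \<open>Test functions in space and time\<close>

context fractional
begin

text \<open>Compactness of the space-time rectangle and of the common support makes the bound and
  the margin independent of time.\<close>

lemma space_time_test_c2c:
  assumes "H \<in> space_time_tests T"
  obtains Ht d B where "\<forall>t\<in>{0..T}. c2c d B (H t)"
    "\<forall>t\<in>{0..T}. \<forall>u\<in>{0..1}. ((\<lambda>s. H s u) has_real_derivative Ht t u) (at t within {0..T})"
    "continuous_on ({0..T} \<times> {0..1}) (\<lambda>(t, u). H t u)" "continuous_on ({0..T} \<times> {0..1}) (\<lambda>(t, u). Ht t u)"
proof -
  from assms obtain Ht Hu Huu K where
    D: "\<forall>t\<in>{0..T}. \<forall>u\<in>{0..1}. ((\<lambda>s. H s u) has_real_derivative Ht t u) (at t within {0..T}) \<and>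
           (H t has_real_derivative Hu t u) (at u within {0..1}) \<and>
           (Hu t has_real_derivative Huu t u) (at u within {0..1})"
    and C: "\<forall>F\<in>{H, Ht, Hu, Huu}. continuous_on ({0..T} \<times> {0..1}) (\<lambda>(t, u). F t u)"
    and K: "compact K" "K \<subseteq> {0<..<1}" "\<forall>t\<in>{0..T}. \<forall>u\<in>{0..1} - K. H t u = 0"
    unfolding space_time_tests_def by blast
  have bd: "\<exists>B. \<forall>t\<in>{0..T}. \<forall>u\<in>{0..1}. \<bar>F t u\<bar> \<le> B" if "F \<in> {H, Ht, Hu, Huu}" for F
  proof -
    have "compact ((\<lambda>(t, u). F t u) ` ({0..T} \<times> {0..1}))"
      using C that by (intro compact_continuous_image compact_Times) auto
    then have "bounded ((\<lambda>(t, u). F t u) ` ({0..T} \<times> {0..1}))" by (rule compact_imp_bounded)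
    then obtain B where "\<forall>x\<in>(\<lambda>(t, u). F t u) ` ({0..T} \<times> {0..1}). norm x \<le> B" by (auto simp: bounded_iff)
    then show ?thesis by (intro exI[of _ B]) auto
  qed
  obtain B1 where B1: "\<forall>t\<in>{0..T}. \<forall>u\<in>{0..1}. \<bar>H t u\<bar> \<le> B1" using bd[of H] by auto
  obtain B2 where B2: "\<forall>t\<in>{0..T}. \<forall>u\<in>{0..1}. \<bar>Huu t u\<bar> \<le> B2" using bd[of Huu] by auto
  obtain d where d: "0 < d" "\<And>u. u < d \<or> 1 - d < u \<Longrightarrow> u \<notin> K"
  proof (cases "K = {}")
    case True
    then show ?thesis using that[of 1] by simp
  next
    case False
    obtain a where a: "a \<in> K" "\<forall>x\<in>K. a \<le> x" using compact_attains_inf[OF K(1) False] by blast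
    obtain b where b: "b \<in> K" "\<forall>x\<in>K. x \<le> b" using compact_attains_sup[OF K(1) False] by blast
    show ?thesis
    proof (rule that[of "min a (1 - b)"])
      show "0 < min a (1 - b)" using a(1) b(1) K(2) by auto
      show "u \<notin> K" if "u < min a (1 - b) \<or> 1 - min a (1 - b) < u" for u
      proof
        assume "u \<in> K"
        then have "a \<le> u" "u \<le> b" using a b by auto
        then show False using that by auto
      qed
    qed
  qed
  have c: "\<forall>t\<in>{0..T}. c2c d (max B1 B2) (H t)"
  proof
    fix t assume t: "t \<in> {0..T}"
    show "c2c d (max B1 B2) (H t)"
      unfolding c2c_def
    proof (rule conjI[OF d(1)], rule exI[of _ "Hu t"], rule exI[of _ "Huu t"], intro ballI conjI)
      fix u :: real assume u: "u \<in> {0..1}"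
      show "(H t has_real_derivative Hu t u) (at u within {0..1})" "(Hu t has_real_derivative Huu t u) (at u within {0..1})"
        using D t u by blast+
      have "\<bar>H t u\<bar> \<le> B1" "\<bar>Huu t u\<bar> \<le> B2" using B1 B2 t u by blast+
      then show "\<bar>H t u\<bar> \<le> max B1 B2" "\<bar>Huu t u\<bar> \<le> max B1 B2" by simp_all
      show "u < d \<or> 1 - d < u \<longrightarrow> H t u = 0" using d(2)[of u] K(3) t u by blast
    qed
  qed
  show thesis by (rule that[of d "max B1 B2" Ht, OF c]) (use C D in auto)
qed

section \<open>Time regularity of integrals against a test function\<close>

lemma (in -) space_time_uniform:
  fixes F :: "real \<Rightarrow> real \<Rightarrow> real"
  assumes F: "continuous_on ({0..T} \<times> {0..1}) (\<lambda>(t, u). F t u)" and "0 < e"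
  obtains \<delta> where "0 < \<delta>" "\<forall>s\<in>{0..T}. \<forall>t\<in>{0..T}. \<forall>u\<in>{0..1}. \<bar>s - t\<bar> < \<delta> \<longrightarrow> \<bar>F s u - F t u\<bar> < e"
proof -
  have "uniformly_continuous_on ({0..T} \<times> {0..1}) (\<lambda>(t, u). F t u)"
    by (intro compact_uniformly_continuous F compact_Times) auto
  then obtain \<delta> where \<delta>: "0 < \<delta>" "\<forall>p\<in>{0..T} \<times> {0..1}. \<forall>p'\<in>{0..T} \<times> {0..1}. dist p' p < \<delta> \<longrightarrow> dist (case p' of (t, u) \<Rightarrow> F t u) (case p of (t, u) \<Rightarrow> F t u) < e"
    using \<open>0 < e\<close> unfolding uniformly_continuous_on_def by blast
  have "\<bar>F s u - F t u\<bar> < e" if "s \<in> {0..T}" "t \<in> {0..T}" "u \<in> {0..1}" "\<bar>s - t\<bar> < \<delta>" for s t u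
    using \<delta>(2)[rule_format, of "(t, u)" "(s, u)"] that by (simp add: dist_prod_def dist_real_def)
  then show thesis using that \<delta>(1) by blast
qed

lemma (in -) slice_continuous:
  fixes F :: "real \<Rightarrow> real \<Rightarrow> real"
  assumes F: "continuous_on ({0..T} \<times> {0..1}) (\<lambda>(t, u). F t u)" and t: "t \<in> {0..T}"
  shows "continuous_on {0..1} (F t)"
proof -
  have "continuous_on {0..1} (\<lambda>u. (\<lambda>(t, u). F t u) (t, u))"
    by (rule continuous_on_compose2[OF F]) (use t in \<open>auto intro!: continuous_intros\<close>)
  then show ?thesis by simp
qed

lemma (in -) ip_slice_continuous:
  fixes F :: "real \<Rightarrow> real \<Rightarrow> real"
  assumes F: "continuous_on ({0..T} \<times> {0..1}) (\<lambda>(t, u). F t u)" and w: "w \<in> sqint unit_leb"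
  shows "continuous_on {0..T} (\<lambda>t. ip2 w (F t))"
  unfolding continuous_on_iff
proof (intro ballI allI impI)
  fix t e :: real assume t: "t \<in> {0..T}" and e: "0 < e"
  \<comment> \<open>The added 1 keeps the divisor positive when \<open>w\<close> has norm zero and
    provides the strict inequality at the end.\<close>
  define c where "c = sqrt (ip2 w w) + 1"
  have c: "0 < c" unfolding c_def using ip_nonneg[of unit_leb w] by (simp add: add_nonneg_pos)
  obtain \<delta> where \<delta>: "0 < \<delta>" "\<forall>s\<in>{0..T}. \<forall>t\<in>{0..T}. \<forall>u\<in>{0..1}. \<bar>s - t\<bar> < \<delta> \<longrightarrow> \<bar>F s u - F t u\<bar> < e / c"
    by (rule space_time_uniform[OF F, of "e / c"]) (use e c in auto)
  have Fs: "F s \<in> sqint unit_leb" if "s \<in> {0..T}" for s by (rule continuous_sqint[OF slice_continuous[OF F that]])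
  show "\<exists>\<delta>>0. \<forall>s\<in>{0..T}. dist s t < \<delta> \<longrightarrow> dist (ip2 w (F s)) (ip2 w (F t)) < e"
  proof (intro exI[of _ \<delta>] conjI \<delta>(1) ballI impI)
    fix s assume s: "s \<in> {0..T}" "dist s t < \<delta>"
    have "\<bar>F s u - F t u\<bar> \<le> e / c" if "u \<in> {0..1}" for u
      using \<delta>(2)[rule_format, OF s(1) t that] s(2) by (simp add: dist_real_def)
    then have le: "nsq unit_leb (\<lambda>u. F s u - F t u) \<le> (e / c)\<^sup>2" by (rule ip2_bound)
    have eq: "ip2 w (F s) - ip2 w (F t) = ip2 w (\<lambda>u. F s u - F t u)"
      by (rule ip_diff_right[symmetric, OF Fs[OF s(1)] Fs[OF t] w])
    have "\<bar>ip2 w (\<lambda>u. F s u - F t u)\<bar> \<le> sqrt (ip2 w w) * sqrt (nsq unit_leb (\<lambda>u. F s u - F t u))"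
      by (intro ip_Cauchy_Schwarz_sqrt w sqint_diff Fs s t)
    also have "\<dots> \<le> sqrt (ip2 w w) * (e / c)"
      using real_sqrt_le_mono[OF le] e c by (intro mult_left_mono) (auto simp: ip_nonneg)
    also have "\<dots> < c * (e / c)" using e c by (intro mult_strict_right_mono) (auto simp: c_def)
    finally show "dist (ip2 w (F s)) (ip2 w (F t)) < e" using c by (simp add: dist_real_def eq)
  qed
qed

text \<open>Subtracting the linear part in time and applying the mean value inequality bounds the
  remainder by the oscillation of \<open>Ht\<close>, uniformly in space; Cauchy-Schwarz then
  differentiates under the integral.\<close>

lemma (in -) ip_slice_deriv:
  assumes H: "continuous_on ({0..T} \<times> {0..1}) (\<lambda>(t, u). H t u)" and Ht: "continuous_on ({0..T} \<times> {0..1}) (\<lambda>(t, u). Ht t u)"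
    and D: "\<forall>t\<in>{0..T}. \<forall>u\<in>{0..1}. ((\<lambda>s. H s u) has_real_derivative Ht t u) (at t within {0..T})"
    and w: "w \<in> sqint unit_leb" and t: "t \<in> {0..T}"
  shows "((\<lambda>s. ip2 w (H s)) has_real_derivative ip2 w (Ht t)) (at t within {0..T})"
proof -
  have Hs: "H s \<in> sqint unit_leb" if "s \<in> {0..T}" for s by (rule continuous_sqint[OF slice_continuous[OF H that]])
  have Hts: "Ht t \<in> sqint unit_leb" by (rule continuous_sqint[OF slice_continuous[OF Ht t]])
  have "\<exists>\<delta>>0. \<forall>s\<in>{0..T}. s \<noteq> t \<and> dist s t < \<delta> \<longrightarrow> dist ((ip2 w (H s) - ip2 w (H t)) / (s - t)) (ip2 w (Ht t)) < e" if e: "0 < e" for e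
  proof -
    define c where "c = sqrt (ip2 w w) + 1"
    have c: "0 < c" unfolding c_def using ip_nonneg[of unit_leb w] by (simp add: add_nonneg_pos)
    obtain \<delta> where \<delta>: "0 < \<delta>" "\<forall>s\<in>{0..T}. \<forall>t\<in>{0..T}. \<forall>u\<in>{0..1}. \<bar>s - t\<bar> < \<delta> \<longrightarrow> \<bar>Ht s u - Ht t u\<bar> < e / c"
      by (rule space_time_uniform[OF Ht, of "e / c"]) (use e c in auto)
    show ?thesis
    proof (intro exI[of _ \<delta>] conjI \<delta>(1) ballI impI)
      fix s assume s: "s \<in> {0..T}" and st: "s \<noteq> t \<and> dist s t < \<delta>"
      let ?R = "\<lambda>u. (H s u - H t u) - (s - t) * Ht t u"
      have R: "\<bar>?R u\<bar> \<le> e / c * \<bar>s - t\<bar>" if u: "u \<in> {0..1}" for u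
      proof -
        let ?S = "{0..T} \<inter> {t - \<delta><..<t + \<delta>}"
        have "norm ((H s u - s * Ht t u) - (H t u - t * Ht t u)) \<le> e / c * norm (s - t)"
        proof (rule field_differentiable_bound[of ?S "\<lambda>r. H r u - r * Ht t u" "\<lambda>r. Ht r u - Ht t u"])
          show "convex ?S" by (intro convex_Int) auto
          fix r assume r: "r \<in> ?S"
          have "((\<lambda>r. H r u) has_real_derivative Ht r u) (at r within ?S)"
            by (rule DERIV_subset[of _ _ _ "{0..T}"]) (use D r u in auto)
          then have "((\<lambda>r. H r u - r * Ht t u) has_real_derivative Ht r u - 1 * Ht t u) (at r within ?S)"
            by (intro DERIV_diff DERIV_cmult_right DERIV_ident)
          then show "((\<lambda>r. H r u - r * Ht t u) has_real_derivative Ht r u - Ht t u) (at r within ?S)" by simp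
          show "norm (Ht r u - Ht t u) \<le> e / c"
          proof -
            have "\<bar>r - t\<bar> < \<delta>" using r by auto
            then have "\<bar>Ht r u - Ht t u\<bar> < e / c" using \<delta>(2) r t u by blast
            then show ?thesis by simp
          qed
        qed (use s t st \<delta>(1) in \<open>auto simp: dist_real_def\<close>)
        then show ?thesis by (simp add: algebra_simps)
      qed
      have le: "ip2 ?R ?R \<le> (e / c * \<bar>s - t\<bar>)\<^sup>2" by (rule ip2_bound[OF R])
      have Rs: "?R \<in> sqint unit_leb" by (intro sqint_diff sqint_cmult Hs s t Hts)
      have "ip2 w ?R = (ip2 w (H s) - ip2 w (H t)) - (s - t) * ip2 w (Ht t)"
        by (simp add: ip_diff_right[OF sqint_diff[OF Hs[OF s] Hs[OF t]] sqint_cmult[OF Hts] w] ip_diff_right[OF Hs[OF s] Hs[OF t] w] ip_cmult_right)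
      then have eq: "(ip2 w (H s) - ip2 w (H t)) / (s - t) - ip2 w (Ht t) = ip2 w ?R / (s - t)"
        using st by (simp add: field_simps)
      have "\<bar>ip2 w ?R\<bar> \<le> sqrt (ip2 w w) * sqrt (ip2 ?R ?R)" by (intro ip_Cauchy_Schwarz_sqrt w Rs)
      also have "\<dots> \<le> sqrt (ip2 w w) * (e / c * \<bar>s - t\<bar>)"
        using real_sqrt_le_mono[OF le] e c by (intro mult_left_mono) (auto simp: ip_nonneg abs_mult)
      also have "\<dots> < c * (e / c * \<bar>s - t\<bar>)" using e c st by (intro mult_strict_right_mono) (auto simp: c_def)
      also have "\<dots> = e * \<bar>s - t\<bar>" using c by simp
      finally have "\<bar>ip2 w ?R / (s - t)\<bar> < e" using st by (simp add: abs_divide divide_less_eq)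
      then show "dist ((ip2 w (H s) - ip2 w (H t)) / (s - t)) (ip2 w (Ht t)) < e" unfolding dist_real_def eq .
    qed
  qed
  then show ?thesis unfolding has_field_derivative_iff Lim_within by (auto simp: dist_real_def)
qed

text \<open>The difference of two energies is the form applied to the difference and the sum of the
  slices. Integration by parts moves the Laplacian to the sum, where it is uniformly bounded, so
  uniform continuity of \<open>H\<close> itself suffices.\<close>

lemma test_energy_continuous:
  fixes H :: "real \<Rightarrow> real \<Rightarrow> real"
  assumes c: "\<forall>t\<in>{0..T}. c2c d B (H t)" and H: "continuous_on ({0..T} \<times> {0..1}) (\<lambda>(t, u). H t u)"
  shows "continuous_on {0..T} (\<lambda>t. energy (H t))"
  unfolding continuous_on_iff
proof (intro ballI allI impI)
  fix t e :: real assume t: "t \<in> {0..T}" and e: "0 < e"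
  have lb: "0 \<le> lapbound d (B + B)"
  proof -
    have "c2c d (B + B) (\<lambda>u. H t u + H t u)" using c t by (intro c2c_add) auto
    from frac_lap_bound[OF this, of 0] show ?thesis by simp
  qed
  define L where "L = lapbound d (B + B) + 1"
  have L: "0 < L" using lb by (simp add: L_def)
  obtain \<delta> where \<delta>: "0 < \<delta>" "\<forall>s\<in>{0..T}. \<forall>t\<in>{0..T}. \<forall>u\<in>{0..1}. \<bar>s - t\<bar> < \<delta> \<longrightarrow> \<bar>H s u - H t u\<bar> < e / L"
    by (rule space_time_uniform[OF H, of "e / L"]) (use e L in auto)
  show "\<exists>\<delta>>0. \<forall>s\<in>{0..T}. dist s t < \<delta> \<longrightarrow> dist (energy (H s)) (energy (H t)) < e"
  proof (intro exI[of _ \<delta>] conjI \<delta>(1) ballI impI)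
    fix s assume s: "s \<in> {0..T}" "dist s t < \<delta>"
    have cs: "c2c d B (H s)" and ct: "c2c d B (H t)" using c s t by auto
    let ?D = "\<lambda>u. H s u - H t u" and ?P = "\<lambda>u. H s u + H t u"
    have cP: "c2c d (B + B) ?P" by (rule c2c_add[OF cs ct])
    have Ss: "H s \<in> sobolev \<gamma>" and St: "H t \<in> sobolev \<gamma>" using c2c_H0(1)[OF cs] c2c_H0(1)[OF ct] by (auto simp: H0_def)
    have DS: "?D \<in> sobolev \<gamma>" by (rule sobolev_diff[OF Ss St])
    have "energy (H s) - energy (H t) = en ?D ?P"
      by (simp add: en_diff_left[OF Ss St sobolev_add[OF Ss St]] en_add_right[OF Ss St Ss] en_add_right[OF Ss St St] en_commute[of "H t" "H s"])
    also have "\<dots> = - ip2 ?D (frac_lap \<gamma> ?P)" using ip_frac_lap[OF DS cP] by simp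
    finally have eq: "energy (H s) - energy (H t) = - ip2 ?D (frac_lap \<gamma> ?P)" .
    have "\<bar>- ip2 ?D (frac_lap \<gamma> ?P)\<bar> \<le> sqrt (ip2 ?D ?D) * sqrt (nsq unit_leb (frac_lap \<gamma> ?P))"
      unfolding abs_minus_cancel
      by (intro ip_Cauchy_Schwarz_sqrt sobolev_sqint DS continuous_sqint frac_lap_continuous[OF cP])
    also have "\<dots> \<le> (e / L) * lapbound d (B + B)"
    proof (rule mult_mono)
      have "\<bar>?D u\<bar> \<le> e / L" if "u \<in> {0..1}" for u
        using \<delta>(2)[rule_format, OF s(1) t that] s(2) by (simp add: dist_real_def)
      then have "ip2 ?D ?D \<le> (e / L)\<^sup>2" by (rule ip2_bound)
      then show "sqrt (ip2 ?D ?D) \<le> e / L" using e L by (intro real_le_lsqrt) (auto simp: ip_nonneg)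
      have "nsq unit_leb (frac_lap \<gamma> ?P) \<le> (lapbound d (B + B))\<^sup>2"
        by (rule ip2_bound[OF frac_lap_bound[OF cP]])
      then show "sqrt (nsq unit_leb (frac_lap \<gamma> ?P)) \<le> lapbound d (B + B)"
        using lb by (intro real_le_lsqrt) (auto simp: ip_nonneg)
    qed (use e L in \<open>auto simp: ip_nonneg\<close>)
    also have "\<dots> < (e / L) * L" using e L by (intro mult_strict_left_mono) (auto simp: L_def)
    finally show "dist (energy (H s)) (energy (H t)) < e" using L by (simp add: dist_real_def eq)
  qed
qed

section \<open>Upper bound for the quasi-potential\<close>

text \<open>Completing the square with the weight that makes the second term exactly the energy
  penalty of one mode; this fixes the divisor 4 l.\<close>

lemma (in -) young_weighted:
  fixes a d h l :: real
  assumes "0 < l"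
  shows "a * (d * h) \<le> a\<^sup>2 / (4 * l) * d\<^sup>2 + l * h\<^sup>2"
proof -
  have "0 \<le> (a * d - 2 * l * h)\<^sup>2 / (4 * l)" using assms by simp
  also have "\<dots> = a\<^sup>2 / (4 * l) * d\<^sup>2 + l * h\<^sup>2 - a * (d * h)"
    using assms by (simp add: power2_eq_square field_simps)
  finally show ?thesis by simp
qed

text \<open>Harmonicity removes the stationary profile, and integration by parts in time leaves in
  each mode the product of the drive and the test coordinate. Young's inequality trades this for the
  cost of the drive plus a spectral term that Bessel's inequality absorbs in the energy penalty. The
  smallest eigenvalue gives the worst factor, which is why only \<open>lam 0\<close>
  appears.\<close>

lemma relax_action:
  assumes T: "0 < T" and psi: "\<psi> \<in> sqint unit_leb"
    and \<Phi>: "\<Phi> \<in> sobolev \<gamma>" "\<And>w. w \<in> H0 \<Longrightarrow> en \<Phi> w = 0"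
    and H: "H \<in> space_time_tests T"
  shows "J_functional \<gamma> T H (\<lambda>t. density_measure (\<lambda>u. \<Phi> u + relax T \<psi> t u)) \<Phi>
    \<le> ip2 \<psi> \<psi> / (2 * (1 - exp (- (2 * lam 0 * T))))"
proof -
  let ?M = "time_leb T" and ?a = "\<lambda>k. ip2 \<psi> (ef k)" and ?b = "\<lambda>k. prof (lam k) T" and ?r = "relax T \<psi>"
  let ?C = "ip2 \<psi> \<psi> / (2 * (1 - exp (- (2 * lam 0 * T))))"
  obtain Ht d B where c: "\<forall>t\<in>{0..T}. c2c d B (H t)"
    and D: "\<forall>t\<in>{0..T}. \<forall>u\<in>{0..1}. ((\<lambda>s. H s u) has_real_derivative Ht t u) (at t within {0..T})"
    and HC: "continuous_on ({0..T} \<times> {0..1}) (\<lambda>(t, u). H t u)" and HtC: "continuous_on ({0..T} \<times> {0..1}) (\<lambda>(t, u). Ht t u)"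
    by (rule space_time_test_c2c[OF H])
  have c': "c2c d B (H t)" if "t \<in> {0..T}" for t using c that by blast
  have HH: "H t \<in> H0" if "t \<in> {0..T}" for t by (rule c2c_H0(1)[OF c'[OF that]])
  have HS: "H t \<in> sobolev \<gamma>" if "t \<in> {0..T}" for t by (rule H0_sobolev[OF HH[OF that]])
  have Hq: "H t \<in> sqint unit_leb" if "t \<in> {0..T}" for t by (rule H0_sqint[OF HH[OF that]])
  have Htq: "Ht t \<in> sqint unit_leb" if "t \<in> {0..T}" for t by (rule continuous_sqint[OF slice_continuous[OF HtC that]])
  have Lq: "frac_lap \<gamma> (H t) \<in> sqint unit_leb" if "t \<in> {0..T}" for t by (rule continuous_sqint[OF frac_lap_continuous[OF c'[OF that]]])
  note \<Phi>s = sobolev_sqint[OF \<Phi>(1)]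
  have T0: "0 \<in> {0..T}" "T \<in> {0..T}" using T by auto
  have "compact ((\<lambda>(t, u). Ht t u) ` ({0..T} \<times> {0..1}))" by (intro compact_continuous_image compact_Times HtC) auto
  then have "bounded ((\<lambda>(t, u). Ht t u) ` ({0..T} \<times> {0..1}))" by (rule compact_imp_bounded)
  then obtain B' where "\<forall>x\<in>(\<lambda>(t, u). Ht t u) ` ({0..T} \<times> {0..1}). norm x \<le> B'" by (auto simp: bounded_iff)
  then have B': "\<bar>Ht t u\<bar> \<le> B'" if "t \<in> {0..T}" "u \<in> {0..1}" for t u using that by auto
  \<comment> \<open>A bound, uniform in space and time, for the time derivative plus the Laplacian
    of the test; it makes the error of the spectral sums uniform in time.\<close>
  define L where "L = B' + lapbound d B"
  let ?K = "\<lambda>s u. Ht s u + frac_lap \<gamma> (H s) u"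
  have Kq: "?K s \<in> sqint unit_leb" if "s \<in> {0..T}" for s by (intro sqint_add Htq Lq that)
  have KL: "\<bar>?K s u\<bar> \<le> L" if "s \<in> {0..T}" "u \<in> {0..1}" for s u
    using B'[OF that] frac_lap_bound[OF c'[OF that(1)] that(2)] unfolding L_def by linarith
  have L0: "0 \<le> L" using KL[OF T0(1), of 0] by auto
  let ?h = "\<lambda>k s. ip2 (ef k) (H s)" and ?h' = "\<lambda>k s. ip2 (ef k) (Ht s)"
  have hc: "continuous_on {0..T} (?h k)" for k by (rule ip_slice_continuous[OF HC ef_sqint])
  have h'c: "continuous_on {0..T} (?h' k)" for k by (rule ip_slice_continuous[OF HtC ef_sqint])
  have hD: "(?h k has_real_derivative ?h' k s) (at s within {0..T})" if "s \<in> {0..T}" for k s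
    by (rule ip_slice_deriv[OF HC HtC D ef_sqint that])
  let ?X = "\<lambda>s. ip2 (?r s) (?K s)" and ?Xn = "\<lambda>n s. \<Sum>k<n. ?a k * (?b k s * ?h' k s - lam k * (?b k s * ?h k s))"
  let ?\<epsilon> = "\<lambda>n. sqrt (tail \<psi> n) * L"
  have Xn: "\<bar>?Xn n s - ?X s\<bar> \<le> ?\<epsilon> n" if s: "s \<in> {0..T}" for n s
  proof -
    have kk: "ip2 (ef k) (?K s) = ?h' k s - lam k * ?h k s" for k
      by (simp add: ip_add_right[OF Htq[OF s] Lq[OF s] ef_sqint] ip_frac_lap[OF ef_sobolev c'[OF s]] en_ef[OF HH[OF s]])
    have "?Xn n s = (\<Sum>k<n. ?b k s * ?a k * ip2 (ef k) (?K s))"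
      unfolding kk by (intro sum.cong refl) (simp add: algebra_simps)
    then have "\<bar>?Xn n s - ?X s\<bar> \<le> sqrt (tail \<psi> n) * sqrt (nsq unit_leb (?K s))"
      using relax_ip_approx[OF T psi s Kq[OF s], of n] by simp
    also have "\<dots> \<le> ?\<epsilon> n"
      using ip2_bound[OF KL[OF s]] L0 tail_nonneg[OF T psi]
      by (intro mult_left_mono real_le_lsqrt) (auto simp: ip_nonneg)
    finally show ?thesis .
  qed
  have Xnc: "continuous_on {0..T} (?Xn n)" for n by (intro continuous_intros prof_continuous hc h'c)
  have Xc: "continuous_on {0..T} ?X"
  proof (rule continuous_on_uniform_bound(1)[where f = ?Xn and \<epsilon> = ?\<epsilon>])
    show "continuous_on {0..T} (?Xn n)" for n by (rule Xnc)
    show "\<bar>?Xn n s - ?X s\<bar> \<le> ?\<epsilon> n" if "s \<in> {0..T}" for n s by (rule Xn[OF that])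
  qed (rule sqrt_tail_lim[OF T psi])
  note int = continuous_integrable_time_leb
  have fin: "pairing (density_measure (\<lambda>u. \<Phi> u + ?r T u)) (H T) = ip2 \<Phi> (H T) + ip2 \<psi> (H T)"
    by (simp add: relax_T[OF T psi] pairing_density_ip[OF sqint_add[OF \<Phi>s psi] Hq[OF T0(2)]] ip_add_left[OF \<Phi>s psi Hq[OF T0(2)]])
  have td: "time_deriv T H s u = Ht s u" if "s \<in> {0..T}" "u \<in> {0..1}" for s u
    unfolding time_deriv_def
    by (rule vector_derivative_within_cbox[of 0 T, simplified])
      (use T that D in \<open>auto simp: has_real_derivative_iff_has_vector_derivative\<close>)
  have mid: "(LINT s:{0..T}|lborel. pairing (density_measure (\<lambda>u. \<Phi> u + ?r s u)) (\<lambda>u. time_deriv T H s u + frac_lap \<gamma> (H s) u))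
      = (ip2 \<Phi> (H T) - ip2 \<Phi> (H 0)) + (LINT s|?M. ?X s)"
  proof -
    have "(LINT s:{0..T}|lborel. pairing (density_measure (\<lambda>u. \<Phi> u + ?r s u)) (\<lambda>u. time_deriv T H s u + frac_lap \<gamma> (H s) u))
        = (LINT s|?M. ip2 \<Phi> (Ht s) + ?X s)"
      unfolding set_integral_time_leb
    proof (rule Bochner_Integration.integral_cong[OF refl])
      fix s assume "s \<in> space ?M"
      then have s: "s \<in> {0..T}" by (simp add: space_restrict_space)
      note rs = relax_sqint[OF T psi s]
      have "pairing (density_measure (\<lambda>u. \<Phi> u + ?r s u)) (\<lambda>u. time_deriv T H s u + frac_lap \<gamma> (H s) u)
          = pairing (density_measure (\<lambda>u. \<Phi> u + ?r s u)) (?K s)"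
        using td[OF s] by (intro pairing_cong) auto
      also have "\<dots> = ip2 \<Phi> (?K s) + ?X s"
        by (simp add: pairing_density_ip[OF sqint_add[OF \<Phi>s rs] Kq[OF s]] ip_add_left[OF \<Phi>s rs Kq[OF s]])
      \<comment> \<open>The Laplacian term is minus the energy form of the profile with the slice,
        and the slice lies in \<open>H0\<close>.\<close>
      also have "ip2 \<Phi> (?K s) = ip2 \<Phi> (Ht s)"
        by (simp add: ip_add_right[OF Htq[OF s] Lq[OF s] \<Phi>s] ip_frac_lap[OF \<Phi>(1) c'[OF s]] \<Phi>(2)[OF HH[OF s]])
      finally show "pairing (density_measure (\<lambda>u. \<Phi> u + ?r s u)) (\<lambda>u. time_deriv T H s u + frac_lap \<gamma> (H s) u) = ip2 \<Phi> (Ht s) + ?X s" .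
    qed
    also have "\<dots> = (LINT s|?M. ip2 \<Phi> (Ht s)) + (LINT s|?M. ?X s)"
      by (intro Bochner_Integration.integral_add int Xc ip_slice_continuous[OF HtC \<Phi>s])
    also have "(LINT s|?M. ip2 \<Phi> (Ht s)) = ip2 \<Phi> (H T) - ip2 \<Phi> (H 0)"
    proof (rule FTC_time_leb[OF less_imp_le[OF T]])
      show "((\<lambda>s. ip2 \<Phi> (H s)) has_real_derivative ip2 \<Phi> (Ht s)) (at s within {0..T})" if "s \<in> {0..T}" for s
        by (rule ip_slice_deriv[OF HC HtC D \<Phi>s that])
    qed (rule ip_slice_continuous[OF HtC \<Phi>s])
    finally show ?thesis .
  qed
  let ?e = "\<lambda>s. energy (H s)"
  have ec: "continuous_on {0..T} ?e" by (rule test_energy_continuous[OF c HC])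
  have ener: "(LINT s:{0..T}|lborel. enn2real (seminorm_sq \<gamma> (H s))) = (LINT s|?M. ?e s)"
    unfolding set_integral_time_leb
  proof (rule Bochner_Integration.integral_cong[OF refl])
    fix s assume "s \<in> space ?M"
    then have "s \<in> {0..T}" by (simp add: space_restrict_space)
    then show "enn2real (seminorm_sq \<gamma> (H s)) = ?e s" by (simp add: seminorm_sq_en[OF HS] en_nonneg)
  qed
  have "(LINT u|unit_leb. \<Phi> u * H 0 u) = ip2 \<Phi> (H 0)" by (simp add: ip_def)
  then have J: "J_functional \<gamma> T H (\<lambda>t. density_measure (\<lambda>u. \<Phi> u + ?r t u)) \<Phi> = ip2 \<psi> (H T) - (LINT s|?M. ?X s) - (LINT s|?M. ?e s)"
    unfolding J_functional_def fin mid ener by simp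
  have main: "(\<Sum>k<n. ?a k * ?h k T) - (LINT s|?M. ?Xn n s) \<le> ?C + (LINT s|?M. ?e s)" for n
  proof -
    let ?d = "\<lambda>k. drive (lam k) T"
    have ic: "continuous_on {0..T} (\<lambda>s. ?d k s * ?h k s)" for k by (intro continuous_intros drive_continuous hc)
    \<comment> \<open>The derivative of \<open>prof\<close> is \<open>drive\<close> minus
      \<open>lam k\<close> times \<open>prof\<close>. The terminal value is 1, the initial value 0,
      and the relaxation terms cancel.\<close>
    have one: "?a k * ?h k T - (LINT s|?M. ?a k * (?b k s * ?h' k s - lam k * (?b k s * ?h k s))) = (LINT s|?M. ?a k * (?d k s * ?h k s))" for k
    proof -
      let ?g = "\<lambda>s. ?b k s * ?h' k s - lam k * (?b k s * ?h k s)"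
      have gc: "continuous_on {0..T} ?g" by (intro continuous_intros prof_continuous hc h'c)
      have "(LINT s|?M. ?d k s * ?h k s + ?g s) = ?b k T * ?h k T - ?b k 0 * ?h k 0"
      proof (rule FTC_time_leb[OF less_imp_le[OF T]])
        fix s assume s: "s \<in> {0..T}"
        have "((\<lambda>s. ?b k s * ?h k s) has_real_derivative (?d k s - lam k * ?b k s) * ?h k s + ?h' k s * ?b k s) (at s within {0..T})"
          by (rule DERIV_mult'[THEN DERIV_cong, OF prof_deriv[OF lam_pos T] hD[OF s]]) (simp add: algebra_simps)
        moreover have "(?d k s - lam k * ?b k s) * ?h k s + ?h' k s * ?b k s = ?d k s * ?h k s + ?g s" by (simp add: algebra_simps)
        ultimately show "((\<lambda>s. ?b k s * ?h k s) has_real_derivative ?d k s * ?h k s + ?g s) (at s within {0..T})" by simp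
      qed (intro continuous_intros ic gc)
      then have "(LINT s|?M. ?d k s * ?h k s) + (LINT s|?M. ?g s) = ?h k T"
        by (simp only: Bochner_Integration.integral_add[OF int[OF ic] int[OF gc]]) (simp add: prof_T[OF lam_pos T] prof_0)
      then have "?h k T - (LINT s|?M. ?g s) = (LINT s|?M. ?d k s * ?h k s)" by simp
      then show ?thesis by (simp only: integral_mult_right_zero right_diff_distrib[symmetric])
    qed
    have "(LINT s|?M. ?Xn n s) = (\<Sum>k<n. LINT s|?M. ?a k * (?b k s * ?h' k s - lam k * (?b k s * ?h k s)))"
      by (intro Bochner_Integration.integral_sum int continuous_intros prof_continuous hc h'c)
    then have "(\<Sum>k<n. ?a k * ?h k T) - (LINT s|?M. ?Xn n s) = (\<Sum>k<n. LINT s|?M. ?a k * (?d k s * ?h k s))"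
      by (simp only: sum_subtractf[symmetric] one)
    also have "\<dots> \<le> (\<Sum>k<n. LINT s|?M. (?a k)\<^sup>2 / (4 * lam k) * (?d k s)\<^sup>2 + lam k * (?h k s)\<^sup>2)"
      by (intro sum_mono integral_mono int continuous_intros drive_continuous hc young_weighted lam_pos)
    also have "\<dots> = (\<Sum>k<n. (LINT s|?M. (?a k)\<^sup>2 / (4 * lam k) * (?d k s)\<^sup>2) + (LINT s|?M. lam k * (?h k s)\<^sup>2))"
      by (intro sum.cong refl Bochner_Integration.integral_add int continuous_intros drive_continuous hc)
    also have "\<dots> = (\<Sum>k<n. LINT s|?M. (?a k)\<^sup>2 / (4 * lam k) * (?d k s)\<^sup>2) + (LINT s|?M. (\<Sum>k<n. lam k * (?h k s)\<^sup>2))"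
      by (subst Bochner_Integration.integral_sum) (auto simp: sum.distrib intro!: int continuous_intros hc)
    also have "\<dots> \<le> ?C + (LINT s|?M. ?e s)"
    proof (rule add_mono)
      have "(LINT s|?M. (?a k)\<^sup>2 / (4 * lam k) * (?d k s)\<^sup>2) \<le> (?a k)\<^sup>2 * (1 / (2 * (1 - exp (- (2 * lam 0 * T)))))" for k
      proof -
        have "(LINT s|?M. (?a k)\<^sup>2 / (4 * lam k) * (?d k s)\<^sup>2) = (?a k)\<^sup>2 / (4 * lam k) * (2 * lam k / (1 - exp (- (2 * lam k * T))))"
          by (simp only: integral_mult_right_zero drive_action[OF lam_pos T])
        also have "\<dots> = (?a k)\<^sup>2 * (1 / (2 * (1 - exp (- (2 * lam k * T)))))" using lam_pos[of k] by simp
        also have "\<dots> \<le> (?a k)\<^sup>2 * (1 / (2 * (1 - exp (- (2 * lam 0 * T)))))"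
        proof (rule mult_left_mono)
          have "2 * lam 0 * T \<le> 2 * lam k * T" using lam_mono[of 0 k] T by simp
          then have "exp (- (2 * lam k * T)) \<le> exp (- (2 * lam 0 * T))" by simp
          moreover have "exp (- (2 * lam 0 * T)) < 1" using lam_pos[of 0] T by simp
          ultimately show "1 / (2 * (1 - exp (- (2 * lam k * T)))) \<le> 1 / (2 * (1 - exp (- (2 * lam 0 * T))))"
            using lam_pos[of k] T by (intro divide_left_mono mult_pos_pos) auto
        qed simp
        finally show ?thesis .
      qed
      then have "(\<Sum>k<n. LINT s|?M. (?a k)\<^sup>2 / (4 * lam k) * (?d k s)\<^sup>2) \<le> (\<Sum>k<n. (?a k)\<^sup>2 * (1 / (2 * (1 - exp (- (2 * lam 0 * T))))))"
        by (intro sum_mono)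
      also have "\<dots> = (\<Sum>k<n. (?a k)\<^sup>2) * (1 / (2 * (1 - exp (- (2 * lam 0 * T)))))" by (simp only: sum_distrib_right)
      also have "\<dots> \<le> ip2 \<psi> \<psi> * (1 / (2 * (1 - exp (- (2 * lam 0 * T)))))"
        using lam_pos[of 0] T by (intro mult_right_mono bessel psi) auto
      finally show "(\<Sum>k<n. LINT s|?M. (?a k)\<^sup>2 / (4 * lam k) * (?d k s)\<^sup>2) \<le> ?C" by simp
      show "(LINT s|?M. (\<Sum>k<n. lam k * (?h k s)\<^sup>2)) \<le> (LINT s|?M. ?e s)"
      proof (rule integral_mono)
        show "integrable ?M (\<lambda>s. \<Sum>k<n. lam k * (?h k s)\<^sup>2)" by (intro int continuous_intros hc)
        show "integrable ?M ?e" by (rule int[OF ec])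
        fix s assume "s \<in> space ?M"
        then have "s \<in> {0..T}" by (simp add: space_restrict_space)
        then show "(\<Sum>k<n. lam k * (?h k s)\<^sup>2) \<le> ?e s" using en_bessel[OF HH, of s n] by (simp add: ip_commute[of unit_leb "H s"])
      qed
    qed
    finally show ?thesis .
  qed
  \<comment> \<open>Replacing the full series by n modes costs an error at the final time and one in
    the time integral, both proportional to the root of the tail.\<close>
  have "ip2 \<psi> (H T) - (LINT s|?M. ?X s) - (LINT s|?M. ?e s) \<le> ?C + sqrt (tail \<psi> n) * (sqrt (nsq unit_leb (H T)) + T * L)" for n
  proof -
    have "\<bar>(\<Sum>k<n. ?a k * ?h k T) - ip2 \<psi> (H T)\<bar> \<le> sqrt (tail \<psi> n) * sqrt (nsq unit_leb (H T))"
      using relax_ip_approx[OF T psi T0(2) Hq[OF T0(2)], of n] by (simp add: prof_T[OF lam_pos T] relax_T[OF T psi])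
    moreover have "(LINT s|?M. ?Xn n s) - (LINT s|?M. ?X s) \<le> T * ?\<epsilon> n"
    proof -
      have "(LINT s|?M. ?Xn n s) - (LINT s|?M. ?X s) = (LINT s|?M. ?Xn n s - ?X s)"
        by (rule Bochner_Integration.integral_diff[symmetric, OF int[OF Xnc] int[OF Xc]])
      also have "\<dots> \<le> (LINT s|?M. ?\<epsilon> n)"
      proof (rule integral_mono)
        show "integrable ?M (\<lambda>s. ?Xn n s - ?X s)" by (intro int continuous_on_diff Xnc Xc)
        show "integrable ?M (\<lambda>s. ?\<epsilon> n)" by (intro int continuous_intros)
        fix s assume "s \<in> space ?M"
        then have "s \<in> {0..T}" by (simp add: space_restrict_space)
        from Xn[OF this, of n] show "?Xn n s - ?X s \<le> ?\<epsilon> n" by linarith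
      qed
      also have "\<dots> = T * ?\<epsilon> n" using T by (simp add: space_restrict_space measure_restrict_space)
      finally show ?thesis .
    qed
    moreover have "sqrt (tail \<psi> n) * (sqrt (nsq unit_leb (H T)) + T * L) = sqrt (tail \<psi> n) * sqrt (nsq unit_leb (H T)) + T * ?\<epsilon> n"
      by (simp add: algebra_simps)
    ultimately show ?thesis using main[of n] by linarith
  qed
  moreover have "(\<lambda>n. ?C + sqrt (tail \<psi> n) * (sqrt (nsq unit_leb (H T)) + T * L)) \<longlonglongrightarrow> ?C + 0"
    by (intro tendsto_add tendsto_const sqrt_tail_lim[OF T psi])
  ultimately have "ip2 \<psi> (H T) - (LINT s|?M. ?X s) - (LINT s|?M. ?e s) \<le> ?C + 0"
    by (intro LIMSEQ_le_const[of _ "?C + 0"]) auto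
  then show ?thesis unfolding J by simp
qed

section \<open>The two inequalities between the quasi-potential and the stationary rate\<close>

lemma stationary_rate_integrand:
  fixes p q :: real
  defines "\<Phi> \<equiv> stationary_profile \<gamma> p q"
  assumes G: "continuous_on {0..1} G"
  shows "pairing \<rho> G - (LINT u|unit_leb. \<Phi> u * G u + (G u)\<^sup>2 / 2) = pairing \<rho> G - ip2 \<Phi> G - ip2 G G / 2"
proof -
  note \<Phi>s = sobolev_sqint[OF stationary_profile(1)[where p = p and q = q, folded \<Phi>_def]]
  note Gs = continuous_sqint[OF G]
  have "(LINT u|unit_leb. \<Phi> u * G u + (G u)\<^sup>2 / 2) = (LINT u|unit_leb. \<Phi> u * G u + 1 / 2 * (G u * G u))"
    by (simp add: power2_eq_square)
  also have "\<dots> = (LINT u|unit_leb. \<Phi> u * G u) + (LINT u|unit_leb. 1 / 2 * (G u * G u))"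
    by (intro Bochner_Integration.integral_add integrable_mult_right sqint_mult_integrable \<Phi>s Gs)
  also have "\<dots> = ip2 \<Phi> G + ip2 G G / 2" by (simp add: ip_def)
  finally show ?thesis by simp
qed

text \<open>Comparing with real upper bounds W of the stationary rate makes the infinite case
  vacuous. A finite W yields a square integrable fluctuation, to which the relaxation path applies
  for every horizon.\<close>

lemma quasi_potential_le:
  fixes p q :: real
  assumes \<rho>: "\<rho> \<in> signed_measures"
  shows "quasi_potential \<gamma> p q \<rho> \<le> stationary_rate \<gamma> p q \<rho>"
proof -
  let ?\<Phi> = "stationary_profile \<gamma> p q"
  note \<Phi> = stationary_profile[where p = p and q = q]
  note \<Phi>s = sobolev_sqint[OF \<Phi>(1)]
  have up: "ereal (pairing \<rho> G - ip2 ?\<Phi> G - ip2 G G / 2) \<le> stationary_rate \<gamma> p q \<rho>" if G: "continuous_on {0..1} G" for G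
    unfolding stationary_rate_def stationary_rate_integrand[OF G, symmetric] using G by (intro SUP_upper) simp
  show ?thesis
  proof (rule ereal_le_real)
    fix W assume W: "stationary_rate \<gamma> p q \<rho> \<le> ereal W"
    have "pairing \<rho> G - ip2 ?\<Phi> G - ip2 G G / 2 \<le> W" if "continuous_on {0..1} G" for G
      using order_trans[OF up[OF that] W] by simp
    then obtain r where r: "r \<in> sqint unit_leb" "\<rho> = density_measure r" "nsq unit_leb (\<lambda>x. r x - ?\<Phi> x) \<le> 2 * W"
      by (rule sqint_of_finite_rate[OF \<rho> \<Phi>s])
    define \<psi> where "\<psi> x = r x - ?\<Phi> x" for x
    have psi: "\<psi> \<in> sqint unit_leb" unfolding \<psi>_def[abs_def] by (rule sqint_diff[OF r(1) \<Phi>s])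
    have bound: "quasi_potential \<gamma> p q \<rho> \<le> ereal (ip2 \<psi> \<psi> / (2 * (1 - exp (- (2 * lam 0 * T)))))" if T: "0 < T" for T
    proof -
      let ?\<pi> = "\<lambda>t. density_measure (\<lambda>u. ?\<Phi> u + relax T \<psi> t u)"
      have ac: "?\<pi> \<in> ac_paths \<gamma> p q T" by (rule relax_ac[OF T psi \<Phi>(1,2,3)])
      have "(LINT u:A|unit_leb. ?\<Phi> u + relax T \<psi> 0 u) = (LINT u:A|unit_leb. ?\<Phi> u)" for A
        unfolding set_lebesgue_integral_def by (intro Bochner_Integration.integral_cong refl) (simp add: relax_0[OF T psi])
      then have 0: "?\<pi> 0 = density_measure ?\<Phi>" by (simp add: density_measure_def fun_eq_iff)
      have 1: "?\<pi> T = \<rho>" by (simp add: relax_T[OF T psi] \<psi>_def r(2))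
      have "rate_functional \<gamma> p q T ?\<pi> ?\<Phi> \<le> ereal (ip2 \<psi> \<psi> / (2 * (1 - exp (- (2 * lam 0 * T)))))"
        unfolding rate_functional_def if_P[OF ac]
      proof (rule SUP_least)
        fix H assume "H \<in> space_time_tests T"
        then have "J_functional \<gamma> T H ?\<pi> ?\<Phi> \<le> ip2 \<psi> \<psi> / (2 * (1 - exp (- (2 * lam 0 * T))))"
          by (intro relax_action[OF T psi \<Phi>(1)] \<Phi>(4))
        then show "ereal (J_functional \<gamma> T H ?\<pi> ?\<Phi>) \<le> ereal (ip2 \<psi> \<psi> / (2 * (1 - exp (- (2 * lam 0 * T)))))" by (simp only: ereal_less_eq)
      qed
      moreover have "?\<pi> \<in> {\<pi> \<in> paths T. \<pi> 0 = density_measure ?\<Phi> \<and> \<pi> T = \<rho>}"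
        using relax_path[OF T psi \<Phi>s] 0 1 by simp
      ultimately show ?thesis
        unfolding quasi_potential_def using T by (meson INF_lower2 greaterThan_iff)
    qed
    \<comment> \<open>The horizons are the positive integers, which turns the correction factor into
      a power of a number below 1.\<close>
    let ?f = "\<lambda>n::nat. ip2 \<psi> \<psi> / (2 * (1 - exp (- (2 * lam 0)) ^ Suc n))"
    have "(\<lambda>n. exp (- (2 * lam 0)) ^ Suc n) \<longlonglongrightarrow> 0"
      by (rule LIMSEQ_Suc, rule LIMSEQ_realpow_zero) (use lam_pos[of 0] in auto)
    then have "?f \<longlonglongrightarrow> ip2 \<psi> \<psi> / (2 * (1 - 0))"
      by (intro tendsto_divide tendsto_mult tendsto_diff tendsto_const) auto
    then have lim: "(\<lambda>n. ereal (?f n)) \<longlonglongrightarrow> ereal (ip2 \<psi> \<psi> / 2)" by simp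
    have "quasi_potential \<gamma> p q \<rho> \<le> ereal (?f n)" for n
    proof -
      have "exp (- (2 * lam 0 * real (Suc n))) = exp (- (2 * lam 0)) ^ Suc n"
        unfolding exp_of_nat2_mult[symmetric] by simp
      then show ?thesis using bound[of "real (Suc n)"] by simp
    qed
    then have "quasi_potential \<gamma> p q \<rho> \<le> ereal (ip2 \<psi> \<psi> / 2)"
      by (intro LIMSEQ_le_const[OF lim]) auto
    also have "\<dots> \<le> ereal W" using r(3) by (simp add: \<psi>_def[abs_def])
    finally show "quasi_potential \<gamma> p q \<rho> \<le> ereal W" .
  qed
qed

text \<open>Paths outside the class of finite energy have infinite rate by definition; for the
  others a real bound on the rate bounds the functional for every test, and
  \<open>rate_lower_bound\<close> applies with each continuous \<open>G\<close>.\<close>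

lemma stationary_rate_le:
  fixes p q :: real
  shows "stationary_rate \<gamma> p q \<rho> \<le> quasi_potential \<gamma> p q \<rho>"
  unfolding quasi_potential_def
proof (intro INF_greatest)
  let ?\<Phi> = "stationary_profile \<gamma> p q"
  fix T \<pi> assume T: "T \<in> {0<..}" and \<pi>: "\<pi> \<in> {\<pi> \<in> paths T. \<pi> 0 = density_measure ?\<Phi> \<and> \<pi> T = \<rho>}"
  show "stationary_rate \<gamma> p q \<rho> \<le> rate_functional \<gamma> p q T \<pi> ?\<Phi>"
  proof (cases "\<pi> \<in> ac_paths \<gamma> p q T")
    case True
    show ?thesis
    proof (rule ereal_le_real)
      fix I assume I: "rate_functional \<gamma> p q T \<pi> ?\<Phi> \<le> ereal I"
      have J: "J_functional \<gamma> T H \<pi> ?\<Phi> \<le> I" if "H \<in> space_time_tests T" for H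
      proof -
        have "ereal (J_functional \<gamma> T H \<pi> ?\<Phi>) \<le> rate_functional \<gamma> p q T \<pi> ?\<Phi>"
          unfolding rate_functional_def if_P[OF True] using that by (rule SUP_upper)
        then show ?thesis using I order_trans by fastforce
      qed
      have "pairing \<rho> G - (LINT u|unit_leb. ?\<Phi> u * G u + (G u)\<^sup>2 / 2) \<le> I" if G: "continuous_on {0..1} G" for G
        unfolding stationary_rate_integrand[OF G]
        using rate_lower_bound[OF _ True J G] T \<pi> by simp
      then show "stationary_rate \<gamma> p q \<rho> \<le> ereal I"
        unfolding stationary_rate_def by (intro SUP_least) simp
    qed
  qed (simp add: rate_functional_def)
qed

end

theorem theorem2p14:
  fixes \<gamma> \<Phi>\<^sub>l \<Phi>\<^sub>r :: real and \<rho> :: "real set \<Rightarrow> real"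
  assumes "1 < \<gamma>" and "\<gamma> < 2"
    and "\<rho> \<in> signed_measures"
  shows "quasi_potential \<gamma> \<Phi>\<^sub>l \<Phi>\<^sub>r \<rho> = stationary_rate \<gamma> \<Phi>\<^sub>l \<Phi>\<^sub>r \<rho>"
proof -
  interpret fractional \<gamma> by unfold_locales (use assms in auto)
  show ?thesis using quasi_potential_le[OF assms(3)] stationary_rate_le by (rule antisym)
qed

end
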